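(* Let $\mathbf{v}$ be a random velocity field satisfying, for a.e. $\omega$, $\mathbf{v}(\omega)\in C([0,\tau],C^2(\overline{B},\mathbb{R}^d))$ and $\mathbf{v}(\omega,t)\cdot n_B=0$ on $\partial B$, with flow $T$. Assume there are deterministic constants $C_T,C_D,C_t,C_J>0$ such that for a.e. $\omega$ $$\|T(\omega)\|_{C([0,\tau],C^2(\overline{B},\mathbb{R}^d))},\ \|T^{-1}(\omega)\|_{C([0,\tau],C^2(\overline{B},\mathbb{R}^d))}\le C_T,$$ $$\|DT(\omega)\|_{C([0,\tau],C^1(\overline{B}))},\ \|DT^{-1}(\omega)\|_{C([0,\tau],C^1(\overline{B}))}\le C_D,\qquad \Big\|\tfrac{d}{dt}T(\omega)\Big\|_{C([0,\tau],C(\overline{B},\mathbb{R}^d))}\le C_t,\qquad \sup_{t,x}\|\nabla_x J_t^{-1}(\omega,x)\|_{\mathbb{R}^d}\le C_J .$$ Let $\hat f\in L^2(0,\tau;L^2(\Omega,H^{-1}(D_0)))$. Then there is a unique $\hat u\in \mathcal{W}(L^2(\Omega,H_0^1(D_0)),L^2(\Omega,H^{-1}(D_0)))$ with $\hat u(0)=0$ such that for a.e. $t\in[0,\tau]$ and every $\varphi\in L^2(\Omega,H_0^1(D_0))$ $$\int_\Omega\langle \hat u',\varphi\rangle_{H^{-1}(D_0),H_0^1(D_0)}\,d\mathbb{P}+\int_\Omega\int_{D_0}\langle DT_t^{-1}DT_t^{-\top}\nabla\hat u,\nabla\varphi\rangle_{\mathbb{R}^d}\,dy\,d\mathbb{P}+\int_\Omega\int_{D_0}\langle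 A\nabla J_t^{-1}-DT_t^{-1}\,(\mathbf{v}\circ T_t),\nabla\hat u\rangle_{\mathbb{R}^d}\,\varphi\,dy\,d\mathbb{P}=\int_\Omega\langle\hat f,\varphi\rangle_{H^{-1}(D_0),H_0^1(D_0)}\,d\mathbb{P}.$$ Moreover, there is a deterministic constant $C>0$ (independent of $\hat f$) with $$\|\hat u\|_{\mathcal{W}(L^2(\Omega,H_0^1(D_0)),L^2(\Omega,H^{-1}(D_0)))}\le C\,\|\hat f\|_{L^2(0,\tau;L^2(\Omega,H^{-1}(D_0)))}.$$
   Context: $(\Omega,\mathcal{F},\mathbb{P})$ is a complete probability space with $L^2(\Omega)$ separable; $\tau\in(0,\infty)$; $D_0\subset\mathbb{R}^d$ is an open bounded set with Lipschitz boundary. $B\subset\mathbb{R}^d$ is a bounded, open, path-connected, locally Lipschitz hold-all domain with outward unit normal $n_B$, containing $D_0$ and all $D_t(\omega)$. The random velocity field $\mathbf{v}:\Omega\times[0,\tau]\times\overline{B}\to\mathbb{R}^d$ is such that its flow is measurable in $\omega$. The flow $T_t(\omega,\cdot)=T(\omega,t,\cdot):\overline{B}\to\overline{B}$ is the solution of $\frac{d}{dt}T_t(\omega,X)=\mathbf{v}(\omega,t,T_t(\omega,X))$, $T_0=\mathrm{Id}$, and $D_t(\omega)=T_t(\omega)(D_0)$. The time interval is assumed to be such that (for a.e. $\omega$) $T(\omega),T^{-1}(\omega)\in C^1([0,\tau],C(\overline{B},\mathbb{R}^d))\cap C([0,\tau],C^2(\overline{B},\mathbb{R}^d))$, where $T^{-1}(\omega)$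 is $t\mapsto T_t(\omega)^{-1}$. $DT_t$ is the Jacobian matrix of $T_t$ in space; in the norm bounds, $DT^{-1}$ is the Jacobian matrix of $T_t^{-1}$. In the equation, $DT_t^{-1}(\omega,y)$ is the inverse of the matrix $DT_t(\omega,y)$ and $DT_t^{-\top}$ its transpose; $J_t=\det DT_t>0$, $J_t^{-1}(\omega,y)=1/J_t(\omega,y)$; $(\mathbf{v}\circ T_t)(\omega,y)=\mathbf{v}(\omega,t,T_t(\omega,y))$; $A(\omega,t,y)=J_t(\omega,y)\,DT_t^{-1}(\omega,y)\,DT_t^{-\top}(\omega,y)$. For a Gelfand triple $\mathcal{V}\hookrightarrow\mathcal{H}\cong\mathcal{H}^*\hookrightarrow\mathcal{V}^*$, $\mathcal{W}(\mathcal{V},\mathcal{V}^* )=\{u\in L^2(0,\tau;\mathcal{V}): u'\in L^2(0,\tau;\mathcal{V}^* )\}$, with $u'$ the weak time derivative and norm $\|u\|^2=\int_0^\tau\|u\|_{\mathcal{V}}^2+\int_0^\tau\|u'\|_{\mathcal{V}^*}^2$; it embeds continuously in $C([0,\tau],\mathcal{H})$. Here $\mathcal{V}=L^2(\Omega,H_0^1(D_0))$, $\mathcal{H}=L^2(\Omega,L^2(D_0))$, $\mathcal{V}^*=L^2(\Omega,H^{-1}(D_0))$. *)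

theory Defs
  imports "HOL-Probability.Probability"
begin

text \<open>
  Function spaces are represented by a carrier set of representatives together with a seminorm,
  so two functions denote the same element of the space iff the seminorm of their
  (pointwise) difference is 0.
\<close>

section \<open>Domains\<close>

text \<open>Near each boundary point, \<open>U\<close> is the strict subgraph in a direction \<open>e\<close> of a Lipschitz
  function of the component orthogonal to \<open>e\<close>.\<close>

definition lipschitz_boundary :: "'a::euclidean_space set \<Rightarrow> bool" where
  "lipschitz_boundary U \<longleftrightarrow>
     (\<forall>x\<in>frontier U. \<exists>e r L \<gamma>. norm e = 1 \<and> r > 0 \<and> L-lipschitz_on UNIV (\<gamma> :: 'a \<Rightarrow> real) \<and>
        (\<forall>y\<in>ball x r. y \<in> U \<longleftrightarrow> y \<bullet> e < \<gamma> (y - (y \<bullet> e) *\<^sub>R e)))"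

text \<open>On a Lipschitz boundary this normal exists precisely where the local graph function is
  differentiable, hence almost everywhere on the boundary.\<close>

definition outward_unit_normal :: "'a::euclidean_space set \<Rightarrow> 'a \<Rightarrow> 'a \<Rightarrow> bool" where
  "outward_unit_normal U x n \<longleftrightarrow> norm n = 1 \<and>
     (\<forall>e>0. \<exists>\<delta>>0. \<forall>y\<in>ball x \<delta>.
        ((y - x) \<bullet> n < - e * norm (y - x) \<longrightarrow> y \<in> U) \<and>
        ((y - x) \<bullet> n > e * norm (y - x) \<longrightarrow> y \<notin> U))"

section \<open>Spaces of continuously differentiable functions on the closure of an open bounded set\<close>

definition fderiv :: "('a::real_normed_vector \<Rightarrow> 'b::real_normed_vector) \<Rightarrow> 'a \<Rightarrow> 'a \<Rightarrow>\<^sub>L 'b" where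
  "fderiv f x = Blinfun (frechet_derivative f (at x))"

text \<open>Derivatives are taken in the open set \<open>B\<close> only and are required to extend continuously to
  the closure. Hence suprema over \<open>B\<close> and over its closure coincide in the norms below.\<close>

definition extends_cont :: "'a::euclidean_space set \<Rightarrow> ('a \<Rightarrow> 'b::real_normed_vector) \<Rightarrow> bool" where
  "extends_cont B f \<longleftrightarrow> (\<exists>g. continuous_on (closure B) g \<and> (\<forall>x\<in>B. g x = f x))"

definition C0_space :: "'a::euclidean_space set \<Rightarrow> ('a \<Rightarrow> 'b::real_normed_vector) set" where
  "C0_space B = {f. continuous_on (closure B) f}"

definition C2_space :: "'a::euclidean_space set \<Rightarrow> ('a \<Rightarrow> 'b::real_normed_vector) set" where
  "C2_space B = {f \<in> C0_space B.
     (\<forall>x\<in>B. f differentiable (at x)) \<and> extends_cont B (fderiv f) \<and>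
     (\<forall>x\<in>B. fderiv f differentiable (at x)) \<and> extends_cont B (fderiv (fderiv f))}"

definition C0_norm :: "'a::euclidean_space set \<Rightarrow> ('a \<Rightarrow> 'b::real_normed_vector) \<Rightarrow> real" where
  "C0_norm B f = (SUP x\<in>B. norm (f x))"

definition C1_norm :: "'a::euclidean_space set \<Rightarrow> ('a \<Rightarrow> 'b::real_normed_vector) \<Rightarrow> real" where
  "C1_norm B f = C0_norm B f + C0_norm B (fderiv f)"

definition C2_norm :: "'a::euclidean_space set \<Rightarrow> ('a \<Rightarrow> 'b::real_normed_vector) \<Rightarrow> real" where
  "C2_norm B f = C0_norm B f + C0_norm B (fderiv f) + C0_norm B (fderiv (fderiv f))"

section \<open>Continuous and continuously differentiable dependence on time\<close>

definition C_time :: "real \<Rightarrow> 'v::minus set \<Rightarrow> ('v \<Rightarrow> real) \<Rightarrow> (real \<Rightarrow> 'v) set" where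
  "C_time \<tau> X N = {f. \<forall>t\<in>{0..\<tau>}. f t \<in> X \<and> ((\<lambda>s. N (f s - f t)) \<longlongrightarrow> 0) (at t within {0..\<tau>})}"

definition C_time_norm :: "real \<Rightarrow> ('v \<Rightarrow> real) \<Rightarrow> (real \<Rightarrow> 'v) \<Rightarrow> real" where
  "C_time_norm \<tau> N f = (SUP t\<in>{0..\<tau>}. N (f t))"

definition time_deriv :: "real \<Rightarrow> (real \<Rightarrow> 'a \<Rightarrow> 'b::real_normed_vector) \<Rightarrow> real \<Rightarrow> 'a \<Rightarrow> 'b" where
  "time_deriv \<tau> f t x = vector_derivative (\<lambda>s. f s x) (at t within {0..\<tau>})"

text \<open>The time derivative of a map into the continuous functions, if it exists, is the pointwise
  one; existence is convergence of the difference quotients uniformly in space.\<close>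

definition C1_time_C0 ::
  "real \<Rightarrow> 'a::euclidean_space set \<Rightarrow> (real \<Rightarrow> 'a \<Rightarrow> 'b::real_normed_vector) set" where
  "C1_time_C0 \<tau> B = {f \<in> C_time \<tau> (C0_space B) (C0_norm B).
     time_deriv \<tau> f \<in> C_time \<tau> (C0_space B) (C0_norm B) \<and>
     (\<forall>t\<in>{0..\<tau>}. ((\<lambda>s. C0_norm B (\<lambda>x. (f s x - f t x) /\<^sub>R (s - t) - time_deriv \<tau> f t x)) \<longlongrightarrow> 0)
        (at t within {0..\<tau>}))}"

section \<open>Lebesgue and Bochner spaces\<close>

definition L2_space :: "'x measure \<Rightarrow> ('x \<Rightarrow> 'b::euclidean_space) set" where
  "L2_space M = {f \<in> borel_measurable M. integrable M (\<lambda>x. (norm (f x))\<^sup>2)}"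

definition L2_norm :: "'x measure \<Rightarrow> ('x \<Rightarrow> 'b::euclidean_space) \<Rightarrow> real" where
  "L2_norm M f = sqrt (\<integral>x. (norm (f x))\<^sup>2 \<partial>M)"

definition separable_seminormed :: "'v::minus set \<Rightarrow> ('v \<Rightarrow> real) \<Rightarrow> bool" where
  "separable_seminormed X N \<longleftrightarrow>
     (\<exists>S\<subseteq>X. countable S \<and> (\<forall>x\<in>X. \<forall>e>0. \<exists>s\<in>S. N (x - s) < e))"

definition strongly_measurable ::
  "'x measure \<Rightarrow> 'v::minus set \<Rightarrow> ('v \<Rightarrow> real) \<Rightarrow> ('x \<Rightarrow> 'v) \<Rightarrow> bool" where
  "strongly_measurable M X N f \<longleftrightarrow> (AE x in M. f x \<in> X) \<and>
     (\<exists>s :: nat \<Rightarrow> 'x \<Rightarrow> 'v. (\<forall>i. simple_function M (s i) \<and> s i ` space M \<subseteq> X) \<and>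
        (AE x in M. (\<lambda>i. N (s i x - f x)) \<longlonglongrightarrow> 0))"

definition bochner_L2 ::
  "'x measure \<Rightarrow> 'v::minus set \<Rightarrow> ('v \<Rightarrow> real) \<Rightarrow> ('x \<Rightarrow> 'v) set" where
  "bochner_L2 M X N = {f. strongly_measurable M X N f \<and> integrable M (\<lambda>x. (N (f x))\<^sup>2)}"

definition bochner_L2_norm :: "'x measure \<Rightarrow> ('v \<Rightarrow> real) \<Rightarrow> ('x \<Rightarrow> 'v) \<Rightarrow> real" where
  "bochner_L2_norm M N f = sqrt (\<integral>x. (N (f x))\<^sup>2 \<partial>M)"

section \<open>Sobolev spaces\<close>

fun partials :: "'a::euclidean_space list \<Rightarrow> ('a \<Rightarrow> real) \<Rightarrow> 'a \<Rightarrow> real" where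
  "partials [] f = f"
| "partials (e # es) f = (\<lambda>x. frechet_derivative (partials es f) (at x) e)"

definition test_functions :: "'a::euclidean_space set \<Rightarrow> ('a \<Rightarrow> real) set" where
  "test_functions U = {\<phi>.
     (\<forall>es x. set es \<subseteq> Basis \<longrightarrow> partials es \<phi> differentiable (at x)) \<and>
     compact (closure {x. \<phi> x \<noteq> 0}) \<and> closure {x. \<phi> x \<noteq> 0} \<subseteq> U}"

definition grad :: "(real ^ 'n \<Rightarrow> real) \<Rightarrow> real ^ 'n \<Rightarrow> real ^ 'n" where
  "grad f x = (\<chi> i. frechet_derivative f (at x) (axis i 1))"

definition is_weak_grad ::
  "(real ^ 'n) set \<Rightarrow> (real ^ 'n \<Rightarrow> real) \<Rightarrow> (real ^ 'n \<Rightarrow> real ^ 'n) \<Rightarrow> bool" where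
  "is_weak_grad D u g \<longleftrightarrow> g \<in> L2_space (lebesgue_on D) \<and>
     (\<forall>\<phi>\<in>test_functions D.
        (\<integral>x. u x *\<^sub>R grad \<phi> x \<partial>lebesgue_on D) = - (\<integral>x. \<phi> x *\<^sub>R g x \<partial>lebesgue_on D))"

definition H1_space :: "(real ^ 'n) set \<Rightarrow> (real ^ 'n \<Rightarrow> real) set" where
  "H1_space D = {u \<in> L2_space (lebesgue_on D). \<exists>g. is_weak_grad D u g}"

text \<open>The weak gradient is unique up to almost everywhere equality in \<open>D\<close>.\<close>

definition weak_grad :: "(real ^ 'n) set \<Rightarrow> (real ^ 'n \<Rightarrow> real) \<Rightarrow> real ^ 'n \<Rightarrow> real ^ 'n" where
  "weak_grad D u = (SOME g. is_weak_grad D u g)"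

definition H1_norm :: "(real ^ 'n) set \<Rightarrow> (real ^ 'n \<Rightarrow> real) \<Rightarrow> real" where
  "H1_norm D u =
     sqrt ((L2_norm (lebesgue_on D) u)\<^sup>2 + (L2_norm (lebesgue_on D) (weak_grad D u))\<^sup>2)"

definition H10_space :: "(real ^ 'n) set \<Rightarrow> (real ^ 'n \<Rightarrow> real) set" where
  "H10_space D = {u \<in> H1_space D. \<forall>e>0. \<exists>\<phi>\<in>test_functions D. H1_norm D (u - \<phi>) < e}"

text \<open>The dual of \<open>H10_space D\<close>; the value of such a functional outside \<open>H10_space D\<close>
  is irrelevant. The pairing of \<open>F\<close> with \<open>u\<close> is \<open>F u\<close>.\<close>

definition Hm1_space :: "(real ^ 'n) set \<Rightarrow> ((real ^ 'n \<Rightarrow> real) \<Rightarrow> real) set" where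
  "Hm1_space D = {F.
     (\<forall>u\<in>H10_space D. \<forall>v\<in>H10_space D. \<forall>a b.
        F (\<lambda>x. a * u x + b * v x) = a * F u + b * F v) \<and>
     (\<exists>K. \<forall>u\<in>H10_space D. \<bar>F u\<bar> \<le> K * H1_norm D u)}"

definition Hm1_norm :: "(real ^ 'n) set \<Rightarrow> ((real ^ 'n \<Rightarrow> real) \<Rightarrow> real) \<Rightarrow> real" where
  "Hm1_norm D F = (SUP u\<in>{u\<in>H10_space D. H1_norm D u \<le> 1}. \<bar>F u\<bar>)"

section \<open>The Gelfand triple of random functions and its evolution space\<close>

definition V_space :: "'w measure \<Rightarrow> (real ^ 'n) set \<Rightarrow> ('w \<Rightarrow> real ^ 'n \<Rightarrow> real) set" where
  "V_space P D = bochner_L2 P (H10_space D) (H1_norm D)"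

definition V_norm :: "'w measure \<Rightarrow> (real ^ 'n) set \<Rightarrow> ('w \<Rightarrow> real ^ 'n \<Rightarrow> real) \<Rightarrow> real" where
  "V_norm P D = bochner_L2_norm P (H1_norm D)"

definition H_space :: "'w measure \<Rightarrow> (real ^ 'n) set \<Rightarrow> ('w \<Rightarrow> real ^ 'n \<Rightarrow> real) set" where
  "H_space P D = bochner_L2 P (L2_space (lebesgue_on D)) (L2_norm (lebesgue_on D))"

definition H_norm :: "'w measure \<Rightarrow> (real ^ 'n) set \<Rightarrow> ('w \<Rightarrow> real ^ 'n \<Rightarrow> real) \<Rightarrow> real" where
  "H_norm P D = bochner_L2_norm P (L2_norm (lebesgue_on D))"

definition H_inner ::
  "'w measure \<Rightarrow> (real ^ 'n) set \<Rightarrow>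
   ('w \<Rightarrow> real ^ 'n \<Rightarrow> real) \<Rightarrow> ('w \<Rightarrow> real ^ 'n \<Rightarrow> real) \<Rightarrow> real" where
  "H_inner P D u v = (\<integral>\<omega>. (\<integral>y. u \<omega> y * v \<omega> y \<partial>lebesgue_on D) \<partial>P)"

definition Vdual_space ::
  "'w measure \<Rightarrow> (real ^ 'n) set \<Rightarrow> ('w \<Rightarrow> (real ^ 'n \<Rightarrow> real) \<Rightarrow> real) set" where
  "Vdual_space P D = bochner_L2 P (Hm1_space D) (Hm1_norm D)"

definition Vdual_norm ::
  "'w measure \<Rightarrow> (real ^ 'n) set \<Rightarrow> ('w \<Rightarrow> (real ^ 'n \<Rightarrow> real) \<Rightarrow> real) \<Rightarrow> real" where
  "Vdual_norm P D = bochner_L2_norm P (Hm1_norm D)"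

definition Vdual_pairing ::
  "'w measure \<Rightarrow> ('w \<Rightarrow> (real ^ 'n \<Rightarrow> real) \<Rightarrow> real) \<Rightarrow> ('w \<Rightarrow> real ^ 'n \<Rightarrow> real) \<Rightarrow> real" where
  "Vdual_pairing P F v = (\<integral>\<omega>. F \<omega> (v \<omega>) \<partial>P)"

definition L2V_space ::
  "real \<Rightarrow> 'w measure \<Rightarrow> (real ^ 'n) set \<Rightarrow> (real \<Rightarrow> 'w \<Rightarrow> real ^ 'n \<Rightarrow> real) set" where
  "L2V_space \<tau> P D = bochner_L2 (lebesgue_on {0..\<tau>}) (V_space P D) (V_norm P D)"

definition L2V_norm ::
  "real \<Rightarrow> 'w measure \<Rightarrow> (real ^ 'n) set \<Rightarrow> (real \<Rightarrow> 'w \<Rightarrow> real ^ 'n \<Rightarrow> real) \<Rightarrow> real" where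
  "L2V_norm \<tau> P D = bochner_L2_norm (lebesgue_on {0..\<tau>}) (V_norm P D)"

definition L2Vdual_space ::
  "real \<Rightarrow> 'w measure \<Rightarrow> (real ^ 'n) set \<Rightarrow> (real \<Rightarrow> 'w \<Rightarrow> (real ^ 'n \<Rightarrow> real) \<Rightarrow> real) set" where
  "L2Vdual_space \<tau> P D = bochner_L2 (lebesgue_on {0..\<tau>}) (Vdual_space P D) (Vdual_norm P D)"

definition L2Vdual_norm ::
  "real \<Rightarrow> 'w measure \<Rightarrow> (real ^ 'n) set \<Rightarrow> (real \<Rightarrow> 'w \<Rightarrow> (real ^ 'n \<Rightarrow> real) \<Rightarrow> real) \<Rightarrow> real" where
  "L2Vdual_norm \<tau> P D = bochner_L2_norm (lebesgue_on {0..\<tau>}) (Vdual_norm P D)"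

text \<open>\<open>u' = w\<close> in the sense of distributions on \<open>(0, \<tau>)\<close> with values in the dual of \<open>V\<close>,
  where \<open>V\<close> is embedded in its dual through the inner product of \<open>H\<close>.\<close>

definition is_weak_time_deriv ::
  "real \<Rightarrow> 'w measure \<Rightarrow> (real ^ 'n) set \<Rightarrow> (real \<Rightarrow> 'w \<Rightarrow> real ^ 'n \<Rightarrow> real) \<Rightarrow>
   (real \<Rightarrow> 'w \<Rightarrow> (real ^ 'n \<Rightarrow> real) \<Rightarrow> real) \<Rightarrow> bool" where
  "is_weak_time_deriv \<tau> P D u w \<longleftrightarrow> w \<in> L2Vdual_space \<tau> P D \<and>
     (\<forall>\<psi>\<in>test_functions {0<..<\<tau>}. \<forall>v\<in>V_space P D.
        (\<integral>t. deriv \<psi> t * H_inner P D (u t) v \<partial>lebesgue_on {0..\<tau>}) =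
        - (\<integral>t. \<psi> t * Vdual_pairing P (w t) v \<partial>lebesgue_on {0..\<tau>}))"

text \<open>The weak time derivative is unique as an element of \<open>L2Vdual_space \<tau> P D\<close>.\<close>

definition weak_time_deriv ::
  "real \<Rightarrow> 'w measure \<Rightarrow> (real ^ 'n) set \<Rightarrow> (real \<Rightarrow> 'w \<Rightarrow> real ^ 'n \<Rightarrow> real) \<Rightarrow>
   real \<Rightarrow> 'w \<Rightarrow> (real ^ 'n \<Rightarrow> real) \<Rightarrow> real" where
  "weak_time_deriv \<tau> P D u = (SOME w. is_weak_time_deriv \<tau> P D u w)"

definition W_space ::
  "real \<Rightarrow> 'w measure \<Rightarrow> (real ^ 'n) set \<Rightarrow> (real \<Rightarrow> 'w \<Rightarrow> real ^ 'n \<Rightarrow> real) set" where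
  "W_space \<tau> P D = {u \<in> L2V_space \<tau> P D. \<exists>w. is_weak_time_deriv \<tau> P D u w}"

definition W_norm ::
  "real \<Rightarrow> 'w measure \<Rightarrow> (real ^ 'n) set \<Rightarrow> (real \<Rightarrow> 'w \<Rightarrow> real ^ 'n \<Rightarrow> real) \<Rightarrow> real" where
  "W_norm \<tau> P D u =
     sqrt ((L2V_norm \<tau> P D u)\<^sup>2 + (L2Vdual_norm \<tau> P D (weak_time_deriv \<tau> P D u))\<^sup>2)"

text \<open>The value at time 0 is that of the representative which is continuous in time with values
  in \<open>H\<close>.\<close>

definition has_initial_value ::
  "real \<Rightarrow> 'w measure \<Rightarrow> (real ^ 'n) set \<Rightarrow> (real \<Rightarrow> 'w \<Rightarrow> real ^ 'n \<Rightarrow> real) \<Rightarrow>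
   ('w \<Rightarrow> real ^ 'n \<Rightarrow> real) \<Rightarrow> bool" where
  "has_initial_value \<tau> P D u u0 \<longleftrightarrow>
     (\<exists>U\<in>C_time \<tau> (H_space P D) (H_norm P D).
        (AE t in lebesgue_on {0..\<tau>}. H_norm P D (U t - u t) = 0) \<and> H_norm P D (U 0 - u0) = 0)"

section \<open>The transformed equation\<close>

definition jac :: "(real ^ 'n \<Rightarrow> real ^ 'n) \<Rightarrow> real ^ 'n \<Rightarrow> real ^ 'n ^ 'n" where
  "jac f y = jacobian f (at y)"

definition inv_jac :: "(real ^ 'n \<Rightarrow> real ^ 'n) \<Rightarrow> real ^ 'n \<Rightarrow> real ^ 'n ^ 'n" where
  "inv_jac f y = matrix_inv (jac f y)"

definition inv_jac_det :: "(real ^ 'n \<Rightarrow> real ^ 'n) \<Rightarrow> real ^ 'n \<Rightarrow> real" where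
  "inv_jac_det f y = 1 / det (jac f y)"

definition A_mat :: "(real ^ 'n \<Rightarrow> real ^ 'n) \<Rightarrow> real ^ 'n \<Rightarrow> real ^ 'n ^ 'n" where
  "A_mat f y = det (jac f y) *\<^sub>R (inv_jac f y ** transpose (inv_jac f y))"

definition inverse_flow ::
  "(real ^ 'n) set \<Rightarrow> (real \<Rightarrow> real ^ 'n \<Rightarrow> real ^ 'n) \<Rightarrow> real \<Rightarrow> real ^ 'n \<Rightarrow> real ^ 'n" where
  "inverse_flow B T t = inv_into (closure B) (T t)"

definition is_flow ::
  "real \<Rightarrow> 'a::real_normed_vector set \<Rightarrow> (real \<Rightarrow> 'a \<Rightarrow> 'a) \<Rightarrow> (real \<Rightarrow> 'a \<Rightarrow> 'a) \<Rightarrow> bool" where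
  "is_flow \<tau> S v T \<longleftrightarrow>
     (\<forall>x\<in>S. T 0 x = x \<and>
        (\<forall>t\<in>{0..\<tau>}. T t x \<in> S \<and>
           ((\<lambda>s. T s x) has_vector_derivative v t (T t x)) (at t within {0..\<tau>})))"

definition is_weak_solution ::
  "real \<Rightarrow> 'w measure \<Rightarrow> (real ^ 'n) set \<Rightarrow>
   ('w \<Rightarrow> real \<Rightarrow> real ^ 'n \<Rightarrow> real ^ 'n) \<Rightarrow> ('w \<Rightarrow> real \<Rightarrow> real ^ 'n \<Rightarrow> real ^ 'n) \<Rightarrow>
   (real \<Rightarrow> 'w \<Rightarrow> (real ^ 'n \<Rightarrow> real) \<Rightarrow> real) \<Rightarrow> (real \<Rightarrow> 'w \<Rightarrow> real ^ 'n \<Rightarrow> real) \<Rightarrow> bool" where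
  "is_weak_solution \<tau> P D v T f u \<longleftrightarrow>
     u \<in> W_space \<tau> P D \<and> has_initial_value \<tau> P D u (\<lambda>\<omega> y. 0) \<and>
     (AE t in lebesgue_on {0..\<tau>}. \<forall>\<phi>\<in>V_space P D.
        (\<integral>\<omega>. weak_time_deriv \<tau> P D u t \<omega> (\<phi> \<omega>) \<partial>P)
      + (\<integral>\<omega>. (\<integral>y. ((inv_jac (T \<omega> t) y ** transpose (inv_jac (T \<omega> t) y))
                 *v weak_grad D (u t \<omega>) y) \<bullet> weak_grad D (\<phi> \<omega>) y \<partial>lebesgue_on D) \<partial>P)
      + (\<integral>\<omega>. (\<integral>y. ((A_mat (T \<omega> t) y *v grad (inv_jac_det (T \<omega> t)) y
                  - inv_jac (T \<omega> t) y *v v \<omega> t (T \<omega> t y))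
                 \<bullet> weak_grad D (u t \<omega>) y) * \<phi> \<omega> y \<partial>lebesgue_on D) \<partial>P)
      = (\<integral>\<omega>. f t \<omega> (\<phi> \<omega>) \<partial>P))"

end

theory Submission
  imports Defs "HOL-Library.Function_Algebras"
begin

text \<open>
  The transformed equation reads \<open>u' + A(t) u = f\<close> in the Gelfand triple, where the bounds on the flow make
  \<open>A(t)\<close> bounded, uniformly in time and in the random parameter, and coercive up to a multiple of the
  norm of \<open>H\<close>. The dual of \<open>V\<close> is identified with \<open>V\<close> by Riesz representation, so that the equation holds
  between functions with values in \<open>V\<close>. For existence, consider the range of \<open>u \<mapsto> u' + A u\<close> on smooth
  functions with \<open>u(0) = 0\<close>. It is dense: if \<open>g\<close> is orthogonal to it, then testing with a smoothing of \<open>g\<close> in time,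
  for which the term with the time derivative has a sign in the limit, and coercivity give \<open>g = 0\<close>. The energy
  estimate bounds \<open>u\<close> by \<open>u' + A u\<close>, hence limits of such \<open>u\<close> solve the equation for every right-hand side.
  Uniqueness follows in the same way from smoothings backwards in time. The coefficients are measurable
  in the random parameter as limits of difference quotients of the flow.
\<close>

section \<open>Semi-inner product spaces of representatives\<close>

text \<open>Elements of the function spaces are representatives, and equality means that the
  seminorm of the difference vanishes. Weak gradients and Riesz representatives are
  \<open>SOME\<close> choices, hence linear only up to null elements. This is why Hilbert space
  theory is developed here for semi-inner products on a carrier, with clauses for null elements in
  the statements on subspaces and operators. The obstacle in time is that neither a function
  orthogonal to the range nor a weak solution may be tested with itself: both are merely square
  integrable in time with values in \<open>V\<close>. A one-sided inequality for their smoothings is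
  all that survives, and it suffices. The weight \<open>exp (- 2 * \<kappa> * t)\<close> turns
  coercivity up to a multiple of the norm of \<open>H\<close> into plain coercivity. Ellipticity
  comes from the bound \<open>m\<close> on the Jacobian of the flow: a vector \<open>g\<close> is
  the image of \<open>w\<close>, the inverse transposed Jacobian applied to \<open>g\<close>, under
  a matrix of norm at most \<open>m\<close>, which gives the constant \<open>1 / m\<^sup>2\<close>.
  On the null set of bad samples the coefficients are replaced by constants with the same
  ellipticity.\<close>

instantiation "fun" :: (type, real_vector) real_vector
begin

definition scaleR_fun_def: "r *\<^sub>R f = (\<lambda>x. r *\<^sub>R f x)"

instance
  by standard (simp_all add: scaleR_fun_def fun_eq_iff scaleR_add_right scaleR_add_left)

end

lemma scaleR_fun_apply [simp]: "(r *\<^sub>R f) x = r *\<^sub>R f x"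
  by (simp add: scaleR_fun_def)

section \<open>Seminormed spaces and completeness\<close>

locale seminormed =
  fixes X :: "'v::real_vector set" and N :: "'v \<Rightarrow> real"
  assumes subspace: "subspace X"
    and N_scale: "x \<in> X \<Longrightarrow> N (a *\<^sub>R x) = \<bar>a\<bar> * N x"
    and N_triangle: "x \<in> X \<Longrightarrow> y \<in> X \<Longrightarrow> N (x + y) \<le> N x + N y"
begin

lemma zero_mem [simp]: "0 \<in> X"
  and add_mem [intro]: "x \<in> X \<Longrightarrow> y \<in> X \<Longrightarrow> x + y \<in> X"
  and diff_mem [intro]: "x \<in> X \<Longrightarrow> y \<in> X \<Longrightarrow> x - y \<in> X"
  and scale_mem [intro]: "x \<in> X \<Longrightarrow> a *\<^sub>R x \<in> X"
  using subspace by (auto simp: subspace_0 subspace_add subspace_diff subspace_scale)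

lemma N_zero [simp]: "N 0 = 0"
  using N_scale[of 0 0] by simp

lemma N_minus: "x \<in> X \<Longrightarrow> N (- x) = N x"
  using N_scale[of x "-1"] by simp

lemma N_diff_commute: "x \<in> X \<Longrightarrow> y \<in> X \<Longrightarrow> N (x - y) = N (y - x)"
  using N_minus[OF diff_mem, of x y] by simp

lemma N_nonneg: "x \<in> X \<Longrightarrow> 0 \<le> N x"
  using N_triangle[of x "- x"] N_minus[of x] scale_mem[of x "-1"] by auto

lemma N_triangle_diff: "x \<in> X \<Longrightarrow> y \<in> X \<Longrightarrow> N (x - y) \<le> N x + N y"
  using N_triangle[of x "- y"] N_minus[of y] scale_mem[of y "-1"] by auto

lemma N_triangle4: "x \<in> X \<Longrightarrow> y \<in> X \<Longrightarrow> z \<in> X \<Longrightarrow> N (x - z) \<le> N (x - y) + N (y - z)"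
  using N_triangle[of "x - y" "y - z"] by auto

lemma N_triangle_rev: "x \<in> X \<Longrightarrow> y \<in> X \<Longrightarrow> \<bar>N x - N y\<bar> \<le> N (x - y)"
  using N_triangle[OF diff_mem, of x y y] N_triangle[OF diff_mem, of y x x] N_diff_commute[of x y] by simp

lemma N_tendsto:
  assumes "\<And>n. f n \<in> X" "x \<in> X" "(\<lambda>n. N (f n - x)) \<longlonglongrightarrow> 0"
  shows "(\<lambda>n. N (f n)) \<longlonglongrightarrow> N x"
proof -
  have "(\<lambda>n. N (f n) - N x) \<longlonglongrightarrow> 0"
    by (rule Lim_null_comparison[OF _ assms(3)]) (use assms N_triangle_rev in auto)
  then show ?thesis by (simp add: LIM_zero_iff)
qed

definition Cau :: "(nat \<Rightarrow> 'v) \<Rightarrow> bool" where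
  "Cau f \<longleftrightarrow> (\<forall>n. f n \<in> X) \<and> (\<forall>e>0. \<exists>k. \<forall>m\<ge>k. \<forall>n\<ge>k. N (f m - f n) < e)"

lemma Cau_bound:
  assumes "\<And>n. f n \<in> X" "(\<lambda>n. e n) \<longlonglongrightarrow> (0::real)" "\<And>m n. N (f m - f n) \<le> e m + e n"
  shows "Cau f"
  unfolding Cau_def
proof (intro conjI allI impI)
  fix d :: real assume "d > 0"
  then obtain k where k: "\<And>n. n \<ge> k \<Longrightarrow> \<bar>e n\<bar> < d / 2"
    using LIMSEQ_D[OF assms(2), of "d / 2"] by auto
  show "\<exists>k. \<forall>m\<ge>k. \<forall>n\<ge>k. N (f m - f n) < d"
  proof (intro exI[of _ k] allI impI)
    fix m n assume "k \<le> m" "k \<le> n"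
    then show "N (f m - f n) < d"
      using k[of m] k[of n] assms(3)[of m n] by linarith
  qed
qed (fact assms)

lemma N_lim_unique:
  assumes "\<And>n. f n \<in> X" "x \<in> X" "y \<in> X"
    "(\<lambda>n. N (f n - x)) \<longlonglongrightarrow> 0" "(\<lambda>n. N (f n - y)) \<longlonglongrightarrow> 0"
  shows "N (x - y) = 0"
proof -
  have "(\<lambda>n. N (f n - x) + N (f n - y)) \<longlonglongrightarrow> 0 + 0"
    by (intro tendsto_intros assms)
  then have "N (x - y) \<le> 0 + 0"
  proof (rule Lim_bounded2, safe)
    fix n show "N (x - y) \<le> N (f n - x) + N (f n - y)"
      using N_triangle4[OF assms(2) assms(1)[of n] assms(3)] N_diff_commute[OF assms(2) assms(1)[of n]]
      by auto
  qed
  then show ?thesis using N_nonneg[of "x - y"] assms by auto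
qed

end

locale complete_seminormed = seminormed +
  assumes Cau_converges: "Cau f \<Longrightarrow> \<exists>x\<in>X. (\<lambda>n. N (f n - x)) \<longlonglongrightarrow> 0"

text \<open>A Cauchy sequence has a subsequence with increments at most \<open>(1/2)^n\<close>, and
  it converges to every limit of that subsequence. Summable increments are what the completeness
  proof for Bochner spaces relies on, because they remain summable at almost every point.\<close>

lemma (in seminormed) complete_if_fast:
  assumes fast: "\<And>f. (\<And>n. f n \<in> X) \<Longrightarrow> (\<And>n. N (f (Suc n) - f n) \<le> (1/2)^n) \<Longrightarrow>
      \<exists>x\<in>X. (\<lambda>n. N (f n - x)) \<longlonglongrightarrow> 0"
  shows "complete_seminormed X N"
proof
  fix f assume f: "Cau f"
  have "\<exists>r. (\<forall>n. \<forall>p\<ge>r n. \<forall>q\<ge>r n. N (f p - f q) < (1/2)^n) \<and> (\<forall>n. r n < r (Suc n))"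
  proof -
    have "\<exists>r. \<forall>n. (\<forall>p\<ge>r n. \<forall>q\<ge>r n. N (f p - f q) < (1/2)^n) \<and> r n < r (Suc n)"
    proof (rule dependent_nat_choice)
      show "\<exists>k. \<forall>p\<ge>k. \<forall>q\<ge>k. N (f p - f q) < (1/2)^0"
        using f unfolding Cau_def by (metis power_0 zero_less_one)
    next
      fix k :: nat and n :: nat
      obtain j where "\<forall>p\<ge>j. \<forall>q\<ge>j. N (f p - f q) < (1/2)^Suc n"
        using f unfolding Cau_def by (metis half_gt_zero_iff zero_less_one zero_less_power)
      then show "\<exists>y. (\<forall>p\<ge>y. \<forall>q\<ge>y. N (f p - f q) < (1/2)^Suc n) \<and> k < y"
        by (intro exI[of _ "max j (Suc k)"]) auto
    qed
    then show ?thesis by blast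
  qed
  then obtain r where r: "\<And>n p q. p \<ge> r n \<Longrightarrow> q \<ge> r n \<Longrightarrow> N (f p - f q) < (1/2)^n"
    and mono: "\<And>n. r n < r (Suc n)" by blast
  have fX: "f n \<in> X" for n using f by (simp add: Cau_def)
  have "\<exists>x\<in>X. (\<lambda>n. N ((f \<circ> r) n - x)) \<longlonglongrightarrow> 0"
    by (rule fast) (use fX r mono in \<open>auto intro!: less_imp_le simp: less_imp_le\<close>)
  then obtain x where x: "x \<in> X" "(\<lambda>n. N (f (r n) - x)) \<longlonglongrightarrow> 0" by auto
  have "(\<lambda>n. N (f n - x)) \<longlonglongrightarrow> 0"
  proof (rule LIMSEQ_I)
    fix e :: real assume e: "e > 0"
    obtain n0 where n0: "\<And>n. n \<ge> n0 \<Longrightarrow> \<bar>N (f (r n) - x)\<bar> < e / 2"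
      using LIMSEQ_D[OF x(2), of "e/2"] e by auto
    obtain n1 where n1: "(1/2)^n1 < e / (2::real)"
      using real_arch_pow_inv[of "e/2" "1/2"] e by auto
    define m where "m = max n0 n1"
    have "(1/2)^m \<le> (1/2::real)^n1" by (intro power_decreasing) (auto simp: m_def)
    show "\<exists>no. \<forall>n\<ge>no. norm (N (f n - x) - 0) < e"
    proof (intro exI[of _ "r m"] allI impI)
      fix n assume n: "r m \<le> n"
      have "N (f n - x) \<le> N (f n - f (r m)) + N (f (r m) - x)"
        using N_triangle4 fX x by auto
      also have "\<dots> < e"
        using r[of m n "r m"] n n0[of m] n1 \<open>(1/2)^m \<le> (1/2::real)^n1\<close> m_def by linarith
      finally show "norm (N (f n - x) - 0) < e" using N_nonneg[OF diff_mem[OF fX x(1)], of n] by simp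
    qed
  qed
  with x show "\<exists>x\<in>X. (\<lambda>n. N (f n - x)) \<longlonglongrightarrow> 0" by blast
qed

text \<open>\<open>N\<close> is a parameter tied to \<open>ip\<close> by \<open>N_eq\<close> and not
  defined from it, so that norms with a definition of their own, such as \<open>H1_norm\<close> and
  \<open>V_norm\<close>, can be plugged in.\<close>

locale semi_inner =
  fixes X :: "'v::real_vector set" and ip :: "'v \<Rightarrow> 'v \<Rightarrow> real" and N :: "'v \<Rightarrow> real"
  assumes ip_subspace: "subspace X"
    and ip_commute: "x \<in> X \<Longrightarrow> y \<in> X \<Longrightarrow> ip x y = ip y x"
    and ip_add_left: "x \<in> X \<Longrightarrow> y \<in> X \<Longrightarrow> z \<in> X \<Longrightarrow> ip (x + y) z = ip x z + ip y z"
    and ip_scale_left: "x \<in> X \<Longrightarrow> z \<in> X \<Longrightarrow> ip (a *\<^sub>R x) z = a * ip x z"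
    and ip_nonneg: "x \<in> X \<Longrightarrow> 0 \<le> ip x x"
    and N_eq: "x \<in> X \<Longrightarrow> N x = sqrt (ip x x)"
begin

lemma ip_add_right: "x \<in> X \<Longrightarrow> y \<in> X \<Longrightarrow> z \<in> X \<Longrightarrow> ip z (x + y) = ip z x + ip z y"
  using ip_add_left ip_commute ip_subspace by (metis subspace_add)

lemma ip_scale_right: "x \<in> X \<Longrightarrow> z \<in> X \<Longrightarrow> ip z (a *\<^sub>R x) = a * ip z x"
  using ip_scale_left ip_commute ip_subspace by (metis subspace_scale)

lemma ip_diff_left: "x \<in> X \<Longrightarrow> y \<in> X \<Longrightarrow> z \<in> X \<Longrightarrow> ip (x - y) z = ip x z - ip y z"
  using ip_add_left[of x "(-1) *\<^sub>R y" z] ip_scale_left[of y z "-1"] subspace_scale[OF ip_subspace, of y "-1"]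
  by simp

lemma ip_diff_right: "x \<in> X \<Longrightarrow> y \<in> X \<Longrightarrow> z \<in> X \<Longrightarrow> ip z (x - y) = ip z x - ip z y"
  using ip_diff_left ip_commute ip_subspace by (metis subspace_diff)

lemma N_power2: "x \<in> X \<Longrightarrow> (N x)\<^sup>2 = ip x x"
  by (simp add: N_eq ip_nonneg)

lemma Cauchy_Schwarz:
  assumes x: "x \<in> X" and y: "y \<in> X" shows "\<bar>ip x y\<bar> \<le> N x * N y"
proof -
  have q: "0 \<le> ip x x - 2 * s * ip x y + s\<^sup>2 * ip y y" for s
  proof -
    have "0 \<le> ip (x - s *\<^sub>R y) (x - s *\<^sub>R y)"
      by (intro ip_nonneg subspace_diff subspace_scale ip_subspace x y)
    also have "\<dots> = ip x x - 2 * s * ip x y + s\<^sup>2 * ip y y"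
      using x y ip_subspace
      by (simp add: ip_diff_left ip_diff_right ip_scale_left ip_scale_right subspace_diff subspace_scale
          ip_commute[of y x] power2_eq_square algebra_simps)
    finally show ?thesis .
  qed
  have "(ip x y)\<^sup>2 \<le> ip x x * ip y y"
  proof (cases "ip y y = 0")
    case True
    have "ip x y = 0"
    proof (rule ccontr)
      assume "ip x y \<noteq> 0"
      \<comment> \<open>The quadratic is affine in \<open>s\<close> here, and this choice gives it
        the value -1.\<close>
      then show False using q[of "(ip x x + 1) / (2 * ip x y)"] True by (simp add: field_simps)
    qed
    then show ?thesis using True by simp
  next
    case False
    then have "ip y y > 0" using ip_nonneg[OF y] by simp
    \<comment> \<open>The minimiser of the quadratic.\<close>
    then show ?thesis using q[of "ip x y / ip y y"]
      by (simp add: field_simps power2_eq_square)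
  qed
  then have "sqrt ((ip x y)\<^sup>2) \<le> sqrt (ip x x * ip y y)" by (rule real_sqrt_le_mono)
  then show ?thesis by (simp add: N_eq x y real_sqrt_mult)
qed

sublocale seminormed X N
proof
  show "subspace X" by (rule ip_subspace)
  fix x assume x: "x \<in> X"
  show "N (a *\<^sub>R x) = \<bar>a\<bar> * N x" for a
    using x ip_subspace by (simp add: N_eq ip_scale_left ip_scale_right subspace_scale real_sqrt_mult
        flip: mult.assoc)
  fix y assume y: "y \<in> X"
  have xy: "x + y \<in> X" using ip_subspace x y by (simp add: subspace_add)
  have nn: "0 \<le> N x" "0 \<le> N y" using x y by (simp_all add: N_eq ip_nonneg)
  have "(N (x + y))\<^sup>2 = ip x x + 2 * ip x y + ip y y"
    using x y xy by (simp add: N_power2 ip_add_left ip_add_right ip_commute[of y x])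
  also have "\<dots> \<le> (N x + N y)\<^sup>2"
    using Cauchy_Schwarz[OF x y] by (simp add: power2_sum N_power2 x y)
  finally show "N (x + y) \<le> N x + N y" using nn by (auto intro: power2_le_imp_le)
qed

lemma N_power2_add: "x \<in> X \<Longrightarrow> y \<in> X \<Longrightarrow> (N (x + y))\<^sup>2 = (N x)\<^sup>2 + 2 * ip x y + (N y)\<^sup>2"
  by (simp add: N_power2 ip_add_left ip_add_right ip_commute[of y x] add_mem)

lemma N_power2_diff: "x \<in> X \<Longrightarrow> y \<in> X \<Longrightarrow> (N (x - y))\<^sup>2 = (N x)\<^sup>2 - 2 * ip x y + (N y)\<^sup>2"
  by (simp add: N_power2 ip_diff_left ip_diff_right ip_commute[of y x] diff_mem)

lemma ip_tendsto:
  assumes f: "\<And>n. f n \<in> X" "x \<in> X" "(\<lambda>n. N (f n - x)) \<longlonglongrightarrow> 0"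
    and g: "\<And>n. g n \<in> X" "y \<in> X" "(\<lambda>n. N (g n - y)) \<longlonglongrightarrow> 0"
  shows "(\<lambda>n. ip (f n) (g n)) \<longlonglongrightarrow> ip x y"
proof -
  have "(\<lambda>n. ip (f n) (g n) - ip x y) \<longlonglongrightarrow> 0"
  proof (rule Lim_null_comparison)
    show "\<forall>\<^sub>F n in sequentially. norm (ip (f n) (g n) - ip x y) \<le> N (f n - x) * N (g n) + N x * N (g n - y)"
    proof (intro always_eventually allI)
      fix n
      have "ip (f n) (g n) - ip x y = ip (f n - x) (g n) + ip x (g n - y)"
        using f g by (simp add: ip_diff_left ip_diff_right)
      also have "norm \<dots> \<le> N (f n - x) * N (g n) + N x * N (g n - y)"
        using Cauchy_Schwarz[of "f n - x" "g n"] Cauchy_Schwarz[of x "g n - y"] f g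
        by (auto simp: diff_mem)
      finally show "norm (ip (f n) (g n) - ip x y) \<le> N (f n - x) * N (g n) + N x * N (g n - y)" .
    qed
    have "(\<lambda>n. N (f n - x) * N (g n) + N x * N (g n - y)) \<longlonglongrightarrow> 0 * N y + N x * 0"
      by (intro tendsto_intros f(3) g(3) N_tendsto[OF g])
    then show "(\<lambda>n. N (f n - x) * N (g n) + N x * N (g n - y)) \<longlonglongrightarrow> 0" by simp
  qed
  then show ?thesis by (simp add: LIM_zero_iff)
qed

lemma ip_null_cong:
  assumes "x \<in> X" "y \<in> X" "z \<in> X" "N (x - y) = 0" shows "ip x z = ip y z"
  using Cauchy_Schwarz[of "x - y" z] assms by (simp add: ip_diff_left diff_mem)

text \<open>Test with \<open>y = x\<close>. The norm of a Riesz representative is thus read off from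
  a bound on its functional.\<close>

lemma N_le_if_ip:
  assumes "x \<in> X" "K \<ge> 0" "\<And>y. y \<in> X \<Longrightarrow> \<bar>ip x y\<bar> \<le> K * N y" shows "N x \<le> K"
proof (cases "N x = 0")
  case False
  then have "N x > 0" using N_nonneg[OF assms(1)] by simp
  moreover have "N x * N x \<le> K * N x"
    using assms(3)[of x] assms(1) N_power2[of x] by (simp add: power2_eq_square)
  ultimately show ?thesis by simp
qed (use assms in simp)

end

section \<open>Riesz representation and density by orthogonality\<close>

locale semi_hilbert = semi_inner + complete_seminormed
begin

text \<open>Minimise \<open>N y ^ 2 - 2 * F y\<close> over \<open>Y\<close>, which is a subspace up to elements of seminorm 0.\<close>

lemma Riesz_on:
  assumes YX: "Y \<subseteq> X" and Y0: "Y \<noteq> {}"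
    and comb: "\<And>x y a b. x \<in> Y \<Longrightarrow> y \<in> Y \<Longrightarrow> \<exists>z\<in>Y. N (a *\<^sub>R x + b *\<^sub>R y - z) = 0"
    and lin: "\<And>x y a b. x \<in> X \<Longrightarrow> y \<in> X \<Longrightarrow> F (a *\<^sub>R x + b *\<^sub>R y) = a * F x + b * F y"
    and bdd: "\<And>x. x \<in> X \<Longrightarrow> \<bar>F x\<bar> \<le> K * N x"
  obtains p q where "p \<in> X" "\<And>n. q n \<in> Y" "(\<lambda>n. N (q n - p)) \<longlonglongrightarrow> 0" "\<And>y. y \<in> Y \<Longrightarrow> ip p y = F y"
proof -
  define J where "J y = (N y)\<^sup>2 - 2 * F y" for y
  have F_add: "F (x + y) = F x + F y" if "x \<in> X" "y \<in> X" for x y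
    using lin[OF that, of 1 1] by simp
  have F_scale: "F (a *\<^sub>R x) = a * F x" if "x \<in> X" for a x
    using lin[OF that that, of a 0] by simp
  have J_null: "J z = J x" if "x \<in> X" "z \<in> X" "N (x - z) = 0" for x z
  proof -
    have "N x = N z" using N_triangle_rev[OF that(1,2)] that(3) by simp
    moreover have "F x = F z"
      using bdd[of "x - z"] F_add[of "x - z" z] that by (auto simp: diff_mem)
    ultimately show ?thesis by (simp add: J_def)
  qed
  have lower: "- K\<^sup>2 \<le> J y" if "y \<in> Y" for y
  proof -
    have "y \<in> X" using that YX by auto
    then have "2 * F y \<le> 2 * (K * N y)" using bdd[of y] by linarith
    also have "\<dots> \<le> K\<^sup>2 + (N y)\<^sup>2" using sum_squares_bound[of K "N y"] by simp
    finally show ?thesis by (simp add: J_def)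
  qed
  define d where "d = Inf (J ` Y)"
  have bb: "bdd_below (J ` Y)" using lower by (intro bdd_belowI[of _ "- K\<^sup>2"]) auto
  have dJ: "d \<le> J y" if "y \<in> Y" for y
    unfolding d_def using that bb by (intro cInf_lower) auto
  have dJ': "d \<le> J x" if "x \<in> X" "y \<in> Y" "N (x - y) = 0" for x y
    using dJ[OF that(2)] J_null[of x y] that YX by auto
  have "\<exists>y\<in>Y. J y < d + 1 / Suc n" for n
    using cInf_lessD[of "J ` Y" "d + 1 / Suc n"] Y0 by (auto simp: d_def)
  then obtain q where q: "\<And>n. q n \<in> Y" "\<And>n. J (q n) < d + 1 / Suc n" by metis
  have qX: "q n \<in> X" for n using q YX by auto
  have Cau_q: "(N (q m - q n))\<^sup>2 \<le> 2 / Suc m + 2 / Suc n" for m n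
  proof -
    obtain z where z: "z \<in> Y" "N ((1/2) *\<^sub>R q m + (1/2) *\<^sub>R q n - z) = 0"
      using comb[OF q(1) q(1)] by blast
    let ?z = "(1/2) *\<^sub>R q m + (1/2) *\<^sub>R q n"
    have zX: "?z \<in> X" using qX by auto
    have "d \<le> J ?z" using dJ'[OF zX z(1,2)] .
    \<comment> \<open>The parallelogram law. Since the midpoint cannot fall below the infimum
      \<open>d\<close>, two almost minimisers are close to each other.\<close>
    moreover have "J ?z = (J (q m) + J (q n)) / 2 - (N (q m - q n))\<^sup>2 / 4"
    proof -
      have "(N ?z)\<^sup>2 = ((N (q m))\<^sup>2 + 2 * ip (q m) (q n) + (N (q n))\<^sup>2) / 4"
        using qX by (simp add: N_power2_add scale_mem N_scale ip_scale_left ip_scale_right power_divide)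
      then show ?thesis
        using qX by (simp add: J_def lin N_power2_diff field_simps)
    qed
    ultimately have "(N (q m - q n))\<^sup>2 \<le> 2 * (J (q m) - d) + 2 * (J (q n) - d)" by (simp add: field_simps)
    also have "\<dots> \<le> 2 * (1 / Suc m) + 2 * (1 / Suc n)"
      using q(2)[of m] q(2)[of n] by (intro add_mono mult_left_mono) auto
    finally show ?thesis by simp
  qed
  have "Cau q"
  proof (rule Cau_bound)
    show "(\<lambda>n. sqrt (2 / Suc n)) \<longlonglongrightarrow> 0"
      using tendsto_real_sqrt[OF tendsto_mult_right[OF LIMSEQ_inverse_real_of_nat, of 2]]
      by (simp add: field_simps)
    show "N (q m - q n) \<le> sqrt (2 / Suc m) + sqrt (2 / Suc n)" for m n
    proof -
      have "N (q m - q n) \<le> sqrt (2 / Suc m + 2 / Suc n)"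
        using Cau_q[of m n] by (rule real_le_rsqrt)
      also have "\<dots> \<le> sqrt (2 / Suc m) + sqrt (2 / Suc n)"
        by (rule sqrt_add_le_add_sqrt) auto
      finally show ?thesis .
    qed
  qed (rule qX)
  then obtain p where p: "p \<in> X" "(\<lambda>n. N (q n - p)) \<longlonglongrightarrow> 0" using Cau_converges by blast
  have "ip p y = F y" if y: "y \<in> Y" for y
  proof -
    have yX: "y \<in> X" using y YX by auto
    \<comment> \<open>First variation: moving \<open>q n\<close> by a multiple of \<open>y\<close>
      cannot lower \<open>J\<close> by more than the error \<open>1 / Suc n\<close>, which
      disappears in the limit.\<close>
    have key: "0 \<le> 2 * s * (ip p y - F y) + s\<^sup>2 * (N y)\<^sup>2" for s
    proof (rule LIMSEQ_le_const)
      have "(\<lambda>n. ip (q n) y) \<longlonglongrightarrow> ip p y"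
        by (rule ip_tendsto[where g = "\<lambda>_. y" and y = y]) (use qX p yX in auto)
      then have "(\<lambda>n. 2 * s * (ip (q n) y - F y) + s\<^sup>2 * (N y)\<^sup>2 + inverse (real (Suc n)))
          \<longlonglongrightarrow> 2 * s * (ip p y - F y) + s\<^sup>2 * (N y)\<^sup>2 + 0"
        by (intro tendsto_intros LIMSEQ_inverse_real_of_nat)
      then show "(\<lambda>n. 2 * s * (ip (q n) y - F y) + s\<^sup>2 * (N y)\<^sup>2 + inverse (real (Suc n)))
          \<longlonglongrightarrow> 2 * s * (ip p y - F y) + s\<^sup>2 * (N y)\<^sup>2" by simp
      show "\<exists>k. \<forall>n\<ge>k. 0 \<le> 2 * s * (ip (q n) y - F y) + s\<^sup>2 * (N y)\<^sup>2 + inverse (real (Suc n))"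
      proof (intro exI allI impI)
        fix n
        obtain z where z: "z \<in> Y" "N (1 *\<^sub>R q n + s *\<^sub>R y - z) = 0"
          using comb[OF q(1) y] by blast
        have "d \<le> J (q n + s *\<^sub>R y)" using dJ'[OF _ z(1)] z(2) qX yX by auto
        also have "\<dots> = J (q n) + 2 * s * (ip (q n) y - F y) + s\<^sup>2 * (N y)\<^sup>2"
          using qX yX by (simp add: J_def N_power2_add scale_mem ip_scale_right N_scale F_add F_scale
              power_mult_distrib algebra_simps)
        finally show "0 \<le> 2 * s * (ip (q n) y - F y) + s\<^sup>2 * (N y)\<^sup>2 + inverse (real (Suc n))"
          using q(2)[of n] by (simp add: inverse_eq_divide)
      qed
    qed
    show ?thesis
    proof (rule ccontr)
      assume "ip p y \<noteq> F y"
      define k where "k = ip p y - F y"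
      have k: "k \<noteq> 0" using \<open>ip p y \<noteq> F y\<close> by (simp add: k_def)
      \<comment> \<open>The summand 1 in the denominator keeps the choice valid when
        \<open>N y = 0\<close>; the variation is still strictly negative.\<close>
      define s where "s = - k / (1 + (N y)\<^sup>2)"
      have pos: "1 + (N y)\<^sup>2 > 0" by (simp add: add_pos_nonneg)
      have sk: "s * (1 + (N y)\<^sup>2) = - k" using pos by (simp add: s_def)
      have "2 * s * k + s\<^sup>2 * (N y)\<^sup>2 = 2 * s * k + s * (s * (1 + (N y)\<^sup>2)) - s\<^sup>2"
        by (simp add: power2_eq_square algebra_simps)
      also have "\<dots> = s * k - s\<^sup>2" by (simp add: sk)
      also have "\<dots> < 0"
      proof -
        have "s * k = - (k\<^sup>2 / (1 + (N y)\<^sup>2))" by (simp add: s_def power2_eq_square)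
        moreover have "k\<^sup>2 / (1 + (N y)\<^sup>2) > 0" using k pos by simp
        ultimately show ?thesis using zero_le_power2[of s] by linarith
      qed
      finally show False using key[of s] by (simp add: k_def)
    qed
  qed
  with p q(1) show thesis by (rule_tac that) auto
qed

lemma Riesz:
  assumes lin: "\<And>x y a b. x \<in> X \<Longrightarrow> y \<in> X \<Longrightarrow> F (a *\<^sub>R x + b *\<^sub>R y) = a * F x + b * F y"
    and bdd: "\<And>x. x \<in> X \<Longrightarrow> \<bar>F x\<bar> \<le> K * N x"
  obtains p where "p \<in> X" "\<And>y. y \<in> X \<Longrightarrow> ip p y = F y"
proof -
  have comb: "\<exists>z\<in>X. N (a *\<^sub>R x + b *\<^sub>R y - z) = 0" if "x \<in> X" "y \<in> X" for x y a b
    using that by (intro bexI[of _ "a *\<^sub>R x + b *\<^sub>R y"]) auto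
  have ne: "X \<noteq> {}" using zero_mem by blast
  show thesis
    by (rule Riesz_on[where Y = X and F = F and K = K]; (rule order_refl ne comb lin bdd that; assumption)?)
qed

text \<open>Riesz representation of \<open>ip x\<close> along \<open>Y\<close> yields the projection
  \<open>p\<close> of \<open>x\<close> onto the closure of \<open>Y\<close>, with a sequence in
  \<open>Y\<close> tending to it. The rest \<open>x - p\<close> is orthogonal to \<open>Y\<close>,
  hence null, so the same sequence tends to \<open>x\<close>.\<close>

lemma dense_if_orthogonal_trivial:
  assumes YX: "Y \<subseteq> X" and Y0: "Y \<noteq> {}"
    and comb: "\<And>x y a b. x \<in> Y \<Longrightarrow> y \<in> Y \<Longrightarrow> \<exists>z\<in>Y. N (a *\<^sub>R x + b *\<^sub>R y - z) = 0"
    and triv: "\<And>g. g \<in> X \<Longrightarrow> (\<And>y. y \<in> Y \<Longrightarrow> ip y g = 0) \<Longrightarrow> N g = 0"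
    and x: "x \<in> X"
  obtains q where "\<And>n. q n \<in> Y" "(\<lambda>n. N (q n - x)) \<longlonglongrightarrow> 0"
proof -
  have lin: "ip x (a *\<^sub>R y + b *\<^sub>R z) = a * ip x y + b * ip x z" if "y \<in> X" "z \<in> X" for y z a b
    using that x by (simp add: ip_add_right ip_scale_right scale_mem)
  show thesis
  proof (rule Riesz_on[where Y = Y and F = "ip x" and K = "N x"])
    fix p q assume p: "p \<in> X" "\<And>n. q n \<in> Y" "(\<lambda>n. N (q n - p)) \<longlonglongrightarrow> 0" "\<And>y. y \<in> Y \<Longrightarrow> ip p y = ip x y"
    have "N (x - p) = 0"
    proof (rule triv)
      fix y assume "y \<in> Y"
      then show "ip y (x - p) = 0" using p x YX by (auto simp: ip_diff_right ip_commute[of y])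
    qed (use x p in auto)
    have "(\<lambda>n. N (q n - x)) \<longlonglongrightarrow> 0"
    proof (rule Lim_null_comparison[OF _ p(3)], intro always_eventually allI)
      fix n
      have "q n \<in> X" using p YX by auto
      then show "norm (N (q n - x)) \<le> N (q n - p)"
        using N_triangle4[of "q n" p x] N_diff_commute[of x p] \<open>N (x - p) = 0\<close> p(1) x
          N_nonneg[OF diff_mem[of "q n" x]] by simp
    qed
    with p(2) show thesis by (rule that)
  qed (fact YX Y0 comb lin Cauchy_Schwarz[OF x])+
qed

end

section \<open>Bochner spaces over spaces of representatives\<close>

abbreviation "smeas \<equiv> strongly_measurable"

lemma (in complete_measure) borel_measurable_cong_AE:
  assumes f: "f \<in> borel_measurable M" and eq: "AE x in M. f x = g x"
  shows "g \<in> borel_measurable M"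
proof (rule measurableI)
  fix A :: "'b set" assume A: "A \<in> sets borel"
  show "g -` A \<inter> space M \<in> sets M"
  proof (rule in_sets_AE)
    show "AE x in M. x \<in> f -` A \<inter> space M \<longleftrightarrow> x \<in> g -` A \<inter> space M"
      using eq by eventually_elim auto
    show "f -` A \<inter> space M \<in> sets M" using f A by (rule measurable_sets)
  qed auto
qed auto

lemma (in complete_measure) borel_measurable_lim_AE:
  fixes f :: "nat \<Rightarrow> 'a \<Rightarrow> 'b::{banach, second_countable_topology}"
  assumes f: "\<And>i. f i \<in> borel_measurable M" and lim: "AE x in M. (\<lambda>i. f i x) \<longlonglongrightarrow> g x"
  shows "g \<in> borel_measurable M"
proof (rule borel_measurable_cong_AE)
  show "(\<lambda>x. lim (\<lambda>i. f i x)) \<in> borel_measurable M" by (intro borel_measurable_lim_metric f)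
  show "AE x in M. lim (\<lambda>i. f i x) = g x" using lim by eventually_elim (rule limI)
qed

text \<open>No measurability is assumed: over a complete measure either both functions are
  measurable or neither is, and in the second case both integrals have the default value 0.\<close>

lemma integral_cong_AE_complete:
  fixes f g :: "'x \<Rightarrow> real"
  assumes M: "complete_measure M" and eq: "AE x in M. f x = g x"
  shows "(\<integral>x. f x \<partial>M) = (\<integral>x. g x \<partial>M)"
proof (cases "f \<in> borel_measurable M")
  case True
  have "g \<in> borel_measurable M" by (rule complete_measure.borel_measurable_cong_AE[OF M True eq])
  with True show ?thesis using eq by (rule integral_cong_AE)
next
  case False
  have "g \<notin> borel_measurable M"
  proof
    assume "g \<in> borel_measurable M"
    then have "f \<in> borel_measurable M"
      by (rule complete_measure.borel_measurable_cong_AE[OF M]) (use eq in \<open>auto elim: eventually_mono\<close>)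
    with False show False ..
  qed
  with False have "\<not> integrable M f" "\<not> integrable M g" using borel_measurable_integrable by blast+
  then show ?thesis by (simp add: not_integrable_integral_eq)
qed

lemma strongly_measurable_map:
  assumes f: "smeas M X N f"
    and L: "\<And>x. x \<in> X \<Longrightarrow> L x \<in> Y" and lip: "\<And>x y. x \<in> X \<Longrightarrow> y \<in> X \<Longrightarrow> N' (L x - L y) \<le> C * N (x - y)"
    and nn: "\<And>x y. x \<in> Y \<Longrightarrow> y \<in> Y \<Longrightarrow> 0 \<le> N' (x - y)"
  shows "smeas M Y N' (\<lambda>x. L (f x))"
proof -
  obtain s where fX: "AE x in M. f x \<in> X" and s: "\<And>i. simple_function M (s i)" "\<And>i. s i ` space M \<subseteq> X"
    and lim: "AE x in M. (\<lambda>i. N (s i x - f x)) \<longlonglongrightarrow> 0"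
    using f unfolding strongly_measurable_def by blast
  have "AE x in M. (\<lambda>i. N' (L (s i x) - L (f x))) \<longlonglongrightarrow> 0"
    using fX lim AE_space
  proof eventually_elim
    case (elim x)
    have "(\<lambda>i. C * N (s i x - f x)) \<longlonglongrightarrow> C * 0" by (intro tendsto_intros elim)
    then show ?case
      unfolding mult_zero_right
      by (rule Lim_null_comparison[rotated])
        (use s elim nn L lip in \<open>auto intro!: always_eventually simp: image_subset_iff\<close>)
  qed
  moreover have "simple_function M (\<lambda>x. L (s i x))" for i using s(1) by (rule simple_function_compose1)
  moreover have "(\<lambda>x. L (s i x)) ` space M \<subseteq> Y" for i using s(2)[of i] L by auto
  moreover have "AE x in M. L (f x) \<in> Y" using fX by eventually_elim (rule L)
  ultimately show ?thesis
    unfolding strongly_measurable_def by (intro conjI exI[of _ "\<lambda>i x. L (s i x)"]) auto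
qed

section \<open>Strong measurability\<close>

context seminormed
begin

lemma sm_AE_mem: "smeas M X N f \<Longrightarrow> AE x in M. f x \<in> X"
  by (simp add: strongly_measurable_def)

lemma sm_simple: "simple_function M s \<Longrightarrow> s ` space M \<subseteq> X \<Longrightarrow> smeas M X N s"
  unfolding strongly_measurable_def by (intro conjI exI[of _ "\<lambda>_. s"]) (auto intro!: AE_I2)

lemma sm_const: "x \<in> X \<Longrightarrow> smeas M X N (\<lambda>_. x)"
  by (rule sm_simple) auto

lemma sm_N_measurable:
  assumes "complete_measure M" "smeas M X N f"
  shows "(\<lambda>x. N (f x)) \<in> borel_measurable M"
proof -
  interpret complete_measure M by fact
  obtain s where fX: "AE x in M. f x \<in> X" and s: "\<And>i. simple_function M (s i)" "\<And>i. s i ` space M \<subseteq> X"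
    and lim: "AE x in M. (\<lambda>i. N (s i x - f x)) \<longlonglongrightarrow> 0"
    using assms(2) unfolding strongly_measurable_def by blast
  show ?thesis
  proof (rule borel_measurable_lim_AE)
    show "(\<lambda>x. N (s i x)) \<in> borel_measurable M" for i
      by (rule borel_measurable_simple_function[OF simple_function_compose1[OF s(1)]])
    show "AE x in M. (\<lambda>i. N (s i x)) \<longlonglongrightarrow> N (f x)"
      using fX lim AE_space by eventually_elim (rule N_tendsto, use s in auto)
  qed
qed

lemma sm_add:
  assumes "smeas M X N f" "smeas M X N g"
  shows "smeas M X N (\<lambda>x. f x + g x)"
proof -
  obtain s where fX: "AE x in M. f x \<in> X" and s: "\<And>i. simple_function M (s i)" "\<And>i. s i ` space M \<subseteq> X"
    and slim: "AE x in M. (\<lambda>i. N (s i x - f x)) \<longlonglongrightarrow> 0"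
    using assms(1) unfolding strongly_measurable_def by blast
  obtain t where gX: "AE x in M. g x \<in> X" and t: "\<And>i. simple_function M (t i)" "\<And>i. t i ` space M \<subseteq> X"
    and tlim: "AE x in M. (\<lambda>i. N (t i x - g x)) \<longlonglongrightarrow> 0"
    using assms(2) unfolding strongly_measurable_def by blast
  have "AE x in M. (\<lambda>i. N ((s i x + t i x) - (f x + g x))) \<longlonglongrightarrow> 0"
    using fX gX slim tlim AE_space
  proof eventually_elim
    case (elim x)
    have m: "s i x \<in> X" "t i x \<in> X" for i using s(2)[of i] t(2)[of i] elim by auto
    have "(\<lambda>i. N (s i x - f x) + N (t i x - g x)) \<longlonglongrightarrow> 0 + 0" by (intro tendsto_intros elim)
    then show ?case unfolding add_0_left
    proof (rule Lim_null_comparison[rotated], intro always_eventually allI)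
      fix i
      have eq: "(s i x + t i x) - (f x + g x) = (s i x - f x) + (t i x - g x)" by simp
      show "norm (N ((s i x + t i x) - (f x + g x))) \<le> N (s i x - f x) + N (t i x - g x)"
        unfolding eq
        using N_triangle[of "s i x - f x" "t i x - g x"] N_nonneg[of "(s i x - f x) + (t i x - g x)"] m elim
        by (auto simp: diff_mem add_mem)
    qed
  qed
  moreover have "simple_function M (\<lambda>x. s i x + t i x)" for i
    using s(1) t(1) by (rule simple_function_compose2)
  moreover have "(\<lambda>x. s i x + t i x) ` space M \<subseteq> X" for i using s(2)[of i] t(2)[of i] by auto
  moreover have "AE x in M. f x + g x \<in> X" using fX gX by eventually_elim auto
  ultimately show ?thesis
    unfolding strongly_measurable_def by (intro conjI exI[of _ "\<lambda>i x. s i x + t i x"]) auto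
qed

lemma sm_scaleR:
  assumes \<phi>: "\<phi> \<in> borel_measurable M" and f: "smeas M X N f"
  shows "smeas M X N (\<lambda>x. \<phi> x *\<^sub>R f x)"
proof -
  obtain s where fX: "AE x in M. f x \<in> X" and s: "\<And>i. simple_function M (s i)" "\<And>i. s i ` space M \<subseteq> X"
    and slim: "AE x in M. (\<lambda>i. N (s i x - f x)) \<longlonglongrightarrow> 0"
    using f unfolding strongly_measurable_def by blast
  obtain p where p: "\<And>i. simple_function M (p i)" "\<And>x. x \<in> space M \<Longrightarrow> (\<lambda>i. p i x) \<longlonglongrightarrow> (\<phi> x::real)"
    using borel_measurable_implies_sequence_metric[OF \<phi>] by blast
  have "AE x in M. (\<lambda>i. N (p i x *\<^sub>R s i x - \<phi> x *\<^sub>R f x)) \<longlonglongrightarrow> 0"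
    using fX slim AE_space
  proof eventually_elim
    case (elim x)
    have m: "s i x \<in> X" for i using s elim by auto
    have "(\<lambda>i. \<bar>p i x\<bar> * N (s i x - f x) + \<bar>p i x - \<phi> x\<bar> * N (f x)) \<longlonglongrightarrow> \<bar>\<phi> x\<bar> * 0 + \<bar>\<phi> x - \<phi> x\<bar> * N (f x)"
      using elim p by (intro tendsto_intros) auto
    then have "(\<lambda>i. \<bar>p i x\<bar> * N (s i x - f x) + \<bar>p i x - \<phi> x\<bar> * N (f x)) \<longlonglongrightarrow> 0" by simp
    then show ?case
    proof (rule Lim_null_comparison[rotated], intro always_eventually allI)
      fix i
      have "p i x *\<^sub>R s i x - \<phi> x *\<^sub>R f x = p i x *\<^sub>R (s i x - f x) + (p i x - \<phi> x) *\<^sub>R f x"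
        by (simp add: algebra_simps)
      moreover have "0 \<le> N (p i x *\<^sub>R s i x - \<phi> x *\<^sub>R f x)"
        using m elim by (intro N_nonneg diff_mem scale_mem) auto
      ultimately show "norm (N (p i x *\<^sub>R s i x - \<phi> x *\<^sub>R f x)) \<le> \<bar>p i x\<bar> * N (s i x - f x) + \<bar>p i x - \<phi> x\<bar> * N (f x)"
        using N_triangle[of "p i x *\<^sub>R (s i x - f x)" "(p i x - \<phi> x) *\<^sub>R f x"] m elim
        by (simp add: diff_mem scale_mem N_scale)
    qed
  qed
  moreover have "simple_function M (\<lambda>x. p i x *\<^sub>R s i x)" for i
    using p(1) s(1) by (rule simple_function_compose2)
  moreover have "(\<lambda>x. p i x *\<^sub>R s i x) ` space M \<subseteq> X" for i using s(2)[of i] by auto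
  moreover have "AE x in M. \<phi> x *\<^sub>R f x \<in> X" using fX by eventually_elim auto
  ultimately show ?thesis
    unfolding strongly_measurable_def by (intro conjI exI[of _ "\<lambda>i x. p i x *\<^sub>R s i x"]) auto
qed

lemma sm_diff:
  assumes "smeas M X N f" "smeas M X N g"
  shows "smeas M X N (\<lambda>x. f x - g x)"
  using sm_add[OF assms(1) sm_scaleR[OF borel_measurable_const assms(2), of "-1"]] by simp

text \<open>Simple functions have finitely many values, so the values of an approximating sequence
  form a countable set, which comes arbitrarily close to almost every \<open>f x\<close>. The
  element 0 is inserted to keep this set nonempty.\<close>

lemma sm_dense_seq:
  assumes "smeas M X N f"
  obtains d :: "nat \<Rightarrow> 'v" where "\<And>i. d i \<in> X" "AE x in M. \<forall>e>0. \<exists>i. N (f x - d i) < e"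
proof -
  obtain s where fX: "AE x in M. f x \<in> X" and s: "\<And>i. simple_function M (s i)" "\<And>i. s i ` space M \<subseteq> X"
    and slim: "AE x in M. (\<lambda>i. N (s i x - f x)) \<longlonglongrightarrow> 0"
    using assms(1) unfolding strongly_measurable_def by blast
  define S where "S = insert 0 (\<Union>i. s i ` space M)"
  have "countable S"
    unfolding S_def using s(1) by (auto simp: simple_function_def intro: countable_finite)
  have SX: "S \<subseteq> X" using s(2) by (auto simp: S_def)
  define d where "d = from_nat_into S"
  have rd: "range d = S" unfolding d_def using \<open>countable S\<close> by (intro range_from_nat_into) (auto simp: S_def)
  show thesis
  proof
    show "d i \<in> X" for i using rd SX by auto
    show "AE x in M. \<forall>e>0. \<exists>i. N (f x - d i) < e"
      using fX slim AE_space
    proof eventually_elim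
      case (elim x)
      show ?case
      proof (intro allI impI)
        fix e :: real assume "e > 0"
        then obtain i where i: "N (s i x - f x) < e"
          using LIMSEQ_D[OF elim(2), of e] by (auto simp: abs_less_iff)
        obtain j where "d j = s i x" using rd elim(3) by (metis S_def UN_I UNIV_I imageE imageI insertI2)
        then show "\<exists>i. N (f x - d i) < e"
          using i s(2)[of i] elim(1,3) N_diff_commute[of "f x" "s i x"] by (intro exI[of _ j]) auto
      qed
    qed
  qed
qed

text \<open>The converse of \<open>sm_dense_seq\<close> once the distances to the sequence are
  measurable, as in Pettis' criterion. It reduces strong measurability to the measurability of real
  functions.\<close>

lemma sm_if_dense_seq:
  fixes d :: "nat \<Rightarrow> 'v"
  assumes d: "\<And>i. d i \<in> X" and fX: "AE x in M. f x \<in> X"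
    and meas: "\<And>i. (\<lambda>x. N (f x - d i)) \<in> borel_measurable M"
    and dense: "AE x in M. \<forall>e>0. \<exists>i. N (f x - d i) < e"
  shows "smeas M X N f"
proof -
  \<comment> \<open>\<open>s k x\<close> is the element nearest to \<open>f x\<close> among
    \<open>d 0\<close>, ..., \<open>d k\<close>; the strict comparison keeps the earlier one in a
    tie.\<close>
  define s where "s = rec_nat (\<lambda>x. d 0) (\<lambda>k r x. if N (f x - d (Suc k)) < N (f x - r x) then d (Suc k) else r x)"
  have s0: "s 0 x = d 0" for x by (simp add: s_def)
  have sS: "s (Suc k) x = (if N (f x - d (Suc k)) < N (f x - s k x) then d (Suc k) else s k x)" for k x
    by (simp add: s_def)
  have sX: "s k x \<in> X" for k x by (induction k) (auto simp: s0 sS d)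
  have m: "(\<lambda>x. N (f x - s k x)) \<in> borel_measurable M" for k
  proof (induction k)
    case (Suc k)
    have "(\<lambda>x. N (f x - s (Suc k) x)) = (\<lambda>x. min (N (f x - d (Suc k))) (N (f x - s k x)))"
      by (auto simp: sS)
    then show ?case using Suc meas by simp
  qed (simp add: s0 meas)
  have simp: "simple_function M (s k)" for k
  proof (induction k)
    case (Suc k)
    have "simple_function M (\<lambda>x. if N (f x - d (Suc k)) < N (f x - s k x) then d (Suc k) else s k x)"
      by (intro simple_function_If Suc simple_function_const) (use meas m in measurable)
    then show ?case by (simp add: sS[abs_def])
  next
    case 0 then show ?case by (simp add: s0[abs_def])
  qed
  have le: "i \<le> k \<Longrightarrow> N (f x - s k x) \<le> N (f x - d i)" for i k x
  proof (induction k)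
    case (Suc k)
    then show ?case by (cases "i = Suc k") (auto simp: sS)
  qed (simp add: s0)
  have "AE x in M. (\<lambda>i. N (s i x - f x)) \<longlonglongrightarrow> 0"
    using fX dense
  proof eventually_elim
    case (elim x)
    show ?case
    proof (rule LIMSEQ_I)
      fix e :: real assume "e > 0"
      then obtain i where "N (f x - d i) < e" using elim by blast
      then show "\<exists>no. \<forall>n\<ge>no. norm (N (s n x - f x) - 0) < e"
        using le[of i _ x] N_diff_commute[OF elim(1) sX] N_nonneg[OF diff_mem[OF elim(1) sX]]
        by (intro exI[of _ i]) (auto intro: le_less_trans)
    qed
  qed
  then show ?thesis
    unfolding strongly_measurable_def using fX simp sX by (intro conjI exI[of _ s]) auto
qed

text \<open>Both conditions of \<open>sm_if_dense_seq\<close> survive the limit: the distances to a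
  fixed element converge almost everywhere, and the dense sequences of all the \<open>f n\<close>
  are merged into one by pairing indices.\<close>

lemma sm_lim:
  assumes M: "complete_measure M" and f: "\<And>n::nat. smeas M X N (f n)"
    and gX: "AE x in M. g x \<in> X" and lim: "AE x in M. (\<lambda>n. N (f n x - g x)) \<longlonglongrightarrow> 0"
  shows "smeas M X N g"
proof -
  interpret complete_measure M by fact
  have "\<exists>d :: nat \<Rightarrow> 'v. (\<forall>i. d i \<in> X) \<and> (AE x in M. \<forall>e>0. \<exists>i. N (f n x - d i) < e)" for n
    by (rule sm_dense_seq[OF f[of n]]) blast
  then have "\<exists>d. \<forall>n. (\<forall>i. d n i \<in> X) \<and> (AE x in M. \<forall>e>0. \<exists>i::nat. N (f n x - d n i) < e)"
    by (intro choice allI)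
  then obtain d :: "nat \<Rightarrow> nat \<Rightarrow> 'v" where d: "\<And>n i. d n i \<in> X" "\<And>n. AE x in M. \<forall>e>0. \<exists>i. N (f n x - d n i) < e"
    by blast
  define d' where "d' k = (case prod_decode k of (n, i) \<Rightarrow> d n i)" for k
  have fX: "AE x in M. \<forall>n. f n x \<in> X"
    using sm_AE_mem[OF f] by (simp add: AE_all_countable)
  have d'X: "d' k \<in> X" for k by (simp add: d'_def d split: prod.split)
  show ?thesis
  proof (rule sm_if_dense_seq[where d = d'])
    show "d' i \<in> X" for i by (rule d'X)
    show "AE x in M. g x \<in> X" by fact
    show "(\<lambda>x. N (g x - d' i)) \<in> borel_measurable M" for i
    proof (rule borel_measurable_lim_AE)
      show "(\<lambda>x. N (f n x - d' i)) \<in> borel_measurable M" for n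
        by (intro sm_N_measurable M sm_diff f sm_const d'X)
      show "AE x in M. (\<lambda>n. N (f n x - d' i)) \<longlonglongrightarrow> N (g x - d' i)"
        using fX gX lim by eventually_elim (rule N_tendsto, use d'X in auto)
    qed
    have "AE x in M. \<forall>n. \<forall>e>0. \<exists>i. N (f n x - d n i) < e"
      using d(2) by (simp add: AE_all_countable)
    then show "AE x in M. \<forall>e>0. \<exists>i. N (g x - d' i) < e"
      using fX gX lim
    proof eventually_elim
      case (elim x)
      show ?case
      proof (intro allI impI)
        fix e :: real assume e: "e > 0"
        obtain n where n: "N (f n x - g x) < e/2" using order_tendstoD(2)[OF elim(4), of "e/2"] e by (auto simp: eventually_sequentially)
        obtain i where i: "N (f n x - d n i) < e/2" using elim(1) e by (meson half_gt_zero)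
        have "N (g x - d n i) \<le> N (g x - f n x) + N (f n x - d n i)"
          using elim d by (intro N_triangle4) auto
        also have "N (g x - f n x) = N (f n x - g x)" using elim by (intro N_diff_commute) auto
        finally have "N (g x - d n i) < e" using n i by simp
        then show "\<exists>i. N (g x - d' i) < e" by (intro exI[of _ "prod_encode (n, i)"]) (simp add: d'_def)
      qed
    qed
  qed
qed

lemma sm_cong_AE:
  assumes f: "smeas M X N f"
    and g: "AE x in M. g x \<in> X" "AE x in M. N (f x - g x) = 0"
  shows "smeas M X N g"
proof -
  obtain s where fX: "AE x in M. f x \<in> X" and s: "\<And>i. simple_function M (s i)" "\<And>i. s i ` space M \<subseteq> X"
    and lim: "AE x in M. (\<lambda>i. N (s i x - f x)) \<longlonglongrightarrow> 0"
    using f unfolding strongly_measurable_def by blast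
  have "AE x in M. (\<lambda>i. N (s i x - g x)) \<longlonglongrightarrow> 0"
    using fX g lim AE_space
  proof eventually_elim
    case (elim x)
    have m: "s i x \<in> X" for i using s elim by auto
    show ?case
    proof (rule Lim_null_comparison[OF _ elim(4)], intro always_eventually allI)
      show "norm (N (s i x - g x)) \<le> N (s i x - f x)" for i
        using N_triangle4[of "s i x" "f x" "g x"] m elim N_nonneg[OF diff_mem[of "s i x" "g x"]] by simp
    qed
  qed
  then show ?thesis
    unfolding strongly_measurable_def using g(1) s by (intro conjI exI[of _ s]) auto
qed

text \<open>On the finitely many level sets of \<open>s\<close> the parameter of the family is
  fixed, so the function is a finite sum of indicators times measurable functions.\<close>

lemma sm_simple_family:
  assumes M: "complete_measure M" and s: "simple_function M s" and F: "\<And>v. v \<in> s ` space M \<Longrightarrow> smeas M X N (F v)"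
  shows "smeas M X N (\<lambda>x. F (s x) x)"
proof -
  have fin: "finite (s ` space M)" using s by (simp add: simple_function_def)
  have eq: "(\<Sum>v\<in>s ` space M. (indicator (s -` {v} \<inter> space M) x) *\<^sub>R F v x) = F (s x) x" if "x \<in> space M" for x
  proof -
    have "(\<Sum>v\<in>s ` space M. (indicator (s -` {v} \<inter> space M) x) *\<^sub>R F v x) =
        (\<Sum>v\<in>s ` space M. if v = s x then F v x else 0)"
      using that by (intro sum.cong) (auto simp: indicator_def)
    then show ?thesis using fin that by simp
  qed
  have "smeas M X N (\<lambda>x. \<Sum>v\<in>A. (indicator (s -` {v} \<inter> space M) x) *\<^sub>R F v x)"
    if "finite A" "A \<subseteq> s ` space M" for A
    using that
  proof (induction A)
    case empty then show ?case by (auto intro: sm_const)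
  next
    case (insert v A)
    have *: "smeas M X N (\<lambda>x. indicator (s -` {v} \<inter> space M) x *\<^sub>R F v x)"
      using s insert by (intro sm_scaleR F) (auto simp: simple_function_def)
    show ?case unfolding sum.insert[OF insert.hyps]
      by (intro sm_add *) (use insert.IH insert.prems in blast)
  qed
  from this[OF fin order_refl] show ?thesis
  proof (rule sm_cong_AE)
    have ae: "AE x in M. \<forall>v\<in>s ` space M. F v x \<in> X"
      using fin F by (intro AE_finite_allI sm_AE_mem) auto
    then show "AE x in M. F (s x) x \<in> X" using AE_space by eventually_elim auto
    show "AE x in M. N ((\<Sum>v\<in>s ` space M. (indicator (s -` {v} \<inter> space M) x) *\<^sub>R F v x) - F (s x) x) = 0"
      using AE_space by eventually_elim (simp add: eq)
  qed
qed

text \<open>Only \<open>f s\<close> for \<open>s\<close> on a finite grid enters the approximation.\<close>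

lemma sm_continuous:
  assumes \<tau>: "\<tau> > 0" and f: "f \<in> C_time \<tau> X N"
  shows "smeas (lebesgue_on {0..\<tau>}) X N f"
proof -
  \<comment> \<open>\<open>g k t\<close> rounds \<open>t\<close> down to a grid of mesh
    \<open>\<tau> / Suc k\<close>; it has finitely many values on \<open>{0..\<tau>}\<close> and
    stays in this interval.\<close>
  define g where "g k t = \<tau> * (of_int \<lfloor>real (Suc k) * t / \<tau>\<rfloor> / real (Suc k))" for k t
  have bd: "0 \<le> \<lfloor>real (Suc k) * t / \<tau>\<rfloor>" "\<lfloor>real (Suc k) * t / \<tau>\<rfloor> \<le> int (Suc k)" if "t \<in> {0..\<tau>}" for k t
  proof -
    have "real (Suc k) * t \<le> real (Suc k) * \<tau>" using that by (intro mult_left_mono) auto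
    then have "real (Suc k) * t / \<tau> \<le> real (Suc k)" using \<tau> by (simp add: field_simps)
    then show "\<lfloor>real (Suc k) * t / \<tau>\<rfloor> \<le> int (Suc k)" by (metis floor_mono floor_of_nat)
    show "0 \<le> \<lfloor>real (Suc k) * t / \<tau>\<rfloor>" using that \<tau> by simp
  qed
  have gI: "g k t \<in> {0..\<tau>}" if "t \<in> {0..\<tau>}" for k t
  proof -
    have "real_of_int \<lfloor>real (Suc k) * t / \<tau>\<rfloor> \<le> real (Suc k)"
      using bd(2)[OF that, of k] by (metis of_int_le_iff of_int_of_nat_eq)
    then have "of_int \<lfloor>real (Suc k) * t / \<tau>\<rfloor> / real (Suc k) \<le> 1" by simp
    then show ?thesis using bd(1)[OF that, of k] \<tau>
      unfolding g_def atLeastAtMost_iff by (intro conjI mult_nonneg_nonneg mult_left_le) auto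
  qed
  have gt: "\<bar>g k t - t\<bar> \<le> \<tau> / real (Suc k)" for k t
  proof -
    let ?y = "real (Suc k) * t / \<tau>"
    have "?y * (\<tau> / real (Suc k)) = t" using \<tau> by simp
    then have "g k t - t = (of_int \<lfloor>?y\<rfloor> - ?y) * (\<tau> / real (Suc k))"
      unfolding g_def left_diff_distrib by simp
    moreover have "\<bar>of_int \<lfloor>?y\<rfloor> - ?y\<bar> \<le> 1" by linarith
    ultimately show ?thesis using \<tau> mult_right_mono[of "\<bar>of_int \<lfloor>?y\<rfloor> - ?y\<bar>" 1 "\<tau> / real (Suc k)"]
      by (simp add: abs_mult)
  qed
  have lim_g: "(\<lambda>k. g k t) \<longlonglongrightarrow> t" for t
  proof -
    have "(\<lambda>k. \<tau> / real (Suc k)) \<longlonglongrightarrow> 0"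
      using tendsto_mult_right[OF LIMSEQ_inverse_real_of_nat, of \<tau>] by (simp add: field_simps)
    then have "(\<lambda>k. g k t - t) \<longlonglongrightarrow> 0"
      by (rule Lim_null_comparison[rotated]) (use gt in auto)
    then show ?thesis by (simp add: LIM_zero_iff)
  qed
  have simple: "simple_function (lebesgue_on {0..\<tau>}) (\<lambda>t. f (g k t))" for k
  proof -
    have "simple_function (lebesgue_on {0..\<tau>}) (\<lambda>t. \<lfloor>real (Suc k) * t / \<tau>\<rfloor>)"
      unfolding simple_function_def
    proof (intro conjI ballI)
      have "(\<lambda>t. \<lfloor>real (Suc k) * t / \<tau>\<rfloor>) ` space (lebesgue_on {0..\<tau>}) \<subseteq> {0..int (Suc k)}"
        using bd by auto
      then show "finite ((\<lambda>t. \<lfloor>real (Suc k) * t / \<tau>\<rfloor>) ` space (lebesgue_on {0..\<tau>}))"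
        by (rule finite_subset) auto
      fix z
      have "(\<lambda>t. \<lfloor>real (Suc k) * t / \<tau>\<rfloor>) \<in> measurable borel (count_space UNIV)" by measurable
      then have "(\<lambda>t. \<lfloor>real (Suc k) * t / \<tau>\<rfloor>) -` {z} \<in> sets borel"
        using measurable_sets[of "\<lambda>t. \<lfloor>real (Suc k) * t / \<tau>\<rfloor>" borel "count_space UNIV" "{z}"] by simp
      then show "(\<lambda>t. \<lfloor>real (Suc k) * t / \<tau>\<rfloor>) -` {z} \<inter> space (lebesgue_on {0..\<tau>}) \<in> sets (lebesgue_on {0..\<tau>})"
        by (auto simp: sets_restrict_space_iff)
    qed
    then have "simple_function (lebesgue_on {0..\<tau>}) (\<lambda>t. (\<lambda>z. f (\<tau> * (of_int z / real (Suc k)))) \<lfloor>real (Suc k) * t / \<tau>\<rfloor>)"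
      by (rule simple_function_compose1)
    then show ?thesis by (simp add: g_def)
  qed
  have lim: "(\<lambda>k. N (f (g k t) - f t)) \<longlonglongrightarrow> 0" if t: "t \<in> {0..\<tau>}" for t
  proof (rule LIMSEQ_I)
    fix e :: real assume "e > 0"
    moreover have "((\<lambda>s. N (f s - f t)) \<longlongrightarrow> 0) (at t within {0..\<tau>})" using f t by (auto simp: C_time_def)
    ultimately obtain \<delta> where \<delta>: "\<delta> > 0" "\<And>s. s \<in> {0..\<tau>} \<Longrightarrow> s \<noteq> t \<Longrightarrow> dist s t < \<delta> \<Longrightarrow> \<bar>N (f s - f t)\<bar> < e"
      unfolding tendsto_iff eventually_at by (fastforce simp: dist_real_def)
    obtain no where no: "\<And>k. k \<ge> no \<Longrightarrow> dist (g k t) t < \<delta>"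
      using lim_g[of t] \<delta>(1) unfolding lim_sequentially by blast
    show "\<exists>no. \<forall>n\<ge>no. norm (N (f (g n t) - f t) - 0) < e"
    proof (intro exI allI impI)
      fix k assume "no \<le> k"
      then show "norm (N (f (g k t) - f t) - 0) < e"
        using \<delta>(2)[OF gI[OF t] _ no[of k]] \<open>e > 0\<close> by (cases "g k t = t") auto
    qed
  qed
  show ?thesis
    unfolding strongly_measurable_def
  proof (intro conjI exI[of _ "\<lambda>k t. f (g k t)"] allI)
    show "AE t in lebesgue_on {0..\<tau>}. f t \<in> X"
      using f by (intro AE_I2) (auto simp: C_time_def)
    show "(\<lambda>t. f (g k t)) ` space (lebesgue_on {0..\<tau>}) \<subseteq> X" for k
      using f gI by (auto simp: C_time_def)
    show "AE t in lebesgue_on {0..\<tau>}. (\<lambda>k. N (f (g k t) - f t)) \<longlonglongrightarrow> 0"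
      using lim by (intro AE_I2) auto
  qed (rule simple)
qed

end

text \<open>For simple \<open>f\<close> this is \<open>sm_simple_family\<close>; the Lipschitz
  bound, with the same constant for almost all \<open>x\<close>, carries it over to limits. In this
  way the measurability of operators with random or time-dependent coefficients has to be checked
  for fixed arguments only.\<close>

lemma strongly_measurable_operator:
  assumes Y: "seminormed Y N'" and M: "complete_measure M"
    and L: "\<And>v. v \<in> X \<Longrightarrow> smeas M Y N' (\<lambda>x. L x v)"
    and LY: "AE x in M. \<forall>v\<in>X. L x v \<in> Y"
    and lip: "AE x in M. \<forall>u\<in>X. \<forall>v\<in>X. N' (L x u - L x v) \<le> C * N (u - v)"
    and f: "smeas M X N f"
  shows "smeas M Y N' (\<lambda>x. L x (f x))"
proof -
  interpret Y: seminormed Y N' by fact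
  obtain s where fX: "AE x in M. f x \<in> X" and s: "\<And>i. simple_function M (s i)" "\<And>i. s i ` space M \<subseteq> X"
    and lim: "AE x in M. (\<lambda>i. N (s i x - f x)) \<longlonglongrightarrow> 0"
    using f unfolding strongly_measurable_def by blast
  show ?thesis
  proof (rule Y.sm_lim[OF M])
    show "smeas M Y N' (\<lambda>x. L x (s n x))" for n
      by (rule Y.sm_simple_family[where F = "\<lambda>v x. L x v", OF M s(1)]) (use L s(2) in blast)
    show "AE x in M. L x (f x) \<in> Y" using fX LY by eventually_elim auto
    show "AE x in M. (\<lambda>n. N' (L x (s n x) - L x (f x))) \<longlonglongrightarrow> 0"
      using fX LY lip lim AE_space
    proof eventually_elim
      case (elim x)
      have m: "s i x \<in> X" for i using s elim by auto
      have "(\<lambda>i. C * N (s i x - f x)) \<longlonglongrightarrow> C * 0" by (intro tendsto_intros elim)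
      then show ?case unfolding mult_zero_right
        by (rule Lim_null_comparison[rotated], intro always_eventually allI)
          (use m elim Y.N_nonneg[OF Y.diff_mem] in auto)
    qed
  qed
qed

section \<open>Bochner spaces of square integrable functions\<close>

definition bochner_inner :: "'x measure \<Rightarrow> ('v \<Rightarrow> 'v \<Rightarrow> real) \<Rightarrow> ('x \<Rightarrow> 'v) \<Rightarrow> ('x \<Rightarrow> 'v) \<Rightarrow> real" where
  "bochner_inner M ip f g = (\<integral>x. ip (f x) (g x) \<partial>M)"

lemma L2_D:
  assumes "f \<in> bochner_L2 M X N"
  shows "smeas M X N f" "integrable M (\<lambda>x. (N (f x))\<^sup>2)" "AE x in M. f x \<in> X"
  using assms by (auto simp: bochner_L2_def strongly_measurable_def)

lemma L2_power2: "(bochner_L2_norm M N f)\<^sup>2 = (\<integral>x. (N (f x))\<^sup>2 \<partial>M)"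
  by (simp add: bochner_L2_norm_def)

lemma L2_nonneg: "0 \<le> bochner_L2_norm M N f"
  by (simp add: bochner_L2_norm_def)

lemma L2_dominated:
  assumes "seminormed Y N'" "complete_measure M"
    and f: "f \<in> bochner_L2 M X N" and g: "smeas M Y N' g"
    and le: "AE x in M. N' (g x) \<le> C * N (f x)" and C: "C \<ge> 0"
  shows "g \<in> bochner_L2 M Y N'" "bochner_L2_norm M N' g \<le> C * bochner_L2_norm M N f"
proof -
  interpret Y: seminormed Y N' by fact
  have meas: "(\<lambda>x. N' (g x)) \<in> borel_measurable M" by (rule Y.sm_N_measurable) fact+
  have sq: "AE x in M. (N' (g x))\<^sup>2 \<le> C\<^sup>2 * (N (f x))\<^sup>2"
    using le Y.sm_AE_mem[OF g]
  proof eventually_elim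
    case (elim x)
    then show ?case using power_mono[OF elim(1) Y.N_nonneg, of 2] by (simp add: power_mult_distrib)
  qed
  have int: "integrable M (\<lambda>x. C\<^sup>2 * (N (f x))\<^sup>2)" using L2_D(2)[OF f] by simp
  have intg: "integrable M (\<lambda>x. (N' (g x))\<^sup>2)"
    by (rule Bochner_Integration.integrable_bound[OF int]) (use meas sq in auto)
  with g show "g \<in> bochner_L2 M Y N'" by (simp add: bochner_L2_def)
  have "(bochner_L2_norm M N' g)\<^sup>2 \<le> (C * bochner_L2_norm M N f)\<^sup>2"
    unfolding power_mult_distrib L2_power2 integral_mult_right_zero[symmetric]
    by (rule integral_mono_AE) (use intg int sq in auto)
  then show "bochner_L2_norm M N' g \<le> C * bochner_L2_norm M N f"
    by (rule power2_le_imp_le) (simp add: C L2_nonneg)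
qed

lemma L2_mono:
  assumes Y: "seminormed Y N'" and M: "complete_measure M" and sub: "X \<subseteq> Y"
    and le: "\<And>x. x \<in> X \<Longrightarrow> N' x \<le> N x" and X: "\<And>x y. x \<in> X \<Longrightarrow> y \<in> X \<Longrightarrow> x - y \<in> X"
    and f: "f \<in> bochner_L2 M X N"
  shows "f \<in> bochner_L2 M Y N'" "bochner_L2_norm M N' f \<le> bochner_L2_norm M N f"
proof -
  have sm: "smeas M Y N' f"
  proof (rule strongly_measurable_map[where L = "\<lambda>x. x" and C = 1, OF L2_D(1)[OF f]])
    show "N' (x - y) \<le> 1 * N (x - y)" if "x \<in> X" "y \<in> X" for x y using le[OF X[OF that]] by simp
    show "0 \<le> N' (x - y)" if "x \<in> Y" "y \<in> Y" for x y
      by (rule seminormed.N_nonneg[OF Y seminormed.diff_mem[OF Y that]])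
  qed (use sub in auto)
  have ae: "AE x in M. N' (f x) \<le> 1 * N (f x)" using L2_D(3)[OF f] by eventually_elim (simp add: le)
  show "f \<in> bochner_L2 M Y N'" "bochner_L2_norm M N' f \<le> bochner_L2_norm M N f"
    using L2_dominated[where f = f and g = f and N = N and N' = N', OF Y M f sm ae] by simp_all
qed

context semi_inner
begin

text \<open>Polarisation reduces the inner product to seminorms.\<close>

lemma sm_ip_measurable:
  assumes M: "complete_measure M" and f: "smeas M X N f" and g: "smeas M X N g"
  shows "(\<lambda>x. ip (f x) (g x)) \<in> borel_measurable M"
proof (rule complete_measure.borel_measurable_cong_AE[OF M])
  show "(\<lambda>x. ((N (f x + g x))\<^sup>2 - (N (f x))\<^sup>2 - (N (g x))\<^sup>2) / 2) \<in> borel_measurable M"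
    using sm_N_measurable[OF M sm_add[OF f g]] sm_N_measurable[OF M f] sm_N_measurable[OF M g] by measurable
  show "AE x in M. ((N (f x + g x))\<^sup>2 - (N (f x))\<^sup>2 - (N (g x))\<^sup>2) / 2 = ip (f x) (g x)"
    using sm_AE_mem[OF f] sm_AE_mem[OF g] by eventually_elim (simp add: N_power2_add)
qed

lemma L2_ip_integrable:
  assumes M: "complete_measure M" and f: "f \<in> bochner_L2 M X N" and g: "g \<in> bochner_L2 M X N"
  shows "integrable M (\<lambda>x. ip (f x) (g x))"
proof (rule Bochner_Integration.integrable_bound)
  show "integrable M (\<lambda>x. (N (f x))\<^sup>2 + (N (g x))\<^sup>2)" using f g by (simp add: bochner_L2_def)
  show "(\<lambda>x. ip (f x) (g x)) \<in> borel_measurable M"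
    by (rule sm_ip_measurable[OF M L2_D(1)[OF f] L2_D(1)[OF g]])
  show "AE x in M. norm (ip (f x) (g x)) \<le> norm ((N (f x))\<^sup>2 + (N (g x))\<^sup>2)"
    using L2_D(3)[OF f] L2_D(3)[OF g]
  proof eventually_elim
    case (elim x)
    have "\<bar>ip (f x) (g x)\<bar> \<le> N (f x) * N (g x)" by (rule Cauchy_Schwarz[OF elim])
    also have "\<dots> \<le> (N (f x))\<^sup>2 + (N (g x))\<^sup>2"
      using sum_squares_bound[of "N (f x)" "N (g x)"] mult_nonneg_nonneg[OF N_nonneg N_nonneg, OF elim] by simp
    finally show ?case by simp
  qed
qed

lemma L2_subspace:
  assumes M: "complete_measure M" shows "subspace (bochner_L2 M X N)"
proof (rule subspaceI)
  show "0 \<in> bochner_L2 M X N" using sm_const[OF zero_mem] by (simp add: bochner_L2_def zero_fun_def)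
next
  fix f g assume fg: "f \<in> bochner_L2 M X N" "g \<in> bochner_L2 M X N"
  have sm: "smeas M X N (\<lambda>x. f x + g x)" using fg by (intro sm_add) (auto simp: bochner_L2_def)
  have "integrable M (\<lambda>x. (N (f x + g x))\<^sup>2)"
  proof (rule Bochner_Integration.integrable_bound)
    show "integrable M (\<lambda>x. 2 * (N (f x))\<^sup>2 + 2 * (N (g x))\<^sup>2)" using fg by (simp add: bochner_L2_def)
    show "(\<lambda>x. (N (f x + g x))\<^sup>2) \<in> borel_measurable M" using sm_N_measurable[OF M sm] by simp
    show "AE x in M. norm ((N (f x + g x))\<^sup>2) \<le> norm (2 * (N (f x))\<^sup>2 + 2 * (N (g x))\<^sup>2)"
      using L2_D(3)[OF fg(1)] L2_D(3)[OF fg(2)]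
    proof eventually_elim
      case (elim x)
      have "(N (f x + g x))\<^sup>2 = 2 * (N (f x))\<^sup>2 + 2 * (N (g x))\<^sup>2 - (N (f x - g x))\<^sup>2"
        using elim by (simp add: N_power2_add N_power2_diff)
      then have "(N (f x + g x))\<^sup>2 \<le> 2 * (N (f x))\<^sup>2 + 2 * (N (g x))\<^sup>2" by simp
      then show ?case by simp
    qed
  qed
  with sm show "f + g \<in> bochner_L2 M X N" by (simp add: bochner_L2_def plus_fun_def)
next
  fix c f assume f: "f \<in> bochner_L2 M X N"
  have sm: "smeas M X N (\<lambda>x. c *\<^sub>R f x)"
    using f by (intro sm_scaleR) (auto simp: bochner_L2_def)
  have "integrable M (\<lambda>x. (N (c *\<^sub>R f x))\<^sup>2)"
  proof (rule Bochner_Integration.integrable_bound)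
    show "integrable M (\<lambda>x. c\<^sup>2 * (N (f x))\<^sup>2)" using f by (simp add: bochner_L2_def)
    show "(\<lambda>x. (N (c *\<^sub>R f x))\<^sup>2) \<in> borel_measurable M" using sm_N_measurable[OF M sm] by simp
    show "AE x in M. norm ((N (c *\<^sub>R f x))\<^sup>2) \<le> norm (c\<^sup>2 * (N (f x))\<^sup>2)"
      using L2_D(3)[OF f] by eventually_elim (simp add: N_scale power_mult_distrib)
  qed
  with sm show "c *\<^sub>R f \<in> bochner_L2 M X N" by (simp add: bochner_L2_def scaleR_fun_def)
qed

lemma L2_semi_inner:
  assumes M: "complete_measure M"
  shows "semi_inner (bochner_L2 M X N) (bochner_inner M ip) (bochner_L2_norm M N)"
proof
  show "subspace (bochner_L2 M X N)" by (rule L2_subspace[OF M])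
next
  fix f g assume f: "f \<in> bochner_L2 M X N" and g: "g \<in> bochner_L2 M X N"
  show "bochner_inner M ip f g = bochner_inner M ip g f"
    unfolding bochner_inner_def
  proof (rule integral_cong_AE)
    show "AE x in M. ip (f x) (g x) = ip (g x) (f x)"
      using L2_D(3)[OF f] L2_D(3)[OF g] by eventually_elim (rule ip_commute)
  qed (intro borel_measurable_integrable L2_ip_integrable M f g)+
  fix h assume h: "h \<in> bochner_L2 M X N"
  have "bochner_inner M ip (f + g) h = (\<integral>x. ip (f x) (h x) + ip (g x) (h x) \<partial>M)"
    unfolding bochner_inner_def
  proof (rule integral_cong_AE)
    show "AE x in M. ip ((f + g) x) (h x) = ip (f x) (h x) + ip (g x) (h x)"
      using L2_D(3)[OF f] L2_D(3)[OF g] L2_D(3)[OF h]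
      by eventually_elim (simp add: ip_add_left)
  qed (intro borel_measurable_integrable Bochner_Integration.integrable_add L2_ip_integrable M f g h
      subspace_add[OF L2_subspace])+
  also have "\<dots> = bochner_inner M ip f h + bochner_inner M ip g h"
    unfolding bochner_inner_def by (intro Bochner_Integration.integral_add L2_ip_integrable M f g h)
  finally show "bochner_inner M ip (f + g) h = bochner_inner M ip f h + bochner_inner M ip g h" .
next
  fix f h c assume f: "f \<in> bochner_L2 M X N" and h: "h \<in> bochner_L2 M X N"
  have "bochner_inner M ip (c *\<^sub>R f) h = (\<integral>x. c * ip (f x) (h x) \<partial>M)"
    unfolding bochner_inner_def
  proof (rule integral_cong_AE)
    show "AE x in M. ip ((c *\<^sub>R f) x) (h x) = c * ip (f x) (h x)"
      using L2_D(3)[OF f] L2_D(3)[OF h]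
      by eventually_elim (simp add: ip_scale_left)
  qed (intro borel_measurable_integrable integrable_mult_right L2_ip_integrable M f h
      subspace_scale[OF L2_subspace])+
  then show "bochner_inner M ip (c *\<^sub>R f) h = c * bochner_inner M ip f h"
    by (simp add: bochner_inner_def)
next
  fix f assume f: "f \<in> bochner_L2 M X N"
  have "(\<integral>x. (N (f x))\<^sup>2 \<partial>M) = bochner_inner M ip f f"
    unfolding bochner_inner_def
  proof (rule integral_cong_AE)
    show "AE x in M. (N (f x))\<^sup>2 = ip (f x) (f x)"
      using L2_D(3)[OF f] by eventually_elim (simp add: N_power2)
  qed (intro borel_measurable_integrable L2_D(2)[OF f] L2_ip_integrable M f)+
  then show "bochner_L2_norm M N f = sqrt (bochner_inner M ip f f)" "0 \<le> bochner_inner M ip f f"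
    by (auto simp: bochner_L2_norm_def simp flip: \<open>_ = bochner_inner M ip f f\<close>)
qed

end

lemma (in seminormed) L2_norm_eq_0_iff:
  assumes M: "complete_measure M" and f: "f \<in> bochner_L2 M X N"
  shows "bochner_L2_norm M N f = 0 \<longleftrightarrow> (AE x in M. N (f x) = 0)"
  unfolding bochner_L2_norm_def real_sqrt_eq_zero_cancel_iff
  by (subst integral_nonneg_eq_0_iff_AE[OF L2_D(2)[OF f]]) auto

text \<open>Fatou's lemma bounds the norm of the limit of the tail of a fast Cauchy sequence.\<close>

lemma (in semi_hilbert) L2_semi_hilbert:
  assumes M: "complete_measure M" and fin: "finite_measure M"
  shows "semi_hilbert (bochner_L2 M X N) (bochner_inner M ip) (bochner_L2_norm M N)"
proof -
  let ?L = "bochner_L2 M X N" and ?n = "bochner_L2_norm M N"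
  interpret M: finite_measure M by fact
  interpret L2: semi_inner ?L "bochner_inner M ip" ?n
    by (rule L2_semi_inner[OF M])
  have "complete_seminormed (?L) (?n)"
  proof (rule L2.complete_if_fast)
    fix f assume f: "\<And>n. f n \<in> ?L"
      and fast: "\<And>n. ?n (f (Suc n) - f n) \<le> (1/2)^n"
    define a where "a n x = N (f (Suc n) x - f n x)" for n x
    have dm: "f (Suc n) - f n \<in> ?L" for n using f by (intro L2.diff_mem)
    have fX: "AE x in M. \<forall>n. f n x \<in> X"
      using L2_D(3)[OF f] by (simp add: AE_all_countable)
    have a_meas: "a n \<in> borel_measurable M" for n
      unfolding a_def using f by (intro sm_N_measurable M sm_diff) (auto simp: bochner_L2_def)
    have a_sq: "integrable M (\<lambda>x. (a n x)\<^sup>2)" for n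
      using L2_D(2)[OF dm] by (simp add: a_def)
    have a_sq_le: "(\<integral>x. (a n x)\<^sup>2 \<partial>M) \<le> ((1/2)^n)\<^sup>2" for n
      using power_mono[OF fast L2_nonneg, of n 2] by (simp add: L2_power2 a_def)
    have a_nonneg: "AE x in M. 0 \<le> a n x" for n
      using fX by eventually_elim (simp add: a_def N_nonneg diff_mem)
    \<comment> \<open>The weights are balanced: the integral of the square of \<open>a n\<close> is
      at most \<open>(1/4)^n\<close>, so both terms on the right have integrals of order
      \<open>(1/2)^n\<close> on a finite measure.\<close>
    have a_le: "a n x \<le> 2^n * (a n x)\<^sup>2 + (1/2)^n" for n x
    proof -
      have "0 \<le> (2^n * a n x - 1)\<^sup>2 * (1/2)^n + (1/2)^n * (2^n * a n x)\<^sup>2 + (1/2)^n" by simp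
      also have "\<dots> = 2 * (2^n * (a n x)\<^sup>2 + (1/2)^n - a n x) "
        by (simp add: power2_eq_square field_simps power_divide)
      finally show ?thesis by simp
    qed
    have dom_int: "integrable M (\<lambda>x. 2^n * (a n x)\<^sup>2 + (1/2)^n)" for n using a_sq by simp
    have a_int: "integrable M (a n)" for n
    proof (rule Bochner_Integration.integrable_bound[OF dom_int a_meas])
      show "AE x in M. norm (a n x) \<le> norm (2^n * (a n x)\<^sup>2 + (1/2)^n)"
        using a_nonneg[of n] by eventually_elim (use a_le in \<open>simp add: order_trans\<close>)
    qed
    have a_int_le: "(\<integral>x. a n x \<partial>M) \<le> (1/2)^n * (1 + measure M (space M))" for n
    proof -
      have "(\<integral>x. a n x \<partial>M) \<le> (\<integral>x. 2^n * (a n x)\<^sup>2 + (1/2)^n \<partial>M)"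
        by (rule integral_mono[OF a_int dom_int a_le])
      also have "\<dots> = 2^n * (\<integral>x. (a n x)\<^sup>2 \<partial>M) + (1/2)^n * measure M (space M)"
        using a_sq by simp
      also have "\<dots> \<le> 2^n * ((1/2)^n)\<^sup>2 + (1/2)^n * measure M (space M)"
        using a_sq_le by (intro add_mono mult_left_mono) auto
      finally show ?thesis by (simp add: power2_eq_square field_simps power_divide)
    qed
    \<comment> \<open>The sum of all increments has a finite integral. Hence it is finite at almost
      every point, where \<open>f n x\<close> is then a Cauchy sequence.\<close>
    have "AE x in M. (\<Sum>n. ennreal (a n x)) \<noteq> \<infinity>"
    proof (rule nn_integral_PInf_AE)
      show "(\<lambda>x. \<Sum>n. ennreal (a n x)) \<in> borel_measurable M" using a_meas by measurable
      have "(\<integral>\<^sup>+x. (\<Sum>n. ennreal (a n x)) \<partial>M) = (\<Sum>n. \<integral>\<^sup>+x. ennreal (a n x) \<partial>M)"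
        using a_meas by (intro nn_integral_suminf) measurable
      also have "\<dots> = (\<Sum>n. ennreal (\<integral>x. a n x \<partial>M))"
        using nn_integral_eq_integral[OF a_int a_nonneg] by simp
      also have "\<dots> \<le> (\<Sum>n. ennreal ((1/2)^n * (1 + measure M (space M))))"
        by (intro suminf_le ennreal_leI a_int_le summableI)
      also have "\<dots> = ennreal (\<Sum>n. (1/2)^n * (1 + measure M (space M)))"
        by (intro suminf_ennreal2 summable_mult2 summable_geometric) auto
      also have "\<dots> < \<infinity>" by simp
      finally show "(\<integral>\<^sup>+x. (\<Sum>n. ennreal (a n x)) \<partial>M) \<noteq> \<infinity>" by simp
    qed
    moreover have "AE x in M. \<forall>n. 0 \<le> a n x" using a_nonneg by (simp add: AE_all_countable)
    ultimately have conv: "AE x in M. \<exists>l\<in>X. (\<lambda>n. N (f n x - l)) \<longlonglongrightarrow> 0"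
      using fX
    proof eventually_elim
      case (elim x)
      have sum: "summable (\<lambda>n. a n x)"
        using elim by (intro summable_suminf_not_top) auto
      define S where "S n = (\<Sum>k<n. a k x)" for n
      have S: "S \<longlonglongrightarrow> suminf (\<lambda>n. a n x)"
        unfolding S_def[abs_def] using summable_LIMSEQ[OF sum] .
      have step: "N (f (n + k) x - f n x) \<le> S (n + k) - S n" for n k
      proof (induction k)
        case (Suc k)
        have "N (f (n + Suc k) x - f n x) \<le> N (f (n + Suc k) x - f (n + k) x) + N (f (n + k) x - f n x)"
          using elim by (intro N_triangle4) auto
        then show ?case using Suc by (simp add: S_def a_def)
      qed simp
      have "Cau (\<lambda>n. f n x)"
      proof (rule Cau_bound)
        show "(\<lambda>n. \<bar>S n - suminf (\<lambda>n. a n x)\<bar>) \<longlonglongrightarrow> 0"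
          using S by (intro tendsto_rabs_zero) (simp add: LIM_zero_iff)
        show "N (f m x - f n x) \<le> \<bar>S m - suminf (\<lambda>n. a n x)\<bar> + \<bar>S n - suminf (\<lambda>n. a n x)\<bar>" for m n
        proof (cases "n \<le> m")
          case True then show ?thesis using step[of n "m - n"] by simp
        next
          case False then show ?thesis using step[of m "n - m"] N_diff_commute[of "f m x" "f n x"] elim by simp
        qed
      qed (use elim in auto)
      then show ?case by (rule Cau_converges)
    qed
    define g where "g x = (SOME l. l \<in> X \<and> (\<lambda>n. N (f n x - l)) \<longlonglongrightarrow> 0)" for x
    have g: "AE x in M. g x \<in> X \<and> (\<lambda>n. N (f n x - g x)) \<longlonglongrightarrow> 0"
      using conv unfolding g_def by eventually_elim (rule someI_ex, blast)
    have sm_g: "smeas M X N g"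
    proof (rule sm_lim[OF M])
      show "smeas M X N (f n)" for n using f by (simp add: bochner_L2_def)
    qed (use g in \<open>auto elim: eventually_mono\<close>)
    have tail: "?n (f (n + k) - f n) \<le> 2 * (1/2)^n" for n k
    proof -
      \<comment> \<open>The geometric sum in closed form, which makes the induction on
        \<open>k\<close> close.\<close>
      have "?n (f (n + k) - f n) \<le> 2 * (1/2)^n - 2 * (1/2)^(n+k)"
      proof (induction k)
        case (Suc k)
        have "?n (f (n + Suc k) - f n) \<le>
            ?n (f (n + Suc k) - f (n + k)) + ?n (f (n + k) - f n)"
          using f by (intro L2.N_triangle4)
        also have "\<dots> \<le> (1/2)^(n+k) + (2 * (1/2)^n - 2 * (1/2)^(n+k))"
          unfolding add_Suc_right by (rule add_mono[OF fast Suc])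
        finally show ?case by (simp add: fun_diff_def)
      qed (use L2.N_zero in \<open>simp add: zero_fun_def fun_diff_def\<close>)
      then show ?thesis using zero_le_power[of "1/2::real" "n+k"] by linarith
    qed
    have sm_d: "smeas M X N (\<lambda>x. g x - f n x)" for n
      using sm_g f by (intro sm_diff) (auto simp: bochner_L2_def)
    have nn_le: "(\<integral>\<^sup>+x. ennreal ((N (g x - f n x))\<^sup>2) \<partial>M) \<le> ennreal ((2 * (1/2)^n)\<^sup>2)" for n
    proof -
      have m: "(\<lambda>x. ennreal ((N (f k x - f n x))\<^sup>2)) \<in> borel_measurable M" for k
        using sm_N_measurable[OF M sm_diff[OF L2_D(1)[OF f] L2_D(1)[OF f]]] by measurable
      have "AE x in M. (\<lambda>k. ennreal ((N (f k x - f n x))\<^sup>2)) \<longlonglongrightarrow> ennreal ((N (g x - f n x))\<^sup>2)"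
        using g fX
      proof eventually_elim
        case (elim x)
        have "(\<lambda>k. N (f k x - f n x)) \<longlonglongrightarrow> N (g x - f n x)"
          by (rule N_tendsto) (use elim in auto)
        then show ?case by (intro tendsto_ennrealI tendsto_power)
      qed
      then have "(\<integral>\<^sup>+x. ennreal ((N (g x - f n x))\<^sup>2) \<partial>M) = (\<integral>\<^sup>+x. liminf (\<lambda>k. ennreal ((N (f k x - f n x))\<^sup>2)) \<partial>M)"
        by (intro nn_integral_cong_AE, eventually_elim)
          (rule lim_imp_Liminf[OF trivial_limit_sequentially, symmetric])
      also have "\<dots> \<le> liminf (\<lambda>k. \<integral>\<^sup>+x. ennreal ((N (f k x - f n x))\<^sup>2) \<partial>M)"
        by (rule nn_integral_liminf) (rule m)
      also have "\<dots> \<le> liminf (\<lambda>k. ennreal ((2 * (1/2)^n)\<^sup>2))"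
      proof (rule Liminf_mono, rule eventually_sequentiallyI)
        fix k assume "n \<le> k"
        have d: "f k - f n \<in> ?L" using f by (intro L2.diff_mem)
        have "(\<integral>\<^sup>+x. ennreal ((N (f k x - f n x))\<^sup>2) \<partial>M) = ennreal ((?n (f k - f n))\<^sup>2)"
          using L2_D(2)[OF d] by (simp add: nn_integral_eq_integral L2_power2)
        also have "\<dots> \<le> ennreal ((2 * (1/2)^n)\<^sup>2)"
          using tail[of n "k - n"] \<open>n \<le> k\<close> by (intro ennreal_leI power_mono L2_nonneg) simp
        finally show "(\<integral>\<^sup>+x. ennreal ((N (f k x - f n x))\<^sup>2) \<partial>M) \<le> ennreal ((2 * (1/2)^n)\<^sup>2)" .
      qed
      also have "\<dots> = ennreal ((2 * (1/2)^n)\<^sup>2)" by (simp add: Liminf_const)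
      finally show ?thesis .
    qed
    have d_mem: "g - f n \<in> ?L" for n
    proof -
      have "integrable M (\<lambda>x. (N (g x - f n x))\<^sup>2)"
      proof (rule integrableI_bounded)
        show "(\<lambda>x. (N (g x - f n x))\<^sup>2) \<in> borel_measurable M"
          using sm_N_measurable[OF M sm_d] by measurable
        show "(\<integral>\<^sup>+x. ennreal (norm ((N (g x - f n x))\<^sup>2)) \<partial>M) < \<infinity>"
          using nn_le[of n] by (auto simp: le_less_trans)
      qed
      then show ?thesis using sm_d[of n] by (simp add: bochner_L2_def fun_diff_def)
    qed
    have "g \<in> ?L"
      using L2.add_mem[OF d_mem[of 0] f[of 0]] by simp
    moreover have "(\<lambda>n. ?n (f n - g)) \<longlonglongrightarrow> 0"
    proof (rule Lim_null_comparison)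
      show "\<forall>\<^sub>F n in sequentially. norm (?n (f n - g)) \<le> 2 * (1/2)^n"
      proof (intro always_eventually allI)
        fix n
        have "ennreal ((?n (g - f n))\<^sup>2) \<le> ennreal ((2 * (1/2)^n)\<^sup>2)"
          using nn_le[of n] L2_D(2)[OF d_mem[of n]]
          by (simp add: nn_integral_eq_integral L2_power2)
        then have "(?n (g - f n))\<^sup>2 \<le> (2 * (1/2)^n)\<^sup>2"
          by (subst (asm) ennreal_le_iff) auto
        then have "?n (g - f n) \<le> 2 * (1/2)^n"
          by (rule power2_le_imp_le) simp
        then show "norm (?n (f n - g)) \<le> 2 * (1/2)^n"
          using L2.N_diff_commute[OF f \<open>g \<in> ?L\<close>, of n] by (simp add: L2_nonneg)
      qed
      have "(\<lambda>n. 2 * (1/2)^n) \<longlonglongrightarrow> 2 * (0::real)"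
        by (intro tendsto_intros LIMSEQ_power_zero) auto
      then show "(\<lambda>n. 2 * (1/2)^n) \<longlonglongrightarrow> (0::real)" by simp
    qed
    ultimately show "\<exists>g\<in>?L. (\<lambda>n. ?n (f n - g)) \<longlonglongrightarrow> 0" by blast
  qed
  then show ?thesis
    by (intro semi_hilbert.intro L2.semi_inner_axioms) (simp add: complete_seminormed_def)
qed

section \<open>Test functions\<close>

abbreviation "time_tests \<tau> \<equiv> test_functions {0<..<\<tau>}"

lemma complete_measure_lebesgue_on:
  assumes "S \<in> sets lebesgue" shows "complete_measure (lebesgue_on S)"
proof
  fix A B assume AB: "B \<subseteq> A" "A \<in> null_sets (lebesgue_on S)"
  then have "A \<in> null_sets lebesgue" using assms by (simp add: null_sets_restrict_space)
  then have "B \<in> null_sets lebesgue" using AB(1) by (rule completion.complete2[rotated])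
  moreover have "B \<subseteq> S" using AB assms by (auto simp: null_sets_restrict_space)
  ultimately show "B \<in> sets (lebesgue_on S)"
    using assms by (auto simp: sets_restrict_space_iff null_setsD2)
qed

text \<open>For \<open>p = 1\<close> this is the classical smooth function
  \<open>exp (- (1 / x))\<close> that vanishes to infinite order at 0. The polynomial in
  \<open>1 / x\<close> makes the family closed under differentiation.\<close>

definition flat :: "real poly \<Rightarrow> real \<Rightarrow> real" where
  "flat p x = (if 0 < x then poly p (1 / x) * exp (- (1 / x)) else 0)"

lemma poly_exp_tendsto_0: "((\<lambda>y::real. y ^ n * poly p y * exp (- y)) \<longlongrightarrow> 0) at_top"
proof (induction p arbitrary: n)
  case (pCons a p)
  have "((\<lambda>y::real. a * (y ^ n / exp y) + y ^ Suc n * poly p y * exp (- y)) \<longlongrightarrow> a * 0 + 0) at_top"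
    by (intro tendsto_intros tendsto_power_div_exp_0 pCons.IH)
  then show ?case by (simp add: algebra_simps exp_minus divide_inverse)
qed simp

lemma flat_tendsto_0: "(flat p \<longlongrightarrow> 0) (at 0)"
proof -
  have "((\<lambda>x. flat p x) \<longlongrightarrow> 0) (at_left 0)"
    by (rule tendsto_eventually) (auto simp: flat_def eventually_at_filter)
  moreover have "((\<lambda>x. flat p x) \<longlongrightarrow> 0) (at_right 0)"
  proof -
    have "((\<lambda>x. (inverse x) ^ 0 * poly p (inverse x) * exp (- inverse x)) \<longlongrightarrow> 0) (at_right (0::real))"
      by (rule filterlim_compose[OF poly_exp_tendsto_0 filterlim_inverse_at_top_right])
    then show ?thesis
      by (rule Lim_transform_eventually) (auto simp: flat_def eventually_at_filter inverse_eq_divide)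
  qed
  ultimately show ?thesis by (simp add: filterlim_at_split)
qed

text \<open>Differentiating \<open>1 / x\<close> produces the factor
  \<open>- (1 / x)\<^sup>2\<close>, hence the monomial of degree 2, and the two terms of the product
  rule give \<open>p - pderiv p\<close>. At 0 the difference quotient of \<open>flat p\<close> is
  itself flat, with \<open>pCons 0 p\<close> in place of \<open>p\<close>, and so tends to
  0.\<close>

lemma flat_has_derivative:
  "(flat p has_real_derivative flat (monom 1 2 * (p - pderiv p)) x) (at x)"
proof -
  consider "x > 0" | "x < 0" | "x = 0" by linarith
  then show ?thesis
  proof cases
    case 1
    have "((\<lambda>x. poly p (1 / x) * exp (- (1 / x))) has_real_derivative
        flat (monom 1 2 * (p - pderiv p)) x) (at x)"
      using 1 by (auto intro!: derivative_eq_intros DERIV_chain'[of _ _ _ _ "poly p"] poly_DERIV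
          simp: flat_def poly_monom power2_eq_square field_simps)
    moreover have "\<forall>\<^sub>F y in nhds x. poly p (1 / y) * exp (- (1 / y)) = flat p y"
      using eventually_nhds_in_open[of "{0<..}" x] 1
      by (auto elim!: eventually_mono simp: flat_def)
    ultimately show ?thesis by (subst DERIV_cong_ev[OF refl _ refl]) (auto simp: eq_commute)
  next
    case 2
    have "\<forall>\<^sub>F y in nhds x. flat p y = 0"
      using eventually_nhds_in_open[of "{..<0}" x] 2
      by (auto elim!: eventually_mono simp: flat_def)
    then have "(flat p has_real_derivative 0) (at x)" by (subst DERIV_cong_ev[OF refl _ refl]) auto
    then show ?thesis using 2 by (simp add: flat_def)
  next
    case 3
    have "(flat p y - flat p 0) / (y - 0) = flat (pCons 0 p) y" for y by (simp add: flat_def)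
    then have "(flat p has_real_derivative 0) (at 0)"
      using flat_tendsto_0[of "pCons 0 p"] by (simp add: has_field_derivative_iff)
    then show ?thesis using 3 by (simp add: flat_def)
  qed
qed

lemma flat_1_bounds: "0 \<le> flat 1 x" "flat 1 x \<le> 1" "flat 1 x \<noteq> 0 \<longleftrightarrow> 0 < x"
  by (auto simp: flat_def)

text \<open>An algebra of functions that contains its own directional derivatives. Infinite
  differentiability then follows by induction on the list of directions, without formulas for higher
  derivatives.\<close>

inductive_set smooth_alg :: "('a::euclidean_space \<Rightarrow> real) set" where
  flat: "(\<lambda>x. flat p (c * (x \<bullet> i) + d)) \<in> smooth_alg"
| const: "(\<lambda>x. c) \<in> smooth_alg"
| add: "f \<in> smooth_alg \<Longrightarrow> g \<in> smooth_alg \<Longrightarrow> (\<lambda>x. f x + g x) \<in> smooth_alg"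
| mult: "f \<in> smooth_alg \<Longrightarrow> g \<in> smooth_alg \<Longrightarrow> (\<lambda>x. f x * g x) \<in> smooth_alg"

lemma smooth_alg_derivative:
  assumes "f \<in> smooth_alg"
  shows "\<exists>D. (\<forall>x. (f has_derivative D x) (at x)) \<and> (\<forall>e. (\<lambda>x. D x e) \<in> smooth_alg)"
  using assms
proof induction
  case (flat p c i d)
  define q where "q = monom 1 2 * (p - pderiv p)"
  have "((\<lambda>x. flat p (c * (x \<bullet> i) + d)) has_derivative (\<lambda>e. flat q (c * (x \<bullet> i) + d) * (c * (e \<bullet> i)))) (at x)" for x
  proof -
    have "((\<lambda>x. c * (x \<bullet> i) + d) has_derivative (\<lambda>e. c * (e \<bullet> i))) (at x)"
      by (auto intro!: derivative_eq_intros)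
    from DERIV_compose_FDERIV[OF flat_has_derivative this] show ?thesis by (simp add: q_def mult.commute)
  qed
  moreover have "(\<lambda>x. flat q (c * (x \<bullet> i) + d) * (c * (e \<bullet> i))) \<in> smooth_alg" for e
    by (intro smooth_alg.intros)
  ultimately show ?case
    by (intro exI[of _ "\<lambda>x e. flat q (c * (x \<bullet> i) + d) * (c * (e \<bullet> i))"]) blast
next
  case (const c)
  show ?case by (intro exI[of _ "\<lambda>x e. 0"]) (auto intro: smooth_alg.const)
next
  case (add f g)
  then obtain D E where "\<forall>x. (f has_derivative D x) (at x)" "\<forall>e. (\<lambda>x. D x e) \<in> smooth_alg"
    "\<forall>x. (g has_derivative E x) (at x)" "\<forall>e. (\<lambda>x. E x e) \<in> smooth_alg" by blast
  then show ?case
    by (intro exI[of _ "\<lambda>x e. D x e + E x e"]) (auto intro!: smooth_alg.add has_derivative_add)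
next
  case (mult f g)
  then obtain D E where "\<forall>x. (f has_derivative D x) (at x)" "\<forall>e. (\<lambda>x. D x e) \<in> smooth_alg"
    "\<forall>x. (g has_derivative E x) (at x)" "\<forall>e. (\<lambda>x. E x e) \<in> smooth_alg" by blast
  then show ?case using mult.hyps
    by (intro exI[of _ "\<lambda>x e. f x * E x e + D x e * g x"])
      (auto intro!: smooth_alg.add smooth_alg.mult has_derivative_mult)
qed

lemma smooth_alg_partials:
  assumes "f \<in> smooth_alg"
  shows "partials es f \<in> smooth_alg" "partials es f differentiable (at x)"
proof -
  show *: "partials es f \<in> smooth_alg" for es
  proof (induction es)
    case (Cons e es)
    then obtain D where D: "\<forall>x. (partials es f has_derivative D x) (at x)" "\<forall>e. (\<lambda>x. D x e) \<in> smooth_alg"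
      using smooth_alg_derivative by blast
    then have "frechet_derivative (partials es f) (at x) = D x" for x
      using frechet_derivative_at by metis
    then show ?case using D by simp
  qed (use assms in simp)
  show "partials es f differentiable (at x)"
    using smooth_alg_derivative[OF *[of es]] by (auto simp: differentiable_def)
qed

text \<open>The factor \<open>Suc n\<close> steepens the profile: the support stays the box, while
  the values in its interior tend to 1. Bumps thus replace the indicator of a box in orthogonality
  relations, by dominated convergence.\<close>

definition bump :: "'a::euclidean_space \<Rightarrow> 'a \<Rightarrow> nat \<Rightarrow> 'a \<Rightarrow> real" where
  "bump a b n x = (\<Prod>i\<in>Basis. flat 1 (real (Suc n) * (x \<bullet> i - a \<bullet> i)) * flat 1 (real (Suc n) * (b \<bullet> i - x \<bullet> i)))"

lemma bump_bounds: "0 \<le> bump a b n x" "bump a b n x \<le> 1"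
  unfolding bump_def using flat_1_bounds
  by (auto intro!: prod_nonneg prod_le_1 mult_nonneg_nonneg mult_le_one)

lemma bump_nonzero_iff: "bump a b n x \<noteq> 0 \<longleftrightarrow> x \<in> box a b"
  using flat_1_bounds(3) by (auto simp: bump_def mem_box zero_less_mult_iff)

lemma bump_tendsto: "(\<lambda>n. bump a b n x) \<longlonglongrightarrow> indicator (box a b) x"
proof (cases "x \<in> box a b")
  case True
  have 1: "(\<lambda>n. flat 1 (real (Suc n) * y)) \<longlonglongrightarrow> 1" if "y > 0" for y
  proof -
    have "(\<lambda>n. exp (- (inverse (real (Suc n)) * (1 / y)))) \<longlonglongrightarrow> exp (- (0 * (1 / y)))"
      by (intro tendsto_intros LIMSEQ_inverse_real_of_nat)
    then show ?thesis using that by (simp add: flat_def inverse_eq_divide)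
  qed
  have "(\<lambda>n. bump a b n x) \<longlonglongrightarrow> (\<Prod>i\<in>(Basis::'a set). 1 * 1)"
    unfolding bump_def using True by (intro tendsto_prod tendsto_mult 1) (auto simp: mem_box)
  then show ?thesis using True by simp
next
  case False
  then have "bump a b n x = 0" for n using bump_nonzero_iff by blast
  then show ?thesis using False by simp
qed

lemma bump_smooth_alg: "bump a b n \<in> smooth_alg"
proof -
  have fac: "(\<lambda>x::'a. flat 1 (real (Suc n) * (x \<bullet> i - a \<bullet> i)) * flat 1 (real (Suc n) * (b \<bullet> i - x \<bullet> i))) \<in> smooth_alg" for i
    using smooth_alg.mult[OF smooth_alg.flat[of 1 "real (Suc n)" i "- real (Suc n) * (a \<bullet> i)"]
        smooth_alg.flat[of 1 "- real (Suc n)" i "real (Suc n) * (b \<bullet> i)"]]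
    by (simp add: algebra_simps)
  have "(\<lambda>x. \<Prod>i\<in>A. flat 1 (real (Suc n) * (x \<bullet> i - a \<bullet> i)) * flat 1 (real (Suc n) * (b \<bullet> i - x \<bullet> i))) \<in> smooth_alg"
    if "finite A" for A
    using that
  proof (induction A)
    case (insert i A)
    have "(\<lambda>x. (flat 1 (real (Suc n) * (x \<bullet> i - a \<bullet> i)) * flat 1 (real (Suc n) * (b \<bullet> i - x \<bullet> i))) *
        (\<Prod>i\<in>A. flat 1 (real (Suc n) * (x \<bullet> i - a \<bullet> i)) * flat 1 (real (Suc n) * (b \<bullet> i - x \<bullet> i)))) \<in> smooth_alg"
      by (intro smooth_alg.mult[OF fac insert.IH])
    then show ?case unfolding prod.insert[OF insert.hyps] .
  qed (simp add: smooth_alg.const)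
  then show ?thesis unfolding bump_def[abs_def] by simp
qed

lemma bump_test_function:
  assumes "cbox a b \<subseteq> U" shows "bump a b n \<in> test_functions U"
proof -
  have "{x. bump a b n x \<noteq> 0} \<subseteq> cbox a b"
    using bump_nonzero_iff[of a b n] box_subset_cbox by blast
  then have sub: "closure {x. bump a b n x \<noteq> 0} \<subseteq> cbox a b"
    by (intro closure_minimal closed_cbox)
  then have "compact (closure {x. bump a b n x \<noteq> 0})"
    by (meson bounded_cbox bounded_subset closed_closure compact_eq_bounded_closed)
  then show ?thesis
    using sub assms smooth_alg_partials(2)[OF bump_smooth_alg] by (auto simp: test_functions_def)
qed

lemma test_functions_differentiable:
  assumes "\<phi> \<in> test_functions U" shows "\<phi> differentiable (at x)"
  using assms by (auto simp: test_functions_def dest: spec[of _ "[]"])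

lemma test_functions_continuous:
  assumes "\<phi> \<in> test_functions U" shows "continuous_on S \<phi>"
  using test_functions_differentiable[OF assms]
  by (meson continuous_at_imp_continuous_on differentiable_imp_continuous_within)

lemma test_function_deriv:
  assumes \<psi>: "\<psi> \<in> time_tests \<tau>"
  shows "(\<psi> has_real_derivative deriv \<psi> t) (at t within S)" "continuous_on S (deriv \<psi>)" "\<psi> 0 = 0" "\<psi> \<tau> = 0"
proof -
  have D: "(\<psi> has_real_derivative deriv \<psi> t) (at t)" for t
    using test_functions_differentiable[OF \<psi>] by (simp add: DERIV_deriv_iff_real_differentiable)
  then show "(\<psi> has_real_derivative deriv \<psi> t) (at t within S)" by (rule DERIV_subset) simp
  have "frechet_derivative \<psi> (at t) = (*) (deriv \<psi> t)" for t
    by (rule frechet_derivative_at[symmetric, OF has_field_derivative_imp_has_derivative[OF D]])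
  then have "deriv \<psi> t = partials [1] \<psi> t" for t by simp
  then have "deriv \<psi> = partials [1] \<psi>" by blast
  then have "deriv \<psi> differentiable (at t)" for t using \<psi> by (auto simp: test_functions_def simp del: partials.simps)
  then show "continuous_on S (deriv \<psi>)"
    by (meson continuous_at_imp_continuous_on differentiable_imp_continuous_within)
  show "\<psi> 0 = 0" "\<psi> \<tau> = 0"
    using \<psi> closure_subset[of "{x. \<psi> x \<noteq> 0}"] by (auto simp: test_functions_def)
qed

text \<open>A locally integrable function that is orthogonal to all bumps has mean value 0 on all boxes.\<close>

lemma AE_0_if_orthogonal_test_functions:
  fixes q :: "'a::euclidean_space \<Rightarrow> real"
  assumes U: "open U" and q: "integrable (lebesgue_on U) q"
    and orth: "\<And>\<phi>. \<phi> \<in> test_functions U \<Longrightarrow> (\<integral>x. \<phi> x * q x \<partial>lebesgue_on U) = 0"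
  shows "AE x in lebesgue_on U. q x = 0"
proof -
  have UL: "U \<in> sets lebesgue" using U by (simp add: borel_open sets_completionI_sets)
  define r where "r x = indicator U x * q x" for x
  have r: "integrable lebesgue r"
    using q UL unfolding r_def[abs_def] by (subst (asm) integrable_restrict_space) auto
  have r_eq: "(\<integral>x. f x * q x \<partial>lebesgue_on U) = (\<integral>x. f x * r x \<partial>lebesgue)" for f
    using UL by (subst integral_restrict_space) (auto simp: r_def mult_ac)
  have box0: "(\<integral>x. indicator (box a b) x * r x \<partial>lebesgue) = 0" if ab: "cbox a b \<subseteq> U" for a b
  proof -
    have "(\<lambda>n. \<integral>x. bump a b n x * r x \<partial>lebesgue) \<longlonglongrightarrow> (\<integral>x. indicator (box a b) x * r x \<partial>lebesgue)"
    proof (rule integral_dominated_convergence)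
      show "integrable lebesgue (\<lambda>x. norm (r x))" using r by simp
      show "AE x in lebesgue. (\<lambda>n. bump a b n x * r x) \<longlonglongrightarrow> indicator (box a b) x * r x"
        by (intro AE_I2 tendsto_intros bump_tendsto)
      show "AE x in lebesgue. norm (bump a b n x * r x) \<le> norm (r x)" for n
        using bump_bounds[of a b n] by (intro AE_I2) (simp add: abs_mult mult_left_le_one_le)
      have "bump a b n \<in> borel_measurable lebesgue" for n
        using test_functions_continuous[OF bump_test_function[OF ab], of UNIV]
        by (intro measurable_completion) (simp add: borel_measurable_continuous_onI)
      then show "(\<lambda>x. bump a b n x * r x) \<in> borel_measurable lebesgue" for n
        using r by (intro borel_measurable_times) auto
      show "(\<lambda>x. indicator (box a b) x * r x) \<in> borel_measurable lebesgue"
        using r by (intro borel_measurable_times borel_measurable_indicator) auto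
    qed
    moreover have "(\<integral>x. bump a b n x * r x \<partial>lebesgue) = 0" for n
      using orth[OF bump_test_function[OF ab], of n] by (simp add: r_eq)
    ultimately show ?thesis by (simp add: LIMSEQ_const_iff)
  qed
  \<comment> \<open>Only boxes whose closure lies in \<open>U\<close> carry bump test functions, so
    the claim is first localised to one such box.\<close>
  have box_AE: "AE x in lebesgue. x \<in> box c d \<longrightarrow> r x = 0" if cd: "cbox c d \<subseteq> U" for c d
  proof -
    define s where "s x = indicator (box c d) x * r x" for x
    have s: "integrable lebesgue s" unfolding s_def[abs_def]
      using integrable_mult_indicator[OF _ r, of "box c d"] by simp
    have sA: "integrable lebesgue (\<lambda>x. indicator A x * s x)" if "A \<in> sets lebesgue" for A
      using integrable_mult_indicator[OF that s] by simp
    let ?E = "range (\<lambda>(a, b). box a b::'a set)"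
    have set0: "(\<integral>x. indicator A x * s x \<partial>lebesgue) = 0" if A: "A \<in> sigma_sets UNIV ?E" for A
    proof -
      have sig: "sigma_sets UNIV ?E = sets borel" by (simp add: borel_eq_box)
      \<comment> \<open>Dynkin's lemma: the boxes are stable under intersection and generate the
        Borel sets, and vanishing integrals pass to complements and to disjoint unions.\<close>
      have "Int_stable ?E" by (auto simp: Int_stable_def box_Int_box)
      moreover have "?E \<subseteq> Pow UNIV" by simp
      ultimately show ?thesis using A
      proof (induction rule: sigma_sets_induct_disjoint)
        case (basic A)
        then obtain a b where A: "A = box a b" by auto
        obtain e f where ef: "box a b \<inter> box c d = box e f" unfolding box_Int_box by blast
        show ?case
        proof (cases "box e f = {}")
          case True
          then have "(\<lambda>x. indicator A x * s x) = (\<lambda>x. 0)" using ef by (auto simp: A s_def indicator_def fun_eq_iff)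
          then show ?thesis by simp
        next
          case False
          then have "cbox e f = closure (box e f)" by (simp add: closure_box)
          also have "\<dots> \<subseteq> closure (box c d)" using ef by (intro closure_mono) auto
          also have "\<dots> \<subseteq> cbox c d" by (intro closure_minimal box_subset_cbox closed_cbox)
          finally have "cbox e f \<subseteq> U" using cd by blast
          moreover have "indicator A x * s x = indicator (box e f) x * r x" for x
            unfolding A s_def ef[symmetric] by (simp add: indicator_inter_arith mult.assoc)
          ultimately show ?thesis using box0 by simp
        qed
      next
        case empty then show ?case by simp
      next
        case (compl A)
        then have AL: "A \<in> sets lebesgue" unfolding sig by (simp add: sets_completionI_sets)
        have "(\<integral>x. indicator (UNIV - A) x * s x \<partial>lebesgue) = (\<integral>x. s x - indicator A x * s x \<partial>lebesgue)"
          by (intro Bochner_Integration.integral_cong) (auto simp: indicator_def)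
        also have "\<dots> = (\<integral>x. s x \<partial>lebesgue) - 0"
          using Bochner_Integration.integral_diff[OF s sA[OF AL]] compl by simp
        also have "(\<integral>x. s x \<partial>lebesgue) = 0" using box0[OF cd] by (simp add: s_def[abs_def])
        finally show ?case by simp
      next
        case (union A)
        then have AL: "A i \<in> sets lebesgue" for i unfolding sig by (auto simp: sets_completionI_sets)
        have UNL: "(\<Union>i. A i) \<in> sets lebesgue" using AL by auto
        have "(LINT x:(\<Union>i. A i)|lebesgue. s x) = (\<Sum>i. (LINT x:(A i)|lebesgue. s x))"
        proof (rule lebesgue_integral_countable_add)
          show "set_integrable lebesgue (\<Union>i. A i) s"
            unfolding set_integrable_def using sA[OF UNL] by simp
        qed (use AL union in \<open>auto simp: disjoint_family_on_def\<close>)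
        then show ?case using union by (simp add: set_lebesgue_integral_def)
      qed
    qed
    have "AE x in lebesgue. s x = 0"
    proof (rule density_unique_real[OF s, of "\<lambda>_. 0"])
      fix A :: "'a set" assume A: "A \<in> sets lebesgue"
      \<comment> \<open>A Lebesgue set agrees with its Borel main part up to a null set.\<close>
      have m: "main_part lborel A \<in> sets borel" using A main_part_sets[of A lborel] by simp
      have "AE x in lebesgue. x \<notin> null_part lborel A"
        using null_part_null_sets[OF A] by (rule AE_not_in)
      then have ae: "AE x in lebesgue. indicator A x * s x = indicator (main_part lborel A) x * s x"
      proof eventually_elim
        case (elim x)
        then show ?case using main_part_null_part_Un[OF A] by (auto simp: indicator_def)
      qed
      have "(\<integral>x. indicator A x * s x \<partial>lebesgue) = (\<integral>x. indicator (main_part lborel A) x * s x \<partial>lebesgue)"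
        by (rule integral_cong_AE[OF _ _ ae])
          (intro borel_measurable_integrable sA A, intro borel_measurable_integrable sA, use m in \<open>simp add: sets_completionI_sets\<close>)
      also have "\<dots> = 0" by (rule set0) (use m in \<open>simp add: borel_eq_box\<close>)
      finally show "(LINT x:A|lebesgue. s x) = (LINT x:A|lebesgue. 0)"
        by (simp add: set_lebesgue_integral_def)
    qed simp
    then show ?thesis by eventually_elim (auto simp: s_def)
  qed
  \<comment> \<open>Countably many closed boxes exhaust \<open>U\<close>, and the frontier of each
    is a null set, so the result for open boxes is enough.\<close>
  obtain \<D> where \<D>: "countable \<D>" "\<And>X. X \<in> \<D> \<Longrightarrow> X \<subseteq> U" "\<And>X. X \<in> \<D> \<Longrightarrow> \<exists>a b. X = cbox a b" "\<Union>\<D> = U"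
    using open_countable_Union_open_cbox[OF U] by (metis Pow_iff subsetD)
  have "AE x in lebesgue. x \<in> X \<longrightarrow> r x = 0" if X: "X \<in> \<D>" for X
  proof -
    obtain a b where ab: "X = cbox a b" using \<D>(3)[OF X] by blast
    have "AE x in lebesgue. x \<notin> cbox a b - box a b"
      using negligible_frontier_interval[of a b] by (intro AE_not_in) (simp add: negligible_iff_null_sets)
    with box_AE[of a b] show ?thesis using \<D>(2)[OF X] unfolding ab by (auto elim: eventually_elim2)
  qed
  then have "AE x in lebesgue. \<forall>X\<in>\<D>. x \<in> X \<longrightarrow> r x = 0"
    using \<D>(1) by (subst AE_ball_countable) auto
  then have "AE x in lebesgue. x \<in> U \<longrightarrow> q x = 0"
    by eventually_elim (use \<D>(4) in \<open>auto simp: r_def indicator_def split: if_splits\<close>)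
  then show ?thesis using UL by (simp add: AE_restrict_space_iff)
qed

section \<open>One-dimensional calculus\<close>

lemma integrable_lebesgue_on_subset:
  fixes f :: "'a::euclidean_space \<Rightarrow> real"
  assumes "integrable (lebesgue_on S) f" "T \<subseteq> S" "S \<in> sets lebesgue" "T \<in> sets lebesgue"
  shows "integrable (lebesgue_on T) f"
proof -
  have "set_integrable lebesgue S f" using assms by (simp add: set_integrable_def integrable_restrict_space)
  then have "set_integrable lebesgue T f" by (rule set_integrable_subset) (use assms in auto)
  then show ?thesis using assms by (simp add: set_integrable_def integrable_restrict_space)
qed

lemma integral_derivative_Icc:
  fixes f F :: "real \<Rightarrow> real"
  assumes "a \<le> b" and F: "\<And>x. x \<in> {a..b} \<Longrightarrow> (F has_real_derivative f x) (at x within {a..b})"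
    and f: "continuous_on {a..b} f"
  shows "(\<integral>x. f x \<partial>lebesgue_on {a..b}) = F b - F a"
proof -
  have "(\<integral>x. f x \<partial>lebesgue_on {a..b}) = integral {a..b} f"
    by (intro lebesgue_integral_eq_integral continuous_imp_integrable_real f) auto
  also have "\<dots> = F b - F a"
    using assms by (intro integral_unique fundamental_theorem_of_calculus)
      (auto simp: has_real_derivative_iff_has_vector_derivative)
  finally show ?thesis .
qed

text \<open>The integral over \<open>{0..s}\<close> is written with an indicator, so that later
  estimates compare integrands over a single measure space.\<close>

lemma integral_derivative_initial:
  fixes f F :: "real \<Rightarrow> real"
  assumes s: "s \<in> {0..\<tau>}" and F: "\<And>x. x \<in> {0..\<tau>} \<Longrightarrow> (F has_real_derivative f x) (at x within {0..\<tau>})"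
    and f: "continuous_on {0..\<tau>} f"
  shows "(\<integral>x. indicator {..s} x * f x \<partial>lebesgue_on {0..\<tau>}) = F s - F 0"
proof -
  have "(\<integral>x. indicator {..s} x * f x \<partial>lebesgue_on {0..\<tau>}) = (\<integral>x. f x \<partial>lebesgue_on {0..s})"
    using s by (simp add: integral_restrict_space flip: mult.assoc)
      (auto intro!: Bochner_Integration.integral_cong simp: indicator_def)
  also have "\<dots> = F s - F 0"
    using s by (intro integral_derivative_Icc DERIV_subset[OF F] continuous_on_subset[OF f]) auto
  finally show ?thesis .
qed

text \<open>Fubini on the triangle \<open>s \<le> t\<close>: after the exchange, the integral of
  \<open>\<theta>'\<close> over \<open>{s..\<tau>}\<close> is \<open>- \<theta> s\<close> because
  \<open>\<theta> \<tau> = 0\<close>. No differentiation of the primitive of \<open>\<rho>\<close>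
  is involved.\<close>

lemma integral_by_parts_initial:
  fixes \<rho> \<theta> \<theta>' :: "real \<Rightarrow> real"
  assumes \<tau>: "\<tau> > 0" and \<rho>: "integrable (lebesgue_on {0..\<tau>}) \<rho>"
    and \<theta>: "\<And>t. t \<in> {0..\<tau>} \<Longrightarrow> (\<theta> has_real_derivative \<theta>' t) (at t within {0..\<tau>})"
    and \<theta>': "continuous_on {0..\<tau>} \<theta>'" and end0: "\<theta> \<tau> = 0"
  shows "(\<integral>t. \<theta>' t * (\<integral>s. indicator {..t} s * \<rho> s \<partial>lebesgue_on {0..\<tau>}) \<partial>lebesgue_on {0..\<tau>})
      = - (\<integral>t. \<theta> t * \<rho> t \<partial>lebesgue_on {0..\<tau>})"
proof -
  let ?I = "lebesgue_on {0..\<tau>}"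
  interpret I: finite_measure ?I by (intro finite_measure_lebesgue_on) simp
  interpret pair_sigma_finite ?I ?I by standard
  have \<theta>'i: "integrable ?I \<theta>'" using \<theta>' by (rule continuous_imp_integrable_real)
  have id: "(\<lambda>x. x) \<in> borel_measurable ?I" by (intro measurable_restrict_space1 measurable_completion) simp
  have m1: "(\<lambda>x. fst x) \<in> borel_measurable (?I \<Otimes>\<^sub>M ?I)" "(\<lambda>x. snd x) \<in> borel_measurable (?I \<Otimes>\<^sub>M ?I)"
    using measurable_compose[OF measurable_fst id] measurable_compose[OF measurable_snd id] by auto
  have prod: "integrable (?I \<Otimes>\<^sub>M ?I) (\<lambda>(t, s). \<theta>' t * \<rho> s)"
  proof (rule Fubini_integrable)
    have "(\<lambda>x. \<theta>' (fst x) * \<rho> (snd x)) \<in> borel_measurable (?I \<Otimes>\<^sub>M ?I)"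
      by (intro borel_measurable_times measurable_compose[OF measurable_fst]
          measurable_compose[OF measurable_snd] borel_measurable_integrable \<theta>'i \<rho>)
    then show "(\<lambda>(t, s). \<theta>' t * \<rho> s) \<in> borel_measurable (?I \<Otimes>\<^sub>M ?I)"
      by (simp add: case_prod_beta')
  qed (use \<theta>'i \<rho> in \<open>auto simp: abs_mult\<close>)
  have ind: "(\<lambda>x. indicator {y. snd y \<le> fst y} x :: real) \<in> borel_measurable (?I \<Otimes>\<^sub>M ?I)"
  proof (rule borel_measurable_indicator')
    show "{x \<in> space (?I \<Otimes>\<^sub>M ?I). x \<in> {y. snd y \<le> fst y}} \<in> sets (?I \<Otimes>\<^sub>M ?I)"
      using borel_measurable_le[OF m1(2,1)] by simp
  qed
  have int: "integrable (?I \<Otimes>\<^sub>M ?I) (\<lambda>(t, s). indicator {..t} s * (\<theta>' t * \<rho> s))"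
  proof (rule Bochner_Integration.integrable_bound[OF prod])
    have "(\<lambda>x. indicator {y. snd y \<le> fst y} x * (case x of (t, s) \<Rightarrow> \<theta>' t * \<rho> s)) \<in> borel_measurable (?I \<Otimes>\<^sub>M ?I)"
      by (intro borel_measurable_times ind borel_measurable_integrable prod)
    then show "(\<lambda>(t, s). indicator {..t} s * (\<theta>' t * \<rho> s)) \<in> borel_measurable (?I \<Otimes>\<^sub>M ?I)"
      by (rule subst[of _ _ "\<lambda>f. f \<in> _", rotated]) (auto simp: fun_eq_iff indicator_def)
  qed (auto simp: indicator_def)
  have "(\<integral>t. \<theta>' t * (\<integral>s. indicator {..t} s * \<rho> s \<partial>?I) \<partial>?I) = (\<integral>t. (\<integral>s. indicator {..t} s * (\<theta>' t * \<rho> s) \<partial>?I) \<partial>?I)"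
    by (simp add: mult.left_commute)
  also have "\<dots> = (\<integral>s. (\<integral>t. indicator {..t} s * (\<theta>' t * \<rho> s) \<partial>?I) \<partial>?I)"
    using Fubini_integral[OF int] by simp
  also have "\<dots> = (\<integral>s. - (\<theta> s * \<rho> s) \<partial>?I)"
  proof (rule Bochner_Integration.integral_cong)
    fix s assume "s \<in> space ?I"
    then have s: "s \<in> {0..\<tau>}" by simp
    have "(\<integral>t. indicator {..t} s * (\<theta>' t * \<rho> s) \<partial>?I) = (\<integral>t. indicator {..t} s * \<theta>' t \<partial>?I) * \<rho> s"
      by (simp flip: mult.assoc)
    also have "(\<integral>t. indicator {..t} s * \<theta>' t \<partial>?I) = (\<integral>t. \<theta>' t \<partial>lebesgue_on {s..\<tau>})"
      using s by (simp add: integral_restrict_space flip: mult.assoc)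
        (auto intro!: Bochner_Integration.integral_cong simp: indicator_def)
    also have "\<dots> = \<theta> \<tau> - \<theta> s"
      using s by (intro integral_derivative_Icc DERIV_subset[OF \<theta>] continuous_on_subset[OF \<theta>']) auto
    finally show "(\<integral>t. indicator {..t} s * (\<theta>' t * \<rho> s) \<partial>?I) = - (\<theta> s * \<rho> s)" using end0 by simp
  qed simp
  finally show ?thesis by simp
qed

lemma continuous_on_initial_integral:
  fixes \<rho> :: "real \<Rightarrow> real"
  assumes \<rho>: "integrable (lebesgue_on {0..\<tau>}) \<rho>"
  shows "continuous_on {0..\<tau>} (\<lambda>t. \<integral>s. indicator {..t} s * \<rho> s \<partial>lebesgue_on {0..\<tau>})"
proof -
  have "(\<integral>s. indicator {..t} s * \<rho> s \<partial>lebesgue_on {0..\<tau>}) = integral {0..t} \<rho>" if t: "t \<in> {0..\<tau>}" for t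
  proof -
    have "(\<integral>x. indicator {..t} x * \<rho> x \<partial>lebesgue_on {0..\<tau>}) = (\<integral>x. \<rho> x \<partial>lebesgue_on {0..t})"
      using t by (simp add: integral_restrict_space flip: mult.assoc)
        (auto intro!: Bochner_Integration.integral_cong simp: indicator_def)
    also have "integrable (lebesgue_on {0..t}) \<rho>"
      using t by (intro integrable_lebesgue_on_subset[OF \<rho>]) auto
    then have "(\<integral>x. \<rho> x \<partial>lebesgue_on {0..t}) = integral {0..t} \<rho>"
      by (rule lebesgue_integral_eq_integral) simp
    finally show ?thesis .
  qed
  moreover have "\<rho> integrable_on {0..\<tau>}" using has_integral_integral_lebesgue_on[OF \<rho>] by auto
  then have "continuous_on {0..\<tau>} (\<lambda>t. integral {0..t} \<rho>)" by (rule indefinite_integral_continuous_1)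
  ultimately show ?thesis by (subst continuous_on_cong[OF refl]) auto
qed

lemma AE_0_if_orthogonal_time_test_functions:
  assumes q: "integrable (lebesgue_on {0..\<tau>}) (q :: real \<Rightarrow> real)"
    and orth: "\<And>\<psi>. \<psi> \<in> time_tests \<tau> \<Longrightarrow> (\<integral>t. \<psi> t * q t \<partial>lebesgue_on {0..\<tau>}) = 0"
  shows "AE t in lebesgue_on {0..\<tau>}. q t = 0"
proof -
  have "AE t in lebesgue_on {0<..<\<tau>}. q t = 0"
  proof (rule AE_0_if_orthogonal_test_functions)
    show "integrable (lebesgue_on {0<..<\<tau>}) q" by (rule integrable_lebesgue_on_subset[OF q]) auto
    fix \<psi> :: "real \<Rightarrow> real" assume \<psi>: "\<psi> \<in> time_tests \<tau>"
    then have "0 < t \<and> t < \<tau>" if "\<psi> t \<noteq> 0" for t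
      using closure_subset[of "{x. \<psi> x \<noteq> 0}"] that by (auto simp: test_functions_def)
    then have "(\<integral>t. \<psi> t * q t \<partial>lebesgue_on {0<..<\<tau>}) = (\<integral>t. \<psi> t * q t \<partial>lebesgue_on {0..\<tau>})"
      by (simp add: integral_restrict_space) (auto intro!: Bochner_Integration.integral_cong simp: indicator_def)
    then show "(\<integral>t. \<psi> t * q t \<partial>lebesgue_on {0<..<\<tau>}) = 0" using orth[OF \<psi>] by simp
  qed simp
  moreover have "AE t in lebesgue. t \<noteq> (0::real)" "AE t in lebesgue. t \<noteq> \<tau>"
    by (rule AE_completion[OF AE_lborel_singleton])+
  ultimately have "AE t in lebesgue. t \<in> {0..\<tau>} \<longrightarrow> q t = 0"
    unfolding AE_restrict_space_iff[of "{0<..<\<tau>}" lebesgue, simplified] by eventually_elim auto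
  then show ?thesis by (simp add: AE_restrict_space_iff)
qed

section \<open>Weak derivatives in time and the du Bois-Reymond lemma\<close>

lemma partials_lin:
  assumes "f \<in> test_functions U" "g \<in> test_functions U" "set es \<subseteq> Basis"
  shows "partials es (\<lambda>x. a * f x + b * g x) = (\<lambda>x. a * partials es f x + b * partials es g x)"
  using assms(3)
proof (induction es)
  case (Cons e es)
  show ?case
  proof
    fix x
    have "partials es f differentiable (at x)" "partials es g differentiable (at x)"
      using Cons.prems assms by (auto simp: test_functions_def)
    then have "(partials es f has_derivative frechet_derivative (partials es f) (at x)) (at x)"
      "(partials es g has_derivative frechet_derivative (partials es g) (at x)) (at x)"
      using frechet_derivative_works by blast+
    then have "((\<lambda>x. a * partials es f x + b * partials es g x) has_derivative
        (\<lambda>h. a * frechet_derivative (partials es f) (at x) h + b * frechet_derivative (partials es g) (at x) h)) (at x)"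
      by (auto intro!: derivative_eq_intros)
    note fd = frechet_derivative_at[OF this]
    show "partials (e # es) (\<lambda>x. a * f x + b * g x) x = a * partials (e # es) f x + b * partials (e # es) g x"
      using Cons.IH Cons.prems by (simp add: fd[symmetric])
  qed
qed simp

lemma test_functions_lin:
  assumes f: "f \<in> test_functions U" and g: "g \<in> test_functions U"
  shows "(\<lambda>x. a * f x + b * g x) \<in> test_functions U"
proof -
  have "closure {x. a * f x + b * g x \<noteq> 0} \<subseteq> closure ({x. f x \<noteq> 0} \<union> {x. g x \<noteq> 0})"
    by (intro closure_mono) auto
  also have "\<dots> = closure {x. f x \<noteq> 0} \<union> closure {x. g x \<noteq> 0}" by (rule closure_Un)
  finally have sub: "closure {x. a * f x + b * g x \<noteq> 0} \<subseteq> closure {x. f x \<noteq> 0} \<union> closure {x. g x \<noteq> 0}" .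
  have "compact (closure {x. f x \<noteq> 0} \<union> closure {x. g x \<noteq> 0})" using f g by (auto simp: test_functions_def)
  then have "compact (closure {x. a * f x + b * g x \<noteq> 0})"
    using sub by (meson bounded_subset closed_closure compact_eq_bounded_closed)
  moreover have "partials es (\<lambda>x. a * f x + b * g x) differentiable (at x)" if "set es \<subseteq> Basis" for es x
    unfolding partials_lin[OF f g that] using f g that
    by (intro differentiable_add differentiable_mult differentiable_const) (auto simp: test_functions_def)
  ultimately show ?thesis using sub f g by (auto simp: test_functions_def)
qed

text \<open>The primitive from 0 is constant to the left and to the right of the support of
  \<open>\<phi>\<close>. It vanishes at 0, and at \<tau> because the mean is 0, so it vanishes on
  both sides and its support is again compact in the open interval.\<close>

lemma test_function_antiderivative:
  assumes \<tau>: "\<tau> > 0" and \<phi>: "\<phi> \<in> time_tests \<tau>" and int0: "(\<integral>t. \<phi> t \<partial>lebesgue_on {0..\<tau>}) = 0"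
  shows "\<exists>\<psi>\<in>time_tests \<tau>. deriv \<psi> = \<phi>"
proof -
  have c: "continuous_on S \<phi>" for S by (rule test_functions_continuous[OF \<phi>])
  have "\<exists>F. \<forall>x. - \<infinity> < ereal x \<longrightarrow> ereal x < \<infinity> \<longrightarrow> (F has_vector_derivative \<phi> x) (at x)"
    by (rule einterval_antiderivative) (use c[of UNIV] in \<open>auto simp: continuous_on_eq_continuous_at\<close>)
  then obtain F where F: "(F has_real_derivative \<phi> t) (at t)" for t
    by (auto simp: has_real_derivative_iff_has_vector_derivative)
  define \<psi> where "\<psi> t = F t - F 0" for t
  have D: "(\<psi> has_real_derivative \<phi> t) (at t within S)" for t S
    unfolding \<psi>_def[abs_def] by (rule DERIV_subset[OF _ subset_UNIV], rule DERIV_cong[OF DERIV_diff[OF F DERIV_const]]) simp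
  let ?K = "closure {x. \<phi> x \<noteq> 0}"
  have K: "compact ?K" "?K \<subseteq> {0<..<\<tau>}" using \<phi> by (auto simp: test_functions_def)
  have "\<exists>a b. 0 < a \<and> b < \<tau> \<and> ?K \<subseteq> {a..b}"
  proof (cases "?K = {}")
    case False
    obtain a where a: "a \<in> ?K" "\<forall>t\<in>?K. a \<le> t" using compact_attains_inf[OF K(1) False] by blast
    obtain b where b: "b \<in> ?K" "\<forall>t\<in>?K. t \<le> b" using compact_attains_sup[OF K(1) False] by blast
    have "?K \<subseteq> {a..b}" using a(2) b(2) by (simp add: subset_iff)
    moreover have "0 < a" "b < \<tau>" using subsetD[OF K(2) a(1)] subsetD[OF K(2) b(1)] by simp_all
    ultimately show ?thesis by blast
  next
    case True
    then show ?thesis using \<tau> by (intro exI[of _ "\<tau> / 2"]) simp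
  qed
  then obtain a b where ab: "0 < a" "b < \<tau>" "?K \<subseteq> {a..b}" by blast
  have out: "\<phi> t = 0" if "t \<notin> {a..b}" for t using ab(3) closure_subset[of "{x. \<phi> x \<noteq> 0}"] that by blast
  have "\<psi> \<tau> = \<psi> 0" using int0 integral_derivative_Icc[of 0 \<tau> \<psi> \<phi>, OF _ D c] \<tau> by simp
  then have end0: "\<psi> 0 = 0" "\<psi> \<tau> = 0" by (simp_all add: \<psi>_def)
  have "(\<psi> has_real_derivative 0) (at t within S)" if "t \<notin> {a..b}" for t S using D[of t S] out[OF that] by simp
  then have "\<exists>d. \<forall>t\<in>{..<a}. \<psi> t = d" "\<exists>d. \<forall>t\<in>{b<..}. \<psi> t = d"
    by (intro has_field_derivative_zero_constant; simp)+
  then obtain d d' where "\<And>t. t < a \<Longrightarrow> \<psi> t = d" "\<And>t. t > b \<Longrightarrow> \<psi> t = d'" by auto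
  then have "\<psi> t = 0" if "t < a \<or> t > b" for t using end0 ab(1,2) that by metis
  then have "\<psi> t = 0" if "t \<notin> {a..b}" for t using that by (auto simp: not_le)
  then have "{t. \<psi> t \<noteq> 0} \<subseteq> {a..b}" by blast
  then have supp: "closure {t. \<psi> t \<noteq> 0} \<subseteq> {a..b}" by (rule closure_minimal) simp
  then have "compact (closure {t. \<psi> t \<noteq> 0})" by (meson bounded_closed_interval bounded_subset closed_closure compact_eq_bounded_closed)
  moreover have "closure {t. \<psi> t \<noteq> 0} \<subseteq> {0<..<\<tau>}" using supp ab by auto
  moreover have "partials es \<psi> differentiable (at t)" if es: "set es \<subseteq> Basis" for es t
  proof (cases es rule: rev_cases)
    case Nil
    then show ?thesis using D[of t UNIV] by (auto simp: real_differentiable_def)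
  next
    case (snoc es' e)
    \<comment> \<open>The last direction of the list is the one applied first, so splitting it off
      turns a partial derivative of \<open>\<psi>\<close> into one of \<open>\<phi>\<close>.\<close>
    have "frechet_derivative \<psi> (at t) 1 = \<phi> t" for t
      by (simp add: frechet_derivative_at[OF has_field_derivative_imp_has_derivative[OF D[of _ UNIV]], symmetric])
    then have "partials (es' @ [1]) \<psi> = partials es' \<phi>" by (induction es') auto
    then show ?thesis using \<phi> es snoc by (auto simp: test_functions_def)
  qed
  ultimately have "\<psi> \<in> time_tests \<tau>" by (simp add: test_functions_def)
  moreover have "deriv \<psi> = \<phi>" using DERIV_imp_deriv[OF D] by blast
  ultimately show ?thesis by blast
qed

text \<open>The du Bois-Reymond lemma. From any test function a multiple of a fixed
  \<open>\<beta>\<close> with nonzero mean is subtracted; the result has mean 0 and is the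
  derivative of a test function. Hence \<open>k - d\<close> is orthogonal to all test
  functions.\<close>

lemma const_if_orthogonal_test_derivatives:
  fixes k :: "real \<Rightarrow> real"
  assumes \<tau>: "\<tau> > 0" and k: "continuous_on {0..\<tau>} k"
    and orth: "\<And>\<psi>. \<psi> \<in> time_tests \<tau> \<Longrightarrow> (\<integral>t. deriv \<psi> t * k t \<partial>lebesgue_on {0..\<tau>}) = 0"
  shows "\<exists>c. \<forall>t\<in>{0..\<tau>}. k t = c"
proof -
  let ?I = "lebesgue_on {0..\<tau>}"
  have i: "integrable ?I f" if "continuous_on {0..\<tau>} f" for f :: "real \<Rightarrow> real" using that by (rule continuous_imp_integrable_real)
  \<comment> \<open>If all means were 0, the constant 1 would be orthogonal to every test function
    and so vanish almost everywhere.\<close>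
  have "\<exists>\<beta>\<in>time_tests \<tau>. (\<integral>t. \<beta> t \<partial>?I) \<noteq> 0"
  proof (rule ccontr)
    assume "\<not> ?thesis"
    then have "AE t in ?I. (1::real) = 0" by (intro AE_0_if_orthogonal_time_test_functions i) auto
    then have "(\<integral>t. 1 \<partial>?I) = (0::real)" by (intro integral_eq_zero_AE)
    then show False using \<tau> by (simp add: measure_restrict_space)
  qed
  then obtain \<beta> where \<beta>: "\<beta> \<in> time_tests \<tau>" "(\<integral>t. \<beta> t \<partial>?I) \<noteq> 0" by blast
  \<comment> \<open>The only candidate for the constant: the average of \<open>k\<close> with weight
    \<open>\<beta>\<close>.\<close>
  define d where "d = (\<integral>t. \<beta> t * k t \<partial>?I) / (\<integral>t. \<beta> t \<partial>?I)"
  have "AE t in ?I. k t - d = 0"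
  proof (rule AE_0_if_orthogonal_time_test_functions)
    show "integrable ?I (\<lambda>t. k t - d)" by (intro i continuous_intros k)
    fix \<phi> assume \<phi>: "\<phi> \<in> time_tests \<tau>"
    note c = test_functions_continuous[OF \<phi>] test_functions_continuous[OF \<beta>(1)]
    have ii: "integrable ?I \<phi>" "integrable ?I \<beta>" "integrable ?I (\<lambda>t. \<phi> t * k t)" "integrable ?I (\<lambda>t. \<beta> t * k t)"
      by (intro i continuous_intros k c)+
    define a where "a = (\<integral>t. \<phi> t \<partial>?I) / (\<integral>t. \<beta> t \<partial>?I)"
    have "(\<integral>t. \<phi> t - a * \<beta> t \<partial>?I) = 0" using ii \<beta>(2) by (simp add: a_def)
    moreover have "(\<lambda>t. \<phi> t - a * \<beta> t) \<in> time_tests \<tau>"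
      using test_functions_lin[OF \<phi> \<beta>(1), of 1 "- a"] by simp
    ultimately obtain \<psi> where "\<psi> \<in> time_tests \<tau>" "deriv \<psi> = (\<lambda>t. \<phi> t - a * \<beta> t)"
      using test_function_antiderivative[OF \<tau>] by blast
    with orth[of \<psi>] have "(\<integral>t. \<phi> t * k t - a * (\<beta> t * k t) \<partial>?I) = 0" by (simp add: left_diff_distrib mult.assoc)
    then have "(\<integral>t. \<phi> t * k t \<partial>?I) = a * (\<integral>t. \<beta> t * k t \<partial>?I)" using ii by simp
    then show "(\<integral>t. \<phi> t * (k t - d) \<partial>?I) = 0" using ii \<beta>(2) by (simp add: right_diff_distrib a_def d_def)
  qed
  then have "(\<integral>t. (k t - d)\<^sup>2 \<partial>?I) = 0" by (intro integral_eq_zero_AE) (auto elim: eventually_mono)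
  moreover have c: "continuous_on {0..\<tau>} (\<lambda>t. (k t - d)\<^sup>2)" by (intro continuous_intros k)
  ultimately have "integral {0..\<tau>} (\<lambda>t. (k t - d)\<^sup>2) = 0" using lebesgue_integral_eq_integral[OF i[OF c]] by simp
  then show ?thesis using integral_eq_0_iff[OF c \<tau>] by (intro exI[of _ d]) simp
qed

text \<open>Test functions vanish near both ends of the interval, \<open>\<eta>\<close> only at
  \<open>\<tau>\<close>. The larger class is admissible because \<open>q 0 = 0\<close>, which makes
  \<open>q\<close> the primitive of \<open>\<rho>\<close> from 0. This is how the initial value
  enters the uniqueness proof.\<close>

lemma weak_derivative_extension:
  fixes q \<rho> \<eta> \<eta>' :: "real \<Rightarrow> real"
  assumes \<tau>: "\<tau> > 0" and q: "continuous_on {0..\<tau>} q" "q 0 = 0" and \<rho>: "integrable (lebesgue_on {0..\<tau>}) \<rho>"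
    and weak: "\<And>\<psi>. \<psi> \<in> time_tests \<tau> \<Longrightarrow>
      (\<integral>t. deriv \<psi> t * q t \<partial>lebesgue_on {0..\<tau>}) = - (\<integral>t. \<psi> t * \<rho> t \<partial>lebesgue_on {0..\<tau>})"
    and \<eta>: "\<And>t. t \<in> {0..\<tau>} \<Longrightarrow> (\<eta> has_real_derivative \<eta>' t) (at t within {0..\<tau>})"
      "continuous_on {0..\<tau>} \<eta>'" "\<eta> \<tau> = 0"
  shows "(\<integral>t. \<eta>' t * q t \<partial>lebesgue_on {0..\<tau>}) = - (\<integral>t. \<eta> t * \<rho> t \<partial>lebesgue_on {0..\<tau>})"
proof -
  let ?I = "lebesgue_on {0..\<tau>}"
  define p where "p t = (\<integral>s. indicator {..t} s * \<rho> s \<partial>?I)" for t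
  have p: "continuous_on {0..\<tau>} p" unfolding p_def[abs_def] by (rule continuous_on_initial_integral[OF \<rho>])
  define k where "k t = q t - p t" for t
  have k: "continuous_on {0..\<tau>} k" unfolding k_def[abs_def] by (intro continuous_intros q p)
  have "(\<integral>t. deriv \<psi> t * k t \<partial>?I) = 0" if \<psi>: "\<psi> \<in> time_tests \<tau>" for \<psi>
  proof -
    note D = test_function_deriv[OF \<psi>]
    have "(\<integral>t. deriv \<psi> t * p t \<partial>?I) = - (\<integral>t. \<psi> t * \<rho> t \<partial>?I)"
      unfolding p_def by (intro integral_by_parts_initial \<tau> \<rho> D)
    moreover have "(\<integral>t. deriv \<psi> t * k t \<partial>?I) = (\<integral>t. deriv \<psi> t * q t \<partial>?I) - (\<integral>t. deriv \<psi> t * p t \<partial>?I)"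
      unfolding k_def right_diff_distrib
      by (intro Bochner_Integration.integral_diff continuous_imp_integrable_real continuous_intros D(2) q p)
    ultimately show ?thesis using weak[OF \<psi>] by simp
  qed
  then obtain d where d: "k t = d" if "t \<in> {0..\<tau>}" for t
    using const_if_orthogonal_test_derivatives[OF \<tau> k] by blast
  have "p 0 = 0"
  proof -
    have "AE s in lebesgue. s \<noteq> (0::real)" by (rule AE_completion[OF AE_lborel_singleton])
    then have "AE s in ?I. indicator {..0} s * \<rho> s = 0"
      by (auto simp: AE_restrict_space_iff elim!: eventually_mono split: split_indicator)
    then show ?thesis unfolding p_def by (rule integral_eq_zero_AE)
  qed
  then have "k 0 = 0" by (simp add: k_def q)
  then have "q t = p t" if "t \<in> {0..\<tau>}" for t
    using d[OF that] d[of 0] \<tau> by (simp add: k_def)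
  then have "(\<integral>t. \<eta>' t * q t \<partial>?I) = (\<integral>t. \<eta>' t * p t \<partial>?I)"
    by (intro Bochner_Integration.integral_cong) auto
  also have "\<dots> = - (\<integral>t. \<eta> t * \<rho> t \<partial>?I)"
    unfolding p_def by (intro integral_by_parts_initial \<tau> \<rho> \<eta>)
  finally show ?thesis .
qed

section \<open>Functions of time with finite-dimensional range\<close>

lemma (in seminormed) C_time_add:
  assumes "u \<in> C_time \<tau> X N" "y \<in> C_time \<tau> X N"
  shows "(\<lambda>t. u t + y t) \<in> C_time \<tau> X N"
  unfolding C_time_def
proof (intro CollectI ballI conjI)
  fix t assume t: "t \<in> {0..\<tau>}"
  show "u t + y t \<in> X" using assms t by (auto simp: C_time_def)
  have "((\<lambda>s. N (u s - u t) + N (y s - y t)) \<longlongrightarrow> 0 + 0) (at t within {0..\<tau>})"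
    using assms t by (intro tendsto_intros) (auto simp: C_time_def)
  then show "((\<lambda>s. N (u s + y s - (u t + y t))) \<longlongrightarrow> 0) (at t within {0..\<tau>})"
    unfolding add_0_left
  proof (rule Lim_null_comparison[rotated])
    show "\<forall>\<^sub>F s in at t within {0..\<tau>}. norm (N (u s + y s - (u t + y t))) \<le> N (u s - u t) + N (y s - y t)"
      unfolding eventually_at_filter
    proof (intro always_eventually allI impI)
      fix s assume s: "s \<in> {0..\<tau>}"
      have m: "u s - u t \<in> X" "y s - y t \<in> X" using assms s t by (auto simp: C_time_def)
      have eq: "u s + y s - (u t + y t) = (u s - u t) + (y s - y t)" by simp
      show "norm (N (u s + y s - (u t + y t))) \<le> N (u s - u t) + N (y s - y t)"
        unfolding eq using N_triangle[OF m] N_nonneg[OF add_mem[OF m]] by simp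
    qed
  qed
qed

lemma (in seminormed) C_time_scaleR:
  assumes \<psi>: "continuous_on {0..\<tau>} \<psi>" and u: "u \<in> C_time \<tau> X N"
  shows "(\<lambda>t. \<psi> t *\<^sub>R u t) \<in> C_time \<tau> X N"
  unfolding C_time_def
proof (intro CollectI ballI conjI)
  fix t assume t: "t \<in> {0..\<tau>}"
  show "\<psi> t *\<^sub>R u t \<in> X" using u t by (auto simp: C_time_def)
  have \<psi>t: "(\<psi> \<longlongrightarrow> \<psi> t) (at t within {0..\<tau>})" using \<psi> t by (simp add: continuous_on)
  have "((\<lambda>s. \<bar>\<psi> s\<bar> * N (u s - u t) + \<bar>\<psi> s - \<psi> t\<bar> * N (u t)) \<longlongrightarrow> \<bar>\<psi> t\<bar> * 0 + \<bar>\<psi> t - \<psi> t\<bar> * N (u t)) (at t within {0..\<tau>})"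
    using u t by (intro tendsto_intros \<psi>t) (auto simp: C_time_def)
  then have "((\<lambda>s. \<bar>\<psi> s\<bar> * N (u s - u t) + \<bar>\<psi> s - \<psi> t\<bar> * N (u t)) \<longlongrightarrow> 0) (at t within {0..\<tau>})" by simp
  then show "((\<lambda>s. N (\<psi> s *\<^sub>R u s - \<psi> t *\<^sub>R u t)) \<longlongrightarrow> 0) (at t within {0..\<tau>})"
  proof (rule Lim_null_comparison[rotated])
    show "\<forall>\<^sub>F s in at t within {0..\<tau>}. norm (N (\<psi> s *\<^sub>R u s - \<psi> t *\<^sub>R u t)) \<le> \<bar>\<psi> s\<bar> * N (u s - u t) + \<bar>\<psi> s - \<psi> t\<bar> * N (u t)"
      unfolding eventually_at_filter
    proof (intro always_eventually allI impI)
      fix s assume s: "s \<in> {0..\<tau>}"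
      have m: "u s \<in> X" "u t \<in> X" using u s t by (auto simp: C_time_def)
      have eq: "\<psi> s *\<^sub>R u s - \<psi> t *\<^sub>R u t = \<psi> s *\<^sub>R (u s - u t) + (\<psi> s - \<psi> t) *\<^sub>R u t"
        by (simp add: algebra_simps)
      have m': "\<psi> s *\<^sub>R (u s - u t) \<in> X" "(\<psi> s - \<psi> t) *\<^sub>R u t \<in> X" using m by auto
      show "norm (N (\<psi> s *\<^sub>R u s - \<psi> t *\<^sub>R u t)) \<le> \<bar>\<psi> s\<bar> * N (u s - u t) + \<bar>\<psi> s - \<psi> t\<bar> * N (u t)"
        unfolding eq using N_triangle[OF m'] N_nonneg[OF add_mem[OF m']] m by (simp add: N_scale diff_mem)
    qed
  qed
qed

lemma (in seminormed) C_time_const: "v \<in> X \<Longrightarrow> (\<lambda>_. v) \<in> C_time \<tau> X N"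
  by (simp add: C_time_def)

lemma (in semi_inner) C_time_ip_continuous:
  assumes u: "u \<in> C_time \<tau> X N" and y: "y \<in> C_time \<tau> X N"
  shows "continuous_on {0..\<tau>} (\<lambda>t. ip (u t) (y t))"
  unfolding continuous_on_sequentially comp_def
proof (intro allI ballI impI, elim conjE)
  fix x t assume t: "t \<in> {0..\<tau>}" and x: "\<forall>n. x n \<in> {0..\<tau>}" "x \<longlonglongrightarrow> t"
  have lim: "(\<lambda>n. N (f (x n) - f t)) \<longlonglongrightarrow> 0" if "f \<in> C_time \<tau> X N" for f
  proof (rule LIMSEQ_I)
    fix e :: real assume "e > 0"
    moreover have "((\<lambda>s. N (f s - f t)) \<longlongrightarrow> 0) (at t within {0..\<tau>})" using that t by (auto simp: C_time_def)
    ultimately obtain \<delta> where \<delta>: "\<delta> > 0" "\<And>s. s \<in> {0..\<tau>} \<Longrightarrow> s \<noteq> t \<Longrightarrow> dist s t < \<delta> \<Longrightarrow> \<bar>N (f s - f t)\<bar> < e"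
      unfolding tendsto_iff eventually_at by (fastforce simp: dist_real_def)
    obtain no where no: "\<And>k. k \<ge> no \<Longrightarrow> dist (x k) t < \<delta>"
      using x(2) \<delta>(1) unfolding lim_sequentially by blast
    show "\<exists>no. \<forall>n\<ge>no. norm (N (f (x n) - f t) - 0) < e"
    proof (intro exI allI impI)
      fix k assume "no \<le> k"
      then show "norm (N (f (x k) - f t) - 0) < e"
        using \<delta>(2)[OF _ _ no[of k]] \<open>e > 0\<close> x(1) by (cases "x k = t") auto
    qed
  qed
  show "(\<lambda>n. ip (u (x n)) (y (x n))) \<longlonglongrightarrow> ip (u t) (y t)"
    by (rule ip_tendsto[OF _ _ lim[OF u] _ _ lim[OF y]]) (use u y x t in \<open>auto simp: C_time_def\<close>)
qed

lemma (in semi_inner) C_time_L2: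
  assumes "\<tau> > 0" "u \<in> C_time \<tau> X N"
  shows "u \<in> bochner_L2 (lebesgue_on {0..\<tau>}) X N"
proof -
  have "integrable (lebesgue_on {0..\<tau>}) (\<lambda>t. ip (u t) (u t))"
    by (intro continuous_imp_integrable_real C_time_ip_continuous assms)
  moreover have "integrable (lebesgue_on {0..\<tau>}) (\<lambda>t. ip (u t) (u t)) = integrable (lebesgue_on {0..\<tau>}) (\<lambda>t. (N (u t))\<^sup>2)"
    using assms by (intro Bochner_Integration.integrable_cong) (auto simp: C_time_def N_power2)
  ultimately show ?thesis using sm_continuous[OF assms] by (simp add: bochner_L2_def)
qed

text \<open>The derivative is carried along as a second function, because a space of representatives
  offers no topology in which to differentiate. The endpoint \<open>z = 0\<close> serves for trial
  functions with zero initial value, \<open>z = \<tau>\<close> for test functions of the backward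
  argument. As every member is a finite sum, calculus reduces to scalar factors.\<close>

inductive nice :: "'v::real_vector set \<Rightarrow> real \<Rightarrow> real \<Rightarrow> (real \<Rightarrow> 'v) \<Rightarrow> (real \<Rightarrow> 'v) \<Rightarrow> bool"
  for X \<tau> z where
  base: "v \<in> X \<Longrightarrow> (\<And>t. t \<in> {0..\<tau>} \<Longrightarrow> (\<psi> has_real_derivative \<psi>' t) (at t within {0..\<tau>})) \<Longrightarrow>
    continuous_on {0..\<tau>} \<psi>' \<Longrightarrow> \<psi> z = 0 \<Longrightarrow> nice X \<tau> z (\<lambda>t. \<psi> t *\<^sub>R v) (\<lambda>t. \<psi>' t *\<^sub>R v)"
| add: "nice X \<tau> z u u' \<Longrightarrow> nice X \<tau> z y y' \<Longrightarrow> nice X \<tau> z (\<lambda>t. u t + y t) (\<lambda>t. u' t + y' t)"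

lemma nice_end: "nice X \<tau> z u u' \<Longrightarrow> u z = 0"
  by (induction rule: nice.induct) auto

lemma nice_mult:
  assumes "nice X \<tau> z u u'"
    and w: "\<And>t. t \<in> {0..\<tau>} \<Longrightarrow> (w has_real_derivative w' t) (at t within {0..\<tau>})" "continuous_on {0..\<tau>} w'"
  shows "nice X \<tau> z (\<lambda>t. w t *\<^sub>R u t) (\<lambda>t. w t *\<^sub>R u' t + w' t *\<^sub>R u t)"
  using assms(1)
proof induction
  case (base v \<psi> \<psi>')
  have c: "continuous_on {0..\<tau>} w" "continuous_on {0..\<tau>} \<psi>"
    using DERIV_continuous_on w(1) base(2) by blast+
  have "nice X \<tau> z (\<lambda>t. (w t * \<psi> t) *\<^sub>R v) (\<lambda>t. (w t * \<psi>' t + w' t * \<psi> t) *\<^sub>R v)"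
  proof (rule nice.base)
    show "((\<lambda>t. w t * \<psi> t) has_real_derivative w t * \<psi>' t + w' t * \<psi> t) (at t within {0..\<tau>})" if "t \<in> {0..\<tau>}" for t
      by (rule DERIV_cong[OF DERIV_mult[OF w(1)[OF that] base(2)[OF that]]]) (simp add: algebra_simps)
    show "continuous_on {0..\<tau>} (\<lambda>t. w t * \<psi>' t + w' t * \<psi> t)" by (intro continuous_intros c w(2) base(3))
  qed (use base in auto)
  then show ?case by (simp add: scaleR_add_left)
next
  case (add u u' y y')
  from nice.add[OF add.IH] show ?case by (simp add: scaleR_add_right algebra_simps)
qed

lemma nice_scaleR: "nice X \<tau> z u u' \<Longrightarrow> nice X \<tau> z (\<lambda>t. c *\<^sub>R u t) (\<lambda>t. c *\<^sub>R u' t)"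
  using nice_mult[of X \<tau> z u u' "\<lambda>_. c" "\<lambda>_. 0"] by simp

lemma nice_diff: "nice X \<tau> z u u' \<Longrightarrow> nice X \<tau> z y y' \<Longrightarrow> nice X \<tau> z (\<lambda>t. u t - y t) (\<lambda>t. u' t - y' t)"
  using nice.add[of X \<tau> z u u', OF _ nice_scaleR[of X \<tau> z y y' "-1"]] by simp

lemma (in seminormed) nice_zero: "nice X \<tau> z (\<lambda>t. 0) (\<lambda>t. 0)"
  using nice.base[of 0 X \<tau> "\<lambda>_. 0" "\<lambda>_. 0" z] by simp

lemma nice_test_function:
  assumes \<psi>: "\<psi> \<in> time_tests \<tau>" and "v \<in> X" "z \<in> {0, \<tau>}"
  shows "nice X \<tau> z (\<lambda>t. \<psi> t *\<^sub>R v) (\<lambda>t. deriv \<psi> t *\<^sub>R v)"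
proof (rule nice.base)
  show "(\<psi> has_real_derivative deriv \<psi> t) (at t within {0..\<tau>})" for t by (rule test_function_deriv(1)[OF \<psi>])
  show "continuous_on {0..\<tau>} (deriv \<psi>)" by (rule test_function_deriv(2)[OF \<psi>])
  show "\<psi> z = 0" using test_function_deriv(3,4)[OF \<psi>] assms(3) by auto
  show "v \<in> X" by (rule assms(2))
qed

text \<open>Exponential smoothing in time: \<open>\<delta> u' + u = g\<close>; a negative \<open>\<delta>\<close> smooths backwards in time.\<close>

lemma nice_smoothing:
  assumes "nice X \<tau> z' g g'" and \<delta>: "\<delta> \<noteq> 0" and \<tau>: "\<tau> > 0"
  shows "\<exists>u u'. nice X \<tau> z u u' \<and> (\<forall>t. u' t = (1 / \<delta>) *\<^sub>R (g t - u t))"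
  using assms(1)
proof induction
  case (base v \<theta> \<theta>')
  have c\<theta>: "continuous_on {0..\<tau>} \<theta>" using DERIV_continuous_on base(2) by blast
  have "continuous_on {0..\<tau>} (\<lambda>s. exp (s / \<delta>) * \<theta> s)" by (intro continuous_intros c\<theta>) (use \<delta> in simp)
  then obtain G where G: "\<And>x. x \<in> {0..\<tau>} \<Longrightarrow> (G has_vector_derivative exp (x / \<delta>) * \<theta> x) (at x within {0..\<tau>})"
    by (rule antiderivative_continuous) blast
  \<comment> \<open>Variation of constants for \<open>\<delta> \<psi>' + \<psi> = \<theta>\<close>,
    started with the value 0 at \<open>z\<close>, which may differ from the endpoint
    \<open>z'\<close> of \<open>g\<close>.\<close>
  define \<psi> where "\<psi> t = exp (- t / \<delta>) * (G t - G z) / \<delta>" for t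
  have D: "(\<psi> has_real_derivative (1 / \<delta>) * (\<theta> t - \<psi> t)) (at t within {0..\<tau>})" if "t \<in> {0..\<tau>}" for t
  proof -
    have "(G has_real_derivative exp (t / \<delta>) * \<theta> t) (at t within {0..\<tau>})"
      using G[OF that] by (simp add: has_real_derivative_iff_has_vector_derivative)
    then have "(\<psi> has_real_derivative (exp (- t / \<delta>) * (- 1 / \<delta>) * (G t - G z) + exp (- t / \<delta>) * (exp (t / \<delta>) * \<theta> t)) / \<delta>) (at t within {0..\<tau>})"
      unfolding \<psi>_def[abs_def] using \<delta> by (auto intro!: derivative_eq_intros simp: field_simps)
    moreover have "exp (- (t / \<delta>)) * exp (t / \<delta>) = 1" by (simp flip: exp_add)
    ultimately show ?thesis
      by (elim DERIV_cong) (simp add: \<psi>_def diff_divide_distrib flip: mult.assoc)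
  qed
  have c\<psi>: "continuous_on {0..\<tau>} \<psi>" by (rule DERIV_continuous_on[OF D])
  have "nice X \<tau> z (\<lambda>t. \<psi> t *\<^sub>R v) (\<lambda>t. ((1 / \<delta>) * (\<theta> t - \<psi> t)) *\<^sub>R v)"
  proof (rule nice.base[OF base(1) D])
    show "continuous_on {0..\<tau>} (\<lambda>t. (1 / \<delta>) * (\<theta> t - \<psi> t))"
      by (intro continuous_intros c\<theta> c\<psi>)
    show "\<psi> z = 0" by (simp add: \<psi>_def)
  qed
  moreover have "((1 / \<delta>) * (\<theta> t - \<psi> t)) *\<^sub>R v = (1 / \<delta>) *\<^sub>R (\<theta> t *\<^sub>R v - \<psi> t *\<^sub>R v)" for t
    by (simp only: scaleR_diff_left[symmetric] scaleR_scaleR)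
  ultimately show ?case
    by (intro exI[of _ "\<lambda>t. \<psi> t *\<^sub>R v"] exI[of _ "\<lambda>t. ((1 / \<delta>) * (\<theta> t - \<psi> t)) *\<^sub>R v"] conjI allI)
next
  case (add u u' y y')
  from add.IH(1) obtain p p' where p: "nice X \<tau> z p p'" "\<forall>t. p' t = (1 / \<delta>) *\<^sub>R (u t - p t)"
    by (elim exE conjE)
  from add.IH(2) obtain q q' where q: "nice X \<tau> z q q'" "\<forall>t. q' t = (1 / \<delta>) *\<^sub>R (y t - q t)"
    by (elim exE conjE)
  show ?case
  proof (intro exI conjI allI)
    show "nice X \<tau> z (\<lambda>t. p t + q t) (\<lambda>t. p' t + q' t)" by (rule nice.add[OF p(1) q(1)])
    show "p' t + q' t = (1 / \<delta>) *\<^sub>R (u t + y t - (p t + q t))" for t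
      unfolding p(2)[rule_format] q(2)[rule_format] by (simp add: scaleR_add_right scaleR_diff_right)
  qed
qed

context semi_inner
begin

lemma nice_C_time:
  assumes "nice X \<tau> z u u'" shows "u \<in> C_time \<tau> X N" "u' \<in> C_time \<tau> X N"
  using assms
proof (induction)
  case (base v \<psi> \<psi>')
  case 1 show ?case using DERIV_continuous_on base by (intro C_time_scaleR C_time_const) blast+
  case 2 show ?case using base by (intro C_time_scaleR C_time_const)
next
  case (add u u' y y')
  case 1 show ?case using add by (intro C_time_add)
  case 2 show ?case using add by (intro C_time_add)
qed

lemma nice_mem:
  assumes "nice X \<tau> z u u'" shows "u t \<in> X" "u' t \<in> X"
  using assms by (induction) (auto intro: add_mem scale_mem)

lemma nice_L2:
  assumes "\<tau> > 0" "nice X \<tau> z u u'"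
  shows "u \<in> bochner_L2 (lebesgue_on {0..\<tau>}) X N" "u' \<in> bochner_L2 (lebesgue_on {0..\<tau>}) X N"
  using C_time_L2 nice_C_time assms by auto

lemma nice_ip_const_derivative:
  assumes "nice X \<tau> z u u'" "v \<in> X" "t \<in> {0..\<tau>}"
  shows "((\<lambda>t. ip (u t) v) has_real_derivative ip (u' t) v) (at t within {0..\<tau>})"
  using assms(1)
proof (induction)
  case (base x \<psi> \<psi>')
  have "((\<lambda>t. \<psi> t * ip x v) has_real_derivative \<psi>' t * ip x v) (at t within {0..\<tau>})"
    by (rule DERIV_cmult_right[OF base(2)[OF assms(3)]])
  then show ?case using base assms by (simp add: ip_scale_left)
next
  case (add u u' y y')
  have "((\<lambda>t. ip (u t) v + ip (y t) v) has_real_derivative ip (u' t) v + ip (y' t) v) (at t within {0..\<tau>})"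
    by (rule DERIV_add[OF add.IH])
  then show ?case using add.hyps assms by (simp add: ip_add_left nice_mem)
qed

lemma nice_ip_derivative:
  assumes u: "nice X \<tau> z u u'" and y: "nice X \<tau> z' y y'" and t: "t \<in> {0..\<tau>}"
  shows "((\<lambda>t. ip (u t) (y t)) has_real_derivative ip (u' t) (y t) + ip (u t) (y' t)) (at t within {0..\<tau>})"
  using y
proof (induction)
  case (base x \<psi> \<psi>')
  have "((\<lambda>t. \<psi> t * ip (u t) x) has_real_derivative \<psi> t * ip (u' t) x + \<psi>' t * ip (u t) x) (at t within {0..\<tau>})"
    by (rule DERIV_cong[OF DERIV_mult[OF base(2)[OF t] nice_ip_const_derivative[OF u base(1) t]]]) simp
  then show ?case using base nice_mem[OF u] by (simp add: ip_scale_right)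
next
  case (add p p' y y')
  have "((\<lambda>t. ip (u t) (p t) + ip (u t) (y t)) has_real_derivative
      (ip (u' t) (p t) + ip (u t) (p' t)) + (ip (u' t) (y t) + ip (u t) (y' t))) (at t within {0..\<tau>})"
    by (rule DERIV_add[OF add.IH])
  then show ?case
    using nice_mem[OF u] nice_mem[OF add.hyps(1)] nice_mem[OF add.hyps(2)] by (simp add: ip_add_right add_ac)
qed

text \<open>The fundamental theorem for \<open>w t * ip (u t) (u t)\<close>. For a decreasing weight
  the term with \<open>w'\<close> supplies the multiple of the norm of \<open>H\<close> by which
  coercivity fails.\<close>

lemma nice_weighted_energy:
  assumes u: "nice X \<tau> z u u'" and s: "s \<in> {0..\<tau>}"
    and w: "\<And>t. t \<in> {0..\<tau>} \<Longrightarrow> (w has_real_derivative w' t) (at t within {0..\<tau>})" "continuous_on {0..\<tau>} w'"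
  shows "(\<integral>t. indicator {..s} t * (2 * (w t * ip (u' t) (u t)) + w' t * ip (u t) (u t)) \<partial>lebesgue_on {0..\<tau>})
    = w s * (N (u s))\<^sup>2 - w 0 * (N (u 0))\<^sup>2"
proof -
  have cw: "continuous_on {0..\<tau>} w" using DERIV_continuous_on w(1) by blast
  have "(\<integral>t. indicator {..s} t * (2 * (w t * ip (u' t) (u t)) + w' t * ip (u t) (u t)) \<partial>lebesgue_on {0..\<tau>})
    = w s * ip (u s) (u s) - w 0 * ip (u 0) (u 0)"
  proof (rule integral_derivative_initial[OF s])
    show "continuous_on {0..\<tau>} (\<lambda>t. 2 * (w t * ip (u' t) (u t)) + w' t * ip (u t) (u t))"
      by (intro continuous_intros cw w C_time_ip_continuous nice_C_time[OF u])
    show "((\<lambda>t. w t * ip (u t) (u t)) has_real_derivative 2 * (w t * ip (u' t) (u t)) + w' t * ip (u t) (u t)) (at t within {0..\<tau>})"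
      if t: "t \<in> {0..\<tau>}" for t
      by (rule DERIV_cong[OF DERIV_mult[OF w(1)[OF t] nice_ip_derivative[OF u u t]]])
        (use nice_mem[OF u] in \<open>simp add: ip_commute[of "u t" "u' t"] algebra_simps\<close>)
  qed
  then show ?thesis using nice_mem[OF u] by (simp add: N_power2)
qed

text \<open>The exceptional null set may depend on \<open>v\<close>; a countable dense sequence for
  \<open>g\<close> merges these sets into one. If \<open>N (g x)\<close> were positive, an element
  of the sequence closer to \<open>g x\<close> than \<open>N (g x)\<close> would contradict the
  Cauchy-Schwarz inequality.\<close>

lemma AE_null_if_weakly_null:
  assumes g: "smeas M X N g" and weak: "\<And>v. v \<in> X \<Longrightarrow> AE x in M. ip (g x) v = 0"
  shows "AE x in M. N (g x) = 0"
proof (rule sm_dense_seq[OF g])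
  fix d :: "nat \<Rightarrow> 'v" assume d: "\<And>i. d i \<in> X" "AE x in M. \<forall>e>0. \<exists>i. N (g x - d i) < e"
  have "AE x in M. \<forall>i. ip (g x) (d i) = 0" using weak d(1) by (simp add: AE_all_countable)
  then show ?thesis using d(2) sm_AE_mem[OF g]
  proof eventually_elim
    case (elim x)
    show ?case
    proof (rule ccontr)
      assume "N (g x) \<noteq> 0"
      then have pos: "N (g x) > 0" using N_nonneg[OF elim(3)] by simp
      then obtain i where i: "N (g x - d i) < N (g x)" using elim(2) by blast
      have "(N (g x))\<^sup>2 = ip (g x) (g x - d i)" using elim d by (simp add: N_power2 ip_diff_right)
      also have "\<dots> \<le> N (g x) * N (g x - d i)" using Cauchy_Schwarz[OF elim(3) diff_mem[OF elim(3) d(1)[of i]]] by simp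
      also have "\<dots> < (N (g x))\<^sup>2" using i pos by (simp add: power2_eq_square)
      finally show False by simp
    qed
  qed
qed

end

section \<open>Abstract parabolic problems\<close>

locale hilbert_pair = V: semi_hilbert VS ipV nV + H: semi_hilbert HS ipH nH
  for VS HS :: "'v::real_vector set" and ipV ipH nV nH +
  fixes \<tau> :: real
  assumes VH: "VS \<subseteq> HS" and nH_le: "v \<in> VS \<Longrightarrow> nH v \<le> nV v" and \<tau>: "\<tau> > 0"
begin

abbreviation "TI \<equiv> lebesgue_on {0..\<tau>}"
abbreviation "LS \<equiv> bochner_L2 TI VS nV"
abbreviation "LI \<equiv> bochner_inner TI ipV"
abbreviation "LN \<equiv> bochner_L2_norm TI nV"
abbreviation "LSH \<equiv> bochner_L2 TI VS nH"
abbreviation "LIH \<equiv> bochner_inner TI ipH"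
abbreviation "LNH \<equiv> bochner_L2_norm TI nH"

lemma TI: "complete_measure TI" "finite_measure TI"
proof -
  show "complete_measure TI" by (rule complete_measure_lebesgue_on) simp
  show "finite_measure TI" by (rule finite_measure_lebesgue_on) simp
qed

text \<open>\<open>V\<close> with the inner product of \<open>H\<close>. Completeness is not
  claimed; the terms with a time derivative are paired in this space.\<close>

sublocale VH: semi_inner VS ipH nH
proof
  show "subspace VS" by (rule V.ip_subspace)
  show "ipH x y = ipH y x" if "x \<in> VS" "y \<in> VS" for x y
    by (rule H.ip_commute) (use VH that in auto)
qed (use VH in \<open>auto simp: H.ip_add_left H.ip_scale_left H.ip_nonneg H.N_eq subset_iff\<close>)

sublocale L: semi_hilbert LS LI LN
  by (rule V.L2_semi_hilbert[OF TI])

sublocale LH: semi_inner LSH LIH LNH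
  by (rule VH.L2_semi_inner[OF TI(1)])

lemma LS_LSH:
  assumes "u \<in> LS" shows "u \<in> LSH" "LNH u \<le> LN u"
  by (rule L2_mono[OF VH.seminormed_axioms TI(1) subset_refl nH_le V.diff_mem assms], assumption+)+

lemma L_tendsto_LH:
  assumes "\<And>n. u n \<in> LS" "y \<in> LS" "(\<lambda>n. LN (u n - y)) \<longlonglongrightarrow> 0"
  shows "(\<lambda>n. LNH (u n - y)) \<longlonglongrightarrow> 0"
proof (rule Lim_null_comparison[OF _ assms(3)], intro always_eventually allI)
  show "norm (LNH (u n - y)) \<le> LN (u n - y)" for n
    using LS_LSH(2)[OF L.diff_mem[OF assms(1,2)], of n] by (simp add: L2_nonneg)
qed

lemma mult_LS:
  assumes N: "semi_inner VS ip N" and w: "continuous_on {0..\<tau>} w" "\<And>t. t \<in> {0..\<tau>} \<Longrightarrow> \<bar>w t\<bar> \<le> C"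
    and u: "u \<in> bochner_L2 TI VS N"
  shows "(\<lambda>t. w t *\<^sub>R u t) \<in> bochner_L2 TI VS N"
    "bochner_L2_norm TI N (\<lambda>t. w t *\<^sub>R u t) \<le> C * bochner_L2_norm TI N u"
proof -
  interpret semi_inner VS ip N by fact
  have "w \<in> borel_measurable TI" by (intro borel_measurable_integrable continuous_imp_integrable_real w)
  then have sm: "smeas TI VS N (\<lambda>t. w t *\<^sub>R u t)"
    using L2_D(1)[OF u] by (rule sm_scaleR)
  have "AE t in TI. N (w t *\<^sub>R u t) \<le> C * N (u t)"
    using L2_D(3)[OF u] AE_space
    by eventually_elim (use w(2) N_nonneg in \<open>auto simp: N_scale intro!: mult_right_mono\<close>)
  moreover have "C \<ge> 0" using w(2)[of 0] \<tau> by simp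
  ultimately show "(\<lambda>t. w t *\<^sub>R u t) \<in> bochner_L2 TI VS N"
    "bochner_L2_norm TI N (\<lambda>t. w t *\<^sub>R u t) \<le> C * bochner_L2_norm TI N u"
    using L2_dominated[OF seminormed_axioms TI(1) u sm] by auto
qed

lemma continuous_bound:
  assumes "continuous_on {0..\<tau>} (w :: real \<Rightarrow> real)"
  shows "\<exists>C\<ge>0. \<forall>t\<in>{0..\<tau>}. \<bar>w t\<bar> \<le> C"
proof -
  have "bounded (w ` {0..\<tau>})" by (intro compact_imp_bounded compact_continuous_image assms) auto
  then obtain C where C: "\<forall>t\<in>{0..\<tau>}. \<bar>w t\<bar> \<le> C" by (auto simp: bounded_iff)
  moreover have "C \<ge> 0" using bspec[OF C, of 0] \<tau> by simp
  ultimately show ?thesis by blast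
qed

text \<open>Stated for an arbitrary semi-inner product on \<open>VS\<close>, because it is applied
  to that of \<open>V\<close> as well as to that of \<open>H\<close>.\<close>

lemma weighted_form_integrable:
  assumes N: "semi_inner VS ip N" and w: "continuous_on {0..\<tau>} w"
    and u: "u \<in> bochner_L2 TI VS N" and y: "y \<in> bochner_L2 TI VS N"
  shows "integrable TI (\<lambda>t. w t * ip (u t) (y t))"
    and "(\<integral>t. w t * ip (u t) (y t) \<partial>TI) = bochner_inner TI ip (\<lambda>t. w t *\<^sub>R u t) y"
proof -
  interpret semi_inner VS ip N by fact
  obtain C where C: "C \<ge> 0" "\<And>t. t \<in> {0..\<tau>} \<Longrightarrow> \<bar>w t\<bar> \<le> C" using continuous_bound[OF w] by blast
  note wu = mult_LS(1)[OF N w C(2) u]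
  have eq: "AE t in TI. ip (w t *\<^sub>R u t) (y t) = w t * ip (u t) (y t)"
    using L2_D(3)[OF u] L2_D(3)[OF y] by eventually_elim (simp add: ip_scale_left)
  have i: "integrable TI (\<lambda>t. ip (w t *\<^sub>R u t) (y t))" by (rule L2_ip_integrable[OF TI(1) wu y])
  have "w \<in> borel_measurable TI" by (intro borel_measurable_integrable continuous_imp_integrable_real w)
  then have m: "(\<lambda>t. w t * ip (u t) (y t)) \<in> borel_measurable TI"
    using borel_measurable_integrable[OF L2_ip_integrable[OF TI(1) u y]] by measurable
  show "integrable TI (\<lambda>t. w t * ip (u t) (y t))"
    using integrable_cong_AE_imp[OF i m] eq by (auto elim: eventually_mono)
  show "(\<integral>t. w t * ip (u t) (y t) \<partial>TI) = bochner_inner TI ip (\<lambda>t. w t *\<^sub>R u t) y"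
    unfolding bochner_inner_def
    by (rule integral_cong_AE_complete[OF TI(1)]) (use eq in \<open>auto elim: eventually_mono\<close>)
qed

lemma weighted_form_tendsto:
  assumes N: "semi_inner VS ip N" and w: "continuous_on {0..\<tau>} w"
    and u: "\<And>n. u n \<in> bochner_L2 TI VS N" "p \<in> bochner_L2 TI VS N" "(\<lambda>n. bochner_L2_norm TI N (u n - p)) \<longlonglongrightarrow> 0"
    and y: "\<And>n. y n \<in> bochner_L2 TI VS N" "q \<in> bochner_L2 TI VS N" "(\<lambda>n. bochner_L2_norm TI N (y n - q)) \<longlonglongrightarrow> 0"
  shows "(\<lambda>n. \<integral>t. w t * ip (u n t) (y n t) \<partial>TI) \<longlonglongrightarrow> (\<integral>t. w t * ip (p t) (q t) \<partial>TI)"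
proof -
  interpret semi_inner VS ip N by fact
  interpret L': semi_inner "bochner_L2 TI VS N" "bochner_inner TI ip" "bochner_L2_norm TI N"
    by (rule L2_semi_inner[OF TI(1)])
  obtain C where C: "C \<ge> 0" "\<And>t. t \<in> {0..\<tau>} \<Longrightarrow> \<bar>w t\<bar> \<le> C" using continuous_bound[OF w] by blast
  have "(\<lambda>n. C * bochner_L2_norm TI N (u n - p)) \<longlonglongrightarrow> C * 0" by (intro tendsto_intros u)
  then have lim: "(\<lambda>n. bochner_L2_norm TI N ((\<lambda>t. w t *\<^sub>R u n t) - (\<lambda>t. w t *\<^sub>R p t))) \<longlonglongrightarrow> 0"
    unfolding mult_zero_right
  proof (rule Lim_null_comparison[rotated], intro always_eventually allI)
    fix n
    have "(\<lambda>t. w t *\<^sub>R u n t) - (\<lambda>t. w t *\<^sub>R p t) = (\<lambda>t. w t *\<^sub>R (u n - p) t)"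
      by (simp add: fun_eq_iff scaleR_diff_right)
    then show "norm (bochner_L2_norm TI N ((\<lambda>t. w t *\<^sub>R u n t) - (\<lambda>t. w t *\<^sub>R p t))) \<le> C * bochner_L2_norm TI N (u n - p)"
      using mult_LS(2)[OF N w C(2) L'.diff_mem[OF u(1) u(2)]] by (simp add: L2_nonneg)
  qed
  show ?thesis
    unfolding weighted_form_integrable(2)[OF N w u(1) y(1)] weighted_form_integrable(2)[OF N w u(2) y(2)]
    by (rule L'.ip_tendsto[OF mult_LS(1)[OF N w C(2) u(1)] mult_LS(1)[OF N w C(2) u(2)] lim y])
qed

lemma nice_LS: "nice VS \<tau> z u u' \<Longrightarrow> u \<in> LS" "nice VS \<tau> z u u' \<Longrightarrow> u' \<in> LS"
  using V.nice_L2[OF \<tau>] by auto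

text \<open>An element orthogonal to all \<open>\<psi> t *\<^sub>R v\<close> with a test function
  \<open>\<psi>\<close> is weakly null at almost every time, hence null. Test functions vanish at
  both ends of the interval, so either endpoint \<open>z\<close> is possible.\<close>

lemma nice_dense:
  assumes g: "g \<in> LS" and z: "z \<in> {0, \<tau>}"
  shows "\<exists>q q'. (\<forall>n. nice VS \<tau> z (q n) (q' n)) \<and> (\<lambda>n. LN (q n - g)) \<longlonglongrightarrow> 0"
proof -
  define Y where "Y = {u. \<exists>u'. nice VS \<tau> z u u'}"
  show ?thesis
  proof (rule L.dense_if_orthogonal_trivial[where Y = Y])
    show "Y \<subseteq> LS" using nice_LS by (auto simp: Y_def)
    show "Y \<noteq> {}" using V.nice_zero by (auto simp: Y_def)
    fix x y a b assume "x \<in> Y" "y \<in> Y"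
    then obtain x' y' where "nice VS \<tau> z x x'" "nice VS \<tau> z y y'" by (auto simp: Y_def)
    from nice.add[OF nice_scaleR[OF this(1), of a] nice_scaleR[OF this(2), of b]]
    have "a *\<^sub>R x + b *\<^sub>R y \<in> Y" by (auto simp: Y_def plus_fun_def scaleR_fun_def)
    then show "\<exists>z\<in>Y. LN (a *\<^sub>R x + b *\<^sub>R y - z) = 0" by (intro bexI[of _ "a *\<^sub>R x + b *\<^sub>R y"]) simp_all
  next
    fix p assume p: "p \<in> LS" and orth: "\<And>y. y \<in> Y \<Longrightarrow> LI y p = 0"
    have "AE t in TI. ipV (p t) v = 0" if v: "v \<in> VS" for v
    proof (rule AE_0_if_orthogonal_time_test_functions)
      have cv: "(\<lambda>_. v) \<in> LS" by (intro V.C_time_L2 \<tau> V.C_time_const v)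
      show "integrable TI (\<lambda>t. ipV (p t) v)" by (rule V.L2_ip_integrable[OF TI(1) p cv])
      fix \<psi> :: "real \<Rightarrow> real" assume \<psi>: "\<psi> \<in> time_tests \<tau>"
      have cont: "continuous_on {0..\<tau>} \<psi>" by (rule test_functions_continuous[OF \<psi>])
      have "(\<lambda>t. \<psi> t *\<^sub>R v) \<in> Y" using nice_test_function[OF \<psi> v z] by (auto simp: Y_def)
      then have "(\<integral>t. \<psi> t * ipV v (p t) \<partial>TI) = 0"
        using orth weighted_form_integrable(2)[OF V.semi_inner_axioms cont cv p] by simp
      moreover have "(\<integral>t. \<psi> t * ipV v (p t) \<partial>TI) = (\<integral>t. \<psi> t * ipV (p t) v \<partial>TI)"
      proof (rule integral_cong_AE_complete[OF TI(1)])
        show "AE t in TI. \<psi> t * ipV v (p t) = \<psi> t * ipV (p t) v"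
          using L2_D(3)[OF p] by eventually_elim (simp add: V.ip_commute[OF v])
      qed
      ultimately show "(\<integral>t. \<psi> t * ipV (p t) v \<partial>TI) = 0" by simp
    qed
    then have "AE t in TI. nV (p t) = 0" by (intro V.AE_null_if_weakly_null L2_D(1)[OF p])
    then show "LN p = 0" by (simp add: V.L2_norm_eq_0_iff[OF TI(1) p])
  next
    show "g \<in> LS" by fact
  next
    fix q assume "\<And>n. q n \<in> Y" "(\<lambda>n. LN (q n - g)) \<longlonglongrightarrow> 0"
    moreover from this obtain q' where "\<And>n. nice VS \<tau> z (q n) (q' n)" unfolding Y_def by simp metis
    ultimately show ?thesis by blast
  qed
qed

text \<open>Pair \<open>\<delta> u' + u = g\<close> with \<open>u\<close> in \<open>V\<close>. The
  first term is half of \<open>\<delta>\<close> times the difference of the squared norms of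
  \<open>u\<close> at \<open>\<tau>\<close> and 0; one of them vanishes, and the sign of
  \<open>\<delta>\<close> makes the other nonnegative.\<close>

lemma smoothing_contraction:
  assumes u: "nice VS \<tau> z u u'" and eq: "\<And>t. t \<in> {0..\<tau>} \<Longrightarrow> u' t = (1 / \<delta>) *\<^sub>R (g t - u t)"
    and g: "g \<in> LS" and z: "z = 0 \<and> \<delta> > 0 \<or> z = \<tau> \<and> \<delta> < 0"
  shows "LN u \<le> LN g"
proof -
  have "0 \<le> \<delta> * (\<integral>t. ipV (u' t) (u t) \<partial>TI)"
  proof -
    have c: "continuous_on {0..\<tau>} (\<lambda>t. ipV (u' t) (u t))"
      by (intro V.C_time_ip_continuous V.nice_C_time[OF u])
    have "(\<integral>t. indicator {..\<tau>} t * (2 * (1 * ipV (u' t) (u t)) + 0 * ipV (u t) (u t)) \<partial>TI)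
      = 1 * (nV (u \<tau>))\<^sup>2 - 1 * (nV (u 0))\<^sup>2"
      by (rule V.nice_weighted_energy[OF u]) (use \<tau> in auto)
    moreover have "(\<integral>t. indicator {..\<tau>} t * (2 * (1 * ipV (u' t) (u t)) + 0 * ipV (u t) (u t)) \<partial>TI)
      = (\<integral>t. 2 * ipV (u' t) (u t) \<partial>TI)"
      by (intro Bochner_Integration.integral_cong) auto
    ultimately have eq: "2 * (\<integral>t. ipV (u' t) (u t) \<partial>TI) = (nV (u \<tau>))\<^sup>2 - (nV (u 0))\<^sup>2" by simp
    have "0 \<le> \<delta> * ((nV (u \<tau>))\<^sup>2 - (nV (u 0))\<^sup>2)"
      using z nice_end[OF u] V.N_zero by (auto intro: mult_nonneg_nonneg mult_nonpos_nonpos)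
    then show ?thesis unfolding eq[symmetric] by simp
  qed
  moreover have "LI g u = LI u u + \<delta> * LI u' u"
  proof -
    have \<delta>: "\<delta> \<noteq> 0" using z by auto
    have "LI g u = LI (u + \<delta> *\<^sub>R u') u"
      unfolding bochner_inner_def using \<delta> eq by (intro Bochner_Integration.integral_cong) auto
    then show ?thesis using nice_LS[OF u] by (simp add: L.ip_add_left L.ip_scale_left L.scale_mem)
  qed
  ultimately have "(LN u)\<^sup>2 \<le> LI g u" using L.N_power2[OF nice_LS(1)[OF u]] by (simp add: bochner_inner_def)
  also have "\<dots> \<le> LN g * LN u" using L.Cauchy_Schwarz[OF g nice_LS(1)[OF u]] by simp
  finally show ?thesis
    using L.N_nonneg[OF nice_LS(1)[OF u]] L.N_nonneg[OF g] by (cases "LN u = 0") (auto simp: power2_eq_square)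
qed

text \<open>Formally \<open>\<sigma> h (g', g) w + \<sigma> / 2 h (g, g) w'\<close> is \<open>\<sigma> / 2\<close> times the derivative of \<open>w h (g, g)\<close>.
  For the exponentially smoothed \<open>u\<close> the defect \<open>h (u', g - u) = \<delta> h (u', u')\<close> has a sign.\<close>

lemma one_sided_energy_approx:
  assumes g: "g \<in> LS" and z: "z = 0 \<and> \<sigma> = 1 \<or> z = \<tau> \<and> \<sigma> = -1"
    and w: "\<And>t. t \<in> {0..\<tau>} \<Longrightarrow> (w has_real_derivative w' t) (at t within {0..\<tau>})" "continuous_on {0..\<tau>} w'"
      "\<And>t. t \<in> {0..\<tau>} \<Longrightarrow> w t \<ge> 0"
    and \<eta>: "\<eta> > 0"
  shows "\<exists>u u'. nice VS \<tau> z u u' \<and> LN (u - g) \<le> \<eta> \<and>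
    \<sigma> * (\<integral>t. w t * ipH (u' t) (g t) \<partial>TI) + \<sigma> / 2 * (\<integral>t. w' t * ipH (u t) (u t) \<partial>TI) \<ge> - \<eta>"
proof -
  have \<sigma>: "\<bar>\<sigma>\<bar> = 1" "\<sigma> * \<sigma> = 1" "\<sigma> \<noteq> 0" and z': "z \<in> {0, \<tau>}" using z by auto
  have cw: "continuous_on {0..\<tau>} w" using DERIV_continuous_on w(1) by blast
  obtain W where W: "W \<ge> 0" "\<And>t. t \<in> {0..\<tau>} \<Longrightarrow> \<bar>w t\<bar> \<le> W" using continuous_bound[OF cw] by blast
  \<comment> \<open>Chosen to satisfy the two inequalities below: \<open>5 * e\<close> bounds the
    distances that occur, and \<open>5 * W * e * e\<close> the error in the time derivative
    term.\<close>
  define e where "e = \<eta> / (5 * (1 + W)) / (1 + \<eta>)"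
  have e: "e > 0" "5 * e \<le> \<eta>" "5 * W * e * e \<le> \<eta>"
  proof -
    show "e > 0" using \<eta> W by (simp add: e_def)
    have e': "e * (5 * (1 + W) * (1 + \<eta>)) = \<eta>" using \<eta> W by (simp add: e_def)
    have "5 * ((1 + W) * e) * 1 \<le> 5 * ((1 + W) * e) * (1 + \<eta>)"
      using \<open>e > 0\<close> \<eta> W by (intro mult_left_mono) auto
    then have 1: "5 * ((1 + W) * e) \<le> \<eta>" using e' by (simp add: mult_ac)
    have "5 * e * \<eta> \<le> e * (5 * (1 + W) * (1 + \<eta>))"
      using \<open>e > 0\<close> \<eta> W by (simp add: algebra_simps)
    then have 2: "e \<le> 1 / 5" using \<eta> e' by (simp add: mult_le_cancel_right1)
    show "5 * e \<le> \<eta>" 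
    proof -
      have "0 \<le> W * e" using W \<open>e > 0\<close> by simp
      moreover have "5 * ((1 + W) * e) = 5 * e + 5 * (W * e)" by (simp add: algebra_simps)
      ultimately show ?thesis using 1 by linarith
    qed
    have "W * e \<le> (1 + W) * e" using \<open>e > 0\<close> by simp
    also have "\<dots> \<le> \<eta> / 5" using 1 by simp
    finally have "5 * (W * e) * e \<le> \<eta> * e" using \<open>e > 0\<close> by (intro mult_right_mono) auto
    also have "\<dots> \<le> \<eta> * 1" using 2 \<eta> by (intro mult_left_mono) auto
    finally show "5 * W * e * e \<le> \<eta>" by (simp add: mult.assoc)
  qed
  obtain q q' where q: "\<And>n. nice VS \<tau> z (q n) (q' n)" "(\<lambda>n. LN (q n - g)) \<longlonglongrightarrow> 0"
    using nice_dense[OF g z'] by blast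
  have near: "\<exists>n. LN (q n - g) < d" if "d > 0" for d
    using order_tendstoD(2)[OF q(2) that] by (auto simp: eventually_sequentially)
  \<comment> \<open>The order of choices matters: \<open>q m\<close> fixes the smoothing parameter
    through the size of \<open>q' m\<close>, and a better approximation \<open>q n\<close> is chosen
    only afterwards. What gets smoothed is \<open>q n\<close>; \<open>q m\<close> serves for
    comparison.\<close>
  obtain m where m: "LN (q m - g) < e" using near[OF e(1)] ..
  \<comment> \<open>Makes \<open>d * LN (q' m) \<le> e\<close>, so that smoothing moves
    \<open>q m\<close> by at most \<open>e\<close>.\<close>
  define d where "d = e / (1 + LN (q' m))"
  have d: "d > 0" using e L.N_nonneg[OF nice_LS(2)[OF q(1)]] by (simp add: d_def add_pos_nonneg)
  \<comment> \<open>The bound \<open>e * d\<close> compensates the factor \<open>1 / d\<close> in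
    the estimate of \<open>u'\<close>.\<close>
  obtain n where n: "LN (q n - g) < min e (e * d)" using near[of "min e (e * d)"] e d by auto
  define \<delta> where "\<delta> = \<sigma> * d"
  have \<delta>: "\<delta> \<noteq> 0" "\<bar>\<delta>\<bar> = d" "z = 0 \<and> \<delta> > 0 \<or> z = \<tau> \<and> \<delta> < 0" using d z by (auto simp: \<delta>_def)
  obtain u u' where u: "nice VS \<tau> z u u'" "\<And>t. u' t = (1 / \<delta>) *\<^sub>R (q n t - u t)"
    using nice_smoothing[OF q(1)[of n] \<delta>(1) \<tau>, where z = z] by blast
  obtain y y' where y: "nice VS \<tau> z y y'" "\<And>t. y' t = (1 / \<delta>) *\<^sub>R (q m t - y t)"
    using nice_smoothing[OF q(1)[of m] \<delta>(1) \<tau>, where z = z] by blast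
  have mem: "u \<in> LS" "u' \<in> LS" "y \<in> LS" "y' \<in> LS" "q k \<in> LS" "q' k \<in> LS" for k
    using nice_LS u(1) y(1) q(1) by blast+
  \<comment> \<open>Smoothing is linear, so \<open>u - y\<close> is the smoothing of
    \<open>q n - q m\<close>.\<close>
  have s1: "LN (u - y) \<le> LN (q n - q m)"
  proof (rule smoothing_contraction[where u' = "u' - y'", OF _ _ _ \<delta>(3)])
    show "nice VS \<tau> z (u - y) (u' - y')" using nice_diff[OF u(1) y(1)] by (simp add: fun_diff_def)
    show "(u' - y') t = (1 / \<delta>) *\<^sub>R ((q n - q m) t - (u - y) t)" for t
      by (simp add: u(2) y(2) algebra_simps)
  qed (use mem in auto)
  \<comment> \<open>The error \<open>y - q m\<close> is itself a smoothing, namely of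
    \<open>- \<delta> *\<^sub>R q' m\<close>.\<close>
  have s2: "LN (y - q m) \<le> LN (- \<delta> *\<^sub>R q' m)"
  proof (rule smoothing_contraction[where u' = "y' - q' m", OF _ _ _ \<delta>(3)])
    show "nice VS \<tau> z (y - q m) (y' - q' m)" using nice_diff[OF y(1) q(1)] by (simp add: fun_diff_def)
    show "(y' - q' m) t = (1 / \<delta>) *\<^sub>R ((- \<delta> *\<^sub>R q' m) t - (y - q m) t)" for t
      using \<delta>(1) by (simp add: y(2) algebra_simps)
    show "- \<delta> *\<^sub>R q' m \<in> LS" using mem L.scale_mem by blast
  qed
  have "LN (- \<delta> *\<^sub>R q' m) = d * LN (q' m)" using L.N_scale[OF mem(6)[of m], of "- \<delta>"] \<delta>(2) by simp
  also have "\<dots> \<le> e" using e L.N_nonneg[OF mem(6), of m] by (simp add: d_def field_simps)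
  finally have s2': "LN (y - q m) \<le> e" using s2 by simp
  have s3: "LN (q n - q m) \<le> 2 * e"
    using L.N_triangle4[OF mem(5) g mem(5), of n m] L.N_diff_commute[OF g mem(5), of m] m n by simp
  have "LN (u - g) \<le> LN (u - y) + LN (y - g)" using mem g by (intro L.N_triangle4)
  moreover have "LN (y - g) \<le> LN (y - q m) + LN (q m - g)" using mem g by (intro L.N_triangle4)
  ultimately have ug: "LN (u - g) \<le> 4 * e" using s1 s2' s3 m by linarith
  have "LN (q n - u) \<le> LN (q n - g) + LN (g - u)" using mem g by (intro L.N_triangle4)
  then have qu: "LN (q n - u) \<le> 5 * e" using ug L.N_diff_commute[OF g mem(1)] n by simp
  have "u' = (1 / \<delta>) *\<^sub>R (q n - u)" by (simp add: fun_eq_iff u(2))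
  then have "LN u' = (1 / d) * LN (q n - u)" using L.N_scale[OF L.diff_mem[OF mem(5,1)]] \<delta>(2) by simp
  then have u'_le: "LN u' \<le> 5 * e / d" using qu d by (simp add: divide_right_mono)
  let ?uu = "\<integral>t. w t * ipH (u' t) (u t) \<partial>TI"
    and ?vv = "\<integral>t. w t * ipH (u' t) (u' t) \<partial>TI"
    and ?ug = "\<integral>t. w t * ipH (u' t) (g t) \<partial>TI"
    and ?ud = "\<integral>t. w t * ipH (u' t) ((g - q n) t) \<partial>TI"
    and ?w = "\<integral>t. w' t * ipH (u t) (u t) \<partial>TI"
  have err: "\<bar>?ud\<bar> \<le> \<eta>"
  proof -
    have gq: "g - q n \<in> LS" using g mem by blast
    note wu = mult_LS[OF VH.semi_inner_axioms cw W(2) LS_LSH(1)[OF mem(2)]]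
    have "\<bar>?ud\<bar> = \<bar>LIH (\<lambda>t. w t *\<^sub>R u' t) (g - q n)\<bar>"
      by (subst weighted_form_integrable(2)[OF VH.semi_inner_axioms cw LS_LSH(1)[OF mem(2)] LS_LSH(1)[OF gq]]) simp
    also have "\<dots> \<le> LNH (\<lambda>t. w t *\<^sub>R u' t) * LNH (g - q n)"
      by (rule LH.Cauchy_Schwarz[OF wu(1) LS_LSH(1)[OF gq]])
    also have "\<dots> \<le> (W * (5 * e / d)) * (e * d)"
    proof (rule mult_mono)
      have "W * LNH u' \<le> W * (5 * e / d)"
        using W(1) LS_LSH(2)[OF mem(2)] u'_le by (intro mult_left_mono) auto
      then show "LNH (\<lambda>t. w t *\<^sub>R u' t) \<le> W * (5 * e / d)" using wu(2) by linarith
      show "LNH (g - q n) \<le> e * d"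
        using LS_LSH(2)[OF gq] n L.N_diff_commute[OF g mem(5), of n] by simp
    qed (use W e d in \<open>auto simp: L2_nonneg\<close>)
    also have "\<dots> = 5 * W * e * e" using d by simp
    also have "\<dots> \<le> \<eta>" by (rule e(3))
    finally show ?thesis .
  qed
  have H: "u \<in> LSH" "u' \<in> LSH" "q n \<in> LSH" "g - q n \<in> LSH" using LS_LSH(1) mem g L.diff_mem by blast+
  note int = weighted_form_integrable(1)[OF VH.semi_inner_axioms]
  \<comment> \<open>The decomposition \<open>g = u + \<delta> u' + (g - q n)\<close>, paired with
    \<open>u'\<close>: an exact derivative, a term with a sign, and a small error.\<close>
  have split1: "?ug =
      ?uu + \<delta> * ?vv + ?ud"
  proof -
    have "?ug =
      (\<integral>t. w t * ipH (u' t) (u t) + \<delta> * (w t * ipH (u' t) (u' t)) + w t * ipH (u' t) ((g - q n) t) \<partial>TI)"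
    proof (rule integral_cong_AE_complete[OF TI(1)])
      show "AE t in TI. w t * ipH (u' t) (g t) = w t * ipH (u' t) (u t) + \<delta> * (w t * ipH (u' t) (u' t)) + w t * ipH (u' t) ((g - q n) t)"
        using L2_D(3)[OF g]
      proof eventually_elim
        case (elim t)
        have mm: "u t \<in> VS" "u' t \<in> VS" "q n t \<in> VS" using V.nice_mem[OF u(1)] V.nice_mem[OF q(1)] by auto
        have "q n t = u t + \<delta> *\<^sub>R u' t" using \<delta>(1) by (simp add: u(2))
        then have gt: "(u t + \<delta> *\<^sub>R u' t) + (g - q n) t = g t" by simp
        have "(g - q n) t \<in> VS" using mm elim by auto
        then have "ipH (u' t) ((u t + \<delta> *\<^sub>R u' t) + (g - q n) t) = ipH (u' t) (u t) + \<delta> * ipH (u' t) (u' t) + ipH (u' t) ((g - q n) t)"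
          using mm by (simp only: VH.ip_add_right VH.ip_scale_right V.add_mem V.scale_mem)
        then have "ipH (u' t) (g t) = ipH (u' t) (u t) + \<delta> * ipH (u' t) (u' t) + ipH (u' t) ((g - q n) t)"
          unfolding gt .
        then show ?case by (simp add: algebra_simps)
      qed
    qed
    also have "\<dots> = ?uu + \<delta> * ?vv + ?ud"
      using int[OF cw H(2,1)] int[OF cw H(2,2)] int[OF cw H(2,4)] by simp
    finally show ?thesis .
  qed
  have nonneg: "0 \<le> \<sigma> * (\<delta> * ?vv)"
  proof -
    have "0 \<le> ?vv"
      using w(3) V.nice_mem[OF u(1)] by (intro integral_nonneg_AE AE_I2) (auto intro!: mult_nonneg_nonneg VH.ip_nonneg)
    moreover have "\<sigma> * \<delta> = d" by (simp add: \<delta>_def \<sigma> flip: mult.assoc)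
    ultimately show ?thesis using d by (simp flip: mult.assoc)
  qed
  have energy: "\<sigma> * ?uu + \<sigma> / 2 * ?w \<ge> 0"
  proof -
    have "(\<integral>t. indicator {..\<tau>} t * (2 * (w t * ipH (u' t) (u t)) + w' t * ipH (u t) (u t)) \<partial>TI)
      = w \<tau> * (nH (u \<tau>))\<^sup>2 - w 0 * (nH (u 0))\<^sup>2"
      by (rule VH.nice_weighted_energy[OF u(1) _ w(1,2)]) (use \<tau> in auto)
    moreover have "(\<integral>t. indicator {..\<tau>} t * (2 * (w t * ipH (u' t) (u t)) + w' t * ipH (u t) (u t)) \<partial>TI)
      = (\<integral>t. 2 * (w t * ipH (u' t) (u t)) + w' t * ipH (u t) (u t) \<partial>TI)"
      by (intro Bochner_Integration.integral_cong) auto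
    moreover have "\<dots> = 2 * ?uu + ?w"
      using int[OF cw H(2,1)] int[OF w(2) H(1,1)] by simp
    ultimately have eq: "2 * ?uu + ?w = w \<tau> * (nH (u \<tau>))\<^sup>2 - w 0 * (nH (u 0))\<^sup>2"
      by simp
    \<comment> \<open>The boundary term at \<open>z\<close> is 0, and \<open>\<sigma>\<close> is the
      sign of the other one.\<close>
    have "0 \<le> \<sigma> * (w \<tau> * (nH (u \<tau>))\<^sup>2 - w 0 * (nH (u 0))\<^sup>2)"
      using z nice_end[OF u(1)] w(3)[of 0] w(3)[of \<tau>] \<tau> VH.N_zero by auto
    then show ?thesis unfolding eq[symmetric] by (simp add: algebra_simps)
  qed
  have "\<bar>\<sigma> * ?ud\<bar> \<le> \<eta>" using err \<sigma>(1) by (simp add: abs_mult)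
  then have "\<sigma> * ?ug + \<sigma> / 2 * ?w \<ge> - \<eta>"
    unfolding split1 distrib_left using nonneg energy by linarith
  moreover have "LN (u - g) \<le> \<eta>" using ug e by linarith
  ultimately show ?thesis using u(1) by blast
qed

end

text \<open>\<open>A t v\<close> is an element of \<open>V\<close> and stands for a functional on
  \<open>V\<close> by Riesz representation. Therefore linearity is required up to null elements, and
  Garding's inequality uses the inner product of \<open>V\<close>.\<close>

locale parabolic = hilbert_pair VS HS ipV ipH nV nH \<tau>
  for VS HS :: "'v::real_vector set" and ipV ipH nV nH \<tau> +
  fixes A :: "real \<Rightarrow> 'v \<Rightarrow> 'v" and C \<kappa> c :: real
  assumes A_mem: "t \<in> {0..\<tau>} \<Longrightarrow> v \<in> VS \<Longrightarrow> A t v \<in> VS"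
    and A_lin: "t \<in> {0..\<tau>} \<Longrightarrow> u \<in> VS \<Longrightarrow> v \<in> VS \<Longrightarrow> nV (A t (a *\<^sub>R u + b *\<^sub>R v) - (a *\<^sub>R A t u + b *\<^sub>R A t v)) = 0"
    and A_bdd: "t \<in> {0..\<tau>} \<Longrightarrow> v \<in> VS \<Longrightarrow> nV (A t v) \<le> C * nV v"
    and A_meas: "v \<in> VS \<Longrightarrow> smeas (lebesgue_on {0..\<tau>}) VS nV (\<lambda>t. A t v)"
    and A_Garding: "t \<in> {0..\<tau>} \<Longrightarrow> v \<in> VS \<Longrightarrow> c * (nV v)\<^sup>2 \<le> ipV (A t v) v + \<kappa> * (nH v)\<^sup>2"
    and C: "C \<ge> 0" and \<kappa>: "\<kappa> \<ge> 0" and c: "c > 0"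
begin

section \<open>Bounded operator families on the evolution space\<close>

definition bounded_family :: "(real \<Rightarrow> 'v \<Rightarrow> 'v) \<Rightarrow> real \<Rightarrow> bool" where
  "bounded_family F B \<longleftrightarrow> B \<ge> 0 \<and> (\<forall>t\<in>{0..\<tau>}. \<forall>v\<in>VS. F t v \<in> VS \<and> nV (F t v) \<le> B * nV v \<and>
     (\<forall>u\<in>VS. \<forall>a b. nV (F t (a *\<^sub>R u + b *\<^sub>R v) - (a *\<^sub>R F t u + b *\<^sub>R F t v)) = 0)) \<and>
     (\<forall>v\<in>VS. smeas TI VS nV (\<lambda>t. F t v))"

lemma bounded_family_mem:
  "bounded_family F B \<Longrightarrow> t \<in> {0..\<tau>} \<Longrightarrow> v \<in> VS \<Longrightarrow> F t v \<in> VS"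
  by (simp add: bounded_family_def)

lemma bounded_family_lipschitz:
  assumes F: "bounded_family F B" and t: "t \<in> {0..\<tau>}" and uv: "u \<in> VS" "v \<in> VS"
  shows "nV (F t u - F t v) \<le> B * nV (u - v)"
proof -
  have m: "F t u \<in> VS" "F t v \<in> VS" "F t (u - v) \<in> VS"
    using uv by (auto intro!: bounded_family_mem[OF F t])
  have "nV (F t (1 *\<^sub>R u + (-1) *\<^sub>R v) - (1 *\<^sub>R F t u + (-1) *\<^sub>R F t v)) = 0"
    using F t uv unfolding bounded_family_def by blast
  then have "nV (F t (u - v) - (F t u - F t v)) = 0" by simp
  then have "nV (F t u - F t v) = nV (F t (u - v))"
    using V.N_triangle_rev[OF m(3) V.diff_mem[OF m(1,2)]] by simp
  also have "\<dots> \<le> B * nV (u - v)" using F t V.diff_mem[OF uv] by (simp add: bounded_family_def)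
  finally show ?thesis .
qed

lemma bounded_family_LS:
  assumes F: "bounded_family F B" and u: "u \<in> LS"
  shows "(\<lambda>t. F t (u t)) \<in> LS" "LN (\<lambda>t. F t (u t)) \<le> B * LN u"
proof -
  have B: "B \<ge> 0" using F by (simp add: bounded_family_def)
  have sm: "smeas TI VS nV (\<lambda>t. F t (u t))"
  proof (rule strongly_measurable_operator[where C = B, OF V.seminormed_axioms TI(1) _ _ _ L2_D(1)[OF u]])
    show "smeas TI VS nV (\<lambda>t. F t v)" if "v \<in> VS" for v
      using F that by (auto simp: bounded_family_def)
    show "AE t in TI. \<forall>v\<in>VS. F t v \<in> VS" using F by (intro AE_I2) (auto simp: bounded_family_def)
    show "AE t in TI. \<forall>u\<in>VS. \<forall>v\<in>VS. nV (F t u - F t v) \<le> B * nV (u - v)"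
      using bounded_family_lipschitz[OF F] by (intro AE_I2) auto
  qed
  have "AE t in TI. nV (F t (u t)) \<le> B * nV (u t)"
    using L2_D(3)[OF u] AE_space by eventually_elim (use F in \<open>auto simp: bounded_family_def\<close>)
  from L2_dominated[OF V.seminormed_axioms TI(1) u sm this B]
  show "(\<lambda>t. F t (u t)) \<in> LS" "LN (\<lambda>t. F t (u t)) \<le> B * LN u" by auto
qed

lemma bounded_family_LS_lipschitz:
  assumes F: "bounded_family F B" and u: "u \<in> LS" and y: "y \<in> LS"
  shows "LN ((\<lambda>t. F t (u t)) - (\<lambda>t. F t (y t))) \<le> B * LN (u - y)"
proof -
  have B: "B \<ge> 0" using F by (simp add: bounded_family_def)
  have d: "(\<lambda>t. F t (u t)) - (\<lambda>t. F t (y t)) \<in> LS"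
    using bounded_family_LS(1)[OF F] u y L.diff_mem by blast
  have "AE t in TI. nV (((\<lambda>t. F t (u t)) - (\<lambda>t. F t (y t))) t) \<le> B * nV ((u - y) t)"
    using L2_D(3)[OF u] L2_D(3)[OF y] AE_space
    by eventually_elim (use bounded_family_lipschitz[OF F] in auto)
  from L2_dominated(2)[OF V.seminormed_axioms TI(1) L.diff_mem[OF u y] L2_D(1)[OF d] this B]
  show ?thesis .
qed

lemma bounded_family_LS_tendsto:
  assumes F: "bounded_family F B" and u: "\<And>n. u n \<in> LS" "y \<in> LS" "(\<lambda>n. LN (u n - y)) \<longlonglongrightarrow> 0"
  shows "(\<lambda>n. LN ((\<lambda>t. F t (u n t)) - (\<lambda>t. F t (y t)))) \<longlonglongrightarrow> 0"
proof (rule Lim_null_comparison)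
  show "\<forall>\<^sub>F n in sequentially. norm (LN ((\<lambda>t. F t (u n t)) - (\<lambda>t. F t (y t)))) \<le> B * LN (u n - y)"
    using bounded_family_LS_lipschitz[OF F u(1,2)] by (intro always_eventually) (simp add: L2_nonneg)
  have "(\<lambda>n. B * LN (u n - y)) \<longlonglongrightarrow> B * 0" by (intro tendsto_intros u)
  then show "(\<lambda>n. B * LN (u n - y)) \<longlonglongrightarrow> 0" by simp
qed

lemma bounded_family_LS_lin:
  assumes F: "bounded_family F B" and u: "u \<in> LS" and y: "y \<in> LS"
  shows "LN ((a *\<^sub>R (\<lambda>t. F t (u t)) + b *\<^sub>R (\<lambda>t. F t (y t))) - (\<lambda>t. F t ((a *\<^sub>R u + b *\<^sub>R y) t))) = 0"
proof -
  note m = bounded_family_LS(1)[OF F]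
  have mm: "a *\<^sub>R (\<lambda>t. F t (u t)) + b *\<^sub>R (\<lambda>t. F t (y t)) \<in> LS" "(\<lambda>t. F t ((a *\<^sub>R u + b *\<^sub>R y) t)) \<in> LS"
    using m[OF u] m[OF y] by (blast intro: L.add_mem L.scale_mem, intro m L.add_mem L.scale_mem u y)
  show ?thesis
    unfolding V.L2_norm_eq_0_iff[OF TI(1) L.diff_mem[OF mm]]
    using L2_D(3)[OF u] L2_D(3)[OF y] AE_space
  proof eventually_elim
    case (elim t)
    then have t: "t \<in> {0..\<tau>}" by simp
    have mt: "F t (u t) \<in> VS" "F t (y t) \<in> VS" "F t (a *\<^sub>R u t + b *\<^sub>R y t) \<in> VS"
      using elim by (auto intro!: bounded_family_mem[OF F t])
    have "nV (F t (a *\<^sub>R u t + b *\<^sub>R y t) - (a *\<^sub>R F t (u t) + b *\<^sub>R F t (y t))) = 0"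
      using F t elim unfolding bounded_family_def by blast
    moreover have "a *\<^sub>R F t (u t) + b *\<^sub>R F t (y t) \<in> VS" using mt by auto
    ultimately show ?case using V.N_diff_commute[OF mt(3)] by simp
  qed
qed

lemma bounded_family_A: "bounded_family A C"
  unfolding bounded_family_def using C A_mem A_bdd A_lin A_meas by auto

text \<open>The embedding of \<open>V\<close> into its dual through \<open>H\<close>, followed by
  Riesz representation. With it the problem \<open>u' + A u = g\<close> reads
  \<open>K u' + A u = g\<close> in \<open>V\<close>.\<close>

definition K :: "'v \<Rightarrow> 'v" where
  "K u = (SOME k. k \<in> VS \<and> (\<forall>v\<in>VS. ipV k v = ipH u v))"

lemma K:
  assumes "u \<in> VS" shows "K u \<in> VS" "v \<in> VS \<Longrightarrow> ipV (K u) v = ipH u v"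
proof -
  have "\<exists>k. k \<in> VS \<and> (\<forall>v\<in>VS. ipV k v = ipH u v)"
  proof (rule V.Riesz[where F = "ipH u" and K = "nH u"])
    show "ipH u (a *\<^sub>R x + b *\<^sub>R y) = a * ipH u x + b * ipH u y" if "x \<in> VS" "y \<in> VS" for x y a b
      using that assms by (simp add: VH.ip_add_right VH.ip_scale_right V.scale_mem)
    show "\<bar>ipH u x\<bar> \<le> nH u * nV x" if "x \<in> VS" for x
      using VH.Cauchy_Schwarz[OF assms that] mult_left_mono[OF nH_le[OF that] VH.N_nonneg[OF assms]] by linarith
  qed blast
  then have "K u \<in> VS \<and> (\<forall>v\<in>VS. ipV (K u) v = ipH u v)" unfolding K_def by (rule someI_ex)
  then show "K u \<in> VS" "v \<in> VS \<Longrightarrow> ipV (K u) v = ipH u v" by auto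
qed

lemma bounded_family_K: "bounded_family (\<lambda>t. K) 1"
  unfolding bounded_family_def
proof (intro conjI ballI allI)
  fix v assume v: "v \<in> VS"
  show "K v \<in> VS" by (rule K(1)[OF v])
  show "smeas TI VS nV (\<lambda>t. K v)" by (rule V.sm_const[OF K(1)[OF v]])
  show "nV (K v) \<le> 1 * nV v"
  proof (rule V.N_le_if_ip[OF K(1)[OF v]])
    fix y assume y: "y \<in> VS"
    have "\<bar>ipV (K v) y\<bar> \<le> nH v * nH y" using VH.Cauchy_Schwarz[OF v y] by (simp add: K(2)[OF v y])
    also have "\<dots> \<le> nV v * nV y" by (intro mult_mono nH_le v y VH.N_nonneg V.N_nonneg)
    finally show "\<bar>ipV (K v) y\<bar> \<le> 1 * nV v * nV y" by simp
  qed (simp add: V.N_nonneg v)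
  fix u a b assume u: "u \<in> VS"
  have uv: "a *\<^sub>R u + b *\<^sub>R v \<in> VS" using u v by auto
  have lin: "a *\<^sub>R K u + b *\<^sub>R K v \<in> VS" using K(1)[OF u] K(1)[OF v] by auto
  have d: "K (a *\<^sub>R u + b *\<^sub>R v) - (a *\<^sub>R K u + b *\<^sub>R K v) \<in> VS" using K(1)[OF uv] lin by auto
  have "nV (K (a *\<^sub>R u + b *\<^sub>R v) - (a *\<^sub>R K u + b *\<^sub>R K v)) \<le> 0"
  proof (rule V.N_le_if_ip[OF d])
    fix y assume y: "y \<in> VS"
    have "ipV (K (a *\<^sub>R u + b *\<^sub>R v) - (a *\<^sub>R K u + b *\<^sub>R K v)) y = ipH (a *\<^sub>R u + b *\<^sub>R v) y - (a * ipH u y + b * ipH v y)"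
      using V.ip_diff_left[OF K(1)[OF uv] lin y] K(1)[OF u] K(1)[OF v] y K(2)[OF uv y] K(2)[OF u y] K(2)[OF v y]
      by (simp add: V.ip_add_left V.ip_scale_left V.scale_mem)
    also have "\<dots> = 0" using u v y by (simp add: VH.ip_add_left VH.ip_scale_left V.scale_mem)
    finally show "\<bar>ipV (K (a *\<^sub>R u + b *\<^sub>R v) - (a *\<^sub>R K u + b *\<^sub>R K v)) y\<bar> \<le> 0 * nV y" by simp
  qed simp
  then show "nV (K (a *\<^sub>R u + b *\<^sub>R v) - (a *\<^sub>R K u + b *\<^sub>R K v)) = 0" using V.N_nonneg[OF d] by simp
qed simp

abbreviation "Kc u \<equiv> (\<lambda>t. K (u t))"
abbreviation "Ac u \<equiv> (\<lambda>t. A t (u t))"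

lemmas K_LS = bounded_family_LS[OF bounded_family_K]
lemmas A_LS = bounded_family_LS[OF bounded_family_A]

lemma Kc_inner:
  assumes u: "u \<in> LS" and y: "y \<in> LS"
  shows "LI (Kc u) y = (\<integral>t. ipH (u t) (y t) \<partial>TI)"
  unfolding bochner_inner_def
proof (rule integral_cong_AE_complete[OF TI(1)])
  show "AE t in TI. ipV (K (u t)) (y t) = ipH (u t) (y t)"
    using L2_D(3)[OF u] L2_D(3)[OF y] by eventually_elim (rule K(2))
qed

text \<open>Since \<open>wt' t = - 2 * \<kappa> * wt t\<close>, the contribution of the weight to
  the energy identity is exactly the term \<open>\<kappa> * (nH v)\<^sup>2\<close> of Garding's
  inequality.\<close>

definition "wt t = exp (- 2 * \<kappa> * t)" for t :: real
definition "wt' t = - 2 * \<kappa> * exp (- 2 * \<kappa> * t)" for t :: real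

lemma wt: "(wt has_real_derivative wt' t) (at t within S)" "continuous_on S wt'" "continuous_on S wt" "wt t > 0"
    "wt' t = - 2 * \<kappa> * wt t" "t \<ge> 0 \<Longrightarrow> wt t \<le> 1" "t \<le> \<tau> \<Longrightarrow> 1 \<le> exp (2 * \<kappa> * \<tau>) * wt t"
proof -
  show "(wt has_real_derivative wt' t) (at t within S)"
    unfolding wt_def[abs_def] wt'_def by (auto intro!: derivative_eq_intros)
  show "continuous_on S wt'" "continuous_on S wt"
    unfolding wt'_def[abs_def] wt_def[abs_def] by (intro continuous_intros)+
  show "t \<ge> 0 \<Longrightarrow> wt t \<le> 1" using \<kappa> by (simp add: wt_def)
  assume "t \<le> \<tau>"
  then have "\<kappa> * t \<le> \<kappa> * \<tau>" using \<kappa> by (intro mult_left_mono)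
  then show "1 \<le> exp (2 * \<kappa> * \<tau>) * wt t" by (simp add: wt_def flip: exp_add)
qed (simp_all add: wt_def wt'_def)

lemma one_sided_energy_seq:
  assumes g: "g \<in> LS" and z: "z = 0 \<and> \<sigma> = 1 \<or> z = \<tau> \<and> \<sigma> = -1"
  obtains u u' where "\<And>n. nice VS \<tau> z (u n) (u' n)" "(\<lambda>n. LN (u n - g)) \<longlonglongrightarrow> 0"
    "\<And>n. \<sigma> * (\<integral>t. wt t * ipH (u' n t) (g t) \<partial>TI) + \<sigma> / 2 * (\<integral>t. wt' t * ipH (u n t) (u n t) \<partial>TI) \<ge> - inverse (real (Suc n))"
proof -
  define Q where "Q n u u' \<longleftrightarrow> nice VS \<tau> z u u' \<and> LN (u - g) \<le> inverse (real (Suc n)) \<and>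
      \<sigma> * (\<integral>t. wt t * ipH (u' t) (g t) \<partial>TI) + \<sigma> / 2 * (\<integral>t. wt' t * ipH (u t) (u t) \<partial>TI) \<ge> - inverse (real (Suc n))"
    for n u u'
  have "\<exists>u u'. Q n u u'" for n
    unfolding Q_def using wt(4) by (intro one_sided_energy_approx g z wt less_imp_le) auto
  then obtain u u' where Q: "\<And>n. Q n (u n) (u' n)" by metis
  show thesis
  proof (rule that)
    show "nice VS \<tau> z (u n) (u' n)" for n using Q[of n] by (simp add: Q_def)
    show "\<sigma> * (\<integral>t. wt t * ipH (u' n t) (g t) \<partial>TI) + \<sigma> / 2 * (\<integral>t. wt' t * ipH (u n t) (u n t) \<partial>TI) \<ge> - inverse (real (Suc n))" for n
      using Q[of n] by (simp add: Q_def)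
    show "(\<lambda>n. LN (u n - g)) \<longlonglongrightarrow> 0"
      by (rule Lim_null_comparison[OF _ LIMSEQ_inverse_real_of_nat])
        (use Q in \<open>auto simp: Q_def L2_nonneg\<close>)
  qed
qed

text \<open>Forward smoothings \<open>u n\<close> of a multiple of \<open>g\<close> vanish at 0, so
  orthogonality applies and trades the term with \<open>u' n\<close> for
  \<open>- LI (Ac (u n)) g\<close>, which converges without control of derivatives. The one-sided
  energy inequality then bounds the form from above by 0, Garding's inequality bounds it from below
  by \<open>c * (LN g)\<^sup>2\<close>.\<close>

lemma range_orthogonal_trivial:
  assumes g: "g \<in> LS" and orth: "\<And>u u'. nice VS \<tau> 0 u u' \<Longrightarrow> LI (Kc u' + Ac u) g = 0"
  shows "LN g = 0"
proof -
  define E where "E t = exp (2 * \<kappa> * t)" for t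
  have cE: "continuous_on {0..\<tau>} E" unfolding E_def[abs_def] by (intro continuous_intros)
  have wE: "wt t * E t = 1" for t by (simp add: wt_def E_def flip: exp_add)
  \<comment> \<open>\<open>p\<close> is smoothed rather than \<open>g\<close>, because
    \<open>wt t *\<^sub>R p t = g t\<close>: the weighted pairing of \<open>u'\<close> with
    \<open>p\<close> is then the unweighted pairing with \<open>g\<close>.\<close>
  define p where "p = (\<lambda>t. E t *\<^sub>R g t)"
  obtain B where B: "\<And>t. t \<in> {0..\<tau>} \<Longrightarrow> \<bar>E t\<bar> \<le> B" using continuous_bound[OF cE] by blast
  have p: "p \<in> LS" unfolding p_def by (rule mult_LS(1)[OF V.semi_inner_axioms cE B g])
  obtain u u' where u: "\<And>n. nice VS \<tau> 0 (u n) (u' n)" "(\<lambda>n. LN (u n - p)) \<longlonglongrightarrow> 0"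
    "\<And>n. 1 * (\<integral>t. wt t * ipH (u' n t) (p t) \<partial>TI) + 1 / 2 * (\<integral>t. wt' t * ipH (u n t) (u n t) \<partial>TI) \<ge> - inverse (real (Suc n))"
    by (rule one_sided_energy_seq[OF p, of 0 1]) auto
  have uL: "u n \<in> LS" "u' n \<in> LS" for n using nice_LS u(1) by blast+
  have eq: "(\<integral>t. wt t * ipH (u' n t) (p t) \<partial>TI) = - LI (Ac (u n)) g" for n
  proof -
    have "(\<integral>t. wt t * ipH (u' n t) (p t) \<partial>TI) = (\<integral>t. ipH (u' n t) (g t) \<partial>TI)"
    proof (rule integral_cong_AE_complete[OF TI(1)])
      show "AE t in TI. wt t * ipH (u' n t) (p t) = ipH (u' n t) (g t)"
        using L2_D(3)[OF g]
        by eventually_elim (use V.nice_mem[OF u(1)] wE in \<open>simp add: p_def VH.ip_scale_right flip: mult.assoc\<close>)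
    qed
    also have "\<dots> = LI (Kc (u' n)) g" by (rule Kc_inner[OF uL(2) g, symmetric])
    also have "\<dots> = - LI (Ac (u n)) g"
      using orth[OF u(1)[of n]] L.ip_add_left[OF K_LS(1)[OF uL(2)] A_LS(1)[OF uL(1)] g, of n n] by simp
    finally show ?thesis .
  qed
  have lim1: "(\<lambda>n. LI (Ac (u n)) g) \<longlonglongrightarrow> LI (Ac p) g"
    by (rule L.ip_tendsto[OF A_LS(1)[OF uL(1)] A_LS(1)[OF p] bounded_family_LS_tendsto[OF bounded_family_A uL(1) p u(2)] g g])
      (simp add: L.N_zero)
  have lim2: "(\<lambda>n. \<integral>t. wt' t * ipH (u n t) (u n t) \<partial>TI) \<longlonglongrightarrow> (\<integral>t. wt' t * ipH (p t) (p t) \<partial>TI)"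
    using LS_LSH(1)[OF uL(1)] LS_LSH(1)[OF p] L_tendsto_LH[OF uL(1) p u(2)]
    by (intro weighted_form_tendsto[OF VH.semi_inner_axioms wt(2)])
  have "(\<lambda>n. - inverse (real (Suc n))) \<longlonglongrightarrow> - 0" by (intro tendsto_intros LIMSEQ_inverse_real_of_nat)
  moreover have "(\<lambda>n. - LI (Ac (u n)) g + 1 / 2 * (\<integral>t. wt' t * ipH (u n t) (u n t) \<partial>TI)) \<longlonglongrightarrow>
      - LI (Ac p) g + 1 / 2 * (\<integral>t. wt' t * ipH (p t) (p t) \<partial>TI)"
    by (intro tendsto_intros lim1 lim2)
  ultimately have "- 0 \<le> - LI (Ac p) g + 1 / 2 * (\<integral>t. wt' t * ipH (p t) (p t) \<partial>TI)"
    by (rule LIMSEQ_le) (use u(3) in \<open>simp add: eq\<close>)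
  moreover have "c * (LN g)\<^sup>2 \<le> LI (Ac p) g - 1 / 2 * (\<integral>t. wt' t * ipH (p t) (p t) \<partial>TI)"
  proof -
    have i1: "integrable TI (\<lambda>t. ipV (A t (p t)) (g t))" by (rule V.L2_ip_integrable[OF TI(1) A_LS(1)[OF p] g])
    have i2: "integrable TI (\<lambda>t. wt' t * ipH (p t) (p t))"
      by (rule weighted_form_integrable(1)[OF VH.semi_inner_axioms wt(2) LS_LSH(1)[OF p] LS_LSH(1)[OF p]])
    have "(\<integral>t. c * (nV (g t))\<^sup>2 \<partial>TI) \<le> (\<integral>t. ipV (A t (p t)) (g t) - 1 / 2 * (wt' t * ipH (p t) (p t)) \<partial>TI)"
    proof (rule integral_mono_AE)
      show "integrable TI (\<lambda>t. c * (nV (g t))\<^sup>2)" using L2_D(2)[OF g] by simp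
      show "integrable TI (\<lambda>t. ipV (A t (p t)) (g t) - 1 / 2 * (wt' t * ipH (p t) (p t)))"
        by (intro Bochner_Integration.integrable_diff integrable_mult_right i1 i2)
      show "AE t in TI. c * (nV (g t))\<^sup>2 \<le> ipV (A t (p t)) (g t) - 1 / 2 * (wt' t * ipH (p t) (p t))"
        using L2_D(3)[OF g] AE_space
      proof eventually_elim
        case (elim t)
        then have t: "t \<in> {0..\<tau>}" and gt: "g t \<in> VS" by auto
        have pt: "p t \<in> VS" using gt by (auto simp: p_def)
        have gp: "g t = wt t *\<^sub>R p t" using wE by (simp add: p_def)
        have E1: "1 \<le> E t" using t \<kappa> by (simp add: E_def)
        have "(nV (g t))\<^sup>2 \<le> E t * (nV (g t))\<^sup>2" using E1 by (simp add: mult_le_cancel_right1)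
        also have "\<dots> = wt t * (nV (p t))\<^sup>2"
          using wE[of t] E1 gt by (simp add: p_def V.N_scale power_mult_distrib power2_eq_square flip: mult.assoc)
        finally have "c * (nV (g t))\<^sup>2 \<le> wt t * (c * (nV (p t))\<^sup>2)" using c by (simp add: mult.left_commute)
        also have "\<dots> \<le> wt t * (ipV (A t (p t)) (p t) + \<kappa> * (nH (p t))\<^sup>2)"
          using A_Garding[OF t pt] wt(4)[of t] by (intro mult_left_mono) auto
        also have "\<dots> = ipV (A t (p t)) (g t) - 1 / 2 * (wt' t * ipH (p t) (p t))"
          unfolding gp using pt A_mem[OF t pt] by (simp add: V.ip_scale_right VH.N_power2 wt(5) algebra_simps)
        finally show ?case .
      qed
    qed
    then show ?thesis
      unfolding L2_power2 using i1 i2 L2_D(2)[OF g] by (simp add: bochner_inner_def)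
  qed
  ultimately have "c * (LN g)\<^sup>2 \<le> 0" by linarith
  then show ?thesis using c by (simp add: mult_le_0_iff)
qed

lemma range_dense:
  assumes g: "g \<in> LS"
  obtains u u' where "\<And>n. nice VS \<tau> 0 (u n) (u' n)" "(\<lambda>n. LN ((Kc (u' n) + Ac (u n)) - g)) \<longlonglongrightarrow> 0"
proof -
  define Y where "Y = {Kc u' + Ac u | u u'. nice VS \<tau> 0 u u'}"
  show thesis
  proof (rule L.dense_if_orthogonal_trivial[where Y = Y])
    show "Y \<subseteq> LS" using nice_LS K_LS(1) A_LS(1) L.add_mem by (auto simp: Y_def)
    show "Y \<noteq> {}" using V.nice_zero by (auto simp: Y_def)
    show "g \<in> LS" by fact
    fix x y a b assume "x \<in> Y" "y \<in> Y"
    then obtain u u' y1 y1' where x: "x = Kc u' + Ac u" "nice VS \<tau> 0 u u'" and y: "y = Kc y1' + Ac y1" "nice VS \<tau> 0 y1 y1'"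
      by (auto simp: Y_def)
    have m: "u \<in> LS" "u' \<in> LS" "y1 \<in> LS" "y1' \<in> LS" using nice_LS x y by blast+
    have n: "nice VS \<tau> 0 (a *\<^sub>R u + b *\<^sub>R y1) (a *\<^sub>R u' + b *\<^sub>R y1')"
      using nice.add[OF nice_scaleR[OF x(2), of a] nice_scaleR[OF y(2), of b]] by (simp add: plus_fun_def scaleR_fun_def)
    have mm: "a *\<^sub>R u + b *\<^sub>R y1 \<in> LS" "a *\<^sub>R u' + b *\<^sub>R y1' \<in> LS" using nice_LS n by blast+
    \<comment> \<open>Not the combination of \<open>x\<close> and \<open>y\<close> itself, since
      \<open>K\<close> and \<open>A\<close> are linear only up to null elements; hence the closure
      condition on \<open>Y\<close> in this form.\<close>
    define z where "z = Kc (a *\<^sub>R u' + b *\<^sub>R y1') + Ac (a *\<^sub>R u + b *\<^sub>R y1)"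
    have zY: "z \<in> Y" using n unfolding Y_def z_def by blast
    let ?k = "(a *\<^sub>R Kc u' + b *\<^sub>R Kc y1') - Kc (a *\<^sub>R u' + b *\<^sub>R y1')"
    let ?a = "(a *\<^sub>R Ac u + b *\<^sub>R Ac y1) - Ac (a *\<^sub>R u + b *\<^sub>R y1)"
    have kL: "?k \<in> LS" "?a \<in> LS"
      using K_LS(1)[OF m(2)] K_LS(1)[OF m(4)] K_LS(1)[OF mm(2)] A_LS(1)[OF m(1)] A_LS(1)[OF m(3)] A_LS(1)[OF mm(1)]
      by (auto intro!: L.diff_mem L.add_mem L.scale_mem)
    have "a *\<^sub>R x + b *\<^sub>R y - z = ?k + ?a" unfolding x(1) y(1) z_def by (simp add: algebra_simps)
    then have le: "LN (a *\<^sub>R x + b *\<^sub>R y - z) \<le> LN ?k + LN ?a" by (simp only: L.N_triangle[OF kL])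
    have k0: "LN ?k = 0" by (rule bounded_family_LS_lin[OF bounded_family_K m(2,4)])
    have a0: "LN ?a = 0" by (rule bounded_family_LS_lin[OF bounded_family_A m(1,3)])
    have "LN (a *\<^sub>R x + b *\<^sub>R y - z) = 0"
      using le L2_nonneg[of TI nV "a *\<^sub>R x + b *\<^sub>R y - z"] unfolding k0 a0 by linarith
    with zY show "\<exists>z\<in>Y. LN (a *\<^sub>R x + b *\<^sub>R y - z) = 0" by blast
  next
    fix p assume p: "p \<in> LS" and orth: "\<And>y. y \<in> Y \<Longrightarrow> LI y p = 0"
    show "LN p = 0"
    proof (rule range_orthogonal_trivial[OF p])
      show "LI (Kc u' + Ac u) p = 0" if "nice VS \<tau> 0 u u'" for u u'
        using that by (intro orth) (auto simp: Y_def)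
    qed
  next
    fix q assume q: "\<And>n. q n \<in> Y" "(\<lambda>n. LN (q n - g)) \<longlonglongrightarrow> 0"
    then have "\<forall>n. \<exists>r. q n = Kc (snd r) + Ac (fst r) \<and> nice VS \<tau> 0 (fst r) (snd r)" by (auto simp: Y_def)
    then obtain r where r: "\<And>n. q n = Kc (snd (r n)) + Ac (fst (r n))" "\<And>n. nice VS \<tau> 0 (fst (r n)) (snd (r n))" by metis
    show thesis
      by (rule that[of "\<lambda>n. fst (r n)" "\<lambda>n. snd (r n)"]) (use r q in auto)
  qed
qed

text \<open>The equation is known only against smooth functions vanishing at the final time.
  Smoothings of \<open>u\<close> backwards in time vanish there and are admissible; the one-sided
  inequality passes to the limit, and Garding's inequality forces \<open>u\<close> to be
  null.\<close>

lemma backward_unique: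
  assumes u: "u \<in> LS" and eq: "\<And>\<phi> \<phi>'. nice VS \<tau> \<tau> \<phi> \<phi>' \<Longrightarrow> (\<integral>t. ipH (u t) (\<phi>' t) \<partial>TI) = LI (Ac u) \<phi>"
  shows "LN u = 0"
proof -
  obtain y y' where y: "\<And>n. nice VS \<tau> \<tau> (y n) (y' n)" "(\<lambda>n. LN (y n - u)) \<longlonglongrightarrow> 0"
    "\<And>n. (-1) * (\<integral>t. wt t * ipH (y' n t) (u t) \<partial>TI) + (-1) / 2 * (\<integral>t. wt' t * ipH (y n t) (y n t) \<partial>TI) \<ge> - inverse (real (Suc n))"
    by (rule one_sided_energy_seq[OF u, of \<tau> "-1"]) auto
  have yL: "y n \<in> LS" "y' n \<in> LS" for n using nice_LS y(1) by blast+
  note LH = LS_LSH(1)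
  note intH = weighted_form_integrable(1)[OF VH.semi_inner_axioms]
  note intV = weighted_form_integrable(1)[OF V.semi_inner_axioms]
  have AuL: "Ac u \<in> LS" by (rule A_LS(1)[OF u])
  have step: "(\<integral>t. wt t * ipH (y' n t) (u t) \<partial>TI) = (\<integral>t. wt t * ipV (A t (u t)) (y n t) \<partial>TI) - (\<integral>t. wt' t * ipH (y n t) (u t) \<partial>TI)" for n
  proof -
    \<comment> \<open>The weighted smoothing is the test function. Its derivative produces a full
      term with \<open>wt'\<close>, of which the energy inequality takes back one half.\<close>
    have n: "nice VS \<tau> \<tau> (\<lambda>t. wt t *\<^sub>R y n t) (\<lambda>t. wt t *\<^sub>R y' n t + wt' t *\<^sub>R y n t)"
      by (rule nice_mult[OF y(1) wt(1,2)])
    have "(\<integral>t. ipH (u t) (wt t *\<^sub>R y' n t + wt' t *\<^sub>R y n t) \<partial>TI) = (\<integral>t. wt t * ipH (y' n t) (u t) + wt' t * ipH (y n t) (u t) \<partial>TI)"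
    proof (rule integral_cong_AE_complete[OF TI(1)])
      show "AE t in TI. ipH (u t) (wt t *\<^sub>R y' n t + wt' t *\<^sub>R y n t) = wt t * ipH (y' n t) (u t) + wt' t * ipH (y n t) (u t)"
        using L2_D(3)[OF u]
      proof eventually_elim
        case (elim t)
        have m: "y n t \<in> VS" "y' n t \<in> VS" using V.nice_mem[OF y(1)] by auto
        then have "ipH (u t) (wt t *\<^sub>R y' n t + wt' t *\<^sub>R y n t) = wt t * ipH (u t) (y' n t) + wt' t * ipH (u t) (y n t)"
          using elim by (simp add: VH.ip_add_right VH.ip_scale_right V.scale_mem)
        then show ?case using VH.ip_commute[OF elim m(1)] VH.ip_commute[OF elim m(2)] by simp
      qed
    qed
    also have "\<dots> = (\<integral>t. wt t * ipH (y' n t) (u t) \<partial>TI) + (\<integral>t. wt' t * ipH (y n t) (u t) \<partial>TI)"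
      by (rule Bochner_Integration.integral_add[OF intH[OF wt(3) LH[OF yL(2)] LH[OF u]] intH[OF wt(2) LH[OF yL(1)] LH[OF u]]])
    finally have 1: "LI (Ac u) (\<lambda>t. wt t *\<^sub>R y n t) = (\<integral>t. wt t * ipH (y' n t) (u t) \<partial>TI) + (\<integral>t. wt' t * ipH (y n t) (u t) \<partial>TI)"
      using eq[OF n] by simp
    have "LI (Ac u) (\<lambda>t. wt t *\<^sub>R y n t) = (\<integral>t. wt t * ipV (A t (u t)) (y n t) \<partial>TI)"
      unfolding bochner_inner_def
    proof (rule integral_cong_AE_complete[OF TI(1)])
      show "AE t in TI. ipV (A t (u t)) (wt t *\<^sub>R y n t) = wt t * ipV (A t (u t)) (y n t)"
        using L2_D(3)[OF AuL] by eventually_elim (use V.nice_mem[OF y(1)] in \<open>simp add: V.ip_scale_right\<close>)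
    qed
    with 1 show ?thesis by simp
  qed
  have z: "(\<lambda>n. LN (x - x)) \<longlonglongrightarrow> 0" "(\<lambda>n. LNH (x - x)) \<longlonglongrightarrow> 0" for x by (simp_all add: L.N_zero LH.N_zero)
  have lim1: "(\<lambda>n. \<integral>t. wt t * ipV (A t (u t)) (y n t) \<partial>TI) \<longlonglongrightarrow> (\<integral>t. wt t * ipV (A t (u t)) (u t) \<partial>TI)"
    by (rule weighted_form_tendsto[OF V.semi_inner_axioms wt(3) AuL AuL z(1) yL(1) u y(2)])
  have lim2: "(\<lambda>n. \<integral>t. wt' t * ipH (y n t) (u t) \<partial>TI) \<longlonglongrightarrow> (\<integral>t. wt' t * ipH (u t) (u t) \<partial>TI)"
    by (rule weighted_form_tendsto[OF VH.semi_inner_axioms wt(2) LH[OF yL(1)] LH[OF u] L_tendsto_LH[OF yL(1) u y(2)] LH[OF u] LH[OF u] z(2)])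
  have lim3: "(\<lambda>n. \<integral>t. wt' t * ipH (y n t) (y n t) \<partial>TI) \<longlonglongrightarrow> (\<integral>t. wt' t * ipH (u t) (u t) \<partial>TI)"
    by (rule weighted_form_tendsto[OF VH.semi_inner_axioms wt(2) LH[OF yL(1)] LH[OF u] L_tendsto_LH[OF yL(1) u y(2)]
        LH[OF yL(1)] LH[OF u] L_tendsto_LH[OF yL(1) u y(2)]])
  have "(\<lambda>n. - inverse (real (Suc n))) \<longlonglongrightarrow> - 0" by (intro tendsto_intros LIMSEQ_inverse_real_of_nat)
  moreover have "(\<lambda>n. (-1) * ((\<integral>t. wt t * ipV (A t (u t)) (y n t) \<partial>TI) - (\<integral>t. wt' t * ipH (y n t) (u t) \<partial>TI)) + (-1) / 2 * (\<integral>t. wt' t * ipH (y n t) (y n t) \<partial>TI)) \<longlonglongrightarrow>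
      (-1) * ((\<integral>t. wt t * ipV (A t (u t)) (u t) \<partial>TI) - (\<integral>t. wt' t * ipH (u t) (u t) \<partial>TI)) + (-1) / 2 * (\<integral>t. wt' t * ipH (u t) (u t) \<partial>TI)"
    by (intro tendsto_intros lim1 lim2 lim3)
  ultimately have "- 0 \<le> (-1) * ((\<integral>t. wt t * ipV (A t (u t)) (u t) \<partial>TI) - (\<integral>t. wt' t * ipH (u t) (u t) \<partial>TI)) + (-1) / 2 * (\<integral>t. wt' t * ipH (u t) (u t) \<partial>TI)"
    by (rule LIMSEQ_le) (use y(3) in \<open>simp only: step, blast\<close>)
  then have le: "(\<integral>t. wt t * ipV (A t (u t)) (u t) \<partial>TI) - 1 / 2 * (\<integral>t. wt' t * ipH (u t) (u t) \<partial>TI) \<le> 0" by simp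
  have iu: "integrable TI (\<lambda>t. wt t * ipV (u t) (u t))" by (rule intV[OF wt(3) u u])
  have nn: "AE t in TI. 0 \<le> wt t * ipV (u t) (u t)"
    using L2_D(3)[OF u] by eventually_elim (simp add: V.ip_nonneg wt(4) less_imp_le)
  have "c * (\<integral>t. wt t * ipV (u t) (u t) \<partial>TI) \<le> (\<integral>t. wt t * ipV (A t (u t)) (u t) \<partial>TI) - 1 / 2 * (\<integral>t. wt' t * ipH (u t) (u t) \<partial>TI)"
  proof -
    have "(\<integral>t. c * (wt t * ipV (u t) (u t)) \<partial>TI) \<le> (\<integral>t. wt t * ipV (A t (u t)) (u t) - 1 / 2 * (wt' t * ipH (u t) (u t)) \<partial>TI)"
    proof (rule integral_mono_AE)
      show "integrable TI (\<lambda>t. wt t * ipV (A t (u t)) (u t) - 1 / 2 * (wt' t * ipH (u t) (u t)))"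
        by (rule Bochner_Integration.integrable_diff[OF intV[OF wt(3) AuL u] integrable_mult_right[OF intH[OF wt(2) LH[OF u] LH[OF u]]]])
      show "AE t in TI. c * (wt t * ipV (u t) (u t)) \<le> wt t * ipV (A t (u t)) (u t) - 1 / 2 * (wt' t * ipH (u t) (u t))"
        using L2_D(3)[OF u] AE_space
      proof eventually_elim
        case (elim t)
        then have t: "t \<in> {0..\<tau>}" and ut: "u t \<in> VS" by auto
        have "wt t * (c * (nV (u t))\<^sup>2) \<le> wt t * (ipV (A t (u t)) (u t) + \<kappa> * (nH (u t))\<^sup>2)"
          using A_Garding[OF t ut] wt(4)[of t] by (intro mult_left_mono) auto
        then show ?case using ut by (simp add: V.N_power2 VH.N_power2 wt(5) algebra_simps)
      qed
    qed (use iu in simp)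
    then show ?thesis
      using Bochner_Integration.integral_diff[OF intV[OF wt(3) AuL u] integrable_mult_right[OF intH[OF wt(2) LH[OF u] LH[OF u]]], of "1/2"]
      by simp
  qed
  then have "c * (\<integral>t. wt t * ipV (u t) (u t) \<partial>TI) \<le> 0" using le by linarith
  then have "(\<integral>t. wt t * ipV (u t) (u t) \<partial>TI) = 0"
    using c integral_nonneg_AE[OF nn] by (simp add: mult_le_0_iff)
  then have "AE t in TI. wt t * ipV (u t) (u t) = 0" using integral_nonneg_eq_0_iff_AE[OF iu nn] by simp
  then have "AE t in TI. nV (u t) = 0"
    using L2_D(3)[OF u] by eventually_elim (use wt(4) in \<open>auto simp: V.N_eq less_imp_neq[OF wt(4), symmetric]\<close>)
  then show ?thesis by (simp add: V.L2_norm_eq_0_iff[OF TI(1) u])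
qed

section \<open>The energy estimate, existence and uniqueness\<close>

lemma indicator_integrable:
  fixes f :: "real \<Rightarrow> real"
  assumes s: "s \<in> {0..\<tau>}" and f: "integrable TI f"
  shows "integrable TI (\<lambda>t. indicator {..s} t * f t)"
proof -
  have "integrable TI (\<lambda>t. indicator {0..s} t *\<^sub>R f t)"
    by (rule integrable_mult_indicator[OF _ f]) (use s in \<open>auto simp: sets_restrict_space_iff\<close>)
  moreover have "integrable TI (\<lambda>t. indicator {0..s} t *\<^sub>R f t) = integrable TI (\<lambda>t. indicator {..s} t * f t)"
    by (rule Bochner_Integration.integrable_cong) (auto simp: indicator_def)
  ultimately show ?thesis by simp
qed

text \<open>The energy identity on \<open>{0..s}\<close>: Garding's inequality provides
  \<open>2 * c\<close> times the squared norm of \<open>V\<close>, Young's inequality for the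
  pairing with the right-hand side consumes half of it. Evaluation at \<open>s\<close> gives the
  bound in \<open>H\<close>, and the half that is left, at \<open>s = \<tau>\<close>, the bound in
  \<open>V\<close>. The factor \<open>exp (2 * \<kappa> * \<tau>)\<close> removes the
  weight.\<close>

lemma nice_a_priori:
  assumes u: "nice VS \<tau> 0 u u'" and s: "s \<in> {0..\<tau>}"
  shows "(nH (u s))\<^sup>2 \<le> exp (2 * \<kappa> * \<tau>) / c * (LN (Kc u' + Ac u))\<^sup>2"
    and "(LN u)\<^sup>2 \<le> exp (2 * \<kappa> * \<tau>) / c\<^sup>2 * (LN (Kc u' + Ac u))\<^sup>2"
proof -
  let ?E = "exp (2 * \<kappa> * \<tau>)"
  have arith: "2 * x \<le> g + v \<Longrightarrow> v \<le> y \<Longrightarrow> 2 * x - 2 * y \<le> g - v" for x y g v :: real by linarith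
  define g where "g = Kc u' + Ac u"
  have uL: "u \<in> LS" "u' \<in> LS" using nice_LS u by blast+
  have g: "g \<in> LS" unfolding g_def using K_LS(1)[OF uL(2)] A_LS(1)[OF uL(1)] by (rule L.add_mem)
  have main: "wt s * (nH (u s))\<^sup>2 \<le> (LN g)\<^sup>2 / c - c * (\<integral>t. indicator {..s} t * (wt t * ipV (u t) (u t)) \<partial>TI)" if s: "s \<in> {0..\<tau>}" for s
  proof -
    have ig: "integrable TI (\<lambda>t. (nV (g t))\<^sup>2)" by (rule L2_D(2)[OF g])
    have iu: "integrable TI (\<lambda>t. wt t * ipV (u t) (u t))" by (rule weighted_form_integrable(1)[OF V.semi_inner_axioms wt(3) uL(1,1)])
    have ic: "integrable TI (\<lambda>t. indicator {..s} t * (2 * (wt t * ipH (u' t) (u t)) + wt' t * ipH (u t) (u t)))"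
      by (rule indicator_integrable[OF s Bochner_Integration.integrable_add[OF integrable_mult_right
              [OF weighted_form_integrable(1)[OF VH.semi_inner_axioms wt(3) LS_LSH(1)[OF uL(2)] LS_LSH(1)[OF uL(1)]]]
              weighted_form_integrable(1)[OF VH.semi_inner_axioms wt(2) LS_LSH(1)[OF uL(1)] LS_LSH(1)[OF uL(1)]]]])
    have "wt s * (nH (u s))\<^sup>2 = (\<integral>t. indicator {..s} t * (2 * (wt t * ipH (u' t) (u t)) + wt' t * ipH (u t) (u t)) \<partial>TI)"
      using VH.nice_weighted_energy[OF u s wt(1,2)] nice_end[OF u] VH.N_zero by simp
    also have "\<dots> \<le> (\<integral>t. (nV (g t))\<^sup>2 / c - c * (indicator {..s} t * (wt t * ipV (u t) (u t))) \<partial>TI)"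
    proof (rule integral_mono[OF ic])
      show "integrable TI (\<lambda>t. (nV (g t))\<^sup>2 / c - c * (indicator {..s} t * (wt t * ipV (u t) (u t))))"
        by (intro Bochner_Integration.integrable_diff integrable_mult_right indicator_integrable[OF s] iu) (use ig in simp)
      fix t assume "t \<in> space TI"
      then have t: "t \<in> {0..\<tau>}" by simp
      have ut: "u t \<in> VS" "u' t \<in> VS" using V.nice_mem[OF u] by auto
      have gt: "g t \<in> VS" "ipV (g t) (u t) = ipH (u' t) (u t) + ipV (A t (u t)) (u t)"
        using ut K[OF ut(2)] A_mem[OF t ut(1)] by (auto simp: g_def V.ip_add_left)
      have "2 * (wt t * ipH (u' t) (u t)) + wt' t * ipH (u t) (u t)
          = wt t * (2 * ipV (g t) (u t) - 2 * (ipV (A t (u t)) (u t) + \<kappa> * (nH (u t))\<^sup>2))"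
        using ut by (simp add: gt(2) wt(5) VH.N_power2 algebra_simps)
      also have "\<dots> \<le> wt t * ((nV (g t))\<^sup>2 / c - c * (nV (u t))\<^sup>2)"
      proof (intro mult_left_mono)
        have "2 * ipV (g t) (u t) \<le> 2 * (nV (g t) * nV (u t))" using V.Cauchy_Schwarz[OF gt(1) ut(1)] by linarith
        \<comment> \<open>Young's inequality with weight \<open>c\<close>, so that the coercive term
          absorbs it.\<close>
        also have "\<dots> \<le> (nV (g t))\<^sup>2 / c + c * (nV (u t))\<^sup>2"
        proof -
          have "0 \<le> (nV (g t) - c * nV (u t))\<^sup>2 / c" using c by simp
          also have "\<dots> = (nV (g t))\<^sup>2 / c + c * (nV (u t))\<^sup>2 - 2 * (nV (g t) * nV (u t))"
            using c by (simp add: power2_eq_square field_simps)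
          finally show ?thesis by simp
        qed
        finally show "2 * ipV (g t) (u t) - 2 * (ipV (A t (u t)) (u t) + \<kappa> * (nH (u t))\<^sup>2) \<le> (nV (g t))\<^sup>2 / c - c * (nV (u t))\<^sup>2"
          using A_Garding[OF t ut(1)] by (rule arith)
      qed (use wt(4)[of t] in simp)
      also have "\<dots> = wt t * ((nV (g t))\<^sup>2 / c) - c * (wt t * ipV (u t) (u t))" using ut by (simp add: V.N_power2 algebra_simps)
      also have "\<dots> \<le> (nV (g t))\<^sup>2 / c - c * (wt t * ipV (u t) (u t))"
        using wt(6)[of t] wt(4)[of t] t c by (intro diff_right_mono mult_left_le_one_le) auto
      finally have "2 * (wt t * ipH (u' t) (u t)) + wt' t * ipH (u t) (u t) \<le> (nV (g t))\<^sup>2 / c - c * (wt t * ipV (u t) (u t))" .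
      then show "indicator {..s} t * (2 * (wt t * ipH (u' t) (u t)) + wt' t * ipH (u t) (u t)) \<le> (nV (g t))\<^sup>2 / c - c * (indicator {..s} t * (wt t * ipV (u t) (u t)))"
        using c by (simp add: indicator_def)
    qed
    also have "\<dots> = (LN g)\<^sup>2 / c - c * (\<integral>t. indicator {..s} t * (wt t * ipV (u t) (u t)) \<partial>TI)"
      unfolding L2_power2 using ig indicator_integrable[OF s iu] by simp
    finally show ?thesis .
  qed
  have nn: "0 \<le> (\<integral>t. indicator {..s} t * (wt t * ipV (u t) (u t)) \<partial>TI)" for s
    using V.nice_mem[OF u] wt(4) by (intro integral_nonneg_AE AE_I2) (auto intro!: mult_nonneg_nonneg V.ip_nonneg less_imp_le[OF wt(4)])
  have "(nH (u s))\<^sup>2 \<le> (?E * wt s) * (nH (u s))\<^sup>2" using wt(7)[of s] s by (simp add: mult_le_cancel_right1)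
  also have "\<dots> = ?E * (wt s * (nH (u s))\<^sup>2)" by simp
  also have "\<dots> \<le> ?E * ((LN g)\<^sup>2 / c)"
    using main[OF s] c mult_nonneg_nonneg[OF less_imp_le[OF c] nn[of s]] by (intro mult_left_mono) (linarith, simp)
  finally show "(nH (u s))\<^sup>2 \<le> ?E / c * (LN (Kc u' + Ac u))\<^sup>2" by (simp add: g_def)
  have \<tau>I: "\<tau> \<in> {0..\<tau>}" using \<tau> by simp
  have iu: "integrable TI (\<lambda>t. wt t * ipV (u t) (u t))" by (rule weighted_form_integrable(1)[OF V.semi_inner_axioms wt(3) uL(1,1)])
  have ieq: "(\<integral>t. indicator {..\<tau>} t * (wt t * ipV (u t) (u t)) \<partial>TI) = (\<integral>t. wt t * ipV (u t) (u t) \<partial>TI)"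
    by (intro Bochner_Integration.integral_cong) auto
  have "0 \<le> wt \<tau> * (nH (u \<tau>))\<^sup>2" using wt(4)[of \<tau>] by simp
  also note main[OF \<tau>I]
  finally have "c * (\<integral>t. wt t * ipV (u t) (u t) \<partial>TI) \<le> (LN g)\<^sup>2 / c" unfolding ieq by (simp only: diff_ge_0_iff_ge)
  then have b: "(\<integral>t. wt t * ipV (u t) (u t) \<partial>TI) \<le> (LN g)\<^sup>2 / c\<^sup>2" using c by (simp add: field_simps power2_eq_square)
  have "(LN u)\<^sup>2 \<le> (\<integral>t. ?E * (wt t * ipV (u t) (u t)) \<partial>TI)"
    unfolding L2_power2
  proof (rule integral_mono[OF L2_D(2)[OF uL(1)]])
    fix t assume "t \<in> space TI"
    then have "1 * ipV (u t) (u t) \<le> (?E * wt t) * ipV (u t) (u t)"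
      using wt(7)[of t] V.nice_mem[OF u] V.ip_nonneg by (intro mult_right_mono) auto
    then show "(nV (u t))\<^sup>2 \<le> ?E * (wt t * ipV (u t) (u t))" using V.nice_mem[OF u] by (simp add: V.N_power2)
  qed (use iu in simp)
  also have "\<dots> \<le> ?E * ((LN g)\<^sup>2 / c\<^sup>2)"
    unfolding integral_mult_right_zero by (rule mult_left_mono[OF b]) simp
  finally show "(LN u)\<^sup>2 \<le> ?E / c\<^sup>2 * (LN (Kc u' + Ac u))\<^sup>2" by (simp add: g_def)
qed

text \<open>Needed to apply the energy estimate to differences of approximate solutions, as
  \<open>K\<close> and \<open>A\<close> are additive only up to null elements.\<close>

lemma range_diff_le:
  assumes "u \<in> LS" "u' \<in> LS" "y \<in> LS" "y' \<in> LS"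
  shows "LN (Kc (u' - y') + Ac (u - y)) \<le> LN ((Kc u' + Ac u) - (Kc y' + Ac y))"
proof -
  let ?k = "(Kc u' - Kc y') - Kc (u' - y')" and ?a = "(Ac u - Ac y) - Ac (u - y)" and ?g = "(Kc u' + Ac u) - (Kc y' + Ac y)"
  have m: "Kc u' \<in> LS" "Kc y' \<in> LS" "Kc (u' - y') \<in> LS" "Ac u \<in> LS" "Ac y \<in> LS" "Ac (u - y) \<in> LS"
    using assms K_LS(1) A_LS(1) L.diff_mem by blast+
  have kL: "?k \<in> LS" "?a \<in> LS" "?g \<in> LS" using m by (auto intro!: L.diff_mem L.add_mem)
  have k0: "LN ?k = 0"
    using bounded_family_LS_lin[OF bounded_family_K assms(2,4), of 1 "-1"] by simp
  have a0: "LN ?a = 0"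
    using bounded_family_LS_lin[OF bounded_family_A assms(1,3), of 1 "-1"] by simp
  have eq: "Kc (u' - y') + Ac (u - y) = ?g - (?k + ?a)" by (simp add: fun_eq_iff)
  show ?thesis
    unfolding eq using L.N_triangle_diff[OF kL(3) L.add_mem[OF kL(1,2)]] L.N_triangle[OF kL(1,2)] k0 a0 by linarith
qed

text \<open>Approximate solutions whose right-hand sides tend to \<open>g\<close> are Cauchy by the
  energy estimate, both in the evolution space and uniformly in time in \<open>H\<close>. The first
  limit solves the equation, the second is its continuous representative. The derivatives
  \<open>u' n\<close> need not converge themselves; their images under \<open>K\<close> do.\<close>

theorem parabolic_existence:
  "\<exists>C0>0. \<forall>g\<in>LS. \<exists>u\<in>LS. \<exists>U\<in>C_time \<tau> HS nH. (AE t in TI. nH (U t - u t) = 0) \<and> nH (U 0) = 0 \<and>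
    (\<forall>\<psi>\<in>time_tests \<tau>. \<forall>v\<in>VS.
      (\<integral>t. deriv \<psi> t * ipH (u t) v \<partial>TI) = - (\<integral>t. \<psi> t * ipV ((g - Ac u) t) v \<partial>TI)) \<and>
    LN u \<le> C0 * LN g \<and> LN (g - Ac u) \<le> C0 * LN g"
proof -
  define S where "S = sqrt (exp (2 * \<kappa> * \<tau>) / c\<^sup>2)"
  define S' where "S' = sqrt (exp (2 * \<kappa> * \<tau>) / c)"
  have S0: "S \<ge> 0" "S' \<ge> 0" using c by (simp_all add: S_def S'_def)
  have ap1: "LN u \<le> S * LN (Kc u' + Ac u)" if "nice VS \<tau> 0 u u'" for u u'
  proof (rule power2_le_imp_le)
    show "(LN u)\<^sup>2 \<le> (S * LN (Kc u' + Ac u))\<^sup>2"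
      using nice_a_priori(2)[OF that, of 0] \<tau> c by (simp add: S_def power_mult_distrib)
  qed (simp add: S0 L2_nonneg)
  have ap2: "nH (u s) \<le> S' * LN (Kc u' + Ac u)" if "nice VS \<tau> 0 u u'" "s \<in> {0..\<tau>}" for u u' s
  proof (rule power2_le_imp_le)
    show "(nH (u s))\<^sup>2 \<le> (S' * LN (Kc u' + Ac u))\<^sup>2"
      using nice_a_priori(1)[OF that] c by (simp add: S'_def power_mult_distrib)
  qed (simp add: S0 L2_nonneg)
  \<comment> \<open>One constant for both bounds: \<open>S\<close> is that of the energy estimate
    for \<open>u\<close>, and \<open>g - Ac u\<close> costs \<open>1 + C * S\<close>.\<close>
  define C0 where "C0 = 1 + S + C * S"
  have C0: "C0 > 0" "S \<le> C0" "1 + C * S \<le> C0" using S0 C by (simp_all add: C0_def add_pos_nonneg)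
  show ?thesis
  proof (intro exI[of _ C0] conjI ballI C0(1))
    fix g assume g: "g \<in> LS"
    obtain u u' where u: "\<And>n. nice VS \<tau> 0 (u n) (u' n)" and gl: "(\<lambda>n. LN ((Kc (u' n) + Ac (u n)) - g)) \<longlonglongrightarrow> 0"
      using range_dense[OF g] by blast
    define G where "G n = Kc (u' n) + Ac (u n)" for n
    define e where "e n = LN (G n - g)" for n
    have e: "e \<longlonglongrightarrow> 0" using gl by (simp add: e_def[abs_def] G_def)
    have uL: "u n \<in> LS" "u' n \<in> LS" for n using nice_LS u by blast+
    have GL: "G n \<in> LS" for n unfolding G_def by (rule L.add_mem[OF K_LS(1)[OF uL(2)] A_LS(1)[OF uL(1)]])
    have Gd: "LN (G m - G n) \<le> e m + e n" for m n
      using L.N_triangle4[OF GL g GL, of m n] L.N_diff_commute[OF g GL, of n] by (simp add: e_def)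
    have nd: "nice VS \<tau> 0 (u m - u n) (u' m - u' n)" for m n
      using nice_diff[OF u u] by (simp add: fun_diff_def)
    have nd_le: "LN (Kc (u' m - u' n) + Ac (u m - u n)) \<le> e m + e n" for m n
      using range_diff_le[OF uL(1)[of m] uL(2)[of m] uL(1)[of n] uL(2)[of n]] Gd[of m n] unfolding G_def by linarith
    have d1: "LN (u m - u n) \<le> S * e m + S * e n" for m n
      using ap1[OF nd, of m n] mult_left_mono[OF nd_le S0(1), of m n] by (simp add: distrib_left)
    have d2: "nH (u m s - u n s) \<le> S' * e m + S' * e n" if "s \<in> {0..\<tau>}" for m n s
      using ap2[OF nd that, of m n] mult_left_mono[OF nd_le S0(2), of m n] by (simp add: distrib_left)
    have Se: "(\<lambda>n. B * e n) \<longlonglongrightarrow> 0" for B using tendsto_mult_left[OF e, of B] by simp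
    have "L.Cau u" by (rule L.Cau_bound[OF uL(1) Se d1])
    then obtain w where w: "w \<in> LS" "(\<lambda>n. LN (u n - w)) \<longlonglongrightarrow> 0" using L.Cau_converges by blast
    have wS: "LN w \<le> S * LN g"
    proof (rule LIMSEQ_le)
      show "(\<lambda>n. LN (u n)) \<longlonglongrightarrow> LN w" by (rule L.N_tendsto[OF uL(1) w])
      show "(\<lambda>n. S * LN (G n)) \<longlonglongrightarrow> S * LN g"
        by (intro tendsto_intros L.N_tendsto[OF GL g]) (use e in \<open>simp add: e_def[abs_def]\<close>)
      show "\<exists>N. \<forall>n\<ge>N. LN (u n) \<le> S * LN (G n)" using ap1[OF u] by (auto simp: G_def)
    qed
    \<comment> \<open>The limit of \<open>K (u' n)\<close>, hence the Riesz representative of the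
      weak derivative of \<open>w\<close>.\<close>
    define r where "r = g - Ac w"
    have r: "r \<in> LS" unfolding r_def by (rule L.diff_mem[OF g A_LS(1)[OF w(1)]])
    have rC: "LN r \<le> C0 * LN g"
    proof -
      have "LN r \<le> LN g + LN (Ac w)" unfolding r_def by (rule L.N_triangle_diff[OF g A_LS(1)[OF w(1)]])
      also have "\<dots> \<le> LN g + C * (S * LN g)"
        using A_LS(2)[OF w(1)] mult_left_mono[OF wS C] by linarith
      also have "\<dots> = (1 + C * S) * LN g" by (simp add: algebra_simps)
      also have "\<dots> \<le> C0 * LN g" using C0(3) by (rule mult_right_mono) (simp add: L2_nonneg)
      finally show ?thesis .
    qed
    have Kr: "(\<lambda>n. LN (Kc (u' n) - r)) \<longlonglongrightarrow> 0"
    proof (rule Lim_null_comparison)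
      show "\<forall>\<^sub>F n in sequentially. norm (LN (Kc (u' n) - r)) \<le> e n + LN (Ac (u n) - Ac w)"
      proof (intro always_eventually allI)
        fix n
        have "Kc (u' n) - r = (G n - g) - (Ac (u n) - Ac w)" by (simp add: G_def r_def fun_eq_iff)
        then show "norm (LN (Kc (u' n) - r)) \<le> e n + LN (Ac (u n) - Ac w)"
          using L.N_triangle_diff[OF L.diff_mem[OF GL g] L.diff_mem[OF A_LS(1)[OF uL(1)] A_LS(1)[OF w(1)]], of n n]
          by (simp only: e_def real_norm_def abs_of_nonneg[OF L2_nonneg])
      qed
      have "(\<lambda>n. e n + LN (Ac (u n) - Ac w)) \<longlonglongrightarrow> 0 + 0"
        by (intro tendsto_intros e bounded_family_LS_tendsto[OF bounded_family_A uL(1) w])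
      then show "(\<lambda>n. e n + LN (Ac (u n) - Ac w)) \<longlonglongrightarrow> 0" by simp
    qed
    have uH: "u n s \<in> HS" for n s using V.nice_mem[OF u] VH by blast
    \<comment> \<open>Limits at every single time, the endpoint 0 included; this gives the initial
      value a meaning.\<close>
    have "\<exists>l\<in>HS. (\<lambda>n. nH (u n s - l)) \<longlonglongrightarrow> 0" if "s \<in> {0..\<tau>}" for s
      by (rule H.Cau_converges, rule H.Cau_bound[OF uH Se d2[OF that]])
    then obtain U where U: "\<And>s. s \<in> {0..\<tau>} \<Longrightarrow> U s \<in> HS" "\<And>s. s \<in> {0..\<tau>} \<Longrightarrow> (\<lambda>n. nH (u n s - U s)) \<longlonglongrightarrow> 0"
      by metis
    have unif: "nH (u n s - U s) \<le> S' * e n" if s: "s \<in> {0..\<tau>}" for n s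
    proof (rule LIMSEQ_le)
      have "(\<lambda>m. nH (u m s - u n s)) \<longlonglongrightarrow> nH (U s - u n s)"
        by (rule H.N_tendsto) (use uH U[OF s] in \<open>auto intro!: H.diff_mem\<close>)
      then show "(\<lambda>m. nH (u m s - u n s)) \<longlonglongrightarrow> nH (u n s - U s)"
        using H.N_diff_commute[OF uH U(1)[OF s]] by simp
      have "(\<lambda>m. S' * e m + S' * e n) \<longlonglongrightarrow> 0 + S' * e n" by (intro tendsto_intros Se)
      then show "(\<lambda>m. S' * e m + S' * e n) \<longlonglongrightarrow> S' * e n" by simp
      show "\<exists>N. \<forall>m\<ge>N. nH (u m s - u n s) \<le> S' * e m + S' * e n" using d2[OF s] by blast
    qed
    have UC: "U \<in> C_time \<tau> HS nH"
      unfolding C_time_def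
    proof (intro CollectI ballI conjI U(1))
      fix t assume t: "t \<in> {0..\<tau>}"
      show "((\<lambda>s. nH (U s - U t)) \<longlongrightarrow> 0) (at t within {0..\<tau>})"
      proof (rule tendstoI)
        fix d :: real assume d: "d > 0"
        then obtain n where n: "S' * e n < d / 4"
          using order_tendstoD(2)[OF Se[of S'], of "d / 4"] by (auto simp: eventually_sequentially)
        have "((\<lambda>s. nH (u n s - u n t)) \<longlongrightarrow> 0) (at t within {0..\<tau>})"
          using VH.nice_C_time(1)[OF u[of n]] t by (auto simp: C_time_def)
        then have "\<forall>\<^sub>F s in at t within {0..\<tau>}. nH (u n s - u n t) < d / 2"
          using d by (intro order_tendstoD(2)) auto
        moreover have "\<forall>\<^sub>F s in at t within {0..\<tau>}. s \<in> {0..\<tau>}" by (simp add: eventually_at_filter)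
        ultimately show "\<forall>\<^sub>F s in at t within {0..\<tau>}. dist (nH (U s - U t)) 0 < d"
        proof eventually_elim
          case (elim s)
          have "nH (U s - U t) \<le> nH (U s - u n s) + nH (u n s - U t)" by (rule H.N_triangle4[OF U(1)[OF elim(2)] uH U(1)[OF t]])
          also have "nH (u n s - U t) \<le> nH (u n s - u n t) + nH (u n t - U t)" by (rule H.N_triangle4[OF uH uH U(1)[OF t]])
          finally have "nH (U s - U t) < d"
            using unif[OF elim(2), of n] unif[OF t, of n] n elim(1) H.N_diff_commute[OF uH U(1)[OF elim(2)], of n s] by linarith
          then show ?case using H.N_nonneg[OF H.diff_mem[OF U(1)[OF elim(2)] U(1)[OF t]]] by simp
        qed
      qed
    qed
    have U0: "nH (U 0) = 0"
    proof -
      have z: "(0::real) \<in> {0..\<tau>}" using \<tau> by simp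
      have "(\<lambda>n. nH (u n 0 - U 0)) = (\<lambda>n. nH (U 0))"
        using nice_end[OF u] H.N_minus[OF U(1)[OF z]] by (simp add: fun_eq_iff)
      then show ?thesis using U(2)[OF z] by (simp add: LIMSEQ_const_iff)
    qed
    \<comment> \<open>Both \<open>U\<close> and \<open>w\<close> are limits of \<open>u n\<close> in
      the square integrable functions with values in \<open>H\<close>.\<close>
    have Uu: "AE t in TI. nH (U t - w t) = 0"
    proof -
      let ?N = "bochner_L2_norm TI nH" and ?X = "bochner_L2 TI HS nH"
      interpret LL: semi_inner ?X "bochner_inner TI ipH" ?N by (rule H.L2_semi_inner[OF TI(1)])
      have toH: "y \<in> ?X" "?N y \<le> LN y" if "y \<in> LS" for y
        by (rule L2_mono[OF H.seminormed_axioms TI(1) VH nH_le V.diff_mem that], assumption+)+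
      have UX: "U \<in> ?X" by (rule H.C_time_L2[OF \<tau> UC])
      have dU: "?N (u n - U) \<le> sqrt \<tau> * (S' * e n)" for n
      proof -
        have m: "u n - U \<in> ?X" using toH(1)[OF uL(1)] UX by (rule LL.diff_mem)
        interpret fin: finite_measure TI by (rule TI)
        have "(?N (u n - U))\<^sup>2 \<le> (\<integral>t. (S' * e n)\<^sup>2 \<partial>TI)"
          unfolding L2_power2
        proof (rule integral_mono[OF L2_D(2)[OF m]])
          fix t assume "t \<in> space TI"
          then have t: "t \<in> {0..\<tau>}" by simp
          show "(nH ((u n - U) t))\<^sup>2 \<le> (S' * e n)\<^sup>2"
            using unif[OF t, of n] H.N_nonneg[OF H.diff_mem[OF uH U(1)[OF t]], of n t] by (simp add: power_mono)
        qed simp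
        also have "\<dots> = (sqrt \<tau> * (S' * e n))\<^sup>2"
          using \<tau> by (simp add: power_mult_distrib measure_restrict_space)
        finally show ?thesis
          by (rule power2_le_imp_le) (use \<tau> S0 in \<open>simp add: e_def L2_nonneg\<close>)
      qed
      have l1: "(\<lambda>n. ?N (u n - U)) \<longlonglongrightarrow> 0"
      proof (rule Lim_null_comparison)
        show "\<forall>\<^sub>F n in sequentially. norm (?N (u n - U)) \<le> (sqrt \<tau> * S') * e n"
          using dU by (intro always_eventually) (simp add: L2_nonneg mult.assoc)
      qed (rule Se)
      have l2: "(\<lambda>n. ?N (u n - w)) \<longlonglongrightarrow> 0"
      proof (rule Lim_null_comparison[OF _ w(2)])
        show "\<forall>\<^sub>F n in sequentially. norm (?N (u n - w)) \<le> LN (u n - w)"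
          using toH(2)[OF L.diff_mem[OF uL(1) w(1)]] by (intro always_eventually) (simp add: L2_nonneg)
      qed
      have "?N (U - w) = 0" by (rule LL.N_lim_unique[OF toH(1)[OF uL(1)] UX toH(1)[OF w(1)] l1 l2])
      then show ?thesis using H.L2_norm_eq_0_iff[OF TI(1) LL.diff_mem[OF UX toH(1)[OF w(1)]]] by simp
    qed
    have weak: "(\<integral>t. deriv \<psi> t * ipH (w t) v \<partial>TI) = - (\<integral>t. \<psi> t * ipV (r t) v \<partial>TI)"
      if \<psi>: "\<psi> \<in> time_tests \<tau>" and v: "v \<in> VS" for \<psi> v
    proof -
      note D = test_function_deriv[OF \<psi>]
      have c\<psi>: "continuous_on {0..\<tau>} \<psi>" by (rule test_functions_continuous[OF \<psi>])
      have vL: "(\<lambda>_. v) \<in> LS" by (intro V.C_time_L2 \<tau> V.C_time_const v)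
      have cH: "continuous_on {0..\<tau>} (\<lambda>t. ipH (y t) v)" if "y \<in> C_time \<tau> VS nH" for y
        by (rule VH.C_time_ip_continuous[OF that VH.C_time_const[OF v]])
      have eq: "(\<integral>t. deriv \<psi> t * ipH (u n t) v \<partial>TI) = - (\<integral>t. \<psi> t * ipV (K (u' n t)) v \<partial>TI)" for n
      proof -
        have cc: "continuous_on {0..\<tau>} (\<lambda>t. deriv \<psi> t * ipH (u n t) v)" "continuous_on {0..\<tau>} (\<lambda>t. \<psi> t * ipH (u' n t) v)"
          by (intro continuous_intros D(2) c\<psi> cH VH.nice_C_time[OF u])+
        have "(\<integral>t. deriv \<psi> t * ipH (u n t) v + \<psi> t * ipH (u' n t) v \<partial>TI) = \<psi> \<tau> * ipH (u n \<tau>) v - \<psi> 0 * ipH (u n 0) v"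
        proof (rule integral_derivative_Icc)
          show "((\<lambda>t. \<psi> t * ipH (u n t) v) has_real_derivative deriv \<psi> t * ipH (u n t) v + \<psi> t * ipH (u' n t) v) (at t within {0..\<tau>})"
            if "t \<in> {0..\<tau>}" for t
            by (rule DERIV_cong[OF DERIV_mult[OF D(1) VH.nice_ip_const_derivative[OF u v that]]]) simp
          show "continuous_on {0..\<tau>} (\<lambda>t. deriv \<psi> t * ipH (u n t) v + \<psi> t * ipH (u' n t) v)"
            by (intro continuous_on_add cc)
        qed (use \<tau> in simp)
        moreover have "(\<integral>t. deriv \<psi> t * ipH (u n t) v + \<psi> t * ipH (u' n t) v \<partial>TI)
            = (\<integral>t. deriv \<psi> t * ipH (u n t) v \<partial>TI) + (\<integral>t. \<psi> t * ipH (u' n t) v \<partial>TI)"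
          by (rule Bochner_Integration.integral_add[OF continuous_imp_integrable_real[OF cc(1)] continuous_imp_integrable_real[OF cc(2)]])
        ultimately show ?thesis using D(3,4) V.nice_mem[OF u] by (simp add: K(2)[OF _ v])
      qed
      have z: "(\<lambda>n. LN (x - x)) \<longlonglongrightarrow> 0" "(\<lambda>n. LNH (x - x)) \<longlonglongrightarrow> 0" for x by (simp_all add: L.N_zero LH.N_zero)
      have l1: "(\<lambda>n. \<integral>t. deriv \<psi> t * ipH (u n t) v \<partial>TI) \<longlonglongrightarrow> (\<integral>t. deriv \<psi> t * ipH (w t) v \<partial>TI)"
        by (rule weighted_form_tendsto[OF VH.semi_inner_axioms D(2) LS_LSH(1)[OF uL(1)] LS_LSH(1)[OF w(1)] L_tendsto_LH[OF uL(1) w]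
              LS_LSH(1)[OF vL] LS_LSH(1)[OF vL] z(2)])
      have l2: "(\<lambda>n. \<integral>t. \<psi> t * ipV (K (u' n t)) v \<partial>TI) \<longlonglongrightarrow> (\<integral>t. \<psi> t * ipV (r t) v \<partial>TI)"
        by (rule weighted_form_tendsto[OF V.semi_inner_axioms c\<psi> K_LS(1)[OF uL(2)] r Kr vL vL z(1)])
      show ?thesis using LIMSEQ_unique[OF l1[unfolded eq] tendsto_minus[OF l2]] by simp
    qed
    have "LN w \<le> C0 * LN g"
      using wS mult_right_mono[OF C0(2), of "LN g"] by (simp add: L2_nonneg)
    show "\<exists>u\<in>LS. \<exists>U\<in>C_time \<tau> HS nH. (AE t in TI. nH (U t - u t) = 0) \<and> nH (U 0) = 0 \<and>
      (\<forall>\<psi>\<in>time_tests \<tau>. \<forall>v\<in>VS.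
        (\<integral>t. deriv \<psi> t * ipH (u t) v \<partial>TI) = - (\<integral>t. \<psi> t * ipV ((g - Ac u) t) v \<partial>TI)) \<and>
      LN u \<le> C0 * LN g \<and> LN (g - Ac u) \<le> C0 * LN g"
    proof (rule bexI[OF _ w(1)], rule bexI[OF _ UC], intro conjI ballI)
      show "LN w \<le> C0 * LN g" by fact
      show "LN (g - Ac w) \<le> C0 * LN g" using rC unfolding r_def .
      fix \<psi> v assume "\<psi> \<in> time_tests \<tau>" "v \<in> VS"
      from weak[OF this] show "(\<integral>t. deriv \<psi> t * ipH (w t) v \<partial>TI) = - (\<integral>t. \<psi> t * ipV ((g - Ac w) t) v \<partial>TI)"
        unfolding r_def .
    qed (fact Uu U0)+
  qed
qed

text \<open>The weak equation is first extended to functions that vanish at the final time only,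
  where the initial value 0 of the continuous representative \<open>U\<close> enters. Then
  \<open>r\<close> is replaced by \<open>- Ac u\<close>, which leaves the hypothesis of
  \<open>backward_unique\<close>. The statement is meant for the difference of two
  solutions.\<close>

theorem parabolic_unique:
  assumes u: "u \<in> LS" and r: "r \<in> LS" and U: "U \<in> C_time \<tau> HS nH" "AE t in TI. nH (U t - u t) = 0" "nH (U 0) = 0"
    and weak: "\<And>\<psi> v. \<psi> \<in> time_tests \<tau> \<Longrightarrow> v \<in> VS \<Longrightarrow>
      (\<integral>t. deriv \<psi> t * ipH (u t) v \<partial>TI) = - (\<integral>t. \<psi> t * ipV (r t) v \<partial>TI)"
    and eq: "AE t in TI. nV (r t + A t (u t)) = 0"
  shows "LN u = 0"
proof (rule backward_unique[OF u])
  fix \<phi> \<phi>' assume n: "nice VS \<tau> \<tau> \<phi> \<phi>'"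
  have UI: "U t \<in> HS" if "t \<in> {0..\<tau>}" for t using U(1) that by (auto simp: C_time_def)
  have "(\<integral>t. ipH (u t) (\<phi>' t) \<partial>TI) = - (\<integral>t. ipV (r t) (\<phi> t) \<partial>TI)"
    using n
  proof induction
    case (base v \<psi> \<psi>')
    have c\<psi>: "continuous_on {0..\<tau>} \<psi>" using DERIV_continuous_on base(2) by blast
    have vL: "(\<lambda>_. v) \<in> LS" by (intro V.C_time_L2 \<tau> V.C_time_const base)
    have vH: "v \<in> HS" using base VH by blast
    define q where "q t = ipH (U t) v" for t
    have q: "continuous_on {0..\<tau>} q" unfolding q_def[abs_def] by (rule H.C_time_ip_continuous[OF U(1) H.C_time_const[OF vH]])
    have qu: "AE t in TI. q t = ipH (u t) v"
      using U(2) L2_D(3)[OF u] AE_space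
    proof eventually_elim
      case (elim t)
      then show ?case unfolding q_def using UI VH vH by (intro H.ip_null_cong) auto
    qed
    have q_eq: "(\<integral>t. \<theta> t * q t \<partial>TI) = (\<integral>t. \<theta> t * ipH (u t) v \<partial>TI)" if \<theta>: "continuous_on {0..\<tau>} \<theta>" for \<theta>
    proof (rule integral_cong_AE_complete[OF TI(1)])
      show "AE t in TI. \<theta> t * q t = \<theta> t * ipH (u t) v" using qu by eventually_elim simp
    qed
    have "(\<integral>t. \<psi>' t * q t \<partial>TI) = - (\<integral>t. \<psi> t * ipV (r t) v \<partial>TI)"
    proof (rule weak_derivative_extension[OF \<tau> q])
      show "q 0 = 0" unfolding q_def using H.Cauchy_Schwarz[OF UI vH, of 0] U(3) \<tau> by simp
      show "integrable TI (\<lambda>t. ipV (r t) v)" by (rule V.L2_ip_integrable[OF TI(1) r vL])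
      show "(\<integral>t. deriv \<theta> t * q t \<partial>TI) = - (\<integral>t. \<theta> t * ipV (r t) v \<partial>TI)" if "\<theta> \<in> time_tests \<tau>" for \<theta>
        using weak[OF that base(1)] q_eq[OF test_function_deriv(2)[OF that]] by simp
    qed (use base in auto)
    then have "(\<integral>t. \<psi>' t * ipH (u t) v \<partial>TI) = - (\<integral>t. \<psi> t * ipV (r t) v \<partial>TI)" using q_eq[OF base(3)] by simp
    moreover have "(\<integral>t. ipH (u t) (\<psi>' t *\<^sub>R v) \<partial>TI) = (\<integral>t. \<psi>' t * ipH (u t) v \<partial>TI)"
    proof (rule integral_cong_AE_complete[OF TI(1)])
      show "AE t in TI. ipH (u t) (\<psi>' t *\<^sub>R v) = \<psi>' t * ipH (u t) v"
        using L2_D(3)[OF u] by eventually_elim (simp add: VH.ip_scale_right base)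
    qed
    moreover have "(\<integral>t. ipV (r t) (\<psi> t *\<^sub>R v) \<partial>TI) = (\<integral>t. \<psi> t * ipV (r t) v \<partial>TI)"
    proof (rule integral_cong_AE_complete[OF TI(1)])
      show "AE t in TI. ipV (r t) (\<psi> t *\<^sub>R v) = \<psi> t * ipV (r t) v"
        using L2_D(3)[OF r] by eventually_elim (simp add: V.ip_scale_right base)
    qed
    ultimately show ?case by simp
  next
    case (add x x' y y')
    have "bochner_inner TI ipH u (x' + y') = bochner_inner TI ipH u x' + bochner_inner TI ipH u y'"
      using LS_LSH(1) u nice_LS(2) add.hyps by (intro LH.ip_add_right) blast+
    moreover have "LI r (x + y) = LI r x + LI r y"
      using r nice_LS(1) add.hyps by (intro L.ip_add_right) blast+
    ultimately show ?case using add.IH by (simp add: bochner_inner_def)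
  qed
  also have "- (\<integral>t. ipV (r t) (\<phi> t) \<partial>TI) = LI (Ac u) \<phi>"
  proof -
    have "(\<integral>t. ipV (A t (u t)) (\<phi> t) \<partial>TI) = (\<integral>t. - ipV (r t) (\<phi> t) \<partial>TI)"
    proof (rule integral_cong_AE_complete[OF TI(1)])
      show "AE t in TI. ipV (A t (u t)) (\<phi> t) = - ipV (r t) (\<phi> t)"
        using eq L2_D(3)[OF r] L2_D(3)[OF A_LS(1)[OF u]]
      proof eventually_elim
        case (elim t)
        have m: "r t + A t (u t) \<in> VS" "\<phi> t \<in> VS" using elim V.nice_mem[OF n] by auto
        have "ipV (r t + A t (u t)) (\<phi> t) = 0" using V.Cauchy_Schwarz[OF m] elim(1) by simp
        then show ?case using elim m by (simp add: V.ip_add_left)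
      qed
    qed
    then show ?thesis by (simp add: bochner_inner_def)
  qed
  finally show "(\<integral>t. ipH (u t) (\<phi>' t) \<partial>TI) = LI (Ac u) \<phi>" .
qed

end

section \<open>Square integrable functions\<close>

text \<open>Makes \<open>L2_space\<close> an instance of \<open>bochner_L2\<close>, so that one
  completeness theorem serves functions with values in numbers, vectors and pairs.\<close>

lemma semi_hilbert_euclidean: "semi_hilbert (UNIV :: 'b::euclidean_space set) (\<bullet>) norm"
proof -
  interpret semi_inner "UNIV :: 'b set" "(\<bullet>)" norm
  proof
    show "x \<bullet> y = y \<bullet> x" for x y :: 'b by (rule inner_commute)
  qed (auto simp: inner_add_left norm_eq_sqrt_inner)
  show ?thesis
  proof
    fix f :: "nat \<Rightarrow> 'b" assume "Cau f"
    then have "Cauchy f" unfolding Cau_def Cauchy_iff by simp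
    then obtain l where "f \<longlonglongrightarrow> l" using Cauchy_convergent_iff convergent_def by blast
    then show "\<exists>x\<in>UNIV. (\<lambda>n. norm (f n - x)) \<longlonglongrightarrow> 0"
      by (intro bexI[of _ l]) (auto simp: tendsto_norm_zero_iff LIM_zero_iff)
  qed
qed

lemma strongly_measurable_euclidean:
  fixes f :: "'x \<Rightarrow> 'b::euclidean_space"
  assumes "complete_measure M"
  shows "smeas M UNIV norm f \<longleftrightarrow> f \<in> borel_measurable M"
proof
  assume "smeas M UNIV norm f"
  then obtain s where s: "\<And>i. simple_function M (s i)" "AE x in M. (\<lambda>i. norm (s i x - f x)) \<longlonglongrightarrow> 0"
    unfolding strongly_measurable_def by blast
  show "f \<in> borel_measurable M"
  proof (rule complete_measure.borel_measurable_lim_AE[OF assms])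
    show "s i \<in> borel_measurable M" for i by (rule borel_measurable_simple_function[OF s(1)])
    show "AE x in M. (\<lambda>i. s i x) \<longlonglongrightarrow> f x"
      using s(2) by eventually_elim (simp add: tendsto_norm_zero_iff LIM_zero_iff)
  qed
next
  assume "f \<in> borel_measurable M"
  then obtain s where s: "\<And>i. simple_function M (s i)" "\<And>x. x \<in> space M \<Longrightarrow> (\<lambda>i. s i x) \<longlonglongrightarrow> f x"
    using borel_measurable_implies_sequence_metric by blast
  then have "AE x in M. (\<lambda>i. norm (s i x - f x)) \<longlonglongrightarrow> 0"
    by (intro AE_I2) (simp add: tendsto_norm_zero_iff LIM_zero_iff)
  with s show "smeas M UNIV norm f"
    unfolding strongly_measurable_def by auto
qed

lemma L2_space_eq: "complete_measure M \<Longrightarrow> L2_space M = bochner_L2 M UNIV norm"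
  by (simp add: L2_space_def bochner_L2_def strongly_measurable_euclidean)

lemma L2_norm_eq: "L2_norm M = bochner_L2_norm M norm"
  by (simp add: L2_norm_def bochner_L2_norm_def fun_eq_iff)

lemma semi_hilbert_L2:
  assumes "complete_measure M" "finite_measure M"
  shows "semi_hilbert (L2_space M :: ('x \<Rightarrow> 'b::euclidean_space) set) (bochner_inner M (\<bullet>)) (L2_norm M)"
  unfolding L2_space_eq[OF assms(1)] L2_norm_eq
  by (rule semi_hilbert.L2_semi_hilbert[OF semi_hilbert_euclidean assms])

lemma L2_norm_dominated:
  fixes f :: "'x \<Rightarrow> 'b::euclidean_space" and g :: "'x \<Rightarrow> 'c::euclidean_space"
  assumes M: "complete_measure M" and g: "g \<in> L2_space M" and f: "f \<in> borel_measurable M"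
    and le: "AE x in M. norm (f x) \<le> C * norm (g x)" and C: "C \<ge> 0"
  shows "f \<in> L2_space M" "L2_norm M f \<le> C * L2_norm M g"
proof -
  interpret E: semi_hilbert "UNIV :: 'b set" "(\<bullet>)" norm by (rule semi_hilbert_euclidean)
  have "smeas M UNIV norm f" using f by (simp add: strongly_measurable_euclidean[OF M])
  from L2_dominated[OF E.seminormed_axioms M g[unfolded L2_space_eq[OF M]] this le C]
  show "f \<in> L2_space M" "L2_norm M f \<le> C * L2_norm M g" by (simp_all add: L2_space_eq[OF M] L2_norm_eq)
qed

text \<open>The isometry is required for differences and not as linearity, because it is applied to
  Riesz representatives, which are additive only up to null elements.\<close>

lemma L2_isometry:
  assumes M: "complete_measure M" and L: "\<And>x. x \<in> X \<Longrightarrow> L x \<in> Y"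
    and iso: "\<And>x y. x \<in> X \<Longrightarrow> y \<in> X \<Longrightarrow> N' (L x - L y) = N (x - y)" "\<And>x. x \<in> X \<Longrightarrow> N' (L x) = N x"
    and nn: "\<And>x y. x \<in> Y \<Longrightarrow> y \<in> Y \<Longrightarrow> 0 \<le> N' (x - y)"
    and f: "f \<in> bochner_L2 M X N"
  shows "(\<lambda>x. L (f x)) \<in> bochner_L2 M Y N'" "bochner_L2_norm M N' (\<lambda>x. L (f x)) = bochner_L2_norm M N f"
    "g \<in> bochner_L2 M X N \<Longrightarrow> bochner_L2_norm M N' ((\<lambda>x. L (f x)) - (\<lambda>x. L (g x))) = bochner_L2_norm M N (f - g)"
proof -
  have eq: "AE x in M. (N' (L (f x)))\<^sup>2 = (N (f x))\<^sup>2"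
    using L2_D(3)[OF f] by eventually_elim (simp add: iso)
  have "smeas M Y N' (\<lambda>x. L (f x))"
  proof (rule strongly_measurable_map[where L = L and C = 1 and X = X and N = N])
    show "smeas M X N f" by (rule L2_D(1)[OF f])
    show "N' (L x - L y) \<le> 1 * N (x - y)" if "x \<in> X" "y \<in> X" for x y using iso(1)[OF that] by simp
  qed (fact L, fact nn)
  moreover have "integrable M (\<lambda>x. (N' (L (f x)))\<^sup>2)"
  proof (rule integrable_cong_AE_imp[OF L2_D(2)[OF f]])
    show "(\<lambda>x. (N' (L (f x)))\<^sup>2) \<in> borel_measurable M"
      by (rule complete_measure.borel_measurable_cong_AE[OF M borel_measurable_integrable[OF L2_D(2)[OF f]]])
        (use eq in \<open>auto elim: eventually_mono\<close>)
    show "AE x in M. (N (f x))\<^sup>2 = (N' (L (f x)))\<^sup>2" using eq by eventually_elim simp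
  qed
  ultimately show "(\<lambda>x. L (f x)) \<in> bochner_L2 M Y N'" by (simp add: bochner_L2_def)
  show "bochner_L2_norm M N' (\<lambda>x. L (f x)) = bochner_L2_norm M N f"
    unfolding bochner_L2_norm_def by (subst integral_cong_AE_complete[OF M eq]) simp
  assume g: "g \<in> bochner_L2 M X N"
  have "AE x in M. (N' (((\<lambda>x. L (f x)) - (\<lambda>x. L (g x))) x))\<^sup>2 = (N ((f - g) x))\<^sup>2"
    using L2_D(3)[OF f] L2_D(3)[OF g] by eventually_elim (simp add: iso)
  then show "bochner_L2_norm M N' ((\<lambda>x. L (f x)) - (\<lambda>x. L (g x))) = bochner_L2_norm M N (f - g)"
    unfolding bochner_L2_norm_def by (subst integral_cong_AE_complete[OF M]) auto
qed

section \<open>Integration by parts\<close>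

text \<open>By translation invariance the difference quotients have integral 0.\<close>

lemma integral_directional_derivative_0:
  fixes F :: "'a::euclidean_space \<Rightarrow> real"
  assumes D: "\<And>x. F differentiable (at x)" and c: "continuous_on UNIV (\<lambda>x. frechet_derivative F (at x) e)"
    and R: "\<And>x. norm x > R \<Longrightarrow> F x = 0"
  shows "(\<integral>x. frechet_derivative F (at x) e \<partial>lborel) = 0"
proof -
  define F' where "F' x = frechet_derivative F (at x) e" for x
  have FD: "(F has_derivative frechet_derivative F (at x)) (at x)" for x
    using D frechet_derivative_works by blast
  have cF: "continuous_on UNIV F"
    using D by (meson continuous_at_imp_continuous_on differentiable_imp_continuous_within)
  have line: "((\<lambda>s. F (x + s *\<^sub>R e)) has_real_derivative F' (x + s *\<^sub>R e)) (at s)" for x s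
  proof -
    have "((\<lambda>s. x + s *\<^sub>R e) has_derivative (\<lambda>h. h *\<^sub>R e)) (at s)" by (auto intro!: derivative_eq_intros)
    from has_derivative_compose[OF this FD]
    have "((\<lambda>s. F (x + s *\<^sub>R e)) has_derivative (\<lambda>h. frechet_derivative F (at (x + s *\<^sub>R e)) (h *\<^sub>R e))) (at s)" .
    moreover have "frechet_derivative F (at y) (h *\<^sub>R e) = F' y * h" for y h
      using linear_frechet_derivative[OF D, of y] by (simp add: F'_def linear_cmul)
    ultimately show ?thesis by (simp add: has_field_derivative_def)
  qed
  \<comment> \<open>The margin \<open>norm e + 1\<close> keeps \<open>x + s *\<^sub>R e\<close> with
    \<open>\<bar>s\<bar> \<le> 1\<close> outside the support whenever
    \<open>norm x > R'\<close>.\<close>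
  define R' where "R' = \<bar>R\<bar> + norm e + 1"
  have F'0: "F' x = 0" if "norm x > R'" for x
  proof -
    have "F' x = 0"
    proof (rule DERIV_unique[OF line[of x 0, simplified]])
      have ev: "\<forall>\<^sub>F s in nhds (0::real). F (x + s *\<^sub>R e) = 0"
        unfolding eventually_nhds_metric
      proof (intro exI[of _ 1] conjI allI impI)
        fix s :: real assume "dist s 0 < 1"
        then have "norm (s *\<^sub>R e) \<le> norm e" by (simp add: mult_left_le_one_le)
        then have "norm (x + s *\<^sub>R e) > R" using that norm_diff_ineq[of x "s *\<^sub>R e"] by (simp add: R'_def)
        then show "F (x + s *\<^sub>R e) = 0" by (rule R)
      qed simp
      then show "((\<lambda>s. F (x + s *\<^sub>R e)) has_real_derivative 0) (at 0)"
        by (subst DERIV_cong_ev[OF refl ev refl]) simp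
    qed
    then show ?thesis .
  qed
  have "compact (F' ` cball 0 (R' + norm e))"
    using c unfolding F'_def[abs_def] by (intro compact_continuous_image continuous_on_subset[OF c]) auto
  then obtain B where B: "\<And>x. x \<in> cball 0 (R' + norm e) \<Longrightarrow> \<bar>F' x\<bar> \<le> B"
    using compact_imp_bounded by (fastforce simp: bounded_iff)
  have B0: "B \<ge> 0" using B[of 0] by (force simp: R'_def)
  have F'B: "\<bar>F' x\<bar> \<le> B" for x
    using B[of x] F'0[of x] B0 norm_ge_zero[of e] by (cases "norm x > R'") auto
  define h where "h n = inverse (real (Suc n))" for n
  have h: "h n > 0" "h n \<le> 1" for n by (auto simp: h_def inverse_le_1_iff)
  define q where "q n x = (F (x + h n *\<^sub>R e) - F x) / h n" for n x
  \<comment> \<open>The mean value theorem along the direction \<open>e\<close> bounds all quotients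
    at once, which is the domination for the limit.\<close>
  have qB: "\<bar>q n x\<bar> \<le> indicator (cball 0 R') x * B" for n x
  proof (cases "norm x > R'")
    case True
    have "norm (h n *\<^sub>R e) \<le> norm e" using h[of n] by (simp add: mult_left_le_one_le)
    then have "norm (x + h n *\<^sub>R e) > R" "norm x > R" using True norm_diff_ineq[of x "h n *\<^sub>R e"] norm_ge_zero[of e] unfolding R'_def by linarith+
    then show ?thesis using R[of x] R[of "x + h n *\<^sub>R e"] True by (simp add: q_def)
  next
    case False
    obtain s where "F (x + h n *\<^sub>R e) - F (x + 0 *\<^sub>R e) = (h n - 0) * F' (x + s *\<^sub>R e)"
      using MVT2[OF h(1)[of n], of "\<lambda>s. F (x + s *\<^sub>R e)" "\<lambda>s. F' (x + s *\<^sub>R e)"] line by blast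
    then have "q n x = F' (x + s *\<^sub>R e)" using h(1)[of n] by (simp add: q_def)
    then show ?thesis using F'B False by simp
  qed
  have cq: "continuous_on UNIV (q n)" for n
    unfolding q_def[abs_def] using h(1)[of n] by (intro continuous_intros continuous_on_compose2[OF cF]) auto
  have Fint: "integrable lborel F"
  proof -
    have "integrable lborel (\<lambda>x. indicator (cball 0 R) x *\<^sub>R F x)"
      by (intro borel_integrable_compact continuous_on_subset[OF cF]) auto
    moreover have "(\<lambda>x. indicator (cball 0 R) x *\<^sub>R F x) = F" using R by (auto simp: fun_eq_iff indicator_def)
    ultimately show ?thesis by simp
  qed
  have trans: "(\<integral>x. F (x + y) \<partial>lborel) = (\<integral>x. F x \<partial>lborel)" "integrable lborel (\<lambda>x. F (x + y))" for y
  proof -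
    have m: "F \<in> borel_measurable borel" using cF by (rule borel_measurable_continuous_onI)
    have "(\<integral>x. F x \<partial>lborel) = (\<integral>x. F x \<partial>distr lborel borel ((+) y))" by (simp add: lborel_distr_plus)
    also have "\<dots> = (\<integral>x. F (y + x) \<partial>lborel)" by (rule integral_distr) (use m in auto)
    finally show "(\<integral>x. F (x + y) \<partial>lborel) = (\<integral>x. F x \<partial>lborel)" by (simp add: add.commute)
    have "integrable (distr lborel borel ((+) y)) F" using Fint by (simp add: lborel_distr_plus)
    then have "integrable lborel (\<lambda>x. F (y + x))" by (subst (asm) integrable_distr_eq) (use m in auto)
    then show "integrable lborel (\<lambda>x. F (x + y))" by (simp add: add.commute)
  qed
  have q0: "(\<integral>x. q n x \<partial>lborel) = 0" for n
    unfolding q_def using trans Fint by simp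
  have "(\<lambda>n. \<integral>x. q n x \<partial>lborel) \<longlonglongrightarrow> (\<integral>x. F' x \<partial>lborel)"
  proof (rule integral_dominated_convergence)
    show "integrable lborel (\<lambda>x. indicator (cball 0 R') x * B)"
      by (intro integrable_mult_left integrable_real_indicator emeasure_bounded_finite bounded_cball) auto
    show "F' \<in> borel_measurable lborel" using c by (simp add: F'_def[abs_def] borel_measurable_continuous_onI)
    show "q n \<in> borel_measurable lborel" for n using cq by (simp add: borel_measurable_continuous_onI)
    show "AE x in lborel. norm (q n x) \<le> indicator (cball 0 R') x * B" for n using qB by simp
    show "AE x in lborel. (\<lambda>n. q n x) \<longlonglongrightarrow> F' x"
    proof (rule AE_I2)
      fix x
      have "((\<lambda>s. (F (x + s *\<^sub>R e) - F (x + 0 *\<^sub>R e)) / (s - 0)) \<longlongrightarrow> F' (x + 0 *\<^sub>R e)) (at 0)"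
        using line[of x 0] unfolding has_field_derivative_iff .
      moreover have "filterlim h (at 0) sequentially"
        unfolding filterlim_at using LIMSEQ_inverse_real_of_nat h(1) by (auto simp: h_def[abs_def] less_imp_neq[symmetric])
      ultimately have "(\<lambda>n. (F (x + h n *\<^sub>R e) - F (x + 0 *\<^sub>R e)) / (h n - 0)) \<longlonglongrightarrow> F' (x + 0 *\<^sub>R e)"
        by (rule filterlim_compose)
      then show "(\<lambda>n. q n x) \<longlonglongrightarrow> F' x" by (simp add: q_def)
    qed
  qed
  then show ?thesis by (simp add: q0 LIMSEQ_const_iff F'_def)
qed

lemma test_functions_zero: "(\<lambda>x. 0) \<in> test_functions U"
proof -
  have "(\<lambda>x. 0 :: real) \<in> smooth_alg" by (rule smooth_alg.const)
  then show ?thesis using smooth_alg_partials(2) by (auto simp: test_functions_def)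
qed

lemma test_functions_eq_0:
  assumes "\<phi> \<in> test_functions U" "x \<notin> U" shows "\<phi> x = 0"
  using assms closure_subset[of "{x. \<phi> x \<noteq> 0}"] by (auto simp: test_functions_def)

lemma continuous_on_directional_derivative_test:
  assumes "\<phi> \<in> test_functions U" "e \<in> Basis"
  shows "continuous_on S (\<lambda>x. frechet_derivative \<phi> (at x) e)"
proof -
  have "partials [e] \<phi> differentiable (at x)" for x
    using assms by (auto simp: test_functions_def simp del: partials.simps)
  then have "continuous_on S (partials [e] \<phi>)"
    by (meson continuous_at_imp_continuous_on differentiable_imp_continuous_within)
  then show ?thesis by simp
qed

text \<open>The derivative of the product of the two functions has integral 0.\<close>

lemma test_functions_by_parts:
  fixes \<phi> \<psi> :: "'a::euclidean_space \<Rightarrow> real"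
  assumes U: "open U" and \<phi>: "\<phi> \<in> test_functions U" and \<psi>: "\<psi> \<in> test_functions U" and e: "e \<in> Basis"
  shows "(\<integral>x. \<phi> x * frechet_derivative \<psi> (at x) e \<partial>lebesgue_on U) = - (\<integral>x. \<psi> x * frechet_derivative \<phi> (at x) e \<partial>lebesgue_on U)"
    (is "?l = - ?r")
proof -
  let ?d = "\<lambda>f x. frechet_derivative f (at x) e"
  have UL: "U \<in> sets lebesgue" using U by (simp add: borel_open sets_completionI_sets)
  have D: "(\<phi> has_derivative frechet_derivative \<phi> (at x)) (at x)" "(\<psi> has_derivative frechet_derivative \<psi> (at x)) (at x)" for x
    using test_functions_differentiable[OF \<phi>] test_functions_differentiable[OF \<psi>] frechet_derivative_works by blast+
  have DP: "((\<lambda>x. \<phi> x * \<psi> x) has_derivative (\<lambda>h. \<phi> x * frechet_derivative \<psi> (at x) h + frechet_derivative \<phi> (at x) h * \<psi> x)) (at x)" for x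
    by (rule has_derivative_mult[OF D])
  have dP: "?d (\<lambda>x. \<phi> x * \<psi> x) x = \<phi> x * ?d \<psi> x + \<psi> x * ?d \<phi> x" for x
    unfolding frechet_derivative_at[OF DP, symmetric] by simp
  have cs: "continuous_on S \<phi>" "continuous_on S \<psi>" "continuous_on S (?d \<phi>)" "continuous_on S (?d \<psi>)" for S
    by (intro test_functions_continuous[OF \<phi>] test_functions_continuous[OF \<psi>]
        continuous_on_directional_derivative_test[OF \<phi> e] continuous_on_directional_derivative_test[OF \<psi> e])+
  have int: "integrable lborel (\<lambda>x. f x * g x)" "(\<integral>x. f x * g x \<partial>lebesgue_on U) = (\<integral>x. f x * g x \<partial>lborel)"
    if f: "f \<in> test_functions U" and g: "continuous_on UNIV g" for f g
  proof -
    let ?K = "closure {x. f x \<noteq> 0}"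
    have cf: "continuous_on UNIV f" by (rule test_functions_continuous[OF f])
    have "integrable lborel (\<lambda>x. indicator ?K x *\<^sub>R (f x * g x))"
      using f by (intro borel_integrable_compact continuous_on_subset[OF continuous_on_mult[OF cf g]])
        (auto simp: test_functions_def)
    moreover have "(\<lambda>x. indicator ?K x *\<^sub>R (f x * g x)) = (\<lambda>x. f x * g x)"
      using closure_subset[of "{x. f x \<noteq> 0}"] by (auto simp: fun_eq_iff indicator_def)
    ultimately show "integrable lborel (\<lambda>x. f x * g x)" by simp
    have "(\<integral>x. f x * g x \<partial>lebesgue_on U) = (\<integral>x. indicator U x *\<^sub>R (f x * g x) \<partial>lebesgue)"
      using UL by (intro integral_restrict_space) simp
    also have "(\<lambda>x. indicator U x *\<^sub>R (f x * g x)) = (\<lambda>x. f x * g x)"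
      using test_functions_eq_0[OF f] by (auto simp: fun_eq_iff indicator_def)
    also have "(\<integral>x. f x * g x \<partial>lebesgue) = (\<integral>x. f x * g x \<partial>lborel)"
      by (intro integral_completion) (simp add: borel_measurable_continuous_onI continuous_on_mult cf g)
    finally show "(\<integral>x. f x * g x \<partial>lebesgue_on U) = (\<integral>x. f x * g x \<partial>lborel)" .
  qed
  have "bounded (closure {x. \<phi> x \<noteq> 0})" using \<phi> by (auto simp: test_functions_def compact_imp_bounded)
  then obtain R where R: "\<And>x. x \<in> closure {x. \<phi> x \<noteq> 0} \<Longrightarrow> norm x \<le> R" by (auto simp: bounded_iff)
  have "(\<integral>x. ?d (\<lambda>x. \<phi> x * \<psi> x) x \<partial>lborel) = 0"
  proof (rule integral_directional_derivative_0)
    show "(\<lambda>x. \<phi> x * \<psi> x) differentiable (at x)" for x using DP by (auto simp: differentiable_def)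
    show "continuous_on UNIV (?d (\<lambda>x. \<phi> x * \<psi> x))" unfolding dP by (intro continuous_intros cs)
    show "\<phi> x * \<psi> x = 0" if "norm x > R" for x
      using R[of x] that closure_subset[of "{x. \<phi> x \<noteq> 0}"] by (auto simp: not_le[symmetric])
  qed
  then show ?thesis
    unfolding dP int(2)[OF \<phi> cs(4)] int(2)[OF \<psi> cs(3)] using int(1)[OF \<phi> cs(4)] int(1)[OF \<psi> cs(3)] by simp
qed

section \<open>Sobolev spaces\<close>

locale bounded_domain =
  fixes D :: "(real ^ 'n) set"
  assumes D_open: "open D" and D_bounded: "bounded D"
begin

abbreviation "DM \<equiv> lebesgue_on D"
abbreviation "L2 \<equiv> L2_space DM"
abbreviation "wg \<equiv> weak_grad D"
abbreviation "nL2 \<equiv> L2_norm DM"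
abbreviation "ip2 \<equiv> bochner_inner DM (\<bullet>)"
abbreviation "H1S \<equiv> H1_space D"
abbreviation "nH1 \<equiv> H1_norm D"
abbreviation "H10 \<equiv> H10_space D"

lemma D_lebesgue: "D \<in> sets lebesgue" "D \<in> lmeasurable"
  using D_open D_bounded by (auto simp: lmeasurable_open borel_open sets_completionI_sets)

lemma DM: "complete_measure DM" "finite_measure DM"
  by (rule complete_measure_lebesgue_on[OF D_lebesgue(1)], rule finite_measure_lebesgue_on[OF D_lebesgue(2)])

sublocale L: semi_hilbert "L2 :: (real ^ 'n \<Rightarrow> real) set" "ip2" "nL2"
  by (rule semi_hilbert_L2[OF DM])

sublocale G: semi_hilbert "L2 :: (real ^ 'n \<Rightarrow> real ^ 'n) set" "ip2" "nL2"
  by (rule semi_hilbert_L2[OF DM])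

lemma L2_if_continuous:
  fixes f :: "real ^ 'n \<Rightarrow> 'b::euclidean_space"
  assumes f: "continuous_on UNIV f" shows "f \<in> L2"
proof -
  interpret finite_measure DM by (rule DM)
  have m: "f \<in> borel_measurable DM"
    using f by (intro measurable_restrict_space1 measurable_completion) (simp add: borel_measurable_continuous_onI)
  have "bounded (f ` closure D)"
    using D_bounded by (intro compact_imp_bounded compact_continuous_image continuous_on_subset[OF f]) auto
  then obtain B where "\<And>x. x \<in> closure D \<Longrightarrow> norm (f x) \<le> B" by (auto simp: bounded_iff)
  then have B: "\<And>x. x \<in> D \<Longrightarrow> norm (f x) \<le> B" using closure_subset by blast
  have "integrable DM (\<lambda>x. (norm (f x))\<^sup>2)"
    by (rule integrable_const_bound[of _ "B\<^sup>2"]) (use B m in \<open>auto intro!: AE_I2 power_mono\<close>)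
  with m show ?thesis by (simp add: L2_space_def)
qed

lemma grad_continuous: "\<phi> \<in> test_functions D \<Longrightarrow> continuous_on S (grad \<phi>)"
  unfolding grad_def[abs_def]
  by (intro continuous_on_vec_lambda continuous_on_directional_derivative_test) (auto simp: axis_in_Basis_iff)

lemma test_L2: "\<phi> \<in> test_functions D \<Longrightarrow> \<phi> \<in> L2" "\<phi> \<in> test_functions D \<Longrightarrow> grad \<phi> \<in> L2"
  by (auto intro!: L2_if_continuous grad_continuous test_functions_continuous)

lemma L2_scaleR_integrable:
  fixes g :: "real ^ 'n \<Rightarrow> 'b::euclidean_space"
  assumes u: "u \<in> L2" and g: "g \<in> L2"
  shows "integrable DM (\<lambda>x. u x *\<^sub>R g x)" "norm (\<integral>x. u x *\<^sub>R g x \<partial>DM) \<le> nL2 u * nL2 g"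
proof -
  interpret B: semi_hilbert "L2 :: (real ^ 'n \<Rightarrow> 'b) set" "ip2" "nL2"
    by (rule semi_hilbert_L2[OF DM])
  have m: "u \<in> borel_measurable DM" "g \<in> borel_measurable DM" using u g by (auto simp: L2_space_def)
  have au: "(\<lambda>x. norm (u x)) \<in> L2" "(\<lambda>x. norm (g x)) \<in> L2"
    using u g by (auto simp: L2_space_def)
  have i: "integrable DM (\<lambda>x. norm (u x) \<bullet> norm (g x))"
    by (rule semi_inner.L2_ip_integrable[OF semi_hilbert.axioms(1)[OF semi_hilbert_euclidean] DM(1) au[unfolded L2_space_eq[OF DM(1)]]])
  then show int: "integrable DM (\<lambda>x. u x *\<^sub>R g x)"
    by (rule Bochner_Integration.integrable_bound) (use m in \<open>auto intro!: borel_measurable_scaleR\<close>)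
  have "norm (\<integral>x. u x *\<^sub>R g x \<partial>DM) \<le> (\<integral>x. norm (u x *\<^sub>R g x) \<partial>DM)" by (rule integral_norm_bound)
  also have "\<dots> = ip2 (\<lambda>x. norm (u x)) (\<lambda>x. norm (g x))" by (simp add: bochner_inner_def)
  also have "\<dots> \<le> nL2 (\<lambda>x. norm (u x)) * nL2 (\<lambda>x. norm (g x))"
    using L.Cauchy_Schwarz[OF au] by linarith
  also have "\<dots> = nL2 u * nL2 g" by (simp add: L2_norm_def)
  finally show "norm (\<integral>x. u x *\<^sub>R g x \<partial>DM) \<le> nL2 u * nL2 g" .
qed

lemma is_weak_grad_test:
  assumes \<phi>: "\<phi> \<in> test_functions D" shows "is_weak_grad D \<phi> (grad \<phi>)"
  unfolding is_weak_grad_def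
proof (intro conjI ballI test_L2(2)[OF \<phi>])
  fix \<psi> assume \<psi>: "\<psi> \<in> test_functions D"
  show "(\<integral>x. \<phi> x *\<^sub>R grad \<psi> x \<partial>DM) = - (\<integral>x. \<psi> x *\<^sub>R grad \<phi> x \<partial>DM)"
  proof (rule vec_eq_iff[THEN iffD2], rule allI)
    fix i
    have comp: "(\<integral>x. f x *\<^sub>R grad g x \<partial>DM) $ i = (\<integral>x. f x * frechet_derivative g (at x) (axis i 1) \<partial>DM)"
      if "f \<in> test_functions D" "g \<in> test_functions D" for f g
    proof -
      have "(\<integral>x. f x *\<^sub>R grad g x \<partial>DM) $ i = (\<integral>x. (f x *\<^sub>R grad g x) \<bullet> axis i 1 \<partial>DM)"
        by (subst integral_inner_left) (use that test_L2 L2_scaleR_integrable(1) in \<open>auto simp: inner_axis\<close>)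
      then show ?thesis by (simp add: inner_axis grad_def)
    qed
    show "(\<integral>x. \<phi> x *\<^sub>R grad \<psi> x \<partial>DM) $ i = (- (\<integral>x. \<psi> x *\<^sub>R grad \<phi> x \<partial>DM)) $ i"
      using test_functions_by_parts[OF D_open \<phi> \<psi>, of "axis i 1"]
      by (simp add: comp[OF \<phi> \<psi>] comp[OF \<psi> \<phi>] axis_in_Basis_iff)
  qed
qed

lemma is_weak_grad_lin:
  assumes u: "u \<in> L2" "is_weak_grad D u g" and v: "v \<in> L2" "is_weak_grad D v k"
  shows "is_weak_grad D (a *\<^sub>R u + b *\<^sub>R v) (a *\<^sub>R g + b *\<^sub>R k)"
  unfolding is_weak_grad_def
proof (intro conjI ballI)
  have gk: "g \<in> L2" "k \<in> L2" using u v by (auto simp: is_weak_grad_def)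
  then show "a *\<^sub>R g + b *\<^sub>R k \<in> L2" by auto
  fix \<phi> assume \<phi>: "\<phi> \<in> test_functions D"
  note i = L2_scaleR_integrable(1)[OF u(1) test_L2(2)[OF \<phi>]] L2_scaleR_integrable(1)[OF v(1) test_L2(2)[OF \<phi>]]
    L2_scaleR_integrable(1)[OF test_L2(1)[OF \<phi>] gk(1)] L2_scaleR_integrable(1)[OF test_L2(1)[OF \<phi>] gk(2)]
  have "(\<integral>x. (a *\<^sub>R u + b *\<^sub>R v) x *\<^sub>R grad \<phi> x \<partial>DM) = a *\<^sub>R (\<integral>x. u x *\<^sub>R grad \<phi> x \<partial>DM) + b *\<^sub>R (\<integral>x. v x *\<^sub>R grad \<phi> x \<partial>DM)"
  proof -
    have "(\<integral>x. (a *\<^sub>R u + b *\<^sub>R v) x *\<^sub>R grad \<phi> x \<partial>DM) = (\<integral>x. a *\<^sub>R (u x *\<^sub>R grad \<phi> x) + b *\<^sub>R (v x *\<^sub>R grad \<phi> x) \<partial>DM)"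
      by (intro Bochner_Integration.integral_cong) (auto simp: scaleR_add_left)
    also have "\<dots> = (\<integral>x. a *\<^sub>R (u x *\<^sub>R grad \<phi> x) \<partial>DM) + (\<integral>x. b *\<^sub>R (v x *\<^sub>R grad \<phi> x) \<partial>DM)"
      using i by (intro Bochner_Integration.integral_add integrable_scaleR_right)
    finally show ?thesis by (simp only: integral_scaleR_right)
  qed
  also have "\<dots> = - (a *\<^sub>R (\<integral>x. \<phi> x *\<^sub>R g x \<partial>DM) + b *\<^sub>R (\<integral>x. \<phi> x *\<^sub>R k x \<partial>DM))"
    using u v \<phi> by (simp add: is_weak_grad_def)
  also have "a *\<^sub>R (\<integral>x. \<phi> x *\<^sub>R g x \<partial>DM) + b *\<^sub>R (\<integral>x. \<phi> x *\<^sub>R k x \<partial>DM) = (\<integral>x. a *\<^sub>R (\<phi> x *\<^sub>R g x) + b *\<^sub>R (\<phi> x *\<^sub>R k x) \<partial>DM)"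
  proof -
    have "(\<integral>x. a *\<^sub>R (\<phi> x *\<^sub>R g x) + b *\<^sub>R (\<phi> x *\<^sub>R k x) \<partial>DM) = (\<integral>x. a *\<^sub>R (\<phi> x *\<^sub>R g x) \<partial>DM) + (\<integral>x. b *\<^sub>R (\<phi> x *\<^sub>R k x) \<partial>DM)"
      using i by (intro Bochner_Integration.integral_add integrable_scaleR_right)
    then show ?thesis by (simp only: integral_scaleR_right)
  qed
  also have "\<dots> = (\<integral>x. \<phi> x *\<^sub>R (a *\<^sub>R g + b *\<^sub>R k) x \<partial>DM)"
    by (intro Bochner_Integration.integral_cong) (auto simp: scaleR_add_right mult.commute)
  finally show "(\<integral>x. (a *\<^sub>R u + b *\<^sub>R v) x *\<^sub>R grad \<phi> x \<partial>DM) = - (\<integral>x. \<phi> x *\<^sub>R (a *\<^sub>R g + b *\<^sub>R k) x \<partial>DM)" .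
qed

text \<open>Each component of the difference is orthogonal to all test functions.\<close>

lemma is_weak_grad_unique:
  assumes g: "is_weak_grad D u g" and k: "is_weak_grad D u k"
  shows "AE x in DM. g x = k x" "nL2 (g - k) = 0"
proof -
  interpret fin: finite_measure DM by (rule DM)
  have gk: "g \<in> L2" "k \<in> L2" using g k by (auto simp: is_weak_grad_def)
  have d: "g - k \<in> L2" using gk by auto
  have "AE x in DM. (g - k) x $ i = 0" for i
  proof (rule AE_0_if_orthogonal_test_functions[OF D_open])
    have "(\<lambda>_. 1) \<in> L2" by (rule L2_if_continuous) simp
    from L2_scaleR_integrable(1)[OF this d] have "integrable DM (\<lambda>x. (g - k) x)" by simp
    then have "integrable DM (\<lambda>x. (g - k) x \<bullet> axis i 1)" by (rule integrable_inner_left)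
    then show "integrable DM (\<lambda>x. (g - k) x $ i)" by (simp add: inner_axis)
    fix \<phi> assume \<phi>: "\<phi> \<in> test_functions D"
    note i = L2_scaleR_integrable(1)[OF test_L2(1)[OF \<phi>] gk(1)] L2_scaleR_integrable(1)[OF test_L2(1)[OF \<phi>] gk(2)]
    have "(\<integral>x. \<phi> x *\<^sub>R (g - k) x \<partial>DM) = (\<integral>x. \<phi> x *\<^sub>R g x \<partial>DM) - (\<integral>x. \<phi> x *\<^sub>R k x \<partial>DM)"
      using i by (simp add: scaleR_diff_right)
    also have "\<dots> = 0"   proof -
    have "- (\<integral>x. \<phi> x *\<^sub>R g x \<partial>DM) = - (\<integral>x. \<phi> x *\<^sub>R k x \<partial>DM)"
      using g k \<phi> unfolding is_weak_grad_def by simp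
    then show ?thesis by simp
  qed
    finally have "(\<integral>x. (\<phi> x *\<^sub>R (g - k) x) \<bullet> axis i 1 \<partial>DM) = 0"
      using L2_scaleR_integrable(1)[OF test_L2(1)[OF \<phi>] d] by (subst integral_inner_left) auto
    then show "(\<integral>x. \<phi> x * (g - k) x $ i \<partial>DM) = 0" by (simp add: inner_axis)
  qed
  then have "AE x in DM. \<forall>i. (g - k) x $ i = 0" by (simp add: AE_all_countable)
  then show ae: "AE x in DM. g x = k x" by eventually_elim (simp add: vec_eq_iff)
  have "(\<integral>x. (norm ((g - k) x))\<^sup>2 \<partial>DM) = 0"
    by (rule integral_eq_zero_AE) (use ae in \<open>auto elim: eventually_mono\<close>)
  then show "nL2 (g - k) = 0" by (simp add: L2_norm_def)
qed

lemma H1_D: "u \<in> H1S \<Longrightarrow> u \<in> L2" "u \<in> H1S \<Longrightarrow> is_weak_grad D u (wg u)"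
  "u \<in> H1S \<Longrightarrow> wg u \<in> L2"
proof -
  assume u: "u \<in> H1S"
  then show "u \<in> L2" by (simp add: H1_space_def)
  from u show w: "is_weak_grad D u (wg u)"
    unfolding weak_grad_def by (intro someI_ex[of "is_weak_grad D u"]) (simp add: H1_space_def)
  then show "wg u \<in> L2" by (simp add: is_weak_grad_def)
qed

lemma test_H1: "\<phi> \<in> test_functions D \<Longrightarrow> \<phi> \<in> H1S"
  using test_L2 is_weak_grad_test by (auto simp: H1_space_def)

section \<open>The space H1 and the closure of the test functions in it\<close>

definition ip1 :: "(real ^ 'n \<Rightarrow> real) \<Rightarrow> (real ^ 'n \<Rightarrow> real) \<Rightarrow> real" where
  "ip1 u v = ip2 u v + ip2 (wg u) (wg v)"

text \<open>\<open>weak_grad\<close> is a \<open>SOME\<close> choice, so its linearity can hold only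
  up to null functions, by uniqueness of weak gradients.\<close>

lemma H1_lin:
  assumes "u \<in> H1S" "v \<in> H1S"
  shows "a *\<^sub>R u + b *\<^sub>R v \<in> H1S"
    "nL2 (wg (a *\<^sub>R u + b *\<^sub>R v) - (a *\<^sub>R wg u + b *\<^sub>R wg v)) = 0"
proof -
  note w = is_weak_grad_lin[OF H1_D(1,2)[OF assms(1)] H1_D(1,2)[OF assms(2)], of a b]
  have "a *\<^sub>R u + b *\<^sub>R v \<in> L2" using H1_D(1) assms by auto
  with w show m: "a *\<^sub>R u + b *\<^sub>R v \<in> H1S" by (auto simp: H1_space_def)
  show "nL2 (wg (a *\<^sub>R u + b *\<^sub>R v) - (a *\<^sub>R wg u + b *\<^sub>R wg v)) = 0"
    by (rule is_weak_grad_unique(2)[OF H1_D(2)[OF m] w])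
qed

lemma H1_semi_inner: "semi_inner H1S ip1 nH1"
proof
  have z: "0 \<in> H1S" using test_H1[OF test_functions_zero] by (simp add: zero_fun_def)
  show "subspace H1S"
    using H1_lin(1)[of _ _ 1 1] H1_lin(1)[of _ _ _ 0] z by (intro subspaceI) auto
  fix x y assume xy: "x \<in> H1S" "y \<in> H1S"
  show "ip1 x y = ip1 y x"
    unfolding ip1_def
    by (simp only: L.ip_commute[OF H1_D(1)[OF xy(1)] H1_D(1)[OF xy(2)]] G.ip_commute[OF H1_D(3)[OF xy(1)] H1_D(3)[OF xy(2)]])
  show "ip1 (x + y) z = ip1 x z + ip1 y z" if "z \<in> H1S" for z
  proof -
    have m: "x + y \<in> H1S" using H1_lin(1)[OF xy, of 1 1] by simp
    have "ip2 (wg (x + y)) (wg z) = ip2 (wg x + wg y) (wg z)"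
      using H1_lin(2)[OF xy, of 1 1] H1_D(3)[OF xy(1)] H1_D(3)[OF xy(2)] H1_D(3)[OF m] H1_D(3)[OF that] by (intro G.ip_null_cong) auto
    then show ?thesis unfolding ip1_def
      by (simp only: L.ip_add_left[OF H1_D(1)[OF xy(1)] H1_D(1)[OF xy(2)] H1_D(1)[OF that]]
          G.ip_add_left[OF H1_D(3)[OF xy(1)] H1_D(3)[OF xy(2)] H1_D(3)[OF that]])
  qed
  show "ip1 (a *\<^sub>R x) y = a * ip1 x y" for a
  proof -
    have m: "a *\<^sub>R x \<in> H1S" using H1_lin(1)[OF xy(1,1), of a 0] by simp
    have "ip2 (wg (a *\<^sub>R x)) (wg y) = ip2 (a *\<^sub>R wg x) (wg y)"
      using H1_lin(2)[OF xy(1,1), of a 0] H1_D(3)[OF xy(1)] H1_D(3)[OF m] H1_D(3)[OF xy(2)] by (intro G.ip_null_cong) auto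
    then show ?thesis unfolding ip1_def
      by (simp only: L.ip_scale_left[OF H1_D(1)[OF xy(1)] H1_D(1)[OF xy(2)]]
          G.ip_scale_left[OF H1_D(3)[OF xy(1)] H1_D(3)[OF xy(2)]] distrib_left)
  qed
next
  fix x assume x: "x \<in> H1S"
  show "0 \<le> ip1 x x" unfolding ip1_def by (intro add_nonneg_nonneg L.ip_nonneg G.ip_nonneg H1_D x)
  show "nH1 x = sqrt (ip1 x x)"
    unfolding ip1_def H1_norm_def by (simp only: L.N_power2[OF H1_D(1)[OF x]] G.N_power2[OF H1_D(3)[OF x]])
qed

sublocale H1: semi_inner "H1S" ip1 "nH1"
  by (rule H1_semi_inner)

lemma H1_norm_ge: "nL2 u \<le> nH1 u" "nL2 (wg u) \<le> nH1 u"
  unfolding H1_norm_def by (rule real_le_rsqrt, simp)+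

lemma weak_grad_diff:
  assumes "u \<in> H1S" "v \<in> H1S"
  shows "nL2 (wg (u - v) - (wg u - wg v)) = 0"
  using H1_lin(2)[OF assms, of 1 "-1"] by simp

lemma H1_norm_diff_power2:
  assumes "u \<in> H1S" "v \<in> H1S"
  shows "(nH1 (u - v))\<^sup>2 = (nL2 (u - v))\<^sup>2 + (nL2 (wg u - wg v))\<^sup>2"
proof -
  have m: "wg (u - v) \<in> L2" "wg u - wg v \<in> L2"
    using H1_D(3) assms by (auto intro: H1_D(3)[OF H1.diff_mem])
  have "nL2 (wg (u - v)) = nL2 (wg u - wg v)"
    using G.N_triangle_rev[OF m] weak_grad_diff[OF assms] by simp
  then show ?thesis by (simp add: H1_norm_def)
qed

text \<open>The weak gradient is a closed operator: if functions and gradients converge separately,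
  the defining identity passes to the limit for each test function.\<close>

lemma H1_hilbert: "semi_hilbert H1S ip1 nH1"
proof
  fix f assume f: "H1.Cau f"
  have fH: "f n \<in> H1S" for n using f by (simp add: H1.Cau_def)
  have le: "nL2 (f m - f n) \<le> nH1 (f m - f n)"
    "nL2 (wg (f m) - wg (f n)) \<le> nH1 (f m - f n)" for m n
  proof -
    show "nL2 (f m - f n) \<le> nH1 (f m - f n)" by (rule H1_norm_ge)
    show "nL2 (wg (f m) - wg (f n)) \<le> nH1 (f m - f n)"
      by (rule power2_le_imp_le) (use H1_norm_diff_power2[OF fH fH] H1.N_nonneg[OF H1.diff_mem[OF fH fH]] in auto)
  qed
  have "L.Cau f" unfolding L.Cau_def
    using f fH H1_D(1) le(1) unfolding H1.Cau_def by (meson le_less_trans)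
  then obtain u where u: "u \<in> L2" "(\<lambda>n. nL2 (f n - u)) \<longlonglongrightarrow> 0" using L.Cau_converges by blast
  have "G.Cau (\<lambda>n. wg (f n))" unfolding G.Cau_def
    using f fH H1_D(3) le(2) unfolding H1.Cau_def by (meson le_less_trans)
  then obtain g where g: "g \<in> L2" "(\<lambda>n. nL2 (wg (f n) - g)) \<longlonglongrightarrow> 0" using G.Cau_converges by blast
  have "is_weak_grad D u g"
    unfolding is_weak_grad_def
  proof (intro conjI ballI g(1))
    fix \<phi> assume \<phi>: "\<phi> \<in> test_functions D"
    note t = test_L2[OF \<phi>]
    have l1: "(\<lambda>n. \<integral>x. f n x *\<^sub>R grad \<phi> x \<partial>DM) \<longlonglongrightarrow> (\<integral>x. u x *\<^sub>R grad \<phi> x \<partial>DM)"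
    proof (rule LIM_zero_cancel, rule Lim_null_comparison)
      have "(\<lambda>n. nL2 (f n - u) * nL2 (grad \<phi>)) \<longlonglongrightarrow> 0 * nL2 (grad \<phi>)"
        by (intro tendsto_intros u)
      then show "(\<lambda>n. nL2 (f n - u) * nL2 (grad \<phi>)) \<longlonglongrightarrow> 0" by simp
      show "\<forall>\<^sub>F n in sequentially. norm ((\<integral>x. f n x *\<^sub>R grad \<phi> x \<partial>DM) - (\<integral>x. u x *\<^sub>R grad \<phi> x \<partial>DM)) \<le> nL2 (f n - u) * nL2 (grad \<phi>)"
      proof (intro always_eventually allI)
        fix n
        have "(\<integral>x. f n x *\<^sub>R grad \<phi> x \<partial>DM) - (\<integral>x. u x *\<^sub>R grad \<phi> x \<partial>DM) = (\<integral>x. (f n - u) x *\<^sub>R grad \<phi> x \<partial>DM)"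
          using L2_scaleR_integrable(1)[OF H1_D(1)[OF fH] t(2)] L2_scaleR_integrable(1)[OF u(1) t(2)] by (simp add: scaleR_diff_left)
        then show "norm ((\<integral>x. f n x *\<^sub>R grad \<phi> x \<partial>DM) - (\<integral>x. u x *\<^sub>R grad \<phi> x \<partial>DM)) \<le> nL2 (f n - u) * nL2 (grad \<phi>)"
          using L2_scaleR_integrable(2)[OF L.diff_mem[OF H1_D(1)[OF fH] u(1)] t(2)] by simp
      qed
    qed
    have l2: "(\<lambda>n. \<integral>x. \<phi> x *\<^sub>R wg (f n) x \<partial>DM) \<longlonglongrightarrow> (\<integral>x. \<phi> x *\<^sub>R g x \<partial>DM)"
    proof (rule LIM_zero_cancel, rule Lim_null_comparison)
      have "(\<lambda>n. nL2 \<phi> * nL2 (wg (f n) - g)) \<longlonglongrightarrow> nL2 \<phi> * 0"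
        by (intro tendsto_intros g)
      then show "(\<lambda>n. nL2 \<phi> * nL2 (wg (f n) - g)) \<longlonglongrightarrow> 0" by simp
      show "\<forall>\<^sub>F n in sequentially. norm ((\<integral>x. \<phi> x *\<^sub>R wg (f n) x \<partial>DM) - (\<integral>x. \<phi> x *\<^sub>R g x \<partial>DM)) \<le> nL2 \<phi> * nL2 (wg (f n) - g)"
      proof (intro always_eventually allI)
        fix n
        have "(\<integral>x. \<phi> x *\<^sub>R wg (f n) x \<partial>DM) - (\<integral>x. \<phi> x *\<^sub>R g x \<partial>DM) = (\<integral>x. \<phi> x *\<^sub>R (wg (f n) - g) x \<partial>DM)"
          using L2_scaleR_integrable(1)[OF t(1) H1_D(3)[OF fH]] L2_scaleR_integrable(1)[OF t(1) g(1)] by (simp add: scaleR_diff_right)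
        then show "norm ((\<integral>x. \<phi> x *\<^sub>R wg (f n) x \<partial>DM) - (\<integral>x. \<phi> x *\<^sub>R g x \<partial>DM)) \<le> nL2 \<phi> * nL2 (wg (f n) - g)"
          using L2_scaleR_integrable(2)[OF t(1) G.diff_mem[OF H1_D(3)[OF fH] g(1)]] by simp
      qed
    qed
    have eq: "(\<integral>x. f n x *\<^sub>R grad \<phi> x \<partial>DM) = - (\<integral>x. \<phi> x *\<^sub>R wg (f n) x \<partial>DM)" for n
      using H1_D(2)[OF fH] \<phi> by (simp add: is_weak_grad_def)
    show "(\<integral>x. u x *\<^sub>R grad \<phi> x \<partial>DM) = - (\<integral>x. \<phi> x *\<^sub>R g x \<partial>DM)"
      by (rule LIMSEQ_unique[OF l1[unfolded eq] tendsto_minus[OF l2]])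
  qed
  then have uH: "u \<in> H1S" using u by (auto simp: H1_space_def)
  \<comment> \<open>The limit of the gradients and the chosen gradient of the limit may differ on a
    null set.\<close>
  have gw: "nL2 (g - wg u) = 0"
    by (rule is_weak_grad_unique(2)[OF \<open>is_weak_grad D u g\<close> H1_D(2)[OF uH]])
  have "(\<lambda>n. sqrt ((nL2 (f n - u))\<^sup>2 + (nL2 (wg (f n) - g))\<^sup>2)) \<longlonglongrightarrow> sqrt (0\<^sup>2 + 0\<^sup>2)"
    by (intro tendsto_intros u g)
  moreover have "nH1 (f n - u) = sqrt ((nL2 (f n - u))\<^sup>2 + (nL2 (wg (f n) - g))\<^sup>2)" for n
  proof -
    have m: "wg (f n) - wg u \<in> L2" "wg (f n) - g \<in> L2" "g - wg u \<in> L2"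
      using H1_D(3) fH uH g by auto
    have "wg (f n) - wg u - (wg (f n) - g) = g - wg u" by simp
    then have "nL2 (wg (f n) - wg u) = nL2 (wg (f n) - g)"
      using G.N_triangle_rev[OF m(1,2)] gw by simp
    then have "(nH1 (f n - u))\<^sup>2 = (nL2 (f n - u))\<^sup>2 + (nL2 (wg (f n) - g))\<^sup>2"
      using H1_norm_diff_power2[OF fH uH, of n] by simp
    then show ?thesis using H1.N_nonneg[OF H1.diff_mem[OF fH uH]] by (metis real_sqrt_unique)
  qed
  ultimately show "\<exists>u\<in>H1S. (\<lambda>n. nH1 (f n - u)) \<longlonglongrightarrow> 0" using uH by (intro bexI[of _ u]) simp_all
qed

sublocale H1: semi_hilbert "H1S" ip1 "nH1"
  by (rule H1_hilbert)

lemma H10_H1: "u \<in> H10 \<Longrightarrow> u \<in> H1S"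
  by (simp add: H10_space_def)

lemma H10_subspace: "subspace H10"
proof -
  have lin: "a *\<^sub>R u + b *\<^sub>R v \<in> H10" if u: "u \<in> H10" and v: "v \<in> H10" for a b u v
    unfolding H10_space_def
  proof (intro CollectI conjI allI impI)
    note uv = H10_H1[OF u] H10_H1[OF v]
    show m: "a *\<^sub>R u + b *\<^sub>R v \<in> H1S" by (rule H1_lin(1)[OF uv])
    fix e :: real assume e: "e > 0"
    \<comment> \<open>The summand 1 covers \<open>a = b = 0\<close> and makes the final inequality
      strict.\<close>
    define d where "d = e / (\<bar>a\<bar> + \<bar>b\<bar> + 1)"
    have d: "d > 0" using e by (simp add: d_def add_nonneg_pos)
    obtain p where p: "p \<in> test_functions D" "nH1 (u - p) < d"
      using u d unfolding H10_space_def by blast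
    obtain q where q: "q \<in> test_functions D" "nH1 (v - q) < d"
      using v d unfolding H10_space_def by blast
    have pq: "p \<in> H1S" "q \<in> H1S" using p q test_H1 by auto
    have t: "a *\<^sub>R p + b *\<^sub>R q \<in> test_functions D"
      using test_functions_lin[OF p(1) q(1), of a b] by (simp add: plus_fun_def scaleR_fun_def)
    have "(a *\<^sub>R u + b *\<^sub>R v) - (a *\<^sub>R p + b *\<^sub>R q) = a *\<^sub>R (u - p) + b *\<^sub>R (v - q)" by (simp add: algebra_simps)
    then have "nH1 ((a *\<^sub>R u + b *\<^sub>R v) - (a *\<^sub>R p + b *\<^sub>R q)) = nH1 (a *\<^sub>R (u - p) + b *\<^sub>R (v - q))" by simp
    also have "\<dots> \<le> \<bar>a\<bar> * nH1 (u - p) + \<bar>b\<bar> * nH1 (v - q)"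
      using H1.N_triangle[of "a *\<^sub>R (u - p)" "b *\<^sub>R (v - q)"] uv pq by (simp add: H1.N_scale H1.scale_mem H1.diff_mem)
    also have "\<dots> \<le> \<bar>a\<bar> * d + \<bar>b\<bar> * d" using p q by (intro add_mono mult_left_mono) auto
    also have "\<dots> < (\<bar>a\<bar> + \<bar>b\<bar> + 1) * d" using d by (simp add: algebra_simps)
    also have "\<dots> = e" by (simp add: d_def add_nonneg_pos)
    finally show "\<exists>\<phi>\<in>test_functions D. nH1 ((a *\<^sub>R u + b *\<^sub>R v) - \<phi>) < e" using t by blast
  qed
  have "0 \<in> H10" unfolding H10_space_def
  proof (intro CollectI conjI allI impI)
    show "0 \<in> H1S" by simp
    fix e :: real assume "e > 0"
    then show "\<exists>\<phi>\<in>test_functions D. nH1 (0 - \<phi>) < e"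
      using test_functions_zero by (intro bexI[of _ 0]) (auto simp: zero_fun_def[symmetric])
  qed
  then show ?thesis using lin[of _ _ 1 1] lin[of _ _ _ 0] by (intro subspaceI) auto
qed

lemma H10_semi_inner: "semi_inner H10 ip1 nH1"
proof
  show "subspace H10" by (rule H10_subspace)
  show "ip1 x y = ip1 y x" if "x \<in> H10" "y \<in> H10" for x y
    by (rule H1.ip_commute[OF H10_H1[OF that(1)] H10_H1[OF that(2)]])
qed (auto simp: H1.ip_add_left H1.ip_scale_left H1.ip_nonneg H1.N_eq H10_H1)

sublocale X: semi_inner "H10" ip1 "nH1"
  by (rule H10_semi_inner)

lemma H10_hilbert: "semi_hilbert H10 ip1 nH1"
proof
  fix f assume f: "X.Cau f"
  have fX: "f n \<in> H10" for n using f by (simp add: X.Cau_def)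
  have "H1.Cau f" using f H10_H1 by (auto simp: X.Cau_def H1.Cau_def)
  then obtain u where u: "u \<in> H1S" "(\<lambda>n. nH1 (f n - u)) \<longlonglongrightarrow> 0" using H1.Cau_converges by blast
  have "u \<in> H10"
    unfolding H10_space_def
  proof (intro CollectI conjI allI impI u(1))
    fix e :: real assume e: "e > 0"
    obtain n where n: "nH1 (f n - u) < e / 2"
      using order_tendstoD(2)[OF u(2), of "e/2"] e by (auto simp: eventually_sequentially)
    obtain p where p: "p \<in> test_functions D" "nH1 (f n - p) < e / 2"
      using fX[of n] half_gt_zero[OF e] unfolding H10_space_def by blast
    have "nH1 (u - p) \<le> nH1 (u - f n) + nH1 (f n - p)"
      by (rule H1.N_triangle4[OF u(1) H10_H1[OF fX] test_H1[OF p(1)]])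
    then have "nH1 (u - p) < e" using n p(2) H1.N_diff_commute[OF u(1) H10_H1[OF fX], of n] by linarith
    then show "\<exists>\<phi>\<in>test_functions D. nH1 (u - \<phi>) < e" using p(1) by blast
  qed
  then show "\<exists>u\<in>H10. (\<lambda>n. nH1 (f n - u)) \<longlonglongrightarrow> 0" using u(2) by blast
qed

sublocale X: semi_hilbert "H10" ip1 "nH1"
  by (rule H10_hilbert)

section \<open>Riesz representation of the dual space\<close>

definition rep :: "((real ^ 'n \<Rightarrow> real) \<Rightarrow> real) \<Rightarrow> real ^ 'n \<Rightarrow> real" where
  "rep F = (SOME r. r \<in> H10 \<and> (\<forall>v\<in>H10. F v = ip1 r v))"

text \<open>The supremum in the dual norm is attained at \<open>r\<close> divided by its norm. If
  \<open>r\<close> is null, the value at 0 shows that the supremum is not negative.\<close>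

lemma Hm1_if_rep:
  assumes r: "r \<in> H10" and F: "\<And>v. v \<in> H10 \<Longrightarrow> F v = ip1 r v"
  shows "F \<in> Hm1_space D" "Hm1_norm D F = nH1 r"
proof -
  show "F \<in> Hm1_space D"
    unfolding Hm1_space_def
  proof (intro CollectI conjI ballI allI exI)
    fix u v a b assume uv: "u \<in> H10" "v \<in> H10"
    have "(\<lambda>x. a * u x + b * v x) = a *\<^sub>R u + b *\<^sub>R v" by (simp add: fun_eq_iff)
    then show "F (\<lambda>x. a * u x + b * v x) = a * F u + b * F v"
      using uv r by (simp add: F X.add_mem X.scale_mem X.ip_add_right X.ip_scale_right)
    show "\<bar>F u\<bar> \<le> nH1 r * nH1 u" using uv r by (simp add: F X.Cauchy_Schwarz)
  qed
  have bd: "\<bar>F u\<bar> \<le> nH1 r" if "u \<in> H10" "nH1 u \<le> 1" for u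
  proof -
    have "\<bar>F u\<bar> \<le> nH1 r * nH1 u" using that r by (simp add: F X.Cauchy_Schwarz)
    also have "\<dots> \<le> nH1 r * 1" using that r by (intro mult_left_mono X.N_nonneg)
    finally show ?thesis by simp
  qed
  show "Hm1_norm D F = nH1 r"
  proof (rule antisym)
    show "Hm1_norm D F \<le> nH1 r"
      unfolding Hm1_norm_def
    proof (rule cSUP_least)
      have "0 \<in> {u \<in> H10. nH1 u \<le> 1}" using X.zero_mem X.N_zero by simp
      then show "{u \<in> H10. nH1 u \<le> 1} \<noteq> {}" by blast
    qed (use bd in auto)
    show "nH1 r \<le> Hm1_norm D F"
    proof (cases "nH1 r = 0")
      case False
      then have pos: "nH1 r > 0" using X.N_nonneg[OF r] by simp
      define u where "u = (1 / nH1 r) *\<^sub>R r"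
      have u: "u \<in> H10" "nH1 u \<le> 1" using r pos by (auto simp: u_def X.N_scale)
      have "F u = nH1 r"
        using r pos X.N_power2[OF r] by (simp add: F[OF u(1)]) (simp add: u_def X.ip_scale_right power2_eq_square field_simps)
      then have "nH1 r \<le> \<bar>F u\<bar>" by simp
      also have "\<dots> \<le> Hm1_norm D F"
        unfolding Hm1_norm_def by (rule cSUP_upper) (use u bd in \<open>auto intro!: bdd_aboveI\<close>)
      finally show ?thesis .
    next
      case True
      have z: "0 \<in> {u \<in> H10. nH1 u \<le> 1}" using X.zero_mem X.N_zero by simp
      have "\<bar>F 0\<bar> \<le> Hm1_norm D F"
        unfolding Hm1_norm_def by (rule cSUP_upper[OF z]) (use bd in \<open>auto intro!: bdd_aboveI\<close>)
      then show ?thesis using True by simp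
    qed
  qed
qed

lemma rep:
  assumes F: "F \<in> Hm1_space D"
  shows "rep F \<in> H10" "v \<in> H10 \<Longrightarrow> ip1 (rep F) v = F v"
proof -
  obtain K where K: "\<forall>u\<in>H10. \<bar>F u\<bar> \<le> K * nH1 u" using F by (auto simp: Hm1_space_def)
  have "\<exists>r. r \<in> H10 \<and> (\<forall>v\<in>H10. F v = ip1 r v)"
  proof (rule X.Riesz[where F = F and K = K])
    show "F (a *\<^sub>R x + b *\<^sub>R y) = a * F x + b * F y" if "x \<in> H10" "y \<in> H10" for x y a b
    proof -
      have "a *\<^sub>R x + b *\<^sub>R y = (\<lambda>t. a * x t + b * y t)" by (simp add: fun_eq_iff)
      then show ?thesis using F that by (simp add: Hm1_space_def)
    qed
    show "\<bar>F x\<bar> \<le> K * nH1 x" if "x \<in> H10" for x using K that by blast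
  next
    fix p assume "p \<in> H10" "\<And>y. y \<in> H10 \<Longrightarrow> ip1 p y = F y"
    then show ?thesis by (intro exI[of _ p]) simp
  qed
  then have "rep F \<in> H10 \<and> (\<forall>v\<in>H10. F v = ip1 (rep F) v)" unfolding rep_def by (rule someI_ex)
  then show "rep F \<in> H10" "v \<in> H10 \<Longrightarrow> ip1 (rep F) v = F v" by auto
qed

lemma rep_isometry:
  assumes F: "F \<in> Hm1_space D" and G: "G \<in> Hm1_space D"
  shows "nH1 (rep F - rep G) = Hm1_norm D (F - G)" "nH1 (rep F) = Hm1_norm D F"
proof -
  show "nH1 (rep F - rep G) = Hm1_norm D (F - G)"
    by (rule Hm1_if_rep(2)[symmetric]) (use rep[OF F] rep[OF G] in \<open>auto simp: X.ip_diff_left\<close>)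
  show "nH1 (rep F) = Hm1_norm D F"
    by (rule Hm1_if_rep(2)[symmetric]) (use rep[OF F] in auto)
qed

lemma ip1_isometry:
  assumes r: "r \<in> H10" and s: "s \<in> H10"
  shows "ip1 r \<in> Hm1_space D" "Hm1_norm D (ip1 r - ip1 s) = nH1 (r - s)" "Hm1_norm D (ip1 r) = nH1 r"
proof -
  show "ip1 r \<in> Hm1_space D" "Hm1_norm D (ip1 r) = nH1 r" using Hm1_if_rep[OF r] by auto
  show "Hm1_norm D (ip1 r - ip1 s) = nH1 (r - s)"
    by (rule Hm1_if_rep(2)) (use r s in \<open>auto simp: X.ip_diff_left\<close>)
qed

end

section \<open>Elliptic operators\<close>

lemma norm_matrix_vector_mult_le:
  fixes A :: "real ^ 'm ^ 'n"
  shows "norm (A *v x) \<le> norm A * norm x"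
proof -
  have "norm (A *v x) = L2_set (\<lambda>i. norm ((A *v x) $ i)) UNIV" by (rule norm_vec_def)
  also have "\<dots> \<le> L2_set (\<lambda>i. norm (A $ i) * norm x) UNIV"
  proof (rule L2_set_mono)
    fix i
    have "(A *v x) $ i = A $ i \<bullet> x" by (simp add: matrix_vector_mult_def inner_vec_def)
    then show "norm ((A *v x) $ i) \<le> norm (A $ i) * norm x"
      using Cauchy_Schwarz_ineq2[of "A $ i" x] by simp
  qed simp
  also have "\<dots> = norm A * norm x" by (simp add: L2_set_left_distrib[symmetric] norm_vec_def[of A])
  finally show ?thesis .
qed

text \<open>The matrix of the second order term and the vector of the first order term act together
  on a gradient. Paired with \<open>jet y\<close>, which collects the gradient and the value of
  \<open>y\<close>, the flux gives both terms of the weak form in one inner product.\<close>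

definition flux :: "(real ^ 'n ^ 'n) \<times> (real ^ 'n) \<Rightarrow> real ^ 'n \<Rightarrow> (real ^ 'n) \<times> real" where
  "flux c g = (fst c *v g, snd c \<bullet> g)"

lemma norm_flux_le: "norm (flux c g) \<le> norm c * norm g"
proof -
  have 1: "norm (fst c *v g) \<le> norm (fst c) * norm g" by (rule norm_matrix_vector_mult_le)
  have 2: "\<bar>snd c \<bullet> g\<bar> \<le> norm (snd c) * norm g" by (rule Cauchy_Schwarz_ineq2)
  have "(norm (flux c g))\<^sup>2 = (norm (fst c *v g))\<^sup>2 + \<bar>snd c \<bullet> g\<bar>\<^sup>2"
    by (simp add: flux_def norm_Pair)
  also have "\<dots> \<le> (norm (fst c) * norm g)\<^sup>2 + (norm (snd c) * norm g)\<^sup>2"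
    using 1 2 by (intro add_mono power_mono) auto
  also have "\<dots> = (norm c * norm g)\<^sup>2"
    by (cases c) (simp add: norm_Pair power_mult_distrib distrib_right)
  finally show ?thesis by (rule power2_le_imp_le) simp
qed

lemma flux_add_scaleR: "flux c (a *\<^sub>R g + b *\<^sub>R h) = a *\<^sub>R flux c g + b *\<^sub>R flux c h"
  by (simp add: flux_def inner_add_right inner_commute matrix_vector_right_distrib matrix_vector_mult_scaleR)

lemma flux_diff_left: "flux (c - d) g = flux c g - flux d g"
  by (simp add: flux_def matrix_vector_mult_diff_rdistrib inner_diff_left)

lemma flux_scaleR_right: "flux c (a *\<^sub>R g) = a *\<^sub>R flux c g"
  using flux_add_scaleR[of c a g 0 0] by simp

lemma flux_diff_right: "flux c (g - h) = flux c g - flux c h"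
  using flux_add_scaleR[of c 1 g "-1" h] by simp

lemma continuous_on_flux: "continuous_on UNIV (\<lambda>(c, g). flux c g)"
proof -
  have "bilinear (flux :: (real ^ 'n ^ 'n) \<times> (real ^ 'n) \<Rightarrow> _)"
    unfolding bilinear_def
    by (intro conjI allI linearI)
      (auto simp: flux_def inner_add_right inner_add_left matrix_vector_right_distrib matrix_vector_mult_scaleR
        matrix_vector_mult_add_rdistrib scaleR_matrix_vector_assoc)
  then have "bounded_bilinear (flux :: (real ^ 'n ^ 'n) \<times> (real ^ 'n) \<Rightarrow> _)" by (simp add: bilinear_conv_bounded_bilinear)
  from bounded_bilinear.continuous_on[OF this continuous_on_fst[OF continuous_on_id] continuous_on_snd[OF continuous_on_id]]
  show ?thesis by (simp add: case_prod_beta')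
qed

lemma borel_measurable_flux [measurable]:
  assumes [measurable]: "c \<in> borel_measurable M" "g \<in> borel_measurable M"
  shows "(\<lambda>x. flux (c x) (g x)) \<in> borel_measurable M"
proof -
  have "(\<lambda>(c, g). flux c g :: (real ^ 'n) \<times> real) \<in> borel_measurable borel"
    by (rule borel_measurable_continuous_onI[OF continuous_on_flux])
  from measurable_compose[OF borel_measurable_Pair[OF assms] this] show ?thesis by simp
qed

lemma L2_norm_cong: "(\<And>x. x \<in> space M \<Longrightarrow> norm (f x) = norm (g x)) \<Longrightarrow> L2_norm M f = L2_norm M g"
  unfolding L2_norm_def by (intro arg_cong[where f = sqrt] Bochner_Integration.integral_cong) auto

context bounded_domain
begin

sublocale J: semi_hilbert "L2 :: (real ^ 'n \<Rightarrow> (real ^ 'n) \<times> real) set" "ip2" "nL2"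
  by (rule semi_hilbert_L2[OF DM])

definition jet :: "(real ^ 'n \<Rightarrow> real) \<Rightarrow> real ^ 'n \<Rightarrow> (real ^ 'n) \<times> real" where
  "jet u x = (wg u x, u x)"

lemma jet_L2:
  assumes u: "u \<in> H1S" shows "jet u \<in> L2" "nL2 (jet u) = nH1 u"
proof -
  note m = H1_D(1)[OF u] H1_D(3)[OF u]
  have i: "integrable DM (\<lambda>x. (norm (u x))\<^sup>2)" "integrable DM (\<lambda>x. (norm (wg u x))\<^sup>2)" using m by (auto simp: L2_space_def)
  have eq: "(norm (jet u x))\<^sup>2 = (norm (u x))\<^sup>2 + (norm (wg u x))\<^sup>2" for x
    by (simp add: jet_def norm_Pair)
  show "jet u \<in> L2"
    unfolding L2_space_def mem_Collect_eq eq using m i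
    by (auto simp: L2_space_def jet_def[abs_def] intro!: borel_measurable_Pair)
  show "nL2 (jet u) = nH1 u"
    unfolding L2_norm_def H1_norm_def eq using i by simp
qed

lemma jet_lin:
  assumes "u \<in> H1S" "v \<in> H1S"
  shows "nL2 (jet (a *\<^sub>R u + b *\<^sub>R v) - (a *\<^sub>R jet u + b *\<^sub>R jet v)) = 0"
proof -
  have "nL2 (jet (a *\<^sub>R u + b *\<^sub>R v) - (a *\<^sub>R jet u + b *\<^sub>R jet v)) =
      nL2 (wg (a *\<^sub>R u + b *\<^sub>R v) - (a *\<^sub>R wg u + b *\<^sub>R wg v))"
    by (rule L2_norm_cong) (simp add: jet_def norm_Pair)
  then show ?thesis using H1_lin(2)[OF assms] by simp
qed

text \<open>For \<open>e = (F, s)\<close> this represents, in the dual of \<open>H10\<close>, the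
  distribution \<open>s - div F\<close>.\<close>

definition flux_rep :: "(real ^ 'n \<Rightarrow> (real ^ 'n) \<times> real) \<Rightarrow> real ^ 'n \<Rightarrow> real" where
  "flux_rep e = rep (\<lambda>y. ip2 e (jet y))"

lemma flux_rep:
  assumes e: "e \<in> L2"
  shows "flux_rep e \<in> H10" "y \<in> H10 \<Longrightarrow> ip1 (flux_rep e) y = ip2 e (jet y)"
proof -
  have F: "(\<lambda>y. ip2 e (jet y)) \<in> Hm1_space D"
    unfolding Hm1_space_def
  proof (intro CollectI conjI ballI allI exI)
    fix u v a b assume uv: "u \<in> H10" "v \<in> H10"
    note H = H10_H1[OF uv(1)] H10_H1[OF uv(2)]
    have eq: "(\<lambda>x. a * u x + b * v x) = a *\<^sub>R u + b *\<^sub>R v" by (simp add: fun_eq_iff)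
    note j = jet_L2(1)[OF H(1)] jet_L2(1)[OF H(2)]
    have m: "jet (a *\<^sub>R u + b *\<^sub>R v) \<in> L2" "a *\<^sub>R jet u + b *\<^sub>R jet v \<in> L2"
      using j H by (auto intro!: jet_L2(1))
    have "ip2 e (jet (a *\<^sub>R u + b *\<^sub>R v)) = ip2 (jet (a *\<^sub>R u + b *\<^sub>R v)) e"
      by (rule J.ip_commute[OF e m(1)])
    also have "\<dots> = ip2 (a *\<^sub>R jet u + b *\<^sub>R jet v) e"
      by (rule J.ip_null_cong[OF m e jet_lin[OF H]])
    also have "\<dots> = ip2 e (a *\<^sub>R jet u + b *\<^sub>R jet v)"
      by (rule J.ip_commute[OF m(2) e])
    also have "\<dots> = a * ip2 e (jet u) + b * ip2 e (jet v)"
      using J.scale_mem j e by (simp add: J.ip_add_right J.ip_scale_right)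
    finally show "ip2 e (jet (\<lambda>x. a * u x + b * v x)) =
      a * ip2 e (jet u) + b * ip2 e (jet v)" by (simp only: eq)
    show "\<bar>ip2 e (jet u)\<bar> \<le> nL2 e * nH1 u"
      using J.Cauchy_Schwarz[OF e j(1)] by (simp add: jet_L2(2)[OF H(1)])
  qed
  show "flux_rep e \<in> H10" "y \<in> H10 \<Longrightarrow> ip1 (flux_rep e) y = ip2 e (jet y)"
    unfolding flux_rep_def using rep[OF F] by auto
qed

text \<open>The constant is 1 because \<open>jet\<close> is norm preserving from H1 to L2.\<close>

lemma flux_rep_lipschitz:
  assumes e: "e \<in> L2" and d: "d \<in> L2"
  shows "nH1 (flux_rep e - flux_rep d) \<le> nL2 (e - d)" "nH1 (flux_rep e) \<le> nL2 e"
proof -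
  have ed: "e - d \<in> L2" by (rule J.diff_mem[OF e d])
  show "nH1 (flux_rep e - flux_rep d) \<le> nL2 (e - d)"
  proof (rule X.N_le_if_ip[OF X.diff_mem[OF flux_rep(1)[OF e] flux_rep(1)[OF d]] J.N_nonneg[OF ed]])
    fix y assume y: "y \<in> H10"
    have "ip1 (flux_rep e - flux_rep d) y = ip2 (e - d) (jet y)"
      using flux_rep[OF e] flux_rep[OF d] y jet_L2(1)[OF H10_H1[OF y]] e d by (simp add: X.ip_diff_left J.ip_diff_left)
    then show "\<bar>ip1 (flux_rep e - flux_rep d) y\<bar> \<le> nL2 (e - d) * nH1 y"
      using J.Cauchy_Schwarz[OF ed jet_L2(1)[OF H10_H1[OF y]]] by (simp add: jet_L2(2)[OF H10_H1[OF y]])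
  qed
  show "nH1 (flux_rep e) \<le> nL2 e"
  proof (rule X.N_le_if_ip[OF flux_rep(1)[OF e] J.N_nonneg[OF e]])
    fix y assume y: "y \<in> H10"
    show "\<bar>ip1 (flux_rep e) y\<bar> \<le> nL2 e * nH1 y"
      using J.Cauchy_Schwarz[OF e jet_L2(1)[OF H10_H1[OF y]]] by (simp add: flux_rep(2)[OF e y] jet_L2(2)[OF H10_H1[OF y]])
  qed
qed

lemma H10_null_if_ip:
  assumes "w \<in> H10" "\<And>y. y \<in> H10 \<Longrightarrow> ip1 w y = 0" shows "nH1 w = 0"
  using X.N_power2[OF assms(1)] assms by simp

lemma flux_rep_lin:
  assumes e: "e \<in> L2" and d: "d \<in> L2"
  shows "nH1 (flux_rep (a *\<^sub>R e + b *\<^sub>R d) - (a *\<^sub>R flux_rep e + b *\<^sub>R flux_rep d)) = 0"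
proof (rule H10_null_if_ip)
  have m: "a *\<^sub>R e + b *\<^sub>R d \<in> L2" using e d by auto
  note r = flux_rep(1)[OF e] flux_rep(1)[OF d] flux_rep(1)[OF m]
  show "flux_rep (a *\<^sub>R e + b *\<^sub>R d) - (a *\<^sub>R flux_rep e + b *\<^sub>R flux_rep d) \<in> H10"
    by (intro X.diff_mem X.add_mem X.scale_mem r)
  fix y assume y: "y \<in> H10"
  note j = jet_L2(1)[OF H10_H1[OF y]]
  have "ip1 (flux_rep (a *\<^sub>R e + b *\<^sub>R d) - (a *\<^sub>R flux_rep e + b *\<^sub>R flux_rep d)) y =
      ip1 (flux_rep (a *\<^sub>R e + b *\<^sub>R d)) y - (a * ip1 (flux_rep e) y + b * ip1 (flux_rep d) y)"
    using r y by (simp add: X.ip_diff_left X.ip_add_left X.ip_scale_left X.add_mem X.scale_mem)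
  also have "\<dots> = 0"
    using e d j y by (simp add: flux_rep(2)[OF e y] flux_rep(2)[OF d y] flux_rep(2)[OF m y] J.ip_add_left J.ip_scale_left J.scale_mem)
  finally show "ip1 (flux_rep (a *\<^sub>R e + b *\<^sub>R d) - (a *\<^sub>R flux_rep e + b *\<^sub>R flux_rep d)) y = 0" .
qed

definition coefficients :: "real \<Rightarrow> (real ^ 'n \<Rightarrow> (real ^ 'n ^ 'n) \<times> (real ^ 'n)) set" where
  "coefficients K = {c \<in> borel_measurable DM. \<forall>x\<in>D. norm (c x) \<le> K}"

lemma coefficients_continuous:
  assumes "continuous_on D c" "\<And>x. x \<in> D \<Longrightarrow> norm (c x) \<le> K" shows "c \<in> coefficients K"
  using assms by (simp add: coefficients_def continuous_imp_measurable_on_sets_lebesgue D_lebesgue)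

lemma flux_L2:
  assumes c: "c \<in> coefficients K" and g: "g \<in> L2" and K: "K \<ge> 0"
  shows "(\<lambda>x. flux (c x) (g x)) \<in> L2" "nL2 (\<lambda>x. flux (c x) (g x)) \<le> K * nL2 g"
proof -
  have [measurable]: "c \<in> borel_measurable DM" "g \<in> borel_measurable DM" using c g by (auto simp: coefficients_def L2_space_def)
  have m: "(\<lambda>x. flux (c x) (g x)) \<in> borel_measurable DM" by measurable
  have le: "AE x in DM. norm (flux (c x) (g x)) \<le> K * norm (g x)"
  proof (rule AE_I2)
    fix x assume "x \<in> space DM"
    then have "norm (c x) * norm (g x) \<le> K * norm (g x)" using c by (intro mult_right_mono) (auto simp: coefficients_def)
    then show "norm (flux (c x) (g x)) \<le> K * norm (g x)" using norm_flux_le[of "c x" "g x"] by linarith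
  qed
  show "(\<lambda>x. flux (c x) (g x)) \<in> L2" "nL2 (\<lambda>x. flux (c x) (g x)) \<le> K * nL2 g"
    by (rule L2_norm_dominated[OF DM(1) g m le K])+
qed

lemma flux_tendsto:
  assumes c: "\<And>k::nat. c k \<in> coefficients K" "d \<in> coefficients K" and K: "K \<ge> 0"
    and lim: "\<And>x. x \<in> D \<Longrightarrow> (\<lambda>k. c k x) \<longlonglongrightarrow> d x" and g: "g \<in> L2"
  shows "(\<lambda>k. nL2 ((\<lambda>x. flux (c k x) (g x)) - (\<lambda>x. flux (d x) (g x)))) \<longlonglongrightarrow> 0"
proof -
  have [measurable]: "c k \<in> borel_measurable DM" "d \<in> borel_measurable DM" "g \<in> borel_measurable DM" for k
    using c g by (auto simp: coefficients_def L2_space_def)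
  have bd: "norm (flux (c k x - d x) (g x)) \<le> norm (c k x - d x) * norm (g x)" for k x by (rule norm_flux_le)
  have le: "(norm (flux (c k x - d x) (g x)))\<^sup>2 \<le> (2 * K)\<^sup>2 * (norm (g x))\<^sup>2" if "x \<in> D" for k x
  proof -
    have "norm (c k x - d x) \<le> 2 * K"
      using norm_triangle_ineq4[of "c k x" "d x"] c(1)[of k] c(2) that by (simp add: coefficients_def) (smt (verit))
    then have "norm (c k x - d x) * norm (g x) \<le> 2 * K * norm (g x)" by (intro mult_right_mono) auto
    then have "(norm (flux (c k x - d x) (g x)))\<^sup>2 \<le> (2 * K * norm (g x))\<^sup>2" using bd[of k x] by (intro power_mono) auto
    then show ?thesis by (simp add: power_mult_distrib)
  qed
  have "(\<lambda>k. \<integral>x. (norm (flux (c k x - d x) (g x)))\<^sup>2 \<partial>DM) \<longlonglongrightarrow> (\<integral>x. 0 \<partial>DM)"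
  proof (rule integral_dominated_convergence)
    show "integrable DM (\<lambda>x. (2 * K)\<^sup>2 * (norm (g x))\<^sup>2)" using g by (simp add: L2_space_def)
    show "AE x in DM. norm ((norm (flux (c k x - d x) (g x)))\<^sup>2) \<le> (2 * K)\<^sup>2 * (norm (g x))\<^sup>2" for k
      using le by (intro AE_I2) simp
    show "AE x in DM. (\<lambda>k. (norm (flux (c k x - d x) (g x)))\<^sup>2) \<longlonglongrightarrow> 0"
    proof (rule AE_I2)
      fix x assume "x \<in> space DM"
      then have "(\<lambda>k. c k x - d x) \<longlonglongrightarrow> 0" using lim by (simp add: LIM_zero_iff)
      then have "(\<lambda>k. norm (c k x - d x) * norm (g x)) \<longlonglongrightarrow> 0 * norm (g x)"
        by (intro tendsto_mult tendsto_norm_zero tendsto_const)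
      then have "(\<lambda>k. norm (c k x - d x) * norm (g x)) \<longlonglongrightarrow> 0" by simp
      then have "(\<lambda>k. norm (flux (c k x - d x) (g x))) \<longlonglongrightarrow> 0"
        by (rule Lim_null_comparison[rotated]) (simp add: bd)
      from tendsto_power[OF this, of 2] show "(\<lambda>k. (norm (flux (c k x - d x) (g x)))\<^sup>2) \<longlonglongrightarrow> 0" by simp
    qed
  qed simp_all
  from tendsto_real_sqrt[OF this] show ?thesis by (simp add: L2_norm_def flux_diff_left)
qed

text \<open>The coefficients are measurable in \<omega> at fixed points and continuous in space.
  Evaluating them at the simple function \<open>q k x\<close> instead of \<open>x\<close> leaves
  finitely many random matrix-vector pairs, each multiplied by a fixed L2 function; dominated
  convergence removes the discretisation.\<close>

lemma sm_flux:
  fixes c :: "'w \<Rightarrow> real ^ 'n \<Rightarrow> (real ^ 'n ^ 'n) \<times> (real ^ 'n)"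
  assumes M: "complete_measure M" and meas: "\<And>x. x \<in> D \<Longrightarrow> (\<lambda>\<omega>. c \<omega> x) \<in> borel_measurable M"
    and cont: "\<And>\<omega>. continuous_on D (c \<omega>)" and bd: "\<And>\<omega> x. x \<in> D \<Longrightarrow> norm (c \<omega> x) \<le> K" and K: "K \<ge> 0"
    and g: "g \<in> L2"
  shows "smeas M L2 nL2 (\<lambda>\<omega> x. flux (c \<omega> x) (g x))"
proof -
  \<comment> \<open>The points \<open>q k x\<close> may leave \<open>D\<close>, where neither
    measurability nor the bound is available; the value there is 0. For large \<open>k\<close> they
    lie in the open set \<open>D\<close>, so the limit is not affected.\<close>
  define c' where "c' \<omega> x = (if x \<in> D then c \<omega> x else 0)" for \<omega> x
  have c'M: "(\<lambda>\<omega>. c' \<omega> p) \<in> borel_measurable M" for p using meas[of p] by (cases "p \<in> D") (simp_all add: c'_def)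
  have gm[measurable]: "g \<in> borel_measurable DM" using g by (auto simp: L2_space_def)
  have "(\<lambda>x::real^'n. x) \<in> borel_measurable DM" by (intro measurable_restrict_space1 measurable_completion) simp
  from borel_measurable_implies_sequence_metric[OF this, of 0]
  obtain q where "\<forall>k. simple_function DM (q k)" "\<forall>x\<in>D. (\<lambda>k. q k x) \<longlonglongrightarrow> x" by auto
  then have q: "\<And>k. simple_function DM (q k)" "\<And>x. x \<in> D \<Longrightarrow> (\<lambda>k. q k x) \<longlonglongrightarrow> x" by auto
  define S where "S k = q k ` D" for k :: nat
  have S: "finite (S k)" for k using simple_functionD(1)[OF q(1)] by (simp add: S_def)
  \<comment> \<open>The part of \<open>g\<close> on the cell where \<open>q k\<close> has the value
    \<open>p\<close>.\<close>
  define G where "G k p x = indicator (q k -` {p} \<inter> D) x *\<^sub>R g x" for k p x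
  have Gmem: "G k p \<in> L2" for k p
  proof (rule L2_norm_dominated(1)[OF DM(1) g])
    have "q k -` {p} \<inter> space DM \<in> sets DM" using simple_functionD(2)[OF q(1)] by blast
    then show "G k p \<in> borel_measurable DM" unfolding G_def[abs_def] by (intro borel_measurable_scaleR borel_measurable_indicator gm) simp
    show "AE x in DM. norm (G k p x) \<le> 1 * norm (g x)" by (intro AE_I2) (simp add: G_def indicator_def)
  qed simp
  have const: "(\<lambda>_. a) \<in> coefficients (norm a)" for a by (simp add: coefficients_def)
  have summand: "smeas M L2 nL2 (\<lambda>\<omega> x. flux (c' \<omega> p) (G k p x))" for k p
  proof (rule strongly_measurable_map[where L = "\<lambda>a x. flux a (G k p x)" and X = UNIV and N = norm and C = "nL2 (G k p)"])
    show "smeas M UNIV norm (\<lambda>\<omega>. c' \<omega> p)" using c'M by (simp add: strongly_measurable_euclidean[OF M])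
    show "(\<lambda>x. flux a (G k p x)) \<in> L2" for a by (rule flux_L2(1)[OF const Gmem]) simp
    show "nL2 ((\<lambda>x. flux a (G k p x)) - (\<lambda>x. flux b (G k p x))) \<le> nL2 (G k p) * norm (a - b)" for a b
    proof -
      have "(\<lambda>x. flux a (G k p x)) - (\<lambda>x. flux b (G k p x)) = (\<lambda>x. flux (a - b) (G k p x))"
        by (simp add: fun_eq_iff flux_diff_left)
      then show ?thesis using flux_L2(2)[OF const[of "a - b"] Gmem[of k p]] by (simp add: mult.commute)
    qed
    show "0 \<le> nL2 (x - y)" if "x \<in> L2" "y \<in> L2" for x y :: "real ^ 'n \<Rightarrow> (real ^ 'n) \<times> real"
      by (rule J.N_nonneg[OF J.diff_mem[OF that]])
  qed
  have sum: "smeas M L2 nL2 (\<lambda>\<omega> x. \<Sum>p\<in>A. flux (c' \<omega> p) (G k p x))"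
    if "finite A" for A k
    using that
  proof induction
    case empty
    have "(\<lambda>_::real^'n. 0 :: (real ^ 'n) \<times> real) \<in> L2" using J.zero_mem by (simp add: zero_fun_def)
    then show ?case by (simp add: J.sm_const)
  next
    case (insert p A)
    have "(\<lambda>\<omega> x. \<Sum>p\<in>insert p A. flux (c' \<omega> p) (G k p x)) =
        (\<lambda>\<omega>. (\<lambda>x. flux (c' \<omega> p) (G k p x)) + (\<lambda>x. \<Sum>p\<in>A. flux (c' \<omega> p) (G k p x)))"
      using insert.hyps by (simp add: fun_eq_iff)
    then show ?case using J.sm_add[OF summand insert.IH] by simp
  qed
  have eq: "(\<Sum>p\<in>S k. flux (c' \<omega> p) (G k p x)) = flux (c' \<omega> (q k x)) (g x)" if "x \<in> D" for \<omega> k x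
  proof -
    have "flux (c' \<omega> p) (G k p x) = (if p = q k x then flux (c' \<omega> (q k x)) (g x) else 0)" for p
      using that by (auto simp: G_def flux_scaleR_right)
    then show ?thesis using S[of k] that by (simp add: S_def)
  qed
  have coef: "(\<lambda>x. c' \<omega> (q k x)) \<in> coefficients K" "c \<omega> \<in> coefficients K" for \<omega> k
  proof -
    have "(\<lambda>x. c' \<omega> (q k x)) \<in> borel_measurable DM"
      by (intro borel_measurable_simple_function simple_function_compose1[OF q(1)])
    then show "(\<lambda>x. c' \<omega> (q k x)) \<in> coefficients K" using bd K by (simp add: coefficients_def c'_def)
    show "c \<omega> \<in> coefficients K" by (rule coefficients_continuous[OF cont bd])
  qed
  show ?thesis
  proof (rule J.sm_lim[OF M sum[OF S]])
    show "AE \<omega> in M. (\<lambda>x. flux (c \<omega> x) (g x)) \<in> L2"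
      by (intro AE_I2 flux_L2(1)[OF coef(2) g K])
    show "AE \<omega> in M. (\<lambda>n. nL2 ((\<lambda>x. \<Sum>p\<in>S n. flux (c' \<omega> p) (G n p x)) - (\<lambda>x. flux (c \<omega> x) (g x)))) \<longlonglongrightarrow> 0"
    proof (rule AE_I2)
      fix \<omega>
      have "(\<lambda>k. nL2 ((\<lambda>x. flux (c' \<omega> (q k x)) (g x)) - (\<lambda>x. flux (c \<omega> x) (g x)))) \<longlonglongrightarrow> 0"
      proof (rule flux_tendsto[OF coef K _ g])
        fix x assume x: "x \<in> D"
        have "isCont (c \<omega>) x" using cont x D_open continuous_on_eq_continuous_at by blast
        then have "(\<lambda>k. c \<omega> (q k x)) \<longlonglongrightarrow> c \<omega> x" using q(2)[OF x] by (rule isCont_tendsto_compose)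
        moreover have "\<forall>\<^sub>F k in sequentially. c \<omega> (q k x) = c' \<omega> (q k x)"
          using topological_tendstoD[OF q(2)[OF x] D_open x] by eventually_elim (simp add: c'_def)
        ultimately show "(\<lambda>k. c' \<omega> (q k x)) \<longlonglongrightarrow> c \<omega> x" by (rule Lim_transform_eventually)
      qed
      moreover have "nL2 ((\<lambda>x. \<Sum>p\<in>S n. flux (c' \<omega> p) (G n p x)) - (\<lambda>x. flux (c \<omega> x) (g x))) =
          nL2 ((\<lambda>x. flux (c' \<omega> (q n x)) (g x)) - (\<lambda>x. flux (c \<omega> x) (g x)))" for n
        by (rule L2_norm_cong) (simp add: eq)
      ultimately show "(\<lambda>n. nL2 ((\<lambda>x. \<Sum>p\<in>S n. flux (c' \<omega> p) (G n p x)) - (\<lambda>x. flux (c \<omega> x) (g x)))) \<longlonglongrightarrow> 0"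
        by simp
    qed
  qed
qed

definition elliptic :: "(real ^ 'n \<Rightarrow> (real ^ 'n ^ 'n) \<times> (real ^ 'n)) \<Rightarrow> (real ^ 'n \<Rightarrow> real) \<Rightarrow> real ^ 'n \<Rightarrow> real" where
  "elliptic c u = flux_rep (\<lambda>x. flux (c x) (wg u x))"

lemma elliptic:
  assumes c: "c \<in> coefficients K" and K: "K \<ge> 0" and u: "u \<in> H10"
  shows "elliptic c u \<in> H10" "nH1 (elliptic c u) \<le> K * nH1 u"
    "y \<in> H10 \<Longrightarrow> integrable DM (\<lambda>x. (fst (c x) *v wg u x) \<bullet> wg y x)"
    "y \<in> H10 \<Longrightarrow> integrable DM (\<lambda>x. (snd (c x) \<bullet> wg u x) * y x)"
    "y \<in> H10 \<Longrightarrow> ip1 (elliptic c u) y =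
      (\<integral>x. (fst (c x) *v wg u x) \<bullet> wg y x \<partial>DM) + (\<integral>x. (snd (c x) \<bullet> wg u x) * y x \<partial>DM)"
    "y \<in> H10 \<Longrightarrow> \<bar>\<integral>x. (snd (c x) \<bullet> wg u x) * y x \<partial>DM\<bar> \<le> K * nL2 (wg u) * nL2 y"
proof -
  let ?g = "wg u"
  let ?e = "\<lambda>x. flux (c x) (?g x)"
  have g: "?g \<in> L2" by (rule H1_D(3)[OF H10_H1[OF u]])
  note e = flux_L2[OF c g K]
  show "elliptic c u \<in> H10" unfolding elliptic_def by (rule flux_rep(1)[OF e(1)])
  have "nH1 (elliptic c u) \<le> K * nL2 ?g"
    unfolding elliptic_def using flux_rep_lipschitz(2)[OF e(1) e(1)] e(2) by linarith
  also have "\<dots> \<le> K * nH1 u" by (intro mult_left_mono H1_norm_ge K)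
  finally show "nH1 (elliptic c u) \<le> K * nH1 u" .
  assume y: "y \<in> H10"
  note yL = H1_D(1)[OF H10_H1[OF y]] H1_D(3)[OF H10_H1[OF y]]
  have em: "(\<lambda>x. fst (?e x)) \<in> borel_measurable DM" "(\<lambda>x. snd (?e x)) \<in> borel_measurable DM"
    using e(1) measurable_compose[OF _ borel_measurable_continuous_onI[OF continuous_on_fst[OF continuous_on_id]], of ?e]
      measurable_compose[OF _ borel_measurable_continuous_onI[OF continuous_on_snd[OF continuous_on_id]], of ?e]
    unfolding L2_space_def by blast+
  have le: "norm (snd (?e x)) \<le> K * norm (?g x)" "norm (fst (?e x)) \<le> K * norm (?g x)" if "x \<in> D" for x
  proof -
    have "norm (c x) * norm (?g x) \<le> K * norm (?g x)" using c that by (intro mult_right_mono) (auto simp: coefficients_def)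
    then have "norm (?e x) \<le> K * norm (?g x)" using norm_flux_le[of "c x" "?g x"] by linarith
    then show "norm (snd (?e x)) \<le> K * norm (?g x)" "norm (fst (?e x)) \<le> K * norm (?g x)"
      using norm_fst_le[of "fst (?e x)" "snd (?e x)"] norm_snd_le[of "snd (?e x)" "fst (?e x)"] by auto
  qed
  have f: "(\<lambda>x. fst (?e x)) \<in> L2"
    by (rule L2_norm_dominated(1)[OF DM(1) g em(1) _ K]) (use le in \<open>auto intro!: AE_I2\<close>)
  have s: "(\<lambda>x. snd (?e x)) \<in> L2" "nL2 (\<lambda>x. snd (?e x)) \<le> K * nL2 ?g"
    by (rule L2_norm_dominated[OF DM(1) g em(2) _ K], use le in \<open>auto intro!: AE_I2\<close>)+
  have i1: "integrable DM (\<lambda>x. fst (?e x) \<bullet> wg y x)"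
    by (rule semi_inner.L2_ip_integrable[OF semi_hilbert.axioms(1)[OF semi_hilbert_euclidean] DM(1)
          f[unfolded L2_space_eq[OF DM(1)]] yL(2)[unfolded L2_space_eq[OF DM(1)]]])
  have i2: "integrable DM (\<lambda>x. snd (?e x) \<bullet> y x)"
    by (rule semi_inner.L2_ip_integrable[OF semi_hilbert.axioms(1)[OF semi_hilbert_euclidean] DM(1)
          s(1)[unfolded L2_space_eq[OF DM(1)]] yL(1)[unfolded L2_space_eq[OF DM(1)]]])
  show I1: "integrable DM (\<lambda>x. (fst (c x) *v wg u x) \<bullet> wg y x)" using i1 by (simp add: flux_def)
  show I2: "integrable DM (\<lambda>x. (snd (c x) \<bullet> wg u x) * y x)" using i2 by (simp add: flux_def)
  have "ip1 (elliptic c u) y = ip2 ?e (jet y)"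
    unfolding elliptic_def by (rule flux_rep(2)[OF e(1) y])
  also have "\<dots> = (\<integral>x. (fst (c x) *v wg u x) \<bullet> wg y x + (snd (c x) \<bullet> wg u x) * y x \<partial>DM)"
    by (simp add: bochner_inner_def flux_def jet_def)
  also have "\<dots> = (\<integral>x. (fst (c x) *v wg u x) \<bullet> wg y x \<partial>DM) + (\<integral>x. (snd (c x) \<bullet> wg u x) * y x \<partial>DM)"
    using I1 I2 by simp
  finally show "ip1 (elliptic c u) y =
      (\<integral>x. (fst (c x) *v wg u x) \<bullet> wg y x \<partial>DM) + (\<integral>x. (snd (c x) \<bullet> wg u x) * y x \<partial>DM)" .
  have "\<bar>\<integral>x. (snd (c x) \<bullet> wg u x) * y x \<partial>DM\<bar> = \<bar>ip2 (\<lambda>x. snd (?e x)) y\<bar>"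
    by (simp add: bochner_inner_def flux_def)
  also have "\<dots> \<le> nL2 (\<lambda>x. snd (?e x)) * nL2 y" by (rule L.Cauchy_Schwarz[OF s(1) yL(1)])
  also have "\<dots> \<le> K * nL2 ?g * nL2 y" by (intro mult_right_mono s(2) L.N_nonneg yL)
  finally show "\<bar>\<integral>x. (snd (c x) \<bullet> wg u x) * y x \<partial>DM\<bar> \<le> K * nL2 (wg u) * nL2 y" .
qed

lemma elliptic_lin:
  assumes c: "c \<in> coefficients K" and K: "K \<ge> 0" and u: "u \<in> H10" and v: "v \<in> H10"
  shows "nH1 (elliptic c (a *\<^sub>R u + b *\<^sub>R v) - (a *\<^sub>R elliptic c u + b *\<^sub>R elliptic c v)) = 0"
proof -
  let ?e = "\<lambda>u x. flux (c x) (wg u x)"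
  note H = H10_H1[OF u] H10_H1[OF v]
  have w: "a *\<^sub>R u + b *\<^sub>R v \<in> H10" using u v by auto
  note g = H1_D(3)[OF H(1)] H1_D(3)[OF H(2)] H1_D(3)[OF H10_H1[OF w]]
  note e = flux_L2(1)[OF c g(1) K] flux_L2(1)[OF c g(2) K] flux_L2(1)[OF c g(3) K]
  have l: "a *\<^sub>R ?e u + b *\<^sub>R ?e v \<in> L2" using J.scale_mem J.add_mem e by blast
  have d: "wg (a *\<^sub>R u + b *\<^sub>R v) - (a *\<^sub>R wg u + b *\<^sub>R wg v) \<in> L2" using g by auto
  have eq: "?e (a *\<^sub>R u + b *\<^sub>R v) - (a *\<^sub>R ?e u + b *\<^sub>R ?e v) =
      (\<lambda>x. flux (c x) ((wg (a *\<^sub>R u + b *\<^sub>R v) - (a *\<^sub>R wg u + b *\<^sub>R wg v)) x))"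
    by (simp add: fun_eq_iff flux_diff_right flux_add_scaleR)
  have "nL2 (?e (a *\<^sub>R u + b *\<^sub>R v) - (a *\<^sub>R ?e u + b *\<^sub>R ?e v)) \<le> 0"
    unfolding eq using flux_L2(2)[OF c d K] H1_lin(2)[OF H, of a b] by simp
  then have "nH1 (elliptic c (a *\<^sub>R u + b *\<^sub>R v) - flux_rep (a *\<^sub>R ?e u + b *\<^sub>R ?e v)) \<le> 0"
    unfolding elliptic_def using flux_rep_lipschitz(1)[OF e(3) l] by linarith
  moreover have "nH1 (flux_rep (a *\<^sub>R ?e u + b *\<^sub>R ?e v) - (a *\<^sub>R elliptic c u + b *\<^sub>R elliptic c v)) = 0"
    unfolding elliptic_def by (rule flux_rep_lin[OF e(1,2)])
  moreover have m: "elliptic c (a *\<^sub>R u + b *\<^sub>R v) \<in> H10" "flux_rep (a *\<^sub>R ?e u + b *\<^sub>R ?e v) \<in> H10"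
    "a *\<^sub>R elliptic c u + b *\<^sub>R elliptic c v \<in> H10"
    using elliptic(1)[OF c K w] elliptic(1)[OF c K u] elliptic(1)[OF c K v] flux_rep(1)[OF l] by auto
  ultimately show ?thesis
    using X.N_triangle4[OF m] X.N_nonneg[OF X.diff_mem[OF m(1,3)]] by linarith
qed

lemma elliptic_tendsto:
  assumes c: "\<And>k::nat. c k \<in> coefficients K" "d \<in> coefficients K" and K: "K \<ge> 0"
    and lim: "\<And>x. x \<in> D \<Longrightarrow> (\<lambda>k. c k x) \<longlonglongrightarrow> d x" and u: "u \<in> H10"
  shows "(\<lambda>k. nH1 (elliptic (c k) u - elliptic d u)) \<longlonglongrightarrow> 0"
proof (rule Lim_null_comparison)
  have g: "wg u \<in> L2" by (rule H1_D(3)[OF H10_H1[OF u]])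
  show "(\<lambda>k. nL2 ((\<lambda>x. flux (c k x) (wg u x)) - (\<lambda>x. flux (d x) (wg u x)))) \<longlonglongrightarrow> 0"
    by (rule flux_tendsto[OF c K lim g])
  show "\<forall>\<^sub>F k in sequentially. norm (nH1 (elliptic (c k) u - elliptic d u)) \<le>
      nL2 ((\<lambda>x. flux (c k x) (wg u x)) - (\<lambda>x. flux (d x) (wg u x)))"
    using flux_rep_lipschitz(1)[OF flux_L2(1)[OF c(1) g K] flux_L2(1)[OF c(2) g K]]
      X.N_nonneg[OF X.diff_mem[OF elliptic(1)[OF c(1) K u] elliptic(1)[OF c(2) K u]]]
    by (simp add: elliptic_def)
qed

text \<open>Young's inequality lets half of the gradient term absorb the first order term, at the
  price of \<open>K\<^sup>2 / (2 * \<kappa>)\<close> times the squared L2 norm. The remaining half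
  becomes the full H1 norm after adding \<open>\<kappa> / 2\<close> times the squared L2 norm on
  both sides.\<close>

lemma elliptic_Garding:
  assumes c: "c \<in> coefficients K" and K: "K \<ge> 0" and u: "u \<in> H10" and \<kappa>: "\<kappa> > 0"
    and coercive: "\<And>x g. x \<in> D \<Longrightarrow> \<kappa> * (norm g)\<^sup>2 \<le> (fst (c x) *v g) \<bullet> g"
  shows "\<kappa> / 2 * (nH1 u)\<^sup>2 \<le> ip1 (elliptic c u) u + (K\<^sup>2 / (2 * \<kappa>) + \<kappa> / 2) * (nL2 u)\<^sup>2"
proof -
  define p where "p = nL2 (wg u)"
  define s where "s = nL2 u"
  have g: "wg u \<in> L2" by (rule H1_D(3)[OF H10_H1[OF u]])
  have "p\<^sup>2 = (\<integral>x. (norm (wg u x))\<^sup>2 \<partial>DM)" by (simp add: p_def L2_norm_def)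
  then have "\<kappa> * p\<^sup>2 = (\<integral>x. \<kappa> * (norm (wg u x))\<^sup>2 \<partial>DM)" by simp
  also have "\<dots> \<le> (\<integral>x. (fst (c x) *v wg u x) \<bullet> wg u x \<partial>DM)"
    by (rule integral_mono) (use g elliptic(3)[OF c K u u] coercive in \<open>auto simp: L2_space_def\<close>)
  finally have 1: "\<kappa> * p\<^sup>2 \<le> (\<integral>x. (fst (c x) *v wg u x) \<bullet> wg u x \<partial>DM)" .
  have 2: "- (K * p * s) \<le> (\<integral>x. (snd (c x) \<bullet> wg u x) * u x \<partial>DM)"
    using elliptic(6)[OF c K u u] unfolding p_def s_def by linarith
  have "0 \<le> (\<kappa> * p - K * s)\<^sup>2 / (2 * \<kappa>)" using \<kappa> by simp
  also have "\<dots> = \<kappa> / 2 * p\<^sup>2 - K * p * s + K\<^sup>2 / (2 * \<kappa>) * s\<^sup>2"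
    using \<kappa> by (simp add: power2_eq_square field_simps)
  finally have 3: "K * p * s \<le> \<kappa> / 2 * p\<^sup>2 + K\<^sup>2 / (2 * \<kappa>) * s\<^sup>2" by linarith
  have "(nH1 u)\<^sup>2 = s\<^sup>2 + p\<^sup>2" by (simp add: H1_norm_def p_def s_def)
  then have "\<kappa> / 2 * (nH1 u)\<^sup>2 = \<kappa> / 2 * s\<^sup>2 + \<kappa> / 2 * p\<^sup>2" by (simp add: distrib_left)
  also have "\<dots> = \<kappa> * p\<^sup>2 - \<kappa> / 2 * p\<^sup>2 + \<kappa> / 2 * s\<^sup>2" by simp
  also have "\<dots> \<le> ip1 (elliptic c u) u + (K\<^sup>2 / (2 * \<kappa>) * s\<^sup>2 + \<kappa> / 2 * s\<^sup>2)"
    using 1 2 3 elliptic(5)[OF c K u u] by linarith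
  finally show ?thesis unfolding s_def by (simp add: distrib_right)
qed

end

section \<open>Random elliptic operators\<close>

context bounded_domain
begin

lemma elliptic_lipschitz:
  assumes c: "c \<in> coefficients K" and K: "K \<ge> 0" and u: "u \<in> H10" and v: "v \<in> H10"
  shows "nH1 (elliptic c u - elliptic c v) \<le> K * nH1 (u - v)"
proof -
  note d = X.diff_mem[OF u v]
  note m = elliptic(1)[OF c K u] elliptic(1)[OF c K v] elliptic(1)[OF c K d]
  have "nH1 (elliptic c (u - v) - (elliptic c u - elliptic c v)) = 0"
    using elliptic_lin[OF c K u v, of 1 "-1"] by simp
  then show ?thesis
    using X.N_triangle_rev[OF m(3) X.diff_mem[OF m(1,2)]] elliptic(2)[OF c K d] by simp
qed

lemma sm_elliptic:
  fixes c :: "'w \<Rightarrow> real ^ 'n \<Rightarrow> (real ^ 'n ^ 'n) \<times> (real ^ 'n)"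
  assumes M: "complete_measure M" and meas: "\<And>x. x \<in> D \<Longrightarrow> (\<lambda>\<omega>. c \<omega> x) \<in> borel_measurable M"
    and cont: "\<And>\<omega>. continuous_on D (c \<omega>)" and bd: "\<And>\<omega> x. x \<in> D \<Longrightarrow> norm (c \<omega> x) \<le> K" and K: "K \<ge> 0"
    and u: "smeas M H10 nH1 u"
  shows "smeas M H10 nH1 (\<lambda>\<omega>. elliptic (c \<omega>) (u \<omega>))"
proof (rule strongly_measurable_operator[where C = K and X = "H10" and N = "nH1" and f = u and L = "\<lambda>\<omega>. elliptic (c \<omega>)"])
  have c: "c \<omega> \<in> coefficients K" for \<omega> by (rule coefficients_continuous[OF cont bd])
  show "smeas M H10 nH1 (\<lambda>\<omega>. elliptic (c \<omega>) v)" if v: "v \<in> H10" for v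
    unfolding elliptic_def
  proof (rule strongly_measurable_map[where L = flux_rep and C = 1])
    show "smeas M L2 nL2 (\<lambda>\<omega> x. flux (c \<omega> x) (wg v x))"
      by (rule sm_flux[OF M meas cont bd K H1_D(3)[OF H10_H1[OF v]]])
    show "flux_rep e \<in> H10" if "e \<in> L2" for e by (rule flux_rep(1)[OF that])
    show "nH1 (flux_rep e - flux_rep d) \<le> 1 * nL2 (e - d)" if "e \<in> L2" "d \<in> L2" for e d
      using flux_rep_lipschitz(1)[OF that] by simp
    show "0 \<le> nH1 (x - y)" if "x \<in> H10" "y \<in> H10" for x y
      by (rule X.N_nonneg[OF X.diff_mem[OF that]])
  qed
  show "seminormed H10 nH1" "complete_measure M" "smeas M H10 nH1 u"
    by (rule X.seminormed_axioms M u)+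
  show "AE \<omega> in M. \<forall>v\<in>H10. elliptic (c \<omega>) v \<in> H10"
    using elliptic(1)[OF c K] by (intro AE_I2) blast
  show "AE \<omega> in M. \<forall>u\<in>H10. \<forall>v\<in>H10. nH1 (elliptic (c \<omega>) u - elliptic (c \<omega>) v) \<le> K * nH1 (u - v)"
    using elliptic_lipschitz[OF c K] by (intro AE_I2) blast
qed

end

text \<open>The conditions are imposed at every \<omega> rather than almost every one, which keeps
  null sets out of the estimates. Coefficients coming from a flow are modified on a null set to
  fit.\<close>

locale random_elliptic = bounded_domain D
  for D :: "(real ^ 'n) set" +
  fixes P :: "'w measure" and \<tau> :: real
    and c :: "'w \<Rightarrow> real \<Rightarrow> real ^ 'n \<Rightarrow> (real ^ 'n ^ 'n) \<times> (real ^ 'n)" and K \<kappa> :: real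
  assumes P: "complete_measure P" "finite_measure P" and \<tau>: "\<tau> > 0" and K: "K \<ge> 0" and \<kappa>: "\<kappa> > 0"
    and c_meas: "t \<in> {0..\<tau>} \<Longrightarrow> x \<in> D \<Longrightarrow> (\<lambda>\<omega>. c \<omega> t x) \<in> borel_measurable P"
    and c_cont: "t \<in> {0..\<tau>} \<Longrightarrow> continuous_on D (c \<omega> t)"
    and c_cont_time: "x \<in> D \<Longrightarrow> continuous_on {0..\<tau>} (\<lambda>t. c \<omega> t x)"
    and c_bdd: "t \<in> {0..\<tau>} \<Longrightarrow> x \<in> D \<Longrightarrow> norm (c \<omega> t x) \<le> K"
    and c_coercive: "t \<in> {0..\<tau>} \<Longrightarrow> x \<in> D \<Longrightarrow> \<kappa> * (norm g)\<^sup>2 \<le> (fst (c \<omega> t x) *v g) \<bullet> g"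
begin

abbreviation "VP \<equiv> V_space P D"
abbreviation "nV \<equiv> V_norm P D"
abbreviation "HP \<equiv> H_space P D"
abbreviation "nH \<equiv> H_norm P D"
abbreviation "ipH \<equiv> H_inner P D"
abbreviation "LV \<equiv> L2V_space \<tau> P D"
abbreviation "LVd \<equiv> L2Vdual_space \<tau> P D"
abbreviation "nLV \<equiv> L2V_norm \<tau> P D"
abbreviation "nLVd \<equiv> L2Vdual_norm \<tau> P D"
abbreviation "wtd \<equiv> weak_time_deriv \<tau> P D"
abbreviation "nW \<equiv> W_norm \<tau> P D"
abbreviation "WS \<equiv> W_space \<tau> P D"
abbreviation "Vd \<equiv> Vdual_space P D"
abbreviation "nVd \<equiv> Vdual_norm P D"
abbreviation "is_wtd \<equiv> is_weak_time_deriv \<tau> P D"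
abbreviation "has_init \<equiv> has_initial_value \<tau> P D"
abbreviation "ipV \<equiv> bochner_inner P ip1"

lemma V_hilbert: "semi_hilbert VP ipV nV"
  unfolding V_space_def V_norm_def by (rule X.L2_semi_hilbert[OF P])

lemma H_hilbert: "semi_hilbert HP ipH nH"
proof -
  have "ipH = bochner_inner P ip2"
    by (simp add: fun_eq_iff H_inner_def bochner_inner_def)
  then show ?thesis unfolding H_space_def H_norm_def using L.L2_semi_hilbert[OF P] by simp
qed

lemma V_H:
  assumes v: "v \<in> VP" shows "v \<in> HP" "nH v \<le> nV v"
  using L2_mono[OF L.seminormed_axioms P(1) _ H1_norm_ge(1) X.diff_mem v[unfolded V_space_def]] H10_H1 H1_D(1)
  by (auto simp: H_space_def H_norm_def V_norm_def)

lemma hilbert_pair: "hilbert_pair VP HP ipV ipH nV nH \<tau>"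
  by (intro hilbert_pair.intro hilbert_pair_axioms.intro V_hilbert H_hilbert) (use V_H \<tau> in auto)

sublocale V: semi_hilbert "VP" "ipV" "nV"
  by (rule V_hilbert)

lemma coef: "t \<in> {0..\<tau>} \<Longrightarrow> c \<omega> t \<in> coefficients K"
  by (rule coefficients_continuous[OF c_cont c_bdd])

definition Aop :: "real \<Rightarrow> ('w \<Rightarrow> real ^ 'n \<Rightarrow> real) \<Rightarrow> 'w \<Rightarrow> real ^ 'n \<Rightarrow> real" where
  "Aop t v = (\<lambda>\<omega>. elliptic (c \<omega> t) (v \<omega>))"

lemma V_D:
  assumes "v \<in> VP"
  shows "smeas P H10 nH1 v" "AE \<omega> in P. v \<omega> \<in> H10"
    "integrable P (\<lambda>\<omega>. (nH1 (v \<omega>))\<^sup>2)"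
  using L2_D assms unfolding V_space_def by blast+

lemma V_norm_eq_0_iff: "v \<in> VP \<Longrightarrow> nV v = 0 \<longleftrightarrow> (AE \<omega> in P. nH1 (v \<omega>) = 0)"
  unfolding V_norm_def V_space_def by (rule X.L2_norm_eq_0_iff[OF P(1)])

lemma elliptic_V:
  fixes b :: "'w \<Rightarrow> real ^ 'n \<Rightarrow> (real ^ 'n ^ 'n) \<times> (real ^ 'n)"
  assumes meas: "\<And>x. x \<in> D \<Longrightarrow> (\<lambda>\<omega>. b \<omega> x) \<in> borel_measurable P"
    and cont: "\<And>\<omega>. continuous_on D (b \<omega>)" and bd: "\<And>\<omega> x. x \<in> D \<Longrightarrow> norm (b \<omega> x) \<le> K"
    and v: "v \<in> VP"
  shows "(\<lambda>\<omega>. elliptic (b \<omega>) (v \<omega>)) \<in> VP" "nV (\<lambda>\<omega>. elliptic (b \<omega>) (v \<omega>)) \<le> K * nV v"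
proof -
  have sm: "smeas P H10 nH1 (\<lambda>\<omega>. elliptic (b \<omega>) (v \<omega>))"
    by (rule sm_elliptic[OF P(1) meas cont bd K V_D(1)[OF v]])
  have le: "AE \<omega> in P. nH1 (elliptic (b \<omega>) (v \<omega>)) \<le> K * nH1 (v \<omega>)"
    using V_D(2)[OF v] by eventually_elim (rule elliptic(2)[OF coefficients_continuous[OF cont bd] K])
  from L2_dominated[where f = v and g = "\<lambda>\<omega>. elliptic (b \<omega>) (v \<omega>)" and N = "nH1" and N' = "nH1",
      OF X.seminormed_axioms P(1) v[unfolded V_space_def] sm le K]
  show "(\<lambda>\<omega>. elliptic (b \<omega>) (v \<omega>)) \<in> VP" "nV (\<lambda>\<omega>. elliptic (b \<omega>) (v \<omega>)) \<le> K * nV v"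
    by (simp_all add: V_space_def V_norm_def)
qed

lemma Aop_V:
  assumes t: "t \<in> {0..\<tau>}" and v: "v \<in> VP"
  shows "Aop t v \<in> VP" "nV (Aop t v) \<le> K * nV v"
  unfolding Aop_def by (rule elliptic_V[OF c_meas[OF t] c_cont[OF t] c_bdd[OF t] v], assumption+)+

lemma Aop_lin:
  assumes t: "t \<in> {0..\<tau>}" and u: "u \<in> VP" and v: "v \<in> VP"
  shows "nV (Aop t (a *\<^sub>R u + b *\<^sub>R v) - (a *\<^sub>R Aop t u + b *\<^sub>R Aop t v)) = 0"
proof -
  have m: "Aop t (a *\<^sub>R u + b *\<^sub>R v) - (a *\<^sub>R Aop t u + b *\<^sub>R Aop t v) \<in> VP"
    by (intro V.diff_mem V.add_mem V.scale_mem Aop_V[OF t] u v)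
  have "AE \<omega> in P. nH1 ((Aop t (a *\<^sub>R u + b *\<^sub>R v) - (a *\<^sub>R Aop t u + b *\<^sub>R Aop t v)) \<omega>) = 0"
    using V_D(2)[OF u] V_D(2)[OF v]
  proof eventually_elim
    case (elim \<omega>)
    show ?case using elliptic_lin[OF coef[OF t] K elim, of \<omega> a b] by (simp add: Aop_def)
  qed
  then show ?thesis using V_norm_eq_0_iff[OF m] by simp
qed

text \<open>For fixed \<open>v\<close> the map is continuous in time, by dominated convergence in
  space for each \<omega> and then in \<omega>. Continuity in operator norm is not claimed.\<close>

lemma Aop_meas:
  assumes v: "v \<in> VP"
  shows "smeas (lebesgue_on {0..\<tau>}) VP nV (\<lambda>t. Aop t v)"
proof (rule V.sm_continuous[OF \<tau>])
  show "(\<lambda>t. Aop t v) \<in> C_time \<tau> VP nV"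
    unfolding C_time_def
  proof (intro CollectI ballI conjI Aop_V v)
    fix t assume t: "t \<in> {0..\<tau>}"
    show "((\<lambda>s. nV (Aop s v - Aop t v)) \<longlongrightarrow> 0) (at t within {0..\<tau>})"
      unfolding tendsto_at_iff_sequentially comp_def
    proof (intro allI impI)
      fix s :: "nat \<Rightarrow> real" assume "\<forall>i. s i \<in> {0..\<tau>} - {t}" and st: "s \<longlonglongrightarrow> t"
      then have s: "s i \<in> {0..\<tau>}" for i by auto
      have dV: "Aop (s i) v - Aop t v \<in> VP" for i by (intro V.diff_mem Aop_V s t v)
      have "(\<lambda>i. \<integral>\<omega>. (nH1 ((Aop (s i) v - Aop t v) \<omega>))\<^sup>2 \<partial>P) \<longlonglongrightarrow> (\<integral>\<omega>. 0 \<partial>P)"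
      proof (rule integral_dominated_convergence)
        show "integrable P (\<lambda>\<omega>. (2 * K)\<^sup>2 * (nH1 (v \<omega>))\<^sup>2)" using V_D(3)[OF v] by simp
        show "(\<lambda>\<omega>. (nH1 ((Aop (s i) v - Aop t v) \<omega>))\<^sup>2) \<in> borel_measurable P" for i
          by (rule borel_measurable_integrable[OF V_D(3)[OF dV]])
        show "AE \<omega> in P. norm ((nH1 ((Aop (s i) v - Aop t v) \<omega>))\<^sup>2) \<le> (2 * K)\<^sup>2 * (nH1 (v \<omega>))\<^sup>2" for i
          using V_D(2)[OF v]
        proof eventually_elim
          case (elim \<omega>)
          note m = elliptic(1)[OF coef[OF s] K elim, of \<omega> i] elliptic(1)[OF coef[OF t] K elim, of \<omega>]
          have "nH1 (elliptic (c \<omega> (s i)) (v \<omega>) - elliptic (c \<omega> t) (v \<omega>)) \<le> 2 * K * nH1 (v \<omega>)"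
            using X.N_triangle_diff[OF m] elliptic(2)[OF coef[OF s] K elim, of \<omega> i] elliptic(2)[OF coef[OF t] K elim, of \<omega>] by linarith
          then have "(nH1 (elliptic (c \<omega> (s i)) (v \<omega>) - elliptic (c \<omega> t) (v \<omega>)))\<^sup>2 \<le> (2 * K * nH1 (v \<omega>))\<^sup>2"
            using X.N_nonneg[OF X.diff_mem[OF m]] by (intro power_mono)
          then show ?case by (simp add: Aop_def power_mult_distrib)
        qed
        show "AE \<omega> in P. (\<lambda>i. (nH1 ((Aop (s i) v - Aop t v) \<omega>))\<^sup>2) \<longlonglongrightarrow> 0"
          using V_D(2)[OF v]
        proof eventually_elim
          case (elim \<omega>)
          have "(\<lambda>i. nH1 (elliptic (c \<omega> (s i)) (v \<omega>) - elliptic (c \<omega> t) (v \<omega>))) \<longlonglongrightarrow> 0"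
          proof (rule elliptic_tendsto[OF coef[OF s] coef[OF t] K _ elim])
            fix x assume "x \<in> D"
            from c_cont_time[OF this, of \<omega>] show "(\<lambda>i. c \<omega> (s i) x) \<longlonglongrightarrow> c \<omega> t x"
              using s t st unfolding continuous_on_sequentially comp_def by blast
          qed
          from tendsto_power[OF this, of 2] show ?case by (simp add: Aop_def)
        qed
      qed simp
      from tendsto_real_sqrt[OF this] show "(\<lambda>i. nV (Aop (s i) v - Aop t v)) \<longlonglongrightarrow> 0"
        by (simp add: V_norm_def bochner_L2_norm_def)
    qed
  qed
qed

lemma Aop_Garding:
  assumes t: "t \<in> {0..\<tau>}" and v: "v \<in> VP"
  shows "\<kappa> / 2 * (nV v)\<^sup>2 \<le> ipV (Aop t v) v + (K\<^sup>2 / (2 * \<kappa>) + \<kappa> / 2) * (nH v)\<^sup>2"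
proof -
  have i1: "integrable P (\<lambda>\<omega>. ip1 (Aop t v \<omega>) (v \<omega>))"
    using X.L2_ip_integrable[OF P(1)] Aop_V(1)[OF t v] v unfolding V_space_def by blast
  have i2: "integrable P (\<lambda>\<omega>. (nL2 (v \<omega>))\<^sup>2)"
    using L2_D(2) V_H(1)[OF v] unfolding H_space_def by blast
  have "\<kappa> / 2 * (nV v)\<^sup>2 = (\<integral>\<omega>. \<kappa> / 2 * (nH1 (v \<omega>))\<^sup>2 \<partial>P)"
    by (simp add: V_norm_def L2_power2)
  also have "\<dots> \<le> (\<integral>\<omega>. ip1 (Aop t v \<omega>) (v \<omega>) + (K\<^sup>2 / (2 * \<kappa>) + \<kappa> / 2) * (nL2 (v \<omega>))\<^sup>2 \<partial>P)"
  proof (rule integral_mono_AE)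
    show "integrable P (\<lambda>\<omega>. \<kappa> / 2 * (nH1 (v \<omega>))\<^sup>2)" using V_D(3)[OF v] by simp
    show "integrable P (\<lambda>\<omega>. ip1 (Aop t v \<omega>) (v \<omega>) + (K\<^sup>2 / (2 * \<kappa>) + \<kappa> / 2) * (nL2 (v \<omega>))\<^sup>2)" using i1 i2 by simp
    show "AE \<omega> in P. \<kappa> / 2 * (nH1 (v \<omega>))\<^sup>2 \<le> ip1 (Aop t v \<omega>) (v \<omega>) + (K\<^sup>2 / (2 * \<kappa>) + \<kappa> / 2) * (nL2 (v \<omega>))\<^sup>2"
      using V_D(2)[OF v] unfolding Aop_def
      by eventually_elim (rule elliptic_Garding[OF coef[OF t] K _ \<kappa> c_coercive[OF t]])
  qed
  also have "\<dots> = ipV (Aop t v) v + (K\<^sup>2 / (2 * \<kappa>) + \<kappa> / 2) * (nH v)\<^sup>2"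
    using i1 i2 by (simp add: H_norm_def L2_power2 bochner_inner_def)
  finally show ?thesis .
qed

sublocale E: parabolic "VP" "HP" "ipV" "ipH" "nV" "nH" \<tau>
    Aop K "K\<^sup>2 / (2 * \<kappa>) + \<kappa> / 2" "\<kappa> / 2"
proof (intro parabolic.intro hilbert_pair parabolic_axioms.intro)
qed (use Aop_V Aop_lin Aop_meas Aop_Garding K \<kappa> in auto)

text \<open>The weak form splits into two integrals over \<open>P\<close> once one of the two parts
  is known to be integrable in \<omega>. The first order part is: it is the form of the elliptic
  operator with coefficients \<open>b\<close>, whose matrix is 0, and the second order part is the
  difference.\<close>

lemma Aop_inner:
  assumes t: "t \<in> {0..\<tau>}" and v: "v \<in> VP" and \<phi>: "\<phi> \<in> VP"
  shows "ipV (Aop t v) \<phi> =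
      (\<integral>\<omega>. (\<integral>y. (fst (c \<omega> t y) *v wg (v \<omega>) y) \<bullet> wg (\<phi> \<omega>) y \<partial>DM) \<partial>P)
    + (\<integral>\<omega>. (\<integral>y. (snd (c \<omega> t y) \<bullet> wg (v \<omega>) y) * \<phi> \<omega> y \<partial>DM) \<partial>P)"
proof -
  define b where "b \<omega> y = (0 :: real ^ 'n ^ 'n, snd (c \<omega> t y))" for \<omega> y
  define J1 where "J1 \<omega> = (\<integral>y. (fst (c \<omega> t y) *v wg (v \<omega>) y) \<bullet> wg (\<phi> \<omega>) y \<partial>DM)" for \<omega>
  define J2 where "J2 \<omega> = (\<integral>y. (snd (c \<omega> t y) \<bullet> wg (v \<omega>) y) * \<phi> \<omega> y \<partial>DM)" for \<omega>
  have bm: "(\<lambda>\<omega>. b \<omega> y) \<in> borel_measurable P" if "y \<in> D" for y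
  proof -
    have "(\<lambda>\<omega>. snd (c \<omega> t y)) \<in> borel_measurable P"
      using measurable_compose[OF c_meas[OF t that] borel_measurable_continuous_onI[OF continuous_on_snd[OF continuous_on_id]]] .
    then show ?thesis unfolding b_def by (intro borel_measurable_Pair) auto
  qed
  have bc: "continuous_on D (b \<omega>)" for \<omega> unfolding b_def[abs_def] by (intro continuous_intros c_cont[OF t])
  have bb: "norm (b \<omega> y) \<le> K" if "y \<in> D" for \<omega> y
    using c_bdd[OF t that, of \<omega>] norm_snd_le[of "snd (c \<omega> t y)" "fst (c \<omega> t y)"] by (simp add: b_def norm_Pair)
  have bV: "(\<lambda>\<omega>. elliptic (b \<omega>) (v \<omega>)) \<in> VP" by (rule elliptic_V(1)[OF bm bc bb v])
  have i: "integrable P (\<lambda>\<omega>. ip1 (Aop t v \<omega>) (\<phi> \<omega>))" "integrable P (\<lambda>\<omega>. ip1 (elliptic (b \<omega>) (v \<omega>)) (\<phi> \<omega>))"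
    using X.L2_ip_integrable[OF P(1)] Aop_V(1)[OF t v] bV \<phi> unfolding V_space_def by blast+
  have eq: "AE \<omega> in P. ip1 (Aop t v \<omega>) (\<phi> \<omega>) = J1 \<omega> + J2 \<omega> \<and> ip1 (elliptic (b \<omega>) (v \<omega>)) (\<phi> \<omega>) = J2 \<omega>"
    using V_D(2)[OF v] V_D(2)[OF \<phi>]
  proof eventually_elim
    case (elim \<omega>)
    show ?case using elliptic(5)[OF coef[OF t] K elim, of \<omega>] elliptic(5)[OF coefficients_continuous[OF bc bb] K elim, of \<omega>]
      by (simp add: Aop_def J1_def J2_def) (simp add: b_def)
  qed
  have e2: "(\<integral>\<omega>. ip1 (elliptic (b \<omega>) (v \<omega>)) (\<phi> \<omega>) \<partial>P) = (\<integral>\<omega>. J2 \<omega> \<partial>P)"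
    by (rule integral_cong_AE_complete[OF P(1)]) (use eq in \<open>auto elim: eventually_mono\<close>)
  have e1: "(\<integral>\<omega>. ip1 (Aop t v \<omega>) (\<phi> \<omega>) - ip1 (elliptic (b \<omega>) (v \<omega>)) (\<phi> \<omega>) \<partial>P) = (\<integral>\<omega>. J1 \<omega> \<partial>P)"
    by (rule integral_cong_AE_complete[OF P(1)]) (use eq in \<open>auto elim: eventually_mono\<close>)
  show ?thesis
    using e1 e2 i unfolding bochner_inner_def J1_def[symmetric] J2_def[symmetric] by simp
qed

end

section \<open>Weak solutions with values in the Gelfand triple\<close>

context random_elliptic
begin

abbreviation "repV F \<equiv> (\<lambda>\<omega>. rep (F \<omega>))"
abbreviation "repT w \<equiv> (\<lambda>t \<omega>. rep (w t \<omega>))"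
abbreviation "unrepT r \<equiv> (\<lambda>t \<omega>. ip1 (r t \<omega>))"

text \<open>Riesz representation is applied pointwise, in the random parameter here and in time in
  \<open>repT\<close>. Being isometric on differences, it preserves strong measurability and norms
  at both levels.\<close>

lemma repV:
  assumes F: "F \<in> Vd"
  shows "repV F \<in> VP" "nV (repV F) = nVd F"
    "G \<in> Vd \<Longrightarrow> nV (repV F - repV G) = nVd (F - G)"
    "\<phi> \<in> VP \<Longrightarrow> ipV (repV F) \<phi> = Vdual_pairing P F \<phi>"
proof -
  have X0: "0 \<le> nH1 (x - y)" if "x \<in> H10" "y \<in> H10" for x y
    by (rule X.N_nonneg[OF X.diff_mem[OF that]])
  note F' = F[unfolded Vdual_space_def]
  note iso = L2_isometry[where L = rep and N' = "nH1" and Y = "H10", OF P(1) rep(1) rep_isometry X0 F']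
  show "repV F \<in> VP" unfolding V_space_def by (rule iso(1))
  show "nV (repV F) = nVd F" unfolding V_norm_def Vdual_norm_def by (rule iso(2))
  show "G \<in> Vd \<Longrightarrow> nV (repV F - repV G) = nVd (F - G)"
    unfolding V_norm_def Vdual_norm_def Vdual_space_def by (rule iso(3))
  assume \<phi>: "\<phi> \<in> VP"
  have "AE \<omega> in P. ip1 (rep (F \<omega>)) (\<phi> \<omega>) = F \<omega> (\<phi> \<omega>)"
    using L2_D(3)[OF F'] V_D(2)[OF \<phi>] by eventually_elim (rule rep(2))
  then show "ipV (repV F) \<phi> = Vdual_pairing P F \<phi>"
    unfolding bochner_inner_def Vdual_pairing_def by (rule integral_cong_AE_complete[OF P(1)])
qed

lemma unrepV:
  assumes r: "r \<in> VP"
  shows "(\<lambda>\<omega>. ip1 (r \<omega>)) \<in> Vd" "nVd (\<lambda>\<omega>. ip1 (r \<omega>)) = nV r"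
    "s \<in> VP \<Longrightarrow> nVd ((\<lambda>\<omega>. ip1 (r \<omega>)) - (\<lambda>\<omega>. ip1 (s \<omega>))) = nV (r - s)"
proof -
  have X0: "0 \<le> Hm1_norm D (x - y)" if "x \<in> Hm1_space D" "y \<in> Hm1_space D" for x y
    unfolding rep_isometry(1)[OF that, symmetric] by (intro X.N_nonneg X.diff_mem rep(1) that)
  note r' = r[unfolded V_space_def]
  note iso = L2_isometry[where L = ip1 and N' = "Hm1_norm D" and Y = "Hm1_space D", OF P(1) ip1_isometry(1) ip1_isometry(2) ip1_isometry(3) X0 r']
  show "(\<lambda>\<omega>. ip1 (r \<omega>)) \<in> Vd" unfolding Vdual_space_def by (rule iso(1))
  show "nVd (\<lambda>\<omega>. ip1 (r \<omega>)) = nV r" unfolding V_norm_def Vdual_norm_def by (rule iso(2))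
  show "s \<in> VP \<Longrightarrow> nVd ((\<lambda>\<omega>. ip1 (r \<omega>)) - (\<lambda>\<omega>. ip1 (s \<omega>))) = nV (r - s)"
    unfolding V_norm_def Vdual_norm_def V_space_def by (rule iso(3))
qed

lemma repT:
  assumes w: "w \<in> LVd"
  shows "repT w \<in> LV" "nLV (repT w) = nLVd w"
proof -
  have X0: "0 \<le> nV (x - y)" for x y unfolding V_norm_def by (rule L2_nonneg)
  note iso = L2_isometry[where L = "\<lambda>F \<omega>. rep (F \<omega>)" and N' = "nV" and Y = "VP",
      OF E.TI(1) repV(1) repV(3) repV(2) X0 w[unfolded L2Vdual_space_def]]
  show "repT w \<in> LV" unfolding L2V_space_def by (rule iso(1))
  show "nLV (repT w) = nLVd w" unfolding L2V_norm_def L2Vdual_norm_def by (rule iso(2))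
qed

lemma unrepT:
  assumes r: "r \<in> LV" shows "unrepT r \<in> LVd"
proof -
  have X0: "0 \<le> nVd (x - y)" for x y unfolding Vdual_norm_def by (rule L2_nonneg)
  note iso = L2_isometry[where L = "\<lambda>r \<omega>. ip1 (r \<omega>)" and N' = "nVd" and Y = "Vd",
      OF E.TI(1) unrepV(1) unrepV(3) unrepV(2) X0 r[unfolded L2V_space_def]]
  show "unrepT r \<in> LVd" unfolding L2Vdual_space_def by (rule iso(1))
qed

lemma L2V_D: "u \<in> LV \<Longrightarrow> AE t in E.TI. u t \<in> VP"
  "w \<in> LVd \<Longrightarrow> AE t in E.TI. w t \<in> Vd"
  unfolding L2V_space_def L2Vdual_space_def by (rule L2_D(3), assumption)+

lemma integral_pairing:
  assumes w: "w \<in> LVd" and v: "v \<in> VP"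
  shows "(\<integral>t. \<psi> t * ipV (repT w t) v \<partial>E.TI) = (\<integral>t. \<psi> t * Vdual_pairing P (w t) v \<partial>E.TI)"
proof (rule integral_cong_AE_complete[OF E.TI(1)])
  show "AE t in E.TI. \<psi> t * ipV (repT w t) v = \<psi> t * Vdual_pairing P (w t) v"
    using L2V_D(2)[OF w] by eventually_elim (simp add: repV(4) v)
qed

lemma is_weak_time_deriv_unrep:
  assumes r: "r \<in> LV"
    and eq: "\<And>\<psi> v. \<psi> \<in> time_tests \<tau> \<Longrightarrow> v \<in> VP \<Longrightarrow>
      (\<integral>t. deriv \<psi> t * ipH (u t) v \<partial>E.TI) = - (\<integral>t. \<psi> t * ipV (r t) v \<partial>E.TI)"
  shows "is_wtd u (unrepT r)"
  unfolding is_weak_time_deriv_def Vdual_pairing_def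
  using unrepT[OF r] eq by (simp add: bochner_inner_def)

lemma weak_time_deriv:
  assumes "u \<in> WS"
  defines "r \<equiv> repT (wtd u)"
  shows "wtd u \<in> LVd" "r \<in> LV"
    "\<psi> \<in> time_tests \<tau> \<Longrightarrow> v \<in> VP \<Longrightarrow>
      (\<integral>t. deriv \<psi> t * ipH (u t) v \<partial>E.TI) = - (\<integral>t. \<psi> t * ipV (r t) v \<partial>E.TI)"
    "nW u = sqrt ((nLV u)\<^sup>2 + (nLV r)\<^sup>2)"
proof -
  have w: "is_wtd u (wtd u)"
    unfolding weak_time_deriv_def using assms(1) by (intro someI_ex[of "is_wtd u"]) (simp add: W_space_def)
  then show wm: "wtd u \<in> LVd" by (simp add: is_weak_time_deriv_def)
  show "r \<in> LV" unfolding r_def by (rule repT(1)[OF wm])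
  show "nW u = sqrt ((nLV u)\<^sup>2 + (nLV r)\<^sup>2)"
    unfolding W_norm_def r_def repT(2)[OF wm] ..
  assume "\<psi> \<in> time_tests \<tau>" "v \<in> VP"
  then show "(\<integral>t. deriv \<psi> t * ipH (u t) v \<partial>E.TI) = - (\<integral>t. \<psi> t * ipV (r t) v \<partial>E.TI)"
    using w unfolding is_weak_time_deriv_def r_def integral_pairing[OF wm \<open>v \<in> _\<close>] by blast
qed

lemma const_L2V: "v \<in> VP \<Longrightarrow> (\<lambda>_. v) \<in> LV"
  unfolding L2V_space_def by (intro V.C_time_L2 \<tau> V.C_time_const)

lemma pairing_integrable:
  assumes \<psi>: "\<psi> \<in> time_tests \<tau>" and v: "v \<in> VP" and r: "r \<in> LV"
  shows "integrable E.TI (\<lambda>t. \<psi> t * ipV (r t) v)"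
  using E.weighted_form_integrable(1)[OF V.semi_inner_axioms test_functions_continuous[OF \<psi>] r[unfolded L2V_space_def]
      const_L2V[OF v, unfolded L2V_space_def]] .

text \<open>Identifies \<open>weak_time_deriv\<close>, which is a \<open>SOME\<close> choice, with a
  derivative that is known explicitly.\<close>

lemma weak_time_deriv_unique:
  assumes r: "r \<in> LV" and s: "s \<in> LV"
    and eq: "\<And>\<psi> v. \<psi> \<in> time_tests \<tau> \<Longrightarrow> v \<in> VP \<Longrightarrow>
      (\<integral>t. \<psi> t * ipV (r t) v \<partial>E.TI) = (\<integral>t. \<psi> t * ipV (s t) v \<partial>E.TI)"
  shows "AE t in E.TI. nV (r t - s t) = 0"
proof -
  have rs: "r - s \<in> LV" using r s unfolding L2V_space_def by (rule E.L.diff_mem)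
  have "AE t in E.TI. nV ((r - s) t) = 0"
  proof (rule V.AE_null_if_weakly_null)
    show "smeas E.TI VP nV (r - s)"
      using rs unfolding L2V_space_def by (rule L2_D(1))
    fix v assume v: "v \<in> VP"
    have split: "AE t in E.TI. ipV ((r - s) t) v = ipV (r t) v - ipV (s t) v"
      using L2V_D(1)[OF r] L2V_D(1)[OF s] by eventually_elim (simp add: V.ip_diff_left v)
    show "AE t in E.TI. ipV ((r - s) t) v = 0"
    proof (rule AE_0_if_orthogonal_time_test_functions)
      show "integrable E.TI (\<lambda>t. ipV ((r - s) t) v)"
        using V.L2_ip_integrable[OF E.TI(1) rs[unfolded L2V_space_def] const_L2V[OF v, unfolded L2V_space_def]] .
      fix \<psi> assume \<psi>: "\<psi> \<in> time_tests \<tau>"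
      have "(\<integral>t. \<psi> t * ipV ((r - s) t) v \<partial>E.TI) = (\<integral>t. \<psi> t * ipV (r t) v - \<psi> t * ipV (s t) v \<partial>E.TI)"
        by (rule integral_cong_AE_complete[OF E.TI(1)], use split in eventually_elim) (simp add: right_diff_distrib)
      also have "\<dots> = 0"
        using pairing_integrable[OF \<psi> v r] pairing_integrable[OF \<psi> v s] eq[OF \<psi> v] by simp
      finally show "(\<integral>t. \<psi> t * ipV ((r - s) t) v \<partial>E.TI) = 0" .
    qed
  qed
  then show ?thesis by simp
qed

definition satisfies :: "(real \<Rightarrow> 'w \<Rightarrow> (real ^ 'n \<Rightarrow> real) \<Rightarrow> real) \<Rightarrow> (real \<Rightarrow> 'w \<Rightarrow> real ^ 'n \<Rightarrow> real) \<Rightarrow> real \<Rightarrow> bool" where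
  "satisfies f u t \<longleftrightarrow> (\<forall>\<phi>\<in>VP.
        (\<integral>\<omega>. wtd u t \<omega> (\<phi> \<omega>) \<partial>P)
      + (\<integral>\<omega>. (\<integral>y. (fst (c \<omega> t y) *v wg (u t \<omega>) y) \<bullet> wg (\<phi> \<omega>) y \<partial>DM) \<partial>P)
      + (\<integral>\<omega>. (\<integral>y. (snd (c \<omega> t y) \<bullet> wg (u t \<omega>) y) * \<phi> \<omega> y \<partial>DM) \<partial>P)
      = (\<integral>\<omega>. f t \<omega> (\<phi> \<omega>) \<partial>P))"

text \<open>Testing with the residual itself shows that the residual is null, so the family of
  equations over all test elements becomes a single one in \<open>V\<close>.\<close>

lemma satisfies_iff:
  assumes t: "t \<in> {0..\<tau>}" and u: "u t \<in> VP" and w: "wtd u t \<in> Vd"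
    and f: "f t \<in> Vd"
  shows "satisfies f u t \<longleftrightarrow> nV (repT (wtd u) t + Aop t (u t) - repT f t) = 0" (is "_ \<longleftrightarrow> nV ?d = 0")
proof -
  note m = repV(1)[OF w] Aop_V(1)[OF t u] repV(1)[OF f]
  have d: "?d \<in> VP" by (intro V.diff_mem V.add_mem m)
  have "satisfies f u t \<longleftrightarrow> (\<forall>\<phi>\<in>VP. ipV ?d \<phi> = 0)"
    unfolding satisfies_def
  proof (rule ball_cong[OF refl])
    fix \<phi> assume \<phi>: "\<phi> \<in> VP"
    have "ipV ?d \<phi> = ipV (repT (wtd u) t) \<phi> + ipV (Aop t (u t)) \<phi> - ipV (repT f t) \<phi>"
      using m \<phi> by (simp add: V.ip_diff_left V.ip_add_left V.add_mem)
    then show "((\<integral>\<omega>. wtd u t \<omega> (\<phi> \<omega>) \<partial>P)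
      + (\<integral>\<omega>. (\<integral>y. (fst (c \<omega> t y) *v wg (u t \<omega>) y) \<bullet> wg (\<phi> \<omega>) y \<partial>DM) \<partial>P)
      + (\<integral>\<omega>. (\<integral>y. (snd (c \<omega> t y) \<bullet> wg (u t \<omega>) y) * \<phi> \<omega> y \<partial>DM) \<partial>P)
      = (\<integral>\<omega>. f t \<omega> (\<phi> \<omega>) \<partial>P)) \<longleftrightarrow> ipV ?d \<phi> = 0"
      unfolding repV(4)[OF w \<phi>] repV(4)[OF f \<phi>] Aop_inner[OF t u \<phi>] Vdual_pairing_def by linarith
  qed
  also have "\<dots> \<longleftrightarrow> nV ?d = 0"
  proof
    assume "\<forall>\<phi>\<in>VP. ipV ?d \<phi> = 0"
    then show "nV ?d = 0" using V.N_power2[OF d] d by simp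
  next
    assume 0: "nV ?d = 0"
    show "\<forall>\<phi>\<in>VP. ipV ?d \<phi> = 0" using V.Cauchy_Schwarz[OF d] 0 by simp
  qed
  finally show ?thesis .
qed

lemma AE_satisfies_iff:
  assumes u: "u \<in> WS" and f: "f \<in> LVd"
  shows "(AE t in E.TI. satisfies f u t) \<longleftrightarrow>
    (AE t in E.TI. nV (repT (wtd u) t + Aop t (u t) - repT f t) = 0)"
proof -
  have uL: "u \<in> LV" using u by (simp add: W_space_def)
  have "AE t in E.TI. satisfies f u t \<longleftrightarrow> nV (repT (wtd u) t + Aop t (u t) - repT f t) = 0"
    using L2V_D(1)[OF uL] L2V_D(2)[OF weak_time_deriv(1)[OF u]] L2V_D(2)[OF f] AE_space
    by eventually_elim (rule satisfies_iff, auto)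
  then show ?thesis by (auto elim: eventually_elim2 intro: AE_mp)
qed

definition solution :: "(real \<Rightarrow> 'w \<Rightarrow> (real ^ 'n \<Rightarrow> real) \<Rightarrow> real) \<Rightarrow> (real \<Rightarrow> 'w \<Rightarrow> real ^ 'n \<Rightarrow> real) \<Rightarrow> bool" where
  "solution f u \<longleftrightarrow> u \<in> WS \<and> has_init u (\<lambda>\<omega> y. 0) \<and> (AE t in E.TI. satisfies f u t)"

lemma L2V_norm_eq_0_iff: "u \<in> LV \<Longrightarrow> nLV u = 0 \<longleftrightarrow> (AE t in E.TI. nV (u t) = 0)"
  unfolding L2V_space_def L2V_norm_def by (rule V.L2_norm_eq_0_iff[OF E.TI(1)])

lemma L2V_norm_cong:
  assumes "r \<in> LV" "s \<in> LV" "AE t in E.TI. nV (r t - s t) = 0"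
  shows "nLV r = nLV s"
proof -
  have m: "r - s \<in> LV" using assms unfolding L2V_space_def by (intro E.L.diff_mem)
  have "nLV (r - s) = 0" using assms(3) L2V_norm_eq_0_iff[OF m] by simp
  then show ?thesis
    using E.L.N_triangle_rev[of r s] assms(1,2) unfolding L2V_space_def L2V_norm_def by simp
qed

lemma solution_exists:
  "\<exists>C>0. \<forall>f\<in>LVd. \<exists>u. solution f u \<and> nW u \<le> C * nLVd f"
proof -
  from E.parabolic_existence obtain C0 where C0: "C0 > 0" and ex: "\<forall>g\<in>E.LS. \<exists>u\<in>E.LS. \<exists>U\<in>C_time \<tau> HP (nH).
      (AE t in E.TI. nH (U t - u t) = 0) \<and> nH (U 0) = 0 \<and>
    (\<forall>\<psi>\<in>time_tests \<tau>. \<forall>v\<in>VP.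
      (\<integral>t. deriv \<psi> t * ipH (u t) v \<partial>E.TI) = - (\<integral>t. \<psi> t * ipV ((g - E.Ac u) t) v \<partial>E.TI)) \<and>
    E.LN u \<le> C0 * E.LN g \<and> E.LN (g - E.Ac u) \<le> C0 * E.LN g" by blast
  \<comment> \<open>The factor 2 arises because the norm of \<open>u\<close> in the evolution space
    is at most the sum of two norms, each bounded with \<open>C0\<close>.\<close>
  show ?thesis
  proof (intro exI[of _ "2 * C0"] conjI ballI)
    show "2 * C0 > 0" using C0 by simp
    fix f assume f: "f \<in> LVd"
    have g: "repT f \<in> E.LS" using repT(1)[OF f] by (simp add: L2V_space_def)
    from bspec[OF ex g] obtain u U where u: "u \<in> E.LS" and U: "U \<in> C_time \<tau> HP nH"
        "AE t in E.TI. nH (U t - u t) = 0" "nH (U 0) = 0"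
      and weak: "\<And>\<psi> v. \<psi> \<in> time_tests \<tau> \<Longrightarrow> v \<in> VP \<Longrightarrow>
      (\<integral>t. deriv \<psi> t * ipH (u t) v \<partial>E.TI) = - (\<integral>t. \<psi> t * ipV ((repT f - E.Ac u) t) v \<partial>E.TI)"
      and bd: "E.LN u \<le> C0 * E.LN (repT f)" "E.LN (repT f - E.Ac u) \<le> C0 * E.LN (repT f)"
      by blast
    define r where "r = repT f - E.Ac u"
    have Au: "E.Ac u \<in> E.LS" by (rule E.A_LS(1)[OF u])
    have r: "r \<in> LV" unfolding r_def L2V_space_def by (rule E.L.diff_mem[OF g Au])
    have uL: "u \<in> LV" using u by (simp add: L2V_space_def)
    have "is_wtd u (unrepT r)"
      by (rule is_weak_time_deriv_unrep[OF r]) (unfold r_def, rule weak)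
    then have W: "u \<in> WS" using uL by (auto simp: W_space_def)
    note w = weak_time_deriv[OF W]
    have wr: "AE t in E.TI. nV (repT (wtd u) t - r t) = 0"
    proof (rule weak_time_deriv_unique[OF w(2) r])
      fix \<psi> v assume \<psi>: "\<psi> \<in> time_tests \<tau>" and v: "v \<in> VP"
      show "(\<integral>t. \<psi> t * ipV (repT (wtd u) t) v \<partial>E.TI) = (\<integral>t. \<psi> t * ipV (r t) v \<partial>E.TI)"
        using w(3)[OF \<psi> v] weak[OF \<psi> v] unfolding r_def by linarith
    qed
    have "AE t in E.TI. nV (repT (wtd u) t + Aop t (u t) - repT f t) = 0"
      using wr
    proof eventually_elim
      case (elim t)
      have "repT (wtd u) t - r t = repT (wtd u) t + Aop t (u t) - repT f t"
        by (simp add: r_def)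
      with elim show ?case by (simp only:)
    qed
    then have sat: "AE t in E.TI. satisfies f u t" using AE_satisfies_iff[OF W f] by simp
    have "(\<lambda>\<omega> y. 0) = (0 :: 'w \<Rightarrow> real ^ 'n \<Rightarrow> real)" by (simp add: fun_eq_iff)
    then have "has_init u (\<lambda>\<omega> y. 0)" unfolding has_initial_value_def using U by (intro bexI[of _ U]) auto
    then have sol: "solution f u" using W sat by (simp add: solution_def)
    have "nLV u \<le> C0 * nLVd f" "nLV r \<le> C0 * nLVd f"
      using bd repT(2)[OF f] by (simp_all add: L2V_norm_def r_def)
    moreover have "nW u = sqrt ((nLV u)\<^sup>2 + (nLV r)\<^sup>2)"
      unfolding w(4) L2V_norm_cong[OF w(2) r wr] ..
    moreover have "\<dots> \<le> nLV u + nLV r"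
      by (rule sqrt_sum_squares_le_sum) (simp_all add: L2V_norm_def L2_nonneg)
    ultimately have "nW u \<le> 2 * C0 * nLVd f" by simp
    with sol show "\<exists>u. solution f u \<and> nW u \<le> 2 * C0 * nLVd f" by blast
  qed
qed

text \<open>The difference of two solutions satisfies the homogeneous equation with initial value 0
  and is null in \<open>L2V_norm\<close>; by the equation its derivative is null as well. Both are
  needed for the norm of the evolution space.\<close>

lemma solution_unique:
  assumes f: "f \<in> LVd" and u: "solution f u" and u': "solution f u'"
  shows "nW (u' - u) = 0"
proof -
  have W: "u \<in> WS" "u' \<in> WS" using u u' by (simp_all add: solution_def)
  then have L: "u \<in> LV" "u' \<in> LV" by (simp_all add: W_space_def)
  define r where "r = repT (wtd u)"
  define r' where "r' = repT (wtd u')"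
  note w = weak_time_deriv[OF W(1), folded r_def] and w' = weak_time_deriv[OF W(2), folded r'_def]
  have d: "u' - u \<in> LV" "r' - r \<in> LV"
    using L w(2) w'(2) unfolding L2V_space_def by (auto intro: E.L.diff_mem)
  have eq: "AE t in E.TI. nV (r t + Aop t (u t) - repT f t) = 0" "AE t in E.TI. nV (r' t + Aop t (u' t) - repT f t) = 0"
    using u u' AE_satisfies_iff[OF W(1) f] AE_satisfies_iff[OF W(2) f] by (auto simp: solution_def r_def r'_def)
  have deq: "AE t in E.TI. nV ((r' - r) t + Aop t ((u' - u) t)) = 0"
    using eq L2V_D(1)[OF L(1)] L2V_D(1)[OF L(2)] L2V_D(1)[OF w(2)] L2V_D(1)[OF w'(2)] L2V_D(2)[OF f] AE_space
  proof eventually_elim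
    case (elim t)
    then have t: "t \<in> {0..\<tau>}" by simp
    note A = Aop_V(1)[OF t elim(3)] Aop_V(1)[OF t elim(4)] Aop_V(1)[OF t V.diff_mem[OF elim(4,3)]]
    note g = repV(1)[OF elim(7)]
    note m = V.diff_mem[OF V.add_mem[OF elim(6) A(2)] g] V.diff_mem[OF V.add_mem[OF elim(5) A(1)] g] V.diff_mem[OF A(3) V.diff_mem[OF A(2,1)]]
    have l: "nV (Aop t (u' t - u t) - (Aop t (u' t) - Aop t (u t))) = 0"
      using Aop_lin[OF t elim(4,3), of 1 "-1"] by simp
    have "(r' - r) t + Aop t ((u' - u) t) =
        ((r' t + Aop t (u' t) - repT f t) - (r t + Aop t (u t) - repT f t)) + (Aop t (u' t - u t) - (Aop t (u' t) - Aop t (u t)))"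
      by (simp add: fun_diff_def fun_eq_iff)
    moreover have "nV (((r' t + Aop t (u' t) - repT f t) - (r t + Aop t (u t) - repT f t)) + (Aop t (u' t - u t) - (Aop t (u' t) - Aop t (u t)))) \<le> 0"
      using V.N_triangle[OF V.diff_mem[OF m(1,2)] m(3)] V.N_triangle_diff[OF m(1,2)] l elim(1,2) by linarith
    ultimately have "nV ((r' - r) t + Aop t ((u' - u) t)) \<le> 0" by (simp only:)
    then show ?case unfolding V_norm_def using L2_nonneg by (rule antisym)
  qed
  have z: "(\<lambda>\<omega> y. 0) = (0 :: 'w \<Rightarrow> real ^ 'n \<Rightarrow> real)" by (simp add: fun_eq_iff)
  obtain U where U: "U \<in> C_time \<tau> HP nH" "AE t in E.TI. nH (U t - u t) = 0" "nH (U 0) = 0"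
    using u unfolding solution_def has_initial_value_def z by auto
  obtain U' where U': "U' \<in> C_time \<tau> HP nH" "AE t in E.TI. nH (U' t - u' t) = 0" "nH (U' 0) = 0"
    using u' unfolding solution_def has_initial_value_def z by auto
  have wd: "(\<integral>t. deriv \<psi> t * ipH ((u' - u) t) v \<partial>E.TI) = - (\<integral>t. \<psi> t * ipV ((r' - r) t) v \<partial>E.TI)"
    if \<psi>: "\<psi> \<in> time_tests \<tau>" and v: "v \<in> VP" for \<psi> v
  proof -
    have "(\<integral>t. \<psi> t * ipV ((r' - r) t) v \<partial>E.TI) = (\<integral>t. \<psi> t * ipV (r' t) v - \<psi> t * ipV (r t) v \<partial>E.TI)"
      by (rule integral_cong_AE_complete[OF E.TI(1)], use L2V_D(1)[OF w(2)] L2V_D(1)[OF w'(2)] in eventually_elim)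
        (simp add: V.ip_diff_left v right_diff_distrib)
    also have "\<dots> = (\<integral>t. \<psi> t * ipV (r' t) v \<partial>E.TI) - (\<integral>t. \<psi> t * ipV (r t) v \<partial>E.TI)"
      using pairing_integrable[OF \<psi> v w(2)] pairing_integrable[OF \<psi> v w'(2)] by simp
    finally have 1: "(\<integral>t. \<psi> t * ipV ((r' - r) t) v \<partial>E.TI) = (\<integral>t. \<psi> t * ipV (r' t) v \<partial>E.TI) - (\<integral>t. \<psi> t * ipV (r t) v \<partial>E.TI)" .
    note c\<psi> = test_function_deriv(2)[OF \<psi>]
    have i: "integrable E.TI (\<lambda>t. deriv \<psi> t * ipH (x t) v)" if "x \<in> LV" for x
      using E.weighted_form_integrable(1)[OF E.VH.semi_inner_axioms c\<psi> E.LS_LSH(1)[OF that[unfolded L2V_space_def]]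
          E.LS_LSH(1)[OF const_L2V[OF v, unfolded L2V_space_def]]] .
    have "(\<integral>t. deriv \<psi> t * ipH ((u' - u) t) v \<partial>E.TI) = (\<integral>t. deriv \<psi> t * ipH (u' t) v - deriv \<psi> t * ipH (u t) v \<partial>E.TI)"
      by (rule integral_cong_AE_complete[OF E.TI(1)], use L2V_D(1)[OF L(1)] L2V_D(1)[OF L(2)] in eventually_elim)
        (simp add: E.VH.ip_diff_left v right_diff_distrib)
    also have "\<dots> = (\<integral>t. deriv \<psi> t * ipH (u' t) v \<partial>E.TI) - (\<integral>t. deriv \<psi> t * ipH (u t) v \<partial>E.TI)"
      using i[OF L(1)] i[OF L(2)] by simp
    finally show ?thesis using 1 w(3)[OF \<psi> v] w'(3)[OF \<psi> v] unfolding r_def r'_def by linarith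
  qed
  have "nLV (u' - u) = 0"
    unfolding L2V_norm_def
  proof (rule E.parabolic_unique[OF d[unfolded L2V_space_def] _ _ _ wd deq])
    have "(\<lambda>t. U' t + (- 1) *\<^sub>R U t) \<in> C_time \<tau> HP nH"
      by (intro E.H.C_time_add E.H.C_time_scaleR U(1) U'(1)) simp
    moreover have "(\<lambda>t. U' t + (- 1) *\<^sub>R U t) = U' - U" by (simp add: fun_eq_iff)
    ultimately show "U' - U \<in> C_time \<tau> HP nH" by (simp only:)
    have m0: "U 0 \<in> HP" "U' 0 \<in> HP" using U(1) U'(1) \<tau> by (auto simp: C_time_def)
    have "nH (U' 0 - U 0) \<le> 0" using E.H.N_triangle_diff[OF m0(2,1)] U(3) U'(3) by simp
    then show "nH ((U' - U) 0) = 0" using E.H.N_nonneg[OF E.H.diff_mem[OF m0(2,1)]] by simp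
    show "AE t in E.TI. nH ((U' - U) t - (u' - u) t) = 0"
      using U(2) U'(2) L2V_D(1)[OF L(1)] L2V_D(1)[OF L(2)] AE_space
    proof eventually_elim
      case (elim t)
      have m: "U t \<in> HP" "U' t \<in> HP" using U(1) U'(1) elim(5) by (auto simp: C_time_def)
      note n = E.H.diff_mem[OF m(2) V_H(1)[OF elim(4)]] E.H.diff_mem[OF m(1) V_H(1)[OF elim(3)]]
      have "(U' - U) t - (u' - u) t = (U' t - u' t) - (U t - u t)" by simp
      moreover have "nH ((U' t - u' t) - (U t - u t)) \<le> 0" using E.H.N_triangle_diff[OF n] elim(1,2) by simp
      moreover have "nH ((U' t - u' t) - (U t - u t)) \<ge> 0"
        by (rule E.H.N_nonneg[OF E.H.diff_mem[OF n]])
      ultimately show ?case by (metis order_antisym)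
    qed
  qed
  then have u0: "AE t in E.TI. nV ((u' - u) t) = 0" using L2V_norm_eq_0_iff[OF d(1)] by simp
  have "AE t in E.TI. nV ((r' - r) t) = 0"
    using u0 deq L2V_D(1)[OF d(1)] L2V_D(1)[OF d(2)] AE_space
  proof eventually_elim
    case (elim t)
    then have t: "t \<in> {0..\<tau>}" by simp
    note A = Aop_V[OF t elim(3)]
    have "nV ((r' - r) t + Aop t ((u' - u) t) - Aop t ((u' - u) t)) \<le> nV ((r' - r) t + Aop t ((u' - u) t)) + nV (Aop t ((u' - u) t))"
      by (rule V.N_triangle_diff[OF V.add_mem[OF elim(4) A(1)] A(1)])
    then have "nV ((r' - r) t) \<le> 0" using elim(1,2) A(2) by simp
    then show ?case using V.N_nonneg[OF elim(4)] by linarith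
  qed
  then have r0: "nLV (r' - r) = 0" using L2V_norm_eq_0_iff[OF d(2)] by simp
  have "is_wtd (u' - u) (unrepT (r' - r))" by (rule is_weak_time_deriv_unrep[OF d(2) wd])
  then have Wd: "u' - u \<in> WS" using d(1) by (auto simp: W_space_def)
  note wdd = weak_time_deriv[OF Wd]
  \<comment> \<open>The chosen derivative of the difference need not be the difference of the chosen
    derivatives.\<close>
  have "AE t in E.TI. nV (repT (wtd (u' - u)) t - (r' - r) t) = 0"
  proof (rule weak_time_deriv_unique[OF wdd(2) d(2)])
    fix \<psi> v assume \<psi>: "\<psi> \<in> time_tests \<tau>" and v: "v \<in> VP"
    show "(\<integral>t. \<psi> t * ipV (repT (wtd (u' - u)) t) v \<partial>E.TI) = (\<integral>t. \<psi> t * ipV ((r' - r) t) v \<partial>E.TI)"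
      using wdd(3)[OF \<psi> v] wd[OF \<psi> v] by linarith
  qed
  from L2V_norm_cong[OF wdd(2) d(2) this] r0 \<open>nLV (u' - u) = 0\<close>
  show ?thesis unfolding wdd(4) by (simp add: fun_diff_def)
qed

end

section \<open>Spaces of continuously differentiable functions\<close>

text \<open>A real supremum bounds its elements only when the set is bounded; here this follows from
  continuity on a compact interval.\<close>

lemma (in seminormed) C_time_norm_upper:
  assumes f: "f \<in> C_time \<tau> X N" and t: "t \<in> {0..\<tau>}"
  shows "N (f t) \<le> C_time_norm \<tau> N f"
proof -
  have "continuous_on {0..\<tau>} (\<lambda>t. N (f t))"
    unfolding continuous_on_def
  proof
    fix t assume t: "t \<in> {0..\<tau>}"
    show "((\<lambda>s. N (f s)) \<longlongrightarrow> N (f t)) (at t within {0..\<tau>})"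
    proof (rule LIM_zero_cancel, rule Lim_null_comparison)
      show "((\<lambda>s. N (f s - f t)) \<longlongrightarrow> 0) (at t within {0..\<tau>})" using f t by (simp add: C_time_def)
      show "\<forall>\<^sub>F s in at t within {0..\<tau>}. norm (N (f s) - N (f t)) \<le> N (f s - f t)"
        using f t N_triangle_rev by (simp add: eventually_at_filter C_time_def)
    qed
  qed
  then have "compact ((\<lambda>t. N (f t)) ` {0..\<tau>})" by (intro compact_continuous_image) auto
  then have "bdd_above ((\<lambda>t. N (f t)) ` {0..\<tau>})" by (intro bounded_imp_bdd_above compact_imp_bounded)
  then show ?thesis unfolding C_time_norm_def using t by (rule cSUP_upper[rotated])
qed

lemma extends_cont_lin:
  assumes "extends_cont B f" "extends_cont B g" shows "extends_cont B (a *\<^sub>R f + b *\<^sub>R g)"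
proof -
  obtain f' g' where "continuous_on (closure B) f'" "\<forall>x\<in>B. f' x = f x" "continuous_on (closure B) g'" "\<forall>x\<in>B. g' x = g x"
    using assms unfolding extends_cont_def by blast
  then show ?thesis unfolding extends_cont_def
    by (intro exI[of _ "\<lambda>x. a *\<^sub>R f' x + b *\<^sub>R g' x"]) (auto intro!: continuous_intros)
qed

lemma extends_cont_cong: "extends_cont B f \<Longrightarrow> (\<And>x. x \<in> B \<Longrightarrow> f x = g x) \<Longrightarrow> extends_cont B g"
  unfolding extends_cont_def by auto

lemma extends_cont_continuous_on:
  assumes "extends_cont B f" shows "continuous_on B f"
proof -
  obtain g where g: "continuous_on (closure B) g" "\<forall>x\<in>B. g x = f x" using assms unfolding extends_cont_def by blast
  have "continuous_on B g" by (rule continuous_on_subset[OF g(1) closure_subset])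
  then show ?thesis using g(2) by (simp cong: continuous_on_cong)
qed

lemma C0_extends_cont: "f \<in> C0_space B \<Longrightarrow> extends_cont B f"
  by (auto simp: C0_space_def extends_cont_def)

lemma extends_cont_bdd:
  assumes B: "bounded B" and f: "extends_cont B f" shows "bdd_above ((\<lambda>x. norm (f x)) ` B)"
proof -
  obtain g where g: "continuous_on (closure B) g" "\<forall>x\<in>B. g x = f x" using f unfolding extends_cont_def by blast
  have "compact (g ` closure B)" using B g(1) by (intro compact_continuous_image) auto
  then obtain K where K: "\<And>x. x \<in> closure B \<Longrightarrow> norm (g x) \<le> K" using compact_imp_bounded by (force simp: bounded_iff)
  show ?thesis
  proof (rule bdd_aboveI2)
    fix x assume "x \<in> B"
    then show "norm (f x) \<le> K" using K[of x] g(2) closure_subset by fastforce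
  qed
qed

lemma C0_norm_upper: "bounded B \<Longrightarrow> extends_cont B f \<Longrightarrow> x \<in> B \<Longrightarrow> norm (f x) \<le> C0_norm B f"
  unfolding C0_norm_def by (rule cSUP_upper[OF _ extends_cont_bdd])

lemma C0_norm_least: "B \<noteq> {} \<Longrightarrow> (\<And>x. x \<in> B \<Longrightarrow> norm (f x) \<le> K) \<Longrightarrow> C0_norm B f \<le> K"
  unfolding C0_norm_def by (rule cSUP_least)

lemma C0_norm_nonneg:
  assumes "B \<noteq> {}" "bounded B" "extends_cont B f" shows "0 \<le> C0_norm B f"
proof -
  obtain x where "x \<in> B" using assms(1) by blast
  then show ?thesis using C0_norm_upper[OF assms(2,3)] norm_ge_zero[of "f x"] order_trans by blast
qed

lemma C0_norm_cong: "(\<And>x. x \<in> B \<Longrightarrow> norm (f x) = norm (g x)) \<Longrightarrow> C0_norm B f = C0_norm B g"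
  unfolding C0_norm_def by (rule SUP_cong) auto

lemma C0_norm_add:
  assumes B: "B \<noteq> {}" "bounded B" and f: "extends_cont B f" and g: "extends_cont B g"
  shows "C0_norm B (f + g) \<le> C0_norm B f + C0_norm B g"
proof (rule C0_norm_least[OF B(1)])
  fix x assume x: "x \<in> B"
  show "norm ((f + g) x) \<le> C0_norm B f + C0_norm B g"
    using norm_triangle_ineq[of "f x" "g x"] C0_norm_upper[OF B(2) f x] C0_norm_upper[OF B(2) g x] by simp
qed

lemma C0_norm_scale:
  assumes B: "B \<noteq> {}" "bounded B" and f: "extends_cont B f"
  shows "C0_norm B (a *\<^sub>R f) = \<bar>a\<bar> * C0_norm B f"
proof -
  have le: "C0_norm B (a *\<^sub>R f) \<le> \<bar>a\<bar> * C0_norm B f" if f: "extends_cont B f" for a and f :: "'a \<Rightarrow> 'b"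
    by (rule C0_norm_least[OF B(1)]) (use C0_norm_upper[OF B(2) f] in \<open>auto intro: mult_left_mono\<close>)
  show ?thesis
  proof (cases "a = 0")
    case True
    have "extends_cont B (a *\<^sub>R f)" using extends_cont_lin[OF f f, of a 0] by simp
    then show ?thesis using le[OF f, of a] C0_norm_nonneg[OF B, of "a *\<^sub>R f"] True by simp
  next
    case False
    have "extends_cont B (a *\<^sub>R f)" using extends_cont_lin[OF f f, of a 0] by simp
    from le[OF this, of "1 / a"] have "C0_norm B f \<le> \<bar>1 / a\<bar> * C0_norm B (a *\<^sub>R f)" using False by simp
    then have "\<bar>a\<bar> * C0_norm B f \<le> C0_norm B (a *\<^sub>R f)" using False by (simp add: field_simps abs_divide)
    with le[OF f, of a] show ?thesis by simp
  qed
qed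

lemma C0_seminormed:
  assumes B: "B \<noteq> {}" "bounded B"
  shows "seminormed (C0_space B :: ('a::euclidean_space \<Rightarrow> 'b::real_normed_vector) set) (C0_norm B)"
proof
  show "subspace (C0_space B :: ('a \<Rightarrow> 'b) set)"
    unfolding C0_space_def by (intro subspaceI) (auto simp: zero_fun_def plus_fun_def scaleR_fun_def intro!: continuous_intros)
  show "C0_norm B (a *\<^sub>R x) = \<bar>a\<bar> * C0_norm B x" if "x \<in> C0_space B" for a and x :: "'a \<Rightarrow> 'b"
    by (rule C0_norm_scale[OF B C0_extends_cont[OF that]])
  show "C0_norm B (x + y) \<le> C0_norm B x + C0_norm B y" if "x \<in> C0_space B" "y \<in> C0_space B" for x y :: "'a \<Rightarrow> 'b"
    by (rule C0_norm_add[OF B C0_extends_cont[OF that(1)] C0_extends_cont[OF that(2)]])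
qed

section \<open>Derivatives of linear combinations and the space C2\<close>

lemma fderiv:
  fixes f :: "'a::euclidean_space \<Rightarrow> 'b::real_normed_vector"
  assumes "f differentiable (at x)" shows "(f has_derivative blinfun_apply (fderiv f x)) (at x)"
proof -
  have d: "(f has_derivative frechet_derivative f (at x)) (at x)" using assms frechet_derivative_works by blast
  then show ?thesis by (simp add: fderiv_def bounded_linear_Blinfun_apply has_derivative_bounded_linear)
qed

lemma fderiv_eqI: "(f has_derivative blinfun_apply L) (at x) \<Longrightarrow> fderiv f x = L"
  by (simp add: fderiv_def frechet_derivative_at[symmetric] blinfun_apply_inverse)

lemma fderiv_lin:
  fixes f g :: "'a::euclidean_space \<Rightarrow> 'b::real_normed_vector"
  assumes f: "f differentiable (at x)" and g: "g differentiable (at x)"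
  shows "(a *\<^sub>R f + b *\<^sub>R g) differentiable (at x)" "fderiv (a *\<^sub>R f + b *\<^sub>R g) x = a *\<^sub>R fderiv f x + b *\<^sub>R fderiv g x"
proof -
  have "((\<lambda>x. a *\<^sub>R f x + b *\<^sub>R g x) has_derivative (\<lambda>h. a *\<^sub>R blinfun_apply (fderiv f x) h + b *\<^sub>R blinfun_apply (fderiv g x) h)) (at x)"
    by (intro has_derivative_add has_derivative_scaleR_right fderiv f g)
  moreover have "(\<lambda>h. a *\<^sub>R blinfun_apply (fderiv f x) h + b *\<^sub>R blinfun_apply (fderiv g x) h) =
      blinfun_apply (a *\<^sub>R fderiv f x + b *\<^sub>R fderiv g x)"
    by (simp add: fun_eq_iff blinfun.add_left blinfun.scaleR_left)
  ultimately have "((a *\<^sub>R f + b *\<^sub>R g) has_derivative blinfun_apply (a *\<^sub>R fderiv f x + b *\<^sub>R fderiv g x)) (at x)"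
    by (simp add: plus_fun_def scaleR_fun_def)
  then show "(a *\<^sub>R f + b *\<^sub>R g) differentiable (at x)" "fderiv (a *\<^sub>R f + b *\<^sub>R g) x = a *\<^sub>R fderiv f x + b *\<^sub>R fderiv g x"
    by (auto intro: differentiableI fderiv_eqI)
qed

lemma fderiv_cong:
  fixes f g :: "'a::euclidean_space \<Rightarrow> 'b::real_normed_vector"
  assumes B: "open B" "x \<in> B" and f: "f differentiable (at x)" and eq: "\<And>x. x \<in> B \<Longrightarrow> f x = g x"
  shows "g differentiable (at x)" "fderiv g x = fderiv f x"
proof -
  have "(g has_derivative blinfun_apply (fderiv f x)) (at x)"
    by (rule has_derivative_transform_within_open[OF fderiv[OF f] B eq])
  then show "g differentiable (at x)" "fderiv g x = fderiv f x" by (auto intro: differentiableI fderiv_eqI)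
qed

lemma C2_D:
  assumes "f \<in> C2_space B"
  shows "f \<in> C0_space B" "extends_cont B f" "extends_cont B (fderiv f)" "extends_cont B (fderiv (fderiv f))"
    "x \<in> B \<Longrightarrow> f differentiable (at x)" "x \<in> B \<Longrightarrow> fderiv f differentiable (at x)"
  using assms by (auto simp: C2_space_def intro: C0_extends_cont)

text \<open>Linearity of \<open>fderiv\<close> is available in \<open>B\<close> only, where both
  functions are differentiable. The second derivative needs it on a neighbourhood of the point,
  hence the openness of \<open>B\<close>.\<close>

lemma C2_lin:
  fixes f g :: "'a::euclidean_space \<Rightarrow> 'b::real_normed_vector"
  assumes B: "open B" and f: "f \<in> C2_space B" and g: "g \<in> C2_space B"
  shows "a *\<^sub>R f + b *\<^sub>R g \<in> C2_space B"
    "x \<in> B \<Longrightarrow> fderiv (a *\<^sub>R f + b *\<^sub>R g) x = (a *\<^sub>R fderiv f + b *\<^sub>R fderiv g) x"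
    "x \<in> B \<Longrightarrow> fderiv (fderiv (a *\<^sub>R f + b *\<^sub>R g)) x = (a *\<^sub>R fderiv (fderiv f) + b *\<^sub>R fderiv (fderiv g)) x"
proof -
  have 1: "(a *\<^sub>R f + b *\<^sub>R g) differentiable (at x)" "fderiv (a *\<^sub>R f + b *\<^sub>R g) x = (a *\<^sub>R fderiv f + b *\<^sub>R fderiv g) x"
    if "x \<in> B" for x
    using fderiv_lin[OF C2_D(5)[OF f that] C2_D(5)[OF g that], of a b] by simp_all
  have 2: "fderiv (a *\<^sub>R f + b *\<^sub>R g) differentiable (at x)"
    "fderiv (fderiv (a *\<^sub>R f + b *\<^sub>R g)) x = (a *\<^sub>R fderiv (fderiv f) + b *\<^sub>R fderiv (fderiv g)) x" if x: "x \<in> B" for x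
  proof -
    note l = fderiv_lin[OF C2_D(6)[OF f x] C2_D(6)[OF g x], of a b]
    note c = fderiv_cong[OF B x l(1), of "fderiv (a *\<^sub>R f + b *\<^sub>R g)", OF 1(2)[symmetric]]
    show "fderiv (a *\<^sub>R f + b *\<^sub>R g) differentiable (at x)" by (rule c(1))
    show "fderiv (fderiv (a *\<^sub>R f + b *\<^sub>R g)) x = (a *\<^sub>R fderiv (fderiv f) + b *\<^sub>R fderiv (fderiv g)) x"
      using c(2) l(2) by simp
  qed
  show "x \<in> B \<Longrightarrow> fderiv (a *\<^sub>R f + b *\<^sub>R g) x = (a *\<^sub>R fderiv f + b *\<^sub>R fderiv g) x" by (rule 1(2))
  show "x \<in> B \<Longrightarrow> fderiv (fderiv (a *\<^sub>R f + b *\<^sub>R g)) x = (a *\<^sub>R fderiv (fderiv f) + b *\<^sub>R fderiv (fderiv g)) x" by (rule 2(2))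
  have "a *\<^sub>R f + b *\<^sub>R g \<in> C0_space B"
    using C2_D(1)[OF f] C2_D(1)[OF g] by (auto simp: C0_space_def plus_fun_def scaleR_fun_def intro!: continuous_intros)
  moreover have "extends_cont B (fderiv (a *\<^sub>R f + b *\<^sub>R g))"
    by (rule extends_cont_cong[OF extends_cont_lin[OF C2_D(3)[OF f] C2_D(3)[OF g]] 1(2)[symmetric]])
  moreover have "extends_cont B (fderiv (fderiv (a *\<^sub>R f + b *\<^sub>R g)))"
    by (rule extends_cont_cong[OF extends_cont_lin[OF C2_D(4)[OF f] C2_D(4)[OF g]] 2(2)[symmetric]])
  ultimately show "a *\<^sub>R f + b *\<^sub>R g \<in> C2_space B" using 1(1) 2(1) by (simp add: C2_space_def)
qed

lemma C2_norm_lin: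
  fixes f g :: "'a::euclidean_space \<Rightarrow> 'b::real_normed_vector"
  assumes B: "open B" and f: "f \<in> C2_space B" and g: "g \<in> C2_space B"
  shows "C2_norm B (a *\<^sub>R f + b *\<^sub>R g) = C0_norm B (a *\<^sub>R f + b *\<^sub>R g) + C0_norm B (a *\<^sub>R fderiv f + b *\<^sub>R fderiv g)
      + C0_norm B (a *\<^sub>R fderiv (fderiv f) + b *\<^sub>R fderiv (fderiv g))"
  unfolding C2_norm_def
  by (intro arg_cong2[where f = "(+)"] refl C0_norm_cong) (simp_all only: C2_lin(2,3)[OF B f g])

lemma fderiv_const: "fderiv (\<lambda>_::'a::euclidean_space. c) = (\<lambda>_. 0 :: 'a \<Rightarrow>\<^sub>L 'c::real_normed_vector)"
proof
  have "blinfun_apply (0 :: 'a \<Rightarrow>\<^sub>L 'c) = (\<lambda>_. 0)" by (simp add: fun_eq_iff)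
  then show "fderiv (\<lambda>_::'a. c) x = (0 :: 'a \<Rightarrow>\<^sub>L 'c)" for x by (intro fderiv_eqI) (simp add: has_derivative_const)
qed

lemma extends_cont_const: "extends_cont B (\<lambda>_. c)"
  unfolding extends_cont_def by (rule exI[of _ "\<lambda>_. c"]) simp

lemma C2_seminormed:
  assumes B: "open B" "B \<noteq> {}" "bounded B"
  shows "seminormed (C2_space B :: ('a::euclidean_space \<Rightarrow> 'b::real_normed_vector) set) (C2_norm B)"
proof
  have lin: "a *\<^sub>R f + b *\<^sub>R g \<in> C2_space B" if "f \<in> C2_space B" "g \<in> C2_space B" for a b and f g :: "'a \<Rightarrow> 'b"
    by (rule C2_lin(1)[OF B(1) that])
  have "(0 :: 'a \<Rightarrow> 'b) \<in> C2_space B"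
    unfolding C2_space_def C0_space_def zero_fun_def by (simp add: fderiv_const extends_cont_const)
  then show "subspace (C2_space B :: ('a \<Rightarrow> 'b) set)"
  proof (rule subspaceI)
    show "f + g \<in> C2_space B" if "f \<in> C2_space B" "g \<in> C2_space B" for f g :: "'a \<Rightarrow> 'b"
      using lin[OF that, of 1 1] by simp
    show "a *\<^sub>R f \<in> C2_space B" if "f \<in> C2_space B" for a and f :: "'a \<Rightarrow> 'b"
      using lin[OF that that, of a 0] by simp
  qed
  fix x y :: "'a \<Rightarrow> 'b" and a assume x: "x \<in> C2_space B"
  have "C2_norm B (a *\<^sub>R x) = C0_norm B (a *\<^sub>R x) + C0_norm B (a *\<^sub>R fderiv x) + C0_norm B (a *\<^sub>R fderiv (fderiv x))"
    using C2_norm_lin[OF B(1) x x, of a 0] by simp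
  also have "\<dots> = \<bar>a\<bar> * C2_norm B x"
    by (simp only: C0_norm_scale[OF B(2,3) C2_D(2)[OF x]] C0_norm_scale[OF B(2,3) C2_D(3)[OF x]]
        C0_norm_scale[OF B(2,3) C2_D(4)[OF x]] C2_norm_def distrib_left)
  finally show "C2_norm B (a *\<^sub>R x) = \<bar>a\<bar> * C2_norm B x" .
  assume y: "y \<in> C2_space B"
  have "C2_norm B (x + y) = C0_norm B (x + y) + C0_norm B (fderiv x + fderiv y) + C0_norm B (fderiv (fderiv x) + fderiv (fderiv y))"
    using C2_norm_lin[OF B(1) x y, of 1 1] by (simp only: scaleR_one)
  then show "C2_norm B (x + y) \<le> C2_norm B x + C2_norm B y"
    unfolding C2_norm_def
    using C0_norm_add[OF B(2,3) C2_D(2)[OF x] C2_D(2)[OF y]] C0_norm_add[OF B(2,3) C2_D(3)[OF x] C2_D(3)[OF y]]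
      C0_norm_add[OF B(2,3) C2_D(4)[OF x] C2_D(4)[OF y]] by linarith
qed

lemma C2_norm_upper:
  assumes B: "B \<noteq> {}" "bounded B" and f: "f \<in> C2_space B" and x: "x \<in> B"
  shows "norm (fderiv f x) \<le> C2_norm B f" "norm (fderiv (fderiv f) x) \<le> C2_norm B f"
  using C0_norm_upper[OF B(2) C2_D(3)[OF f] x] C0_norm_upper[OF B(2) C2_D(4)[OF f] x]
    C0_norm_nonneg[OF B C2_D(2)[OF f]] C0_norm_nonneg[OF B C2_D(3)[OF f]] C0_norm_nonneg[OF B C2_D(4)[OF f]]
  unfolding C2_norm_def by linarith+

lemma C_time_C2_continuous:
  fixes f :: "real \<Rightarrow> 'a::euclidean_space \<Rightarrow> 'b::real_normed_vector"
  assumes B: "open B" "bounded B" and x: "x \<in> B" and f: "f \<in> C_time \<tau> (C2_space B) (C2_norm B)"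
  shows "continuous_on {0..\<tau>} (\<lambda>t. fderiv (f t) x)" "continuous_on {0..\<tau>} (\<lambda>t. fderiv (fderiv (f t)) x)"
proof -
  have B0: "B \<noteq> {}" using x by auto
  have m: "f t \<in> C2_space B" if "t \<in> {0..\<tau>}" for t using f that by (simp add: C_time_def)
  have le: "norm (fderiv (f s) x - fderiv (f t) x) \<le> C2_norm B (f s - f t)"
    "norm (fderiv (fderiv (f s)) x - fderiv (fderiv (f t)) x) \<le> C2_norm B (f s - f t)"
    if "s \<in> {0..\<tau>}" "t \<in> {0..\<tau>}" for s t
    using C2_norm_upper[OF B0 B(2) C2_lin(1)[OF B(1) m[OF that(1)] m[OF that(2)], of 1 "-1"] x]
      C2_lin(2,3)[OF B(1) m[OF that(1)] m[OF that(2)] x, of 1 "-1"] by simp_all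
  have lim: "((\<lambda>s. g s - g t) \<longlongrightarrow> 0) (at t within {0..\<tau>})"
    if "\<And>s t. s \<in> {0..\<tau>} \<Longrightarrow> t \<in> {0..\<tau>} \<Longrightarrow> norm (g s - g t) \<le> C2_norm B (f s - f t)" "t \<in> {0..\<tau>}"
    for t and g :: "real \<Rightarrow> 'c::real_normed_vector"
  proof (rule Lim_null_comparison)
    show "((\<lambda>s. C2_norm B (f s - f t)) \<longlongrightarrow> 0) (at t within {0..\<tau>})" using f that(2) by (simp add: C_time_def)
    show "\<forall>\<^sub>F s in at t within {0..\<tau>}. norm (g s - g t) \<le> C2_norm B (f s - f t)"
      using that by (simp add: eventually_at_filter)
  qed
  show "continuous_on {0..\<tau>} (\<lambda>t. fderiv (f t) x)" "continuous_on {0..\<tau>} (\<lambda>t. fderiv (fderiv (f t)) x)"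
    unfolding continuous_on_def by (auto intro!: LIM_zero_cancel[OF lim] le)
qed

lemma C_time_C0_continuous:
  fixes f :: "real \<Rightarrow> 'a::euclidean_space \<Rightarrow> 'b::real_normed_vector"
  assumes B: "bounded B" and x: "x \<in> B" and f: "f \<in> C_time \<tau> (C0_space B) (C0_norm B)"
  shows "continuous_on {0..\<tau>} (\<lambda>t. f t x)"
  unfolding continuous_on_def
proof (rule ballI, rule LIM_zero_cancel, rule Lim_null_comparison)
  fix t assume t: "t \<in> {0..\<tau>}"
  have B0: "B \<noteq> {}" using x by auto
  interpret seminormed "C0_space B :: ('a \<Rightarrow> 'b) set" "C0_norm B" by (rule C0_seminormed[OF B0 B])
  show "((\<lambda>s. C0_norm B (f s - f t)) \<longlongrightarrow> 0) (at t within {0..\<tau>})" using f t by (simp add: C_time_def)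
  have "norm (f s x - f t x) \<le> C0_norm B (f s - f t)" if "s \<in> {0..\<tau>}" for s
    using C0_norm_upper[OF B C0_extends_cont[OF diff_mem] x, of "f s" "f t"] f t that by (simp add: C_time_def)
  then show "\<forall>\<^sub>F s in at t within {0..\<tau>}. norm (f s x - f t x) \<le> C0_norm B (f s - f t)"
    by (simp add: eventually_at_filter)
qed

section \<open>Matrices\<close>

lemma norm_transpose: "norm (transpose A) = norm (A :: real ^ 'm ^ 'n)"
proof -
  have "(norm (transpose A))\<^sup>2 = (\<Sum>i\<in>UNIV. \<Sum>j\<in>UNIV. (A $ j $ i)\<^sup>2)"
    by (simp add: norm_vec_def L2_set_def transpose_def sum_nonneg)
  also have "\<dots> = (\<Sum>j\<in>UNIV. \<Sum>i\<in>UNIV. (A $ j $ i)\<^sup>2)" by (rule sum.swap)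
  also have "\<dots> = (norm A)\<^sup>2" by (simp add: norm_vec_def L2_set_def sum_nonneg)
  finally show ?thesis by (simp add: power2_eq_iff_nonneg)
qed

lemma norm_matrix_matrix_mult_le:
  fixes A :: "real ^ 'm ^ 'n" and C :: "real ^ 'k ^ 'm"
  shows "norm (A ** C) \<le> norm A * norm C"
proof -
  have "norm (A ** C) = L2_set (\<lambda>i. norm ((A ** C) $ i)) UNIV" by (rule norm_vec_def)
  also have "\<dots> \<le> L2_set (\<lambda>i. norm (A $ i) * norm C) UNIV"
  proof (rule L2_set_mono)
    fix i
    have "(A ** C) $ i = transpose C *v (A $ i)"
      by (simp add: vec_eq_iff matrix_matrix_mult_def matrix_vector_mult_def transpose_def mult.commute)
    then show "norm ((A ** C) $ i) \<le> norm (A $ i) * norm C"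
      using norm_matrix_vector_mult_le[of "transpose C" "A $ i"] by (simp add: norm_transpose mult.commute)
  qed simp
  also have "\<dots> = norm A * norm C" by (simp add: L2_set_left_distrib[symmetric] norm_vec_def[of A])
  finally show ?thesis .
qed

text \<open>The Leibniz formula has \<open>fact CARD('n)\<close> terms. A crude bound is enough, as
  only a deterministic constant is sought.\<close>

lemma abs_det_le:
  fixes A :: "real ^ 'n ^ 'n"
  shows "\<bar>det A\<bar> \<le> fact CARD('n) * norm A ^ CARD('n)"
proof -
  have e: "\<bar>A $ i $ j\<bar> \<le> norm A" for i j
    using Finite_Cartesian_Product.norm_nth_le[of A i] component_le_norm_cart[of "A $ i" j] by linarith
  have "\<bar>det A\<bar> \<le> (\<Sum>p | p permutes (UNIV :: 'n set). \<bar>of_int (sign p) * (\<Prod>i\<in>UNIV. A $ i $ p i)\<bar>)"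
    unfolding det_def by (rule sum_abs)
  also have "\<dots> \<le> (\<Sum>p | p permutes (UNIV :: 'n set). norm A ^ CARD('n))"
  proof (rule sum_mono)
    fix p assume "p \<in> {p. p permutes (UNIV :: 'n set)}"
    have "\<bar>of_int (sign p) * (\<Prod>i\<in>UNIV. A $ i $ p i)\<bar> = (\<Prod>i\<in>UNIV. \<bar>A $ i $ p i\<bar>)"
      by (simp add: abs_mult abs_prod sign_def)
    also have "\<dots> \<le> (\<Prod>i\<in>(UNIV :: 'n set). norm A)" by (rule prod_mono) (use e in auto)
    finally show "\<bar>of_int (sign p) * (\<Prod>i\<in>UNIV. A $ i $ p i)\<bar> \<le> norm A ^ CARD('n)" by simp
  qed
  also have "\<dots> = fact CARD('n) * norm A ^ CARD('n)" by (simp add: card_permutations)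
  finally show ?thesis .
qed

lemma matrix_inv_eq:
  fixes A C :: "real ^ 'n ^ 'n"
  assumes "A ** C = mat 1" shows "matrix_inv A = C"
proof -
  have "C ** A = mat 1" using assms matrix_left_right_inverse by blast
  then have "A ** matrix_inv A = mat 1 \<and> matrix_inv A ** A = mat 1"
    unfolding matrix_inv_def using assms by (intro someI_ex[of "\<lambda>A'. A ** A' = mat 1 \<and> A' ** A = mat 1"]) blast
  then have "matrix_inv A = matrix_inv A ** (A ** C)" using assms by simp
  also have "\<dots> = C" using \<open>A ** matrix_inv A = _ \<and> _\<close> by (simp add: matrix_mul_assoc)
  finally show ?thesis .
qed

text \<open>Cramer's rule writes the inverse through determinants, from which both its continuity
  and its measurability are read off.\<close>

lemma matrix_inv_cramer:
  fixes A :: "real ^ 'n ^ 'n"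
  assumes A: "det A \<noteq> 0"
  shows "matrix_inv A = (\<chi> k l. det (\<chi> i j. if j = k then axis l 1 $ i else A $ i $ j) / det A)"
proof -
  obtain C where C: "A ** C = mat 1" using A invertible_det_nz[of A] unfolding invertible_def by blast
  have "C $ k $ l = det (\<chi> i j. if j = k then axis l 1 $ i else A $ i $ j) / det A" for k l
  proof -
    have "A *v (C *v axis l 1) = axis l 1" using C by (simp add: matrix_vector_mul_assoc)
    then have "C *v axis l 1 = (\<chi> k. det (\<chi> i j. if j = k then axis l 1 $ i else A $ i $ j) / det A)"
      using cramer[OF A] by blast
    then show ?thesis by (simp add: vec_eq_iff matrix_vector_mult_basis column_def)
  qed
  then show ?thesis using matrix_inv_eq[OF C] by (simp add: vec_eq_iff)
qed

lemma continuous_on_det: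
  fixes A :: "'z::topological_space \<Rightarrow> real ^ 'n ^ 'n"
  assumes "continuous_on S A" shows "continuous_on S (\<lambda>z. det (A z))"
  unfolding det_def by (intro continuous_intros assms)

lemma continuous_on_matrix_inv:
  fixes A :: "'z::topological_space \<Rightarrow> real ^ 'n ^ 'n"
  assumes A: "continuous_on S A" and nz: "\<And>z. z \<in> S \<Longrightarrow> det (A z) \<noteq> 0"
  shows "continuous_on S (\<lambda>z. matrix_inv (A z))"
proof -
  have "continuous_on S (\<lambda>z. if j = k then c else A z $ i $ j)" for i j k c
    using A by (cases "j = k") (auto intro!: continuous_intros)
  then have "continuous_on S (\<lambda>z. \<chi> k l. det (\<chi> i j. if j = k then axis l 1 $ i else A z $ i $ j) / det (A z))"
    by (intro continuous_on_vec_lambda continuous_on_divide continuous_on_det A) (use nz in auto)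
  then show ?thesis using matrix_inv_cramer[OF nz] by (simp cong: continuous_on_cong)
qed

lemma borel_measurable_det:
  fixes A :: "'z \<Rightarrow> real ^ 'n ^ 'n"
  assumes "A \<in> borel_measurable M" shows "(\<lambda>z. det (A z)) \<in> borel_measurable M"
  by (rule measurable_compose[OF assms borel_measurable_continuous_onI[OF continuous_on_det[OF continuous_on_id]]])

text \<open>The differential of the determinant at \<open>A\<close> in the direction
  \<open>H\<close>: the product rule applied to the Leibniz formula.\<close>

definition ddet :: "real ^ 'n ^ 'n \<Rightarrow> real ^ 'n ^ 'n \<Rightarrow> real" where
  "ddet A H = (\<Sum>p | p permutes UNIV. of_int (sign p) * (\<Sum>k\<in>UNIV. H $ k $ p k * (\<Prod>j\<in>UNIV - {k}. A $ j $ p j)))"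

lemma has_derivative_det:
  assumes "(A has_derivative A') (at x)"
  shows "((\<lambda>x. det (A x :: real ^ 'n ^ 'n)) has_derivative (\<lambda>h. ddet (A x) (A' h))) (at x)"
proof -
  have "((\<lambda>x. A x $ i $ j) has_derivative (\<lambda>h. A' h $ i $ j)) (at x)" for i j
    by (intro bounded_linear.has_derivative[OF bounded_linear_vec_nth] assms)
  then show ?thesis unfolding det_def ddet_def
    by (intro has_derivative_sum has_derivative_mult_right has_derivative_prod)
qed

lemma continuous_on_ddet:
  fixes A H :: "'z::topological_space \<Rightarrow> real ^ 'n ^ 'n"
  assumes "continuous_on S A" "continuous_on S H" shows "continuous_on S (\<lambda>z. ddet (A z) (H z))"
  unfolding ddet_def by (intro continuous_intros assms)

definition mtx :: "((real ^ 'n) \<Rightarrow>\<^sub>L (real ^ 'n)) \<Rightarrow> real ^ 'n ^ 'n" where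
  "mtx L = matrix (blinfun_apply L)"

lemma mtx_nth: "mtx L $ i $ j = blinfun_apply L (axis j 1) $ i"
  by (simp add: mtx_def matrix_def)

text \<open>Passes from the operator norm of a bounded linear map to the Euclidean norm of its
  matrix, by adding up all entries.\<close>

lemma norm_mtx_le: "norm (mtx L :: real ^ 'n ^ 'n) \<le> (real CARD('n))\<^sup>2 * norm L"
proof -
  have e: "\<bar>mtx L $ i $ j\<bar> \<le> norm L" for i j
    using component_le_norm_cart[of "blinfun_apply L (axis j 1)" i] norm_blinfun[of L "axis j 1"] by (simp add: mtx_nth)
  have "norm (mtx L) \<le> (\<Sum>i\<in>UNIV. norm (mtx L $ i))" unfolding norm_vec_def[of "mtx L"] by (rule L2_set_le_sum) simp
  also have "\<dots> \<le> (\<Sum>i\<in>(UNIV :: 'n set). \<Sum>j\<in>(UNIV :: 'n set). \<bar>mtx L $ i $ j\<bar>)" by (intro sum_mono norm_le_l1_cart)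
  also have "\<dots> \<le> (\<Sum>i\<in>(UNIV :: 'n set). \<Sum>j\<in>(UNIV :: 'n set). norm L)" by (intro sum_mono e)
  also have "\<dots> = (real CARD('n))\<^sup>2 * norm L" by (simp add: power2_eq_square)
  finally show ?thesis .
qed

lemma bounded_linear_mtx: "bounded_linear mtx"
proof (rule bounded_linear_intro)
  show "norm (mtx L) \<le> norm L * (real CARD('n))\<^sup>2" for L :: "(real ^ 'n) \<Rightarrow>\<^sub>L (real ^ 'n)"
    using norm_mtx_le[of L] by (simp add: mult.commute)
qed (simp_all add: vec_eq_iff mtx_nth blinfun.add_left blinfun.scaleR_left)

lemma continuous_on_mtx: "continuous_on S L \<Longrightarrow> continuous_on S (\<lambda>z. mtx (L z))"
  by (rule bounded_linear.continuous_on[OF bounded_linear_mtx])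

lemma jac_eq:
  fixes f :: "real ^ 'n \<Rightarrow> real ^ 'n"
  assumes "f differentiable (at y)" shows "jac f y = mtx (fderiv f y)"
proof -
  have "(f has_derivative frechet_derivative f (at y)) (at y)" using assms frechet_derivative_works by blast
  then show ?thesis
    by (simp add: jac_def jacobian_def mtx_def fderiv_def bounded_linear_Blinfun_apply has_derivative_bounded_linear)
qed

lemma has_derivative_jac:
  fixes f :: "real ^ 'n \<Rightarrow> real ^ 'n"
  assumes f: "f \<in> C2_space B" and B: "open B" "y \<in> B"
  shows "(jac f has_derivative (\<lambda>h. mtx (blinfun_apply (fderiv (fderiv f) y) h))) (at y)"
proof -
  have "((\<lambda>y. mtx (fderiv f y)) has_derivative (\<lambda>h. mtx (blinfun_apply (fderiv (fderiv f) y) h))) (at y)"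
    by (rule bounded_linear.has_derivative[OF bounded_linear_mtx fderiv[OF C2_D(6)[OF f B(2)]]])
  then show ?thesis
    by (rule has_derivative_transform_within_open[OF _ B]) (simp add: jac_eq C2_D(5)[OF f])
qed

lemma has_derivative_inv_jac_det:
  fixes f :: "real ^ 'n \<Rightarrow> real ^ 'n"
  assumes f: "f \<in> C2_space B" and B: "open B" "y \<in> B" and nz: "det (jac f y) \<noteq> 0"
  shows "(inv_jac_det f has_derivative (\<lambda>h. - (ddet (jac f y) (mtx (blinfun_apply (fderiv (fderiv f) y) h)) / (det (jac f y))\<^sup>2))) (at y)"
proof -
  have "((\<lambda>x. 1 / det (jac f x)) has_derivative (\<lambda>h. - 1 * (inverse (det (jac f y)) *
      ddet (jac f y) (mtx (blinfun_apply (fderiv (fderiv f) y) h)) * inverse (det (jac f y))) + 0 / det (jac f y))) (at y)"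
    by (rule has_derivative_divide[OF has_derivative_const has_derivative_det[OF has_derivative_jac[OF f B]] nz])
  then show ?thesis by (simp add: inv_jac_det_def[abs_def] power2_eq_square divide_simps)
qed

text \<open>Only first and second derivatives of \<open>f\<close> occur on the right, so regularity
  of the gradient in space and time follows from that of the flow in C2.\<close>

lemma grad_inv_jac_det:
  fixes f :: "real ^ 'n \<Rightarrow> real ^ 'n"
  assumes f: "f \<in> C2_space B" and B: "open B" "y \<in> B" and nz: "det (jac f y) \<noteq> 0"
  shows "grad (inv_jac_det f) y = (\<chi> i. - (ddet (jac f y) (mtx (blinfun_apply (fderiv (fderiv f) y) (axis i 1))) / (det (jac f y))\<^sup>2))"
  unfolding grad_def frechet_derivative_at[OF has_derivative_inv_jac_det[OF assms], symmetric] ..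

section \<open>The coefficients of the transformed equation\<close>

text \<open>The coefficients of the transformed equation as one pair, in the form that
  \<open>flux\<close> expects.\<close>

definition flow_coef ::
  "(real \<Rightarrow> real ^ 'n \<Rightarrow> real ^ 'n) \<Rightarrow> (real \<Rightarrow> real ^ 'n \<Rightarrow> real ^ 'n) \<Rightarrow> real \<Rightarrow> real ^ 'n \<Rightarrow> (real ^ 'n ^ 'n) \<times> (real ^ 'n)" where
  "flow_coef v T t y = (inv_jac (T t) y ** transpose (inv_jac (T t) y),
     A_mat (T t) y *v grad (inv_jac_det (T t)) y - inv_jac (T t) y *v v t (T t y))"

lemma continuous_on_transpose: "continuous_on S A \<Longrightarrow> continuous_on S (\<lambda>z. transpose (A z :: real ^ 'm ^ 'n))"
  unfolding transpose_def by (intro continuous_on_vec_lambda continuous_intros)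

lemma continuous_on_matrix_mult:
  fixes A :: "'z::topological_space \<Rightarrow> real ^ 'm ^ 'n"
  shows "continuous_on S A \<Longrightarrow> continuous_on S C \<Longrightarrow> continuous_on S (\<lambda>z. A z ** C z)"
  unfolding matrix_matrix_mult_def by (intro continuous_on_vec_lambda continuous_intros)

lemma continuous_on_matrix_vector_mult:
  fixes A :: "'z::topological_space \<Rightarrow> real ^ 'm ^ 'n"
  shows "continuous_on S A \<Longrightarrow> continuous_on S x \<Longrightarrow> continuous_on S (\<lambda>z. A z *v x z)"
  unfolding matrix_vector_mult_def by (intro continuous_on_vec_lambda continuous_intros)

lemma at_within_Icc_nontrivial:
  fixes a b :: real assumes "a < b" "t \<in> {a..b}" shows "at t within {a..b} \<noteq> bot"
proof -
  have "{a..b} \<noteq> {t}" using assms by (auto simp: set_eq_iff) (metis atLeastAtMost_iff less_eq_real_def not_less)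
  then have "t islimpt {a..b}" using connected_imp_perfect[of "{a..b}" t] assms by auto
  then show ?thesis using trivial_limit_within by blast
qed

lemma vector_derivative_quotient:
  assumes d: "(f has_vector_derivative d) (at t within S)" and s: "\<And>k. s k \<in> S - {t}" "s \<longlonglongrightarrow> t"
  shows "(\<lambda>k. (f (s k) - f t) /\<^sub>R (s k - t)) \<longlonglongrightarrow> d"
proof -
  have "((\<lambda>y. norm (f y - f t - (y - t) *\<^sub>R d) / norm (y - t)) \<longlongrightarrow> 0) (at t within S)"
    using d by (simp add: has_vector_derivative_def has_derivative_iff_norm)
  moreover have "filterlim s (at t within S) sequentially" using s by (simp add: filterlim_at)
  ultimately have lim: "(\<lambda>k. norm (f (s k) - f t - (s k - t) *\<^sub>R d) / norm (s k - t)) \<longlonglongrightarrow> 0" by (rule filterlim_compose)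
  have "norm ((f (s k) - f t) /\<^sub>R (s k - t) - d) = norm (f (s k) - f t - (s k - t) *\<^sub>R d) / norm (s k - t)" for k
  proof -
    have "(f (s k) - f t) /\<^sub>R (s k - t) - d = (f (s k) - f t - (s k - t) *\<^sub>R d) /\<^sub>R (s k - t)"
      using s(1)[of k] by (simp add: scaleR_diff_right)
    then show ?thesis by (simp add: divide_inverse mult.commute)
  qed
  with lim have "(\<lambda>k. norm ((f (s k) - f t) /\<^sub>R (s k - t) - d)) \<longlonglongrightarrow> 0" by (simp only:)
  then show ?thesis by (rule LIM_zero_cancel[OF tendsto_norm_zero_cancel])
qed

text \<open>A sequential form of the derivative: countably many quotients are what measurability
  arguments can use.\<close>

lemma directional_derivative_quotient:
  fixes h :: "nat \<Rightarrow> real"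
  assumes f: "(f has_derivative f') (at y)" and h: "h \<longlonglongrightarrow> 0" "\<And>k. h k \<noteq> 0"
  shows "(\<lambda>k. (f (y + h k *\<^sub>R e) - f y) /\<^sub>R h k) \<longlonglongrightarrow> f' e"
proof -
  have "((\<lambda>s. y + s *\<^sub>R e) has_derivative (\<lambda>s. s *\<^sub>R e)) (at 0)" by (auto intro!: derivative_eq_intros)
  from has_derivative_compose[OF this, of f f'] f
  have "((\<lambda>s. f (y + s *\<^sub>R e)) has_vector_derivative f' e) (at 0)"
    using linear_cmul[OF has_derivative_linear[OF f]] by (simp add: has_vector_derivative_def)
  from vector_derivative_quotient[OF this, of h] h show ?thesis by simp
qed

text \<open>The assumptions for a single sample, so that all estimates on the coefficients are
  deterministic and share their constants.\<close>

locale regular_flow =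
  fixes \<tau> :: real and D B :: "(real ^ 'n) set" and v T :: "real \<Rightarrow> real ^ 'n \<Rightarrow> real ^ 'n" and CT Ct CJ :: real
  assumes \<tau>: "\<tau> > 0" and D_open: "open D" and B_open: "open B" and B_bdd: "bounded B" and D_B: "D \<subseteq> B"
    and CT: "CT > 0" and Ct: "Ct > 0" and CJ: "CJ > 0"
    and image: "\<forall>t\<in>{0..\<tau>}. T t ` D \<subseteq> B"
    and flow: "is_flow \<tau> (closure B) v T"
    and bij: "\<forall>t\<in>{0..\<tau>}. bij_betw (T t) (closure B) (closure B)"
    and T: "T \<in> C1_time_C0 \<tau> B \<inter> C_time \<tau> (C2_space B) (C2_norm B)"
    and S: "inverse_flow B T \<in> C1_time_C0 \<tau> B \<inter> C_time \<tau> (C2_space B) (C2_norm B)"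
    and T_le: "C_time_norm \<tau> (C2_norm B) T \<le> CT"
    and S_le: "C_time_norm \<tau> (C2_norm B) (inverse_flow B T) \<le> CT"
    and dT_le: "C_time_norm \<tau> (C0_norm B) (time_deriv \<tau> T) \<le> Ct"
    and J_le: "\<forall>t\<in>{0..\<tau>}. \<forall>x\<in>B. norm (grad (inv_jac_det (T t)) x) \<le> CJ"
begin

abbreviation "S \<equiv> inverse_flow B T"

text \<open>Bounds the Jacobian matrices of the flow and of its inverse; the factor in front of
  \<open>CT\<close> is the one from \<open>norm_mtx_le\<close>.\<close>

definition "m = (real CARD('n))\<^sup>2 * CT"

lemma m: "m > 0" using CT by (simp add: m_def)

lemma C2_mem: "t \<in> {0..\<tau>} \<Longrightarrow> T t \<in> C2_space B" "t \<in> {0..\<tau>} \<Longrightarrow> S t \<in> C2_space B"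
  using T S by (auto simp: C_time_def)

lemma norm_jac_le:
  assumes t: "t \<in> {0..\<tau>}" and y: "y \<in> B" shows "norm (jac (T t) y) \<le> m" "norm (jac (S t) y) \<le> m"
proof -
  have B0: "B \<noteq> {}" using y by auto
  have "norm (jac f y) \<le> m" if f: "f \<in> C2_space B" "C2_norm B f \<le> CT" for f :: "real ^ 'n \<Rightarrow> real ^ 'n"
  proof -
    have "norm (jac f y) \<le> (real CARD('n))\<^sup>2 * norm (fderiv f y)"
      unfolding jac_eq[OF C2_D(5)[OF f(1) y]] by (rule norm_mtx_le)
    also have "\<dots> \<le> m" unfolding m_def
      using C2_norm_upper(1)[OF B0 B_bdd f(1) y] f(2) by (intro mult_left_mono) auto
    finally show ?thesis .
  qed
  moreover have "C2_norm B (T t) \<le> CT" "C2_norm B (S t) \<le> CT"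
    using seminormed.C_time_norm_upper[OF C2_seminormed[OF B_open B0 B_bdd] _ t, of T]
      seminormed.C_time_norm_upper[OF C2_seminormed[OF B_open B0 B_bdd] _ t, of S] T S T_le S_le by auto
  ultimately show "norm (jac (T t) y) \<le> m" "norm (jac (S t) y) \<le> m" using C2_mem[OF t] by auto
qed

text \<open>The chain rule for \<open>S t\<close> after \<open>T t\<close>. It needs the derivative
  of \<open>S t\<close> at \<open>T t y\<close>, which is available because the flow keeps
  \<open>D\<close> inside the open set \<open>B\<close>. The inverse Jacobian is thus bounded by the
  C2 norm of the inverse flow.\<close>

lemma jac_inverse:
  assumes t: "t \<in> {0..\<tau>}" and y: "y \<in> D"
  shows "jac (T t) y ** jac (S t) (T t y) = mat 1" "inv_jac (T t) y = jac (S t) (T t y)"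
    "inv_jac (T t) y ** jac (T t) y = mat 1" "det (jac (T t) y) \<noteq> 0" "norm (inv_jac (T t) y) \<le> m"
proof -
  have yB: "y \<in> B" and TB: "T t y \<in> B" using D_B y image t by blast+
  note dT = C2_D(5)[OF C2_mem(1)[OF t] yB] and dS = C2_D(5)[OF C2_mem(2)[OF t] TB]
  have ST: "S t (T t x) = x" if "x \<in> B" for x
    unfolding inverse_flow_def using bij t subsetD[OF closure_subset that] by (intro inv_into_f_f) (auto simp: bij_betw_def)
  have "((\<lambda>x. S t (T t x)) has_derivative (\<lambda>h. blinfun_apply (fderiv (S t) (T t y)) (blinfun_apply (fderiv (T t) y) h))) (at y)"
    by (rule has_derivative_compose[OF fderiv[OF dT] fderiv[OF dS]])
  then have "((\<lambda>x. x) has_derivative (\<lambda>h. blinfun_apply (fderiv (S t) (T t y)) (blinfun_apply (fderiv (T t) y) h))) (at y)"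
    by (rule has_derivative_transform_within_open[OF _ B_open yB ST])
  from has_derivative_unique[OF this has_derivative_ident]
  have comp: "blinfun_apply (fderiv (S t) (T t y)) \<circ> blinfun_apply (fderiv (T t) y) = id" by (simp add: fun_eq_iff)
  have "matrix (blinfun_apply (fderiv (S t) (T t y)) \<circ> blinfun_apply (fderiv (T t) y)) = jac (S t) (T t y) ** jac (T t) y"
    unfolding jac_eq[OF dT] jac_eq[OF dS] mtx_def
    by (rule matrix_compose) (auto intro: bounded_linear.linear blinfun.bounded_linear_right)
  then have l: "jac (S t) (T t y) ** jac (T t) y = mat 1" unfolding comp by (simp add: matrix_id_mat_1)
  then show r: "jac (T t) y ** jac (S t) (T t y) = mat 1" using matrix_left_right_inverse by blast
  then show i: "inv_jac (T t) y = jac (S t) (T t y)" unfolding inv_jac_def by (rule matrix_inv_eq)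
  show "inv_jac (T t) y ** jac (T t) y = mat 1" unfolding i by (rule l)
  have "det (jac (T t) y) * det (jac (S t) (T t y)) = 1" unfolding det_mul[symmetric] r by (rule det_I)
  then show "det (jac (T t) y) \<noteq> 0" by auto
  show "norm (inv_jac (T t) y) \<le> m" unfolding i by (rule norm_jac_le(2)[OF t TB])
qed

text \<open>The velocity enters the equation only along the flow, where it is the time derivative of
  \<open>T\<close>. Its bound and its continuity are taken from there.\<close>

lemma velocity:
  assumes t: "t \<in> {0..\<tau>}" and y: "y \<in> closure B"
  shows "time_deriv \<tau> T t y = v t (T t y)" "((\<lambda>s. T s y) has_vector_derivative v t (T t y)) (at t within {0..\<tau>})"
proof -
  show d: "((\<lambda>s. T s y) has_vector_derivative v t (T t y)) (at t within {0..\<tau>})"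
    using flow t y unfolding is_flow_def by blast
  show "time_deriv \<tau> T t y = v t (T t y)"
    unfolding time_deriv_def using at_within_Icc_nontrivial[OF \<tau> t] d by (rule vector_derivative_within)
qed

lemma norm_velocity_le:
  assumes t: "t \<in> {0..\<tau>}" and y: "y \<in> B" shows "norm (v t (T t y)) \<le> Ct"
proof -
  have B0: "B \<noteq> {}" using y by auto
  have dT: "time_deriv \<tau> T \<in> C_time \<tau> (C0_space B) (C0_norm B)" using T by (simp add: C1_time_C0_def)
  have "time_deriv \<tau> T t \<in> C0_space B" using dT t by (simp add: C_time_def)
  from C0_norm_upper[OF B_bdd C0_extends_cont[OF this] y]
  have "norm (v t (T t y)) \<le> C0_norm B (time_deriv \<tau> T t)" using velocity(1)[OF t] y closure_subset by fastforce
  also have "\<dots> \<le> C_time_norm \<tau> (C0_norm B) (time_deriv \<tau> T)"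
    by (rule seminormed.C_time_norm_upper[OF C0_seminormed[OF B0 B_bdd] dT t])
  finally show ?thesis using dT_le by linarith
qed

text \<open>The first summand bounds the diffusion matrix. In the second, the determinant estimate
  times \<open>m * m\<close> bounds \<open>A_mat\<close> and \<open>CJ\<close> the gradient next to
  it; the last is the velocity term.\<close>

definition "coef_bound = m * m + (fact CARD('n) * m ^ CARD('n) * (m * m) * CJ + m * Ct)"

lemma norm_flow_coef_le:
  assumes t: "t \<in> {0..\<tau>}" and y: "y \<in> D" shows "norm (flow_coef v T t y) \<le> coef_bound"
proof -
  let ?M = "inv_jac (T t) y"
  have yB: "y \<in> B" using y D_B by auto
  note M = jac_inverse(5)[OF t y]
  have MM: "norm (?M ** transpose ?M) \<le> m * m"
    using norm_matrix_matrix_mult_le[of ?M "transpose ?M"] mult_mono[OF M M] m by (simp add: norm_transpose)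
  have "\<bar>det (jac (T t) y)\<bar> \<le> fact CARD('n) * norm (jac (T t) y) ^ CARD('n)" by (rule abs_det_le)
  also have "\<dots> \<le> fact CARD('n) * m ^ CARD('n)"
    using norm_jac_le(1)[OF t yB] by (intro mult_left_mono power_mono) auto
  finally have det: "\<bar>det (jac (T t) y)\<bar> \<le> fact CARD('n) * m ^ CARD('n)" .
  have "norm (A_mat (T t) y) \<le> fact CARD('n) * m ^ CARD('n) * (m * m)"
    unfolding A_mat_def norm_scaleR using m by (intro mult_mono det MM) auto
  moreover have "norm (grad (inv_jac_det (T t)) y) \<le> CJ" using J_le t yB by blast
  ultimately have "norm (A_mat (T t) y) * norm (grad (inv_jac_det (T t)) y) \<le> fact CARD('n) * m ^ CARD('n) * (m * m) * CJ"
    using m by (intro mult_mono) auto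
  with norm_matrix_vector_mult_le have 1: "norm (A_mat (T t) y *v grad (inv_jac_det (T t)) y) \<le> fact CARD('n) * m ^ CARD('n) * (m * m) * CJ"
    by (rule order_trans)
  have "norm ?M * norm (v t (T t y)) \<le> m * Ct" using M norm_velocity_le[OF t yB] m by (intro mult_mono) auto
  with norm_matrix_vector_mult_le have 2: "norm (?M *v v t (T t y)) \<le> m * Ct" by (rule order_trans)
  have "norm (flow_coef v T t y) \<le> norm (?M ** transpose ?M) + norm (A_mat (T t) y *v grad (inv_jac_det (T t)) y - ?M *v v t (T t y))"
    unfolding flow_coef_def by (rule norm_Pair_le)
  then show ?thesis using MM norm_triangle_ineq4[of "A_mat (T t) y *v grad (inv_jac_det (T t)) y" "?M *v v t (T t y)"] 1 2
    unfolding coef_bound_def by linarith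
qed

text \<open>With \<open>w\<close> the transposed inverse Jacobian applied to \<open>g\<close>, the
  form is the square of the norm of \<open>w\<close>, and \<open>g\<close> is recovered from
  \<open>w\<close> by a matrix of norm at most \<open>m\<close>.\<close>

lemma flow_coef_coercive:
  assumes t: "t \<in> {0..\<tau>}" and y: "y \<in> D"
  shows "1 / m\<^sup>2 * (norm g)\<^sup>2 \<le> (fst (flow_coef v T t y) *v g) \<bullet> g"
proof -
  let ?M = "inv_jac (T t) y" and ?A = "jac (T t) y"
  define w where "w = transpose ?M *v g"
  have "(fst (flow_coef v T t y) *v g) \<bullet> g = g \<bullet> (?M *v w)"
    by (simp add: flow_coef_def w_def matrix_vector_mul_assoc[symmetric] inner_commute del: transpose_matrix_vector)
  also have "\<dots> = (transpose ?M *v g) \<bullet> w" by (simp add: dot_lmul_matrix)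
  also have "\<dots> = (norm w)\<^sup>2" by (simp add: w_def power2_norm_eq_inner)
  finally have 1: "(fst (flow_coef v T t y) *v g) \<bullet> g = (norm w)\<^sup>2" .
  have "transpose ?A *v w = (transpose ?A ** transpose ?M) *v g" by (simp only: w_def matrix_vector_mul_assoc)
  also have "transpose ?A ** transpose ?M = mat 1"
    unfolding matrix_transpose_mul[symmetric] jac_inverse(3)[OF t y] by (simp add: transpose_mat)
  finally have "g = transpose ?A *v w" by simp
  then have "norm g \<le> norm ?A * norm w" using norm_matrix_vector_mult_le[of "transpose ?A" w] by (simp add: norm_transpose)
  also have "\<dots> \<le> m * norm w" using norm_jac_le(1)[OF t] y D_B by (intro mult_right_mono) auto
  finally have "(norm g)\<^sup>2 \<le> (m * norm w)\<^sup>2" by (intro power_mono) auto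
  then show ?thesis unfolding 1 using m by (simp add: power_mult_distrib field_simps)
qed

text \<open>Everything is expressed by the first and second space derivatives and the time
  derivative of \<open>T\<close>, quantities that depend continuously both on space and on
  time.\<close>

lemma flow_coef_eq:
  assumes t: "t \<in> {0..\<tau>}" and y: "y \<in> D"
  shows "flow_coef v T t y = (matrix_inv (mtx (fderiv (T t) y)) ** transpose (matrix_inv (mtx (fderiv (T t) y))),
     (det (mtx (fderiv (T t) y)) *\<^sub>R (matrix_inv (mtx (fderiv (T t) y)) ** transpose (matrix_inv (mtx (fderiv (T t) y))))) *v
       (\<chi> i. - (ddet (mtx (fderiv (T t) y)) (mtx (blinfun_apply (fderiv (fderiv (T t)) y) (axis i 1))) / (det (mtx (fderiv (T t) y)))\<^sup>2))
       - matrix_inv (mtx (fderiv (T t) y)) *v time_deriv \<tau> T t y)"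
proof -
  have yB: "y \<in> B" "y \<in> closure B" using y D_B closure_subset by auto
  note j = jac_eq[OF C2_D(5)[OF C2_mem(1)[OF t] yB(1)]]
  show ?thesis
    unfolding flow_coef_def A_mat_def inv_jac_def grad_inv_jac_det[OF C2_mem(1)[OF t] B_open yB(1) jac_inverse(4)[OF t y]]
      velocity(1)[OF t yB(2)] j ..
qed

text \<open>The index \<open>z\<close> is left abstract, since it is a point of \<open>D\<close> in
  one application and a time in the other.\<close>

lemma continuous_on_coef:
  fixes L :: "'z::topological_space \<Rightarrow> ((real ^ 'n) \<Rightarrow>\<^sub>L (real ^ 'n))"
  assumes L: "continuous_on A L" and H: "continuous_on A H" and w: "continuous_on A w" and nz: "\<And>z. z \<in> A \<Longrightarrow> det (mtx (L z)) \<noteq> 0"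
  shows "continuous_on A (\<lambda>z. (matrix_inv (mtx (L z)) ** transpose (matrix_inv (mtx (L z))),
     (det (mtx (L z)) *\<^sub>R (matrix_inv (mtx (L z)) ** transpose (matrix_inv (mtx (L z))))) *v
       (\<chi> i. - (ddet (mtx (L z)) (mtx (blinfun_apply (H z) (axis i 1))) / (det (mtx (L z)))\<^sup>2))
       - matrix_inv (mtx (L z)) *v w z))"
proof -
  note l = continuous_on_mtx[OF L]
  note i = continuous_on_matrix_inv[OF l nz]
  have h: "continuous_on A (\<lambda>z. mtx (blinfun_apply (H z) (axis i 1)))" for i
    by (intro continuous_on_mtx bounded_bilinear.continuous_on[OF bounded_bilinear_blinfun_apply H continuous_on_const])
  show ?thesis
    by (intro continuous_on_Pair continuous_on_matrix_mult continuous_on_matrix_vector_mult continuous_on_transpose continuous_on_diff continuous_on_scaleR continuous_on_vec_lambda continuous_on_minus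
        continuous_on_divide continuous_on_power continuous_on_ddet continuous_on_det l i h w) (use nz in auto)
qed

lemma continuous_on_flow_coef:
  assumes t: "t \<in> {0..\<tau>}" shows "continuous_on D (flow_coef v T t)"
proof -
  note f = C2_mem(1)[OF t]
  have 1: "continuous_on D (fderiv (T t))" "continuous_on D (fderiv (fderiv (T t)))"
    by (rule continuous_on_subset[OF extends_cont_continuous_on D_B], rule C2_D[OF f])+
  have "time_deriv \<tau> T t \<in> C0_space B" using T t by (simp add: C1_time_C0_def C_time_def)
  then have 2: "continuous_on D (time_deriv \<tau> T t)"
    unfolding C0_space_def using D_B closure_subset by (auto intro: continuous_on_subset)
  have nz: "det (mtx (fderiv (T t) y)) \<noteq> 0" if "y \<in> D" for y
    using jac_inverse(4)[OF t that] jac_eq[OF C2_D(5)[OF f]] D_B that by auto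
  show ?thesis using continuous_on_coef[OF 1 2 nz] flow_coef_eq[OF t] by (simp cong: continuous_on_cong)
qed

lemma continuous_on_flow_coef_time:
  assumes y: "y \<in> D" shows "continuous_on {0..\<tau>} (\<lambda>t. flow_coef v T t y)"
proof -
  have yB: "y \<in> B" using y D_B by auto
  have T2: "T \<in> C_time \<tau> (C2_space B) (C2_norm B)" "time_deriv \<tau> T \<in> C_time \<tau> (C0_space B) (C0_norm B)"
    using T by (auto simp: C1_time_C0_def)
  have nz: "det (mtx (fderiv (T t) y)) \<noteq> 0" if "t \<in> {0..\<tau>}" for t
    using jac_inverse(4)[OF that y] jac_eq[OF C2_D(5)[OF C2_mem(1)[OF that] yB]] by auto
  show ?thesis
    by (rule continuous_on_cong[THEN iffD2, OF refl flow_coef_eq[OF _ y]], assumption)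
      (rule continuous_on_coef[OF C_time_C2_continuous[OF B_open B_bdd yB T2(1)] C_time_C0_continuous[OF B_bdd yB T2(2)] nz])
qed

end

section \<open>Measurability of the coefficients in the random parameter\<close>

lemma borel_measurable_vecI:
  fixes f :: "'x \<Rightarrow> ('b::euclidean_space) ^ 'n"
  assumes "\<And>i. (\<lambda>x. f x $ i) \<in> borel_measurable M" shows "f \<in> borel_measurable M"
proof (rule borel_measurable_euclidean_space[THEN iffD2], rule ballI)
  fix b :: "'b ^ 'n" assume "b \<in> Basis"
  then obtain i u where "b = axis i u" unfolding Basis_vec_def by blast
  then have "(\<lambda>x. f x \<bullet> b) = (\<lambda>x. f x $ i \<bullet> u)" by (simp add: inner_axis)
  then show "(\<lambda>x. f x \<bullet> b) \<in> borel_measurable M"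
    using borel_measurable_inner[OF assms[of i] borel_measurable_const[of u]] by simp
qed

lemma borel_measurable_vec_nth:
  fixes f :: "'x \<Rightarrow> ('b::euclidean_space) ^ 'n"
  assumes "f \<in> borel_measurable M" shows "(\<lambda>x. f x $ i) \<in> borel_measurable M"
  by (rule measurable_compose[OF assms borel_measurable_continuous_onI]) (intro continuous_intros)

lemma borel_measurable_matrix_inv:
  fixes A :: "'x \<Rightarrow> real ^ 'n ^ 'n"
  assumes M: "complete_measure M" and A: "A \<in> borel_measurable M" and nz: "AE x in M. det (A x) \<noteq> 0"
  shows "(\<lambda>x. matrix_inv (A x)) \<in> borel_measurable M"
proof (rule complete_measure.borel_measurable_cong_AE[OF M])
  have "(\<lambda>x. if j = k then c else A x $ i $ j) \<in> borel_measurable M" for i j k c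
    using borel_measurable_vec_nth[OF borel_measurable_vec_nth[OF A]] by (cases "j = k") auto
  then have "(\<lambda>x. \<chi> i j. if j = k then axis l (1::real) $ i else A x $ i $ j) \<in> borel_measurable M" for k l :: 'n
    by (intro borel_measurable_vecI) simp
  then have "(\<lambda>x. det (\<chi> i j. if j = k then axis l 1 $ i else A x $ i $ j) / det (A x)) \<in> borel_measurable M" for k l :: 'n
    by (rule borel_measurable_divide[OF borel_measurable_det borel_measurable_det[OF A]])
  then show "(\<lambda>x. \<chi> k l. det (\<chi> i j. if j = k then axis l 1 $ i else A x $ i $ j) / det (A x)) \<in> borel_measurable M"
    by (intro borel_measurable_vecI) simp
  show "AE x in M. (\<chi> k l. det (\<chi> i j. if j = k then axis l 1 $ i else A x $ i $ j) / det (A x)) = matrix_inv (A x)"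
    using nz by eventually_elim (simp add: matrix_inv_cramer)
qed

lemma flow_coef_measurable:
  fixes v T :: "'w \<Rightarrow> real \<Rightarrow> real ^ 'n \<Rightarrow> real ^ 'n"
  assumes P: "complete_measure P" and \<tau>: "\<tau> > 0" and D: "open D" "D \<subseteq> B"
    and good: "AE \<omega> in P. regular_flow \<tau> D B (v \<omega>) (T \<omega>) CT Ct CJ"
    and meas: "\<forall>t\<in>{0..\<tau>}. \<forall>x\<in>closure B. (\<lambda>\<omega>. T \<omega> t x) \<in> borel_measurable P"
    and t: "t \<in> {0..\<tau>}" and y: "y \<in> D"
  shows "(\<lambda>\<omega>. flow_coef (v \<omega>) (T \<omega>) t y) \<in> borel_measurable P"
proof -
  have Tm: "(\<lambda>\<omega>. T \<omega> s x) \<in> borel_measurable P" if "s \<in> {0..\<tau>}" "x \<in> D" for s x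
    using meas that D(2) closure_subset[of B] by blast
  \<comment> \<open>Increments that stay in \<open>D\<close> for all coordinate directions at once.
    They are used twice: for the Jacobian of the flow, and then for the gradient of the inverse
    determinant, whose quotients require the Jacobian at the shifted points.\<close>
  have steps: "\<exists>h :: nat \<Rightarrow> real. h \<longlonglongrightarrow> 0 \<and> (\<forall>k. h k \<noteq> 0) \<and> (\<forall>k j. z + h k *\<^sub>R axis j 1 \<in> D)" if z: "z \<in> D" for z
  proof -
    obtain e where e: "e > 0" "ball z e \<subseteq> D" using D(1) z open_contains_ball by blast
    define h where "h k = e / 2 * inverse (real (Suc k))" for k
    have "h \<longlonglongrightarrow> e / 2 * 0" unfolding h_def by (intro tendsto_intros LIMSEQ_inverse_real_of_nat)
    moreover have "h k > 0" "h k < e" for k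
    proof -
      show "h k > 0" using e by (simp add: h_def)
      have "h k \<le> e / 2 * 1" unfolding h_def using e(1) by (intro mult_left_mono) (auto simp: inverse_le_1_iff)
      then show "h k < e" using e(1) by simp
    qed
    moreover have "z + h k *\<^sub>R axis j 1 \<in> D" for k j
      using e(2) \<open>h k > 0\<close> \<open>h k < e\<close> by (auto simp: dist_norm intro!: subsetD[OF e(2)])
    ultimately show ?thesis by (intro exI[of _ h]) (auto simp: less_imp_neq[symmetric])
  qed
  have jac_m: "(\<lambda>\<omega>. jac (T \<omega> t) z) \<in> borel_measurable P" if z: "z \<in> D" for z
  proof -
    obtain h :: "nat \<Rightarrow> real" where h: "h \<longlonglongrightarrow> 0" "\<And>k. h k \<noteq> 0" "\<And>k j. z + h k *\<^sub>R axis j 1 \<in> D" using steps[OF z] by blast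
    have "(\<lambda>\<omega>. column j (jac (T \<omega> t) z)) \<in> borel_measurable P" for j
    proof (rule complete_measure.borel_measurable_lim_AE[OF P])
      show "(\<lambda>\<omega>. (T \<omega> t (z + h k *\<^sub>R axis j 1) - T \<omega> t z) /\<^sub>R h k) \<in> borel_measurable P" for k
        by (intro borel_measurable_scaleR borel_measurable_diff borel_measurable_const Tm t z h(3))
      show "AE \<omega> in P. (\<lambda>k. (T \<omega> t (z + h k *\<^sub>R axis j 1) - T \<omega> t z) /\<^sub>R h k) \<longlonglongrightarrow> column j (jac (T \<omega> t) z)"
        using good
      proof eventually_elim
        case (elim \<omega>)
        then interpret regular_flow \<tau> D B "v \<omega>" "T \<omega>" CT Ct CJ .
        have "T \<omega> t differentiable (at z)" using C2_D(5)[OF C2_mem(1)[OF t]] z D_B by blast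
        then have "(T \<omega> t has_derivative (\<lambda>h. jac (T \<omega> t) z *v h)) (at z)" unfolding jac_def jacobian_works .
        from directional_derivative_quotient[OF this h(1,2), of "axis j 1"] show ?case by (simp add: matrix_vector_mult_basis)
      qed
    qed
    from borel_measurable_vec_nth[OF this] have "(\<lambda>\<omega>. jac (T \<omega> t) z $ i $ j) \<in> borel_measurable P" for i j
      by (simp add: column_def)
    then show ?thesis by (intro borel_measurable_vecI)
  qed
  have nz: "AE \<omega> in P. det (jac (T \<omega> t) y) \<noteq> 0"
    using good by eventually_elim (rule regular_flow.jac_inverse(4)[OF _ t y])
  have inv_m: "(\<lambda>\<omega>. inv_jac (T \<omega> t) y) \<in> borel_measurable P"
    unfolding inv_jac_def by (rule borel_measurable_matrix_inv[OF P jac_m[OF y] nz])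
  have idet_m: "(\<lambda>\<omega>. inv_jac_det (T \<omega> t) z) \<in> borel_measurable P" if "z \<in> D" for z
    unfolding inv_jac_det_def by (intro borel_measurable_divide borel_measurable_const borel_measurable_det jac_m that)
  have grad_m: "(\<lambda>\<omega>. grad (inv_jac_det (T \<omega> t)) y) \<in> borel_measurable P"
  proof (rule borel_measurable_vecI)
    fix i
    obtain h :: "nat \<Rightarrow> real" where h: "h \<longlonglongrightarrow> 0" "\<And>k. h k \<noteq> 0" "\<And>k j. y + h k *\<^sub>R axis j 1 \<in> D" using steps[OF y] by blast
    show "(\<lambda>\<omega>. grad (inv_jac_det (T \<omega> t)) y $ i) \<in> borel_measurable P"
    proof (rule complete_measure.borel_measurable_lim_AE[OF P])
      show "(\<lambda>\<omega>. (inv_jac_det (T \<omega> t) (y + h k *\<^sub>R axis i 1) - inv_jac_det (T \<omega> t) y) /\<^sub>R h k) \<in> borel_measurable P" for k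
        by (intro borel_measurable_scaleR borel_measurable_diff borel_measurable_const idet_m y h(3))
      show "AE \<omega> in P. (\<lambda>k. (inv_jac_det (T \<omega> t) (y + h k *\<^sub>R axis i 1) - inv_jac_det (T \<omega> t) y) /\<^sub>R h k) \<longlonglongrightarrow> grad (inv_jac_det (T \<omega> t)) y $ i"
        using good
      proof eventually_elim
        case (elim \<omega>)
        then interpret regular_flow \<tau> D B "v \<omega>" "T \<omega>" CT Ct CJ .
        have "inv_jac_det (T \<omega> t) differentiable (at y)"
          using has_derivative_inv_jac_det[OF C2_mem(1)[OF t] B_open subsetD[OF D_B y] jac_inverse(4)[OF t y]]
          by (rule differentiableI)
        then have "(inv_jac_det (T \<omega> t) has_derivative frechet_derivative (inv_jac_det (T \<omega> t)) (at y)) (at y)"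
          using frechet_derivative_works by blast
        from directional_derivative_quotient[OF this h(1,2), of "axis i 1"] show ?case by (simp add: grad_def)
      qed
    qed
  qed
  \<comment> \<open>Along the flow the velocity is a limit of difference quotients in time, so its
    measurability follows from that of the flow.\<close>
  have vel_m: "(\<lambda>\<omega>. v \<omega> t (T \<omega> t y)) \<in> borel_measurable P"
  proof -
    have "t islimpt {0..\<tau>}" using at_within_Icc_nontrivial[OF \<tau> t] trivial_limit_within by blast
    then obtain s where s: "\<And>k. s k \<in> {0..\<tau>} - {t}" "s \<longlonglongrightarrow> t" unfolding islimpt_sequential by blast
    show ?thesis
    proof (rule complete_measure.borel_measurable_lim_AE[OF P])
      show "(\<lambda>\<omega>. (T \<omega> (s k) y - T \<omega> t y) /\<^sub>R (s k - t)) \<in> borel_measurable P" for k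
        using s(1)[of k] by (intro borel_measurable_scaleR borel_measurable_diff borel_measurable_const Tm t y) auto
      show "AE \<omega> in P. (\<lambda>k. (T \<omega> (s k) y - T \<omega> t y) /\<^sub>R (s k - t)) \<longlonglongrightarrow> v \<omega> t (T \<omega> t y)"
        using good
      proof eventually_elim
        case (elim \<omega>)
        then interpret regular_flow \<tau> D B "v \<omega>" "T \<omega>" CT Ct CJ .
        have "y \<in> closure B" using y D_B closure_subset by blast
        from vector_derivative_quotient[OF velocity(2)[OF t this] s] show ?case .
      qed
    qed
  qed
  define F :: "real \<times> (real ^ 'n ^ 'n) \<times> (real ^ 'n) \<times> (real ^ 'n) \<Rightarrow> (real ^ 'n ^ 'n) \<times> (real ^ 'n)"
    where "F = (\<lambda>z. (fst (snd z) ** transpose (fst (snd z)),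
      (fst z *\<^sub>R (fst (snd z) ** transpose (fst (snd z)))) *v fst (snd (snd z)) - fst (snd z) *v snd (snd (snd z))))"
  have "continuous_on UNIV F" unfolding F_def
    by (intro continuous_on_Pair continuous_on_matrix_mult continuous_on_matrix_vector_mult continuous_on_transpose
        continuous_on_diff continuous_on_scaleR continuous_on_fst continuous_on_snd continuous_on_id)
  from measurable_compose[OF borel_measurable_Pair[OF borel_measurable_det[OF jac_m[OF y]]
        borel_measurable_Pair[OF inv_m borel_measurable_Pair[OF grad_m vel_m]]] borel_measurable_continuous_onI[OF this]]
  show ?thesis by (simp add: F_def flow_coef_def A_mat_def)
qed

theorem theorem4p1:
  fixes P :: "'w measure"
    and \<tau> C\<^sub>T C\<^sub>D C\<^sub>t C\<^sub>J :: real
    and D\<^sub>0 B :: "(real ^ 'n) set"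
    and v T :: "'w \<Rightarrow> real \<Rightarrow> real ^ 'n \<Rightarrow> real ^ 'n"
  assumes "prob_space P" and "complete_measure P"
    and "separable_seminormed (L2_space P :: ('w \<Rightarrow> real) set) (L2_norm P)"
    and "\<tau> > 0"
    and "open D\<^sub>0" and "bounded D\<^sub>0" and "lipschitz_boundary D\<^sub>0"
    and "open B" and "bounded B" and "path_connected B" and "lipschitz_boundary B"
    and "D\<^sub>0 \<subseteq> B" and "AE \<omega> in P. \<forall>t\<in>{0..\<tau>}. T \<omega> t ` D\<^sub>0 \<subseteq> B"
    and "AE \<omega> in P. v \<omega> \<in> C_time \<tau> (C2_space B) (C2_norm B)"
    and "AE \<omega> in P. \<forall>t\<in>{0..\<tau>}. \<forall>x\<in>frontier B. \<forall>n. outward_unit_normal B x n \<longrightarrow> v \<omega> t x \<bullet> n = 0"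
    and "AE \<omega> in P. is_flow \<tau> (closure B) (v \<omega>) (T \<omega>)"
    and "\<forall>t\<in>{0..\<tau>}. \<forall>x\<in>closure B. (\<lambda>\<omega>. T \<omega> t x) \<in> borel_measurable P"
    and "AE \<omega> in P. \<forall>t\<in>{0..\<tau>}. bij_betw (T \<omega> t) (closure B) (closure B)"
    and "AE \<omega> in P. T \<omega> \<in> C1_time_C0 \<tau> B \<inter> C_time \<tau> (C2_space B) (C2_norm B)"
    and "AE \<omega> in P. inverse_flow B (T \<omega>) \<in> C1_time_C0 \<tau> B \<inter> C_time \<tau> (C2_space B) (C2_norm B)"
    and "C\<^sub>T > 0" and "C\<^sub>D > 0" and "C\<^sub>t > 0" and "C\<^sub>J > 0"
    and "AE \<omega> in P. C_time_norm \<tau> (C2_norm B) (T \<omega>) \<le> C\<^sub>T"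
    and "AE \<omega> in P. C_time_norm \<tau> (C2_norm B) (inverse_flow B (T \<omega>)) \<le> C\<^sub>T"
    and "AE \<omega> in P. C_time_norm \<tau> (C1_norm B) (\<lambda>t. jac (T \<omega> t)) \<le> C\<^sub>D"
    and "AE \<omega> in P. C_time_norm \<tau> (C1_norm B) (\<lambda>t. jac (inverse_flow B (T \<omega>) t)) \<le> C\<^sub>D"
    and "AE \<omega> in P. C_time_norm \<tau> (C0_norm B) (time_deriv \<tau> (T \<omega>)) \<le> C\<^sub>t"
    and "AE \<omega> in P. \<forall>t\<in>{0..\<tau>}. \<forall>x\<in>B. norm (grad (inv_jac_det (T \<omega> t)) x) \<le> C\<^sub>J"
  shows "\<exists>C>0. \<forall>f\<in>L2Vdual_space \<tau> P D\<^sub>0.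
           \<exists>u. is_weak_solution \<tau> P D\<^sub>0 v T f u \<and>
               (\<forall>u'. is_weak_solution \<tau> P D\<^sub>0 v T f u' \<longrightarrow> W_norm \<tau> P D\<^sub>0 (u' - u) = 0) \<and>
               W_norm \<tau> P D\<^sub>0 u \<le> C * L2Vdual_norm \<tau> P D\<^sub>0 f"
proof -
  \<comment> \<open>The countably additive measure allows finitely many almost sure statements to be
    collected into one event of full measure.\<close>
  define good where "good \<omega> \<longleftrightarrow> regular_flow \<tau> D\<^sub>0 B (v \<omega>) (T \<omega>) C\<^sub>T C\<^sub>t C\<^sub>J" for \<omega>
  have good: "AE \<omega> in P. good \<omega>"
    using assms(13,16,18,19,20,25,26,29,30)
  proof eventually_elim
    case (elim \<omega>)
    show ?case unfolding good_def
      by (intro regular_flow.intro elim assms(4,5,8,9,12,21,23,24))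
  qed
  define M where "M = (real CARD('n))\<^sup>2 * C\<^sub>T"
  have M: "M > 0" using assms(21) by (simp add: M_def)
  define K0 where "K0 = M * M + (fact CARD('n) * M ^ CARD('n) * (M * M) * C\<^sub>J + M * C\<^sub>t)"
  \<comment> \<open>Constant coefficients for the exceptional samples: a multiple of the identity
    with exactly the ellipticity constant of the good samples, and no first order term.\<close>
  define e where "e = ((1 / M\<^sup>2) *\<^sub>R (mat 1 :: real ^ 'n ^ 'n), 0 :: real ^ 'n)"
  \<comment> \<open>Large enough for the coefficients of good samples, bounded by \<open>K0\<close>,
    and for the substitute \<open>e\<close>.\<close>
  define K where "K = K0 + norm e"
  have K0: "K0 \<ge> 0" using M assms(23,24) by (simp add: K0_def)
  define c where "c \<omega> t y = (if good \<omega> then flow_coef (v \<omega>) (T \<omega>) t y else e)" for \<omega> t y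
  interpret random_elliptic D\<^sub>0 P \<tau> c K "1 / M\<^sup>2"
  proof (intro random_elliptic.intro bounded_domain.intro random_elliptic_axioms.intro assms(2,4,5,6))
    show "finite_measure P" using assms(1) by (rule prob_space.axioms(1))
    show "K \<ge> 0" "1 / M\<^sup>2 > 0" using K0 M by (simp_all add: K_def)
    fix t y assume t: "t \<in> {0..\<tau>}" and y: "y \<in> D\<^sub>0"
    show "(\<lambda>\<omega>. c \<omega> t y) \<in> borel_measurable P"
    proof (rule complete_measure.borel_measurable_cong_AE[OF assms(2)])
      show "(\<lambda>\<omega>. flow_coef (v \<omega>) (T \<omega>) t y) \<in> borel_measurable P"
        by (rule flow_coef_measurable[OF assms(2,4,5,12) good[unfolded good_def] assms(17) t y])
      show "AE \<omega> in P. flow_coef (v \<omega>) (T \<omega>) t y = c \<omega> t y" using good by eventually_elim (simp add: c_def)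
    qed
    show "norm (c \<omega> t y) \<le> K" for \<omega>
    proof (cases "good \<omega>")
      case True
      then interpret regular_flow \<tau> D\<^sub>0 B "v \<omega>" "T \<omega>" C\<^sub>T C\<^sub>t C\<^sub>J by (simp add: good_def)
      have "coef_bound = K0" by (simp only: coef_bound_def K0_def m_def M_def)
      then show ?thesis using norm_flow_coef_le[OF t y] True by (simp add: c_def K_def add_increasing2)
    qed (use K0 in \<open>simp add: c_def K_def\<close>)
    show "1 / M\<^sup>2 * (norm g)\<^sup>2 \<le> (fst (c \<omega> t y) *v g) \<bullet> g" for \<omega> g
    proof (cases "good \<omega>")
      case True
      then interpret regular_flow \<tau> D\<^sub>0 B "v \<omega>" "T \<omega>" C\<^sub>T C\<^sub>t C\<^sub>J by (simp add: good_def)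
      show ?thesis using flow_coef_coercive[OF t y, of g] True unfolding m_def M_def by (simp add: c_def)
    next
      case False
      then show ?thesis by (simp add: c_def e_def scaleR_matrix_vector_assoc[symmetric] power2_norm_eq_inner)
    qed
  next
    fix t \<omega> assume t: "t \<in> {0..\<tau>}"
    show "continuous_on D\<^sub>0 (c \<omega> t)"
    proof (cases "good \<omega>")
      case True
      then have "c \<omega> t = flow_coef (v \<omega>) (T \<omega>) t" by (simp add: c_def fun_eq_iff)
      then show ?thesis using regular_flow.continuous_on_flow_coef[OF True[unfolded good_def] t] by simp
    next
      case False
      then have "c \<omega> t = (\<lambda>_. e)" by (simp add: c_def fun_eq_iff)
      then show ?thesis by simp
    qed
  next
    fix y \<omega> assume y: "y \<in> D\<^sub>0"
    show "continuous_on {0..\<tau>} (\<lambda>t. c \<omega> t y)"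
    proof (cases "good \<omega>")
      case True
      then have "(\<lambda>t. c \<omega> t y) = (\<lambda>t. flow_coef (v \<omega>) (T \<omega>) t y)" by (simp add: c_def fun_eq_iff)
      then show ?thesis using regular_flow.continuous_on_flow_coef_time[OF True[unfolded good_def] y] by (simp only:)
    next
      case False
      then have "(\<lambda>t. c \<omega> t y) = (\<lambda>_. e)" by (simp add: c_def)
      then show ?thesis by (simp only: continuous_on_const)
    qed
  qed
  \<comment> \<open>Replacing the coefficients on a null set leaves the integrals over
    \<open>P\<close> unchanged, even where they are default values, so both notions of solution
    agree.\<close>
  have sol: "is_weak_solution \<tau> P D\<^sub>0 v T f u \<longleftrightarrow> solution f u" for f u
  proof -
    have 1: "(\<integral>\<omega>. (\<integral>y. ((inv_jac (T \<omega> t) y ** transpose (inv_jac (T \<omega> t) y)) *v weak_grad D\<^sub>0 (u t \<omega>) y) \<bullet> weak_grad D\<^sub>0 (\<phi> \<omega>) y \<partial>DM) \<partial>P) =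
        (\<integral>\<omega>. (\<integral>y. (fst (c \<omega> t y) *v weak_grad D\<^sub>0 (u t \<omega>) y) \<bullet> weak_grad D\<^sub>0 (\<phi> \<omega>) y \<partial>DM) \<partial>P)" for t \<phi>
      by (rule integral_cong_AE_complete[OF assms(2)], use good in eventually_elim) (simp add: c_def flow_coef_def)
    have 2: "(\<integral>\<omega>. (\<integral>y. ((A_mat (T \<omega> t) y *v grad (inv_jac_det (T \<omega> t)) y - inv_jac (T \<omega> t) y *v v \<omega> t (T \<omega> t y)) \<bullet> weak_grad D\<^sub>0 (u t \<omega>) y) * \<phi> \<omega> y \<partial>DM) \<partial>P) =
        (\<integral>\<omega>. (\<integral>y. (snd (c \<omega> t y) \<bullet> weak_grad D\<^sub>0 (u t \<omega>) y) * \<phi> \<omega> y \<partial>DM) \<partial>P)" for t \<phi>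
      by (rule integral_cong_AE_complete[OF assms(2)], use good in eventually_elim) (simp add: c_def flow_coef_def)
    show ?thesis unfolding is_weak_solution_def solution_def satisfies_def 1 2 ..
  qed
  obtain C where C: "C > 0" and ex: "\<forall>f\<in>L2Vdual_space \<tau> P D\<^sub>0. \<exists>u. solution f u \<and> W_norm \<tau> P D\<^sub>0 u \<le> C * L2Vdual_norm \<tau> P D\<^sub>0 f"
    using solution_exists by blast
  show ?thesis unfolding sol
  proof (intro exI[of _ C] conjI ballI C)
    fix f assume f: "f \<in> L2Vdual_space \<tau> P D\<^sub>0"
    obtain u where u: "solution f u" "W_norm \<tau> P D\<^sub>0 u \<le> C * L2Vdual_norm \<tau> P D\<^sub>0 f" using bspec[OF ex f] by blast
    then show "\<exists>u. solution f u \<and> (\<forall>u'. solution f u' \<longrightarrow> W_norm \<tau> P D\<^sub>0 (u' - u) = 0) \<and>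
        W_norm \<tau> P D\<^sub>0 u \<le> C * L2Vdual_norm \<tau> P D\<^sub>0 f"
      using solution_unique[OF f u(1)] by (intro exI[of _ u]) auto
  qed
qed

end
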